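(* Let $E$ be an elliptic curve over $\mathbb{Q}$ (with or without complex multiplication). For each prime $p$ at which $E$ has good reduction, let $a_p(E) := p+1-\#E(\mathbb{F}_p)\in\mathbb{Z}$ (for the finitely many primes of bad reduction, set $a_p(E)$ to be any integer; this does not affect the element below). Then the element $\bm{a}=(a_p(E)\bmod p)_p\in\mathcal{A}$ is $\mathcal{P}_{\mathcal{A}}^{0}$-transcendental, i.e. $\bm{a}\notin\mathcal{P}_{\mathcal{A}}^{0}$.
   Context: Let $\mathcal{A}=\prod_{p}\mathbb{F}_p\big/\bigoplus_{p}\mathbb{F}_p$, where $p$ runs over all rational primes; thus two sequences $(t_p \bmod p)_p$ define the same element of $\mathcal{A}$ iff they agree for all but finitely many $p$. A sequence $(a_n)_{n\ge 0}$ of rational numbers is linear recurrent if there exist $k\ge 1$ and $c_1,\dots,c_k\in\mathbb{Q}$ with $a_{n+k}=c_1a_{n+k-1}+\cdots+c_ka_n$ for all $n\ge 0$. The set $\mathcal{P}_{\mathcal{A}}^{0}\subset\mathcal{A}$ of (Rosen's) finite algebraic numbers is the set of elements of the form $(a_p\bmod p)_p$ for some linear recurrent sequence $(a_n)_n\in\mathbb{Q}^{\mathbb{N}}$ (reduction mod $p$ being defined for all $p$ not dividing the denominators, i.e. for all but finitely many $p$). Equivalently, $\bm{t}\in\mathcal{P}_{\mathcal{A}}^{0}$ iff there exist a finite Galois extension $L/\mathbb{Q}$ and a map $g\colon\mathrm{Gal}(L/\mathbb{Q})\to L$ with $g(\sigma\tau\sigma^{-1})=\sigma g(\tau)$ for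 all $\sigma,\tau$, such that $\bm{t}=(g(\mathrm{Frob}_{\mathfrak{P}})\bmod\mathfrak{P})_p$, where $\mathfrak{P}\mid p$ is a prime of $L$. An element of $\mathcal{A}$ not in $\mathcal{P}_{\mathcal{A}}^{0}$ is called $\mathcal{P}_{\mathcal{A}}^{0}$-transcendental. *)

theory Defs
  imports "HOL-Number_Theory.Number_Theory" "HOL-Computational_Algebra.Computational_Algebra"
begin

section \<open>The ring of integers modulo infinitely large primes\<close>

text \<open>
  An element of the product of all \<open>\<F>\<^sub>p\<close> is represented by an integer sequence indexed by the natural
  numbers, of which only the residues \<open>t p mod p\<close> at prime indices matter. Dividing by the direct
  sum identifies two such sequences when they agree modulo \<open>p\<close> at all but finitely many primes \<open>p\<close>.
  Only the underlying set of the quotient is introduced, not its ring operations.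
\<close>

definition eq_almost_all_primes :: "(nat \<Rightarrow> int) \<Rightarrow> (nat \<Rightarrow> int) \<Rightarrow> bool" where
  "eq_almost_all_primes s t \<longleftrightarrow> finite {p. prime p \<and> \<not> [s p = t p] (mod int p)}"

lemma equivp_eq_almost_all_primes: "equivp eq_almost_all_primes"
proof (rule equivpI)
  show "reflp eq_almost_all_primes"
    by (auto simp: reflp_def eq_almost_all_primes_def)
  show "symp eq_almost_all_primes"
    by (auto simp: symp_def eq_almost_all_primes_def cong_sym_eq)
  show "transp eq_almost_all_primes"
  proof (rule transpI)
    fix r s t
    assume "eq_almost_all_primes r s" "eq_almost_all_primes s t"
    then have "finite ({p. prime p \<and> \<not> [r p = s p] (mod int p)} \<union>
                       {p. prime p \<and> \<not> [s p = t p] (mod int p)})"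
      by (simp add: eq_almost_all_primes_def)
    then show "eq_almost_all_primes r t"
      unfolding eq_almost_all_primes_def
      by (rule rev_finite_subset) (auto intro: cong_trans)
  qed
qed

quotient_type poor_adele = "nat \<Rightarrow> int" / eq_almost_all_primes
  morphisms rep_poor_adele residues_class
  by (rule equivp_eq_almost_all_primes)

lemma residues_class_eq_iff:
  "residues_class s = residues_class t \<longleftrightarrow> finite {p. prime p \<and> \<not> [s p = t p] (mod int p)}"
  using poor_adele.abs_eq_iff[of s t] by (simp add: eq_almost_all_primes_def)


section \<open>Reduction of rational numbers modulo a prime\<close>

definition p_integral :: "nat \<Rightarrow> rat \<Rightarrow> bool" where
  "p_integral p q \<longleftrightarrow> \<not> int p dvd snd (quotient_of q)"

text \<open>Only meaningful for a prime \<open>p\<close> that does not divide the denominator of \<open>q\<close>.\<close>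

definition rat_mod :: "nat \<Rightarrow> rat \<Rightarrow> int" where
  "rat_mod p q =
     (fst (quotient_of q) * modular_inverse (int p) (snd (quotient_of q))) mod int p"


section \<open>Finite algebraic numbers\<close>

definition linear_recurrent :: "(nat \<Rightarrow> rat) \<Rightarrow> bool" where
  "linear_recurrent a \<longleftrightarrow>
     (\<exists>k\<ge>1. \<exists>c :: nat \<Rightarrow> rat. \<forall>n. a (n + k) = (\<Sum>i=1..k. c i * a (n + k - i)))"

text \<open>
  A linear recurrent sequence is \<open>p\<close>-integral for all but finitely many \<open>p\<close>, so the values of
  \<^const>\<open>rat_mod\<close> at the primes dividing a denominator do not affect the class.
\<close>

definition finite_algebraic_numbers :: "poor_adele set" where
  "finite_algebraic_numbers =
     {residues_class (\<lambda>p. rat_mod p (a p)) | a. linear_recurrent a}"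

definition finite_transcendental :: "poor_adele \<Rightarrow> bool" where
  "finite_transcendental t \<longleftrightarrow> t \<notin> finite_algebraic_numbers"


section \<open>Elliptic curves\<close>

text \<open>
  \<open>Weierstrass a1 a2 a3 a4 a6\<close> is the equation
  \<open>y\<^sup>2 + a1 x y + a3 y = x\<^sup>3 + a2 x\<^sup>2 + a4 x + a6\<close>.
\<close>

datatype 'a weierstrass = Weierstrass 'a 'a 'a 'a 'a

fun weierstrass_poly :: "'a :: comm_ring_1 weierstrass \<Rightarrow> 'a \<Rightarrow> 'a \<Rightarrow> 'a" where
  "weierstrass_poly (Weierstrass a1 a2 a3 a4 a6) x y =
     y^2 + a1 * x * y + a3 * y - (x^3 + a2 * x^2 + a4 * x + a6)"

fun discriminant :: "'a :: comm_ring_1 weierstrass \<Rightarrow> 'a" where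
  "discriminant (Weierstrass a1 a2 a3 a4 a6) =
     (let b2 = a1^2 + 4 * a2;
          b4 = 2 * a4 + a1 * a3;
          b6 = a3^2 + 4 * a6;
          b8 = a1^2 * a6 + 4 * a2 * a6 - a1 * a3 * a4 + a2 * a3^2 - a4^2
      in - (b2^2 * b8) - 8 * b4^3 - 27 * b6^2 + 9 * b2 * b4 * b6)"

definition elliptic_curve :: "'a :: field weierstrass \<Rightarrow> bool" where
  "elliptic_curve E \<longleftrightarrow> discriminant E \<noteq> 0"

text \<open>
  The equation obtained by the substitution \<open>x = u\<^sup>2 x' + r\<close>, \<open>y = u\<^sup>3 y' + s u\<^sup>2 x' + t\<close>
  and division by \<open>u\<^sup>6\<close>. Over a field, these are exactly the isomorphisms between elliptic
  curves in Weierstrass form.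
\<close>

fun change_vars :: "'a :: field \<Rightarrow> 'a \<Rightarrow> 'a \<Rightarrow> 'a \<Rightarrow> 'a weierstrass \<Rightarrow> 'a weierstrass" where
  "change_vars u r s t (Weierstrass a1 a2 a3 a4 a6) =
     Weierstrass
       ((a1 + 2 * s) / u)
       ((a2 - s * a1 + 3 * r - s^2) / u^2)
       ((a3 + r * a1 + 2 * t) / u^3)
       ((a4 - s * a3 + 2 * r * a2 - (t + r * s) * a1 + 3 * r^2 - 2 * s * t) / u^4)
       ((a6 + r * a4 + r^2 * a2 + r^3 - t * a3 - t^2 - r * t * a1) / u^6)"

lemma weierstrass_poly_change_vars:
  fixes u :: "'a :: field"
  assumes "u \<noteq> 0"
  shows "weierstrass_poly E (u^2 * x + r) (u^3 * y + s * u^2 * x + t) =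
           u^6 * weierstrass_poly (change_vars u r s t E) x y"
proof (cases E)
  case (Weierstrass a1 a2 a3 a4 a6)
  have cancel: "u^6 * (c / u) = u^5 * c" "u^6 * (c / u^2) = u^4 * c" "u^6 * (c / u^3) = u^3 * c"
    "u^6 * (c / u^4) = u^2 * c" "u^6 * (c / u^6) = c" for c
    using assms by (simp_all add: field_simps flip: power_Suc power_add)
  define A1 A2 A3 A4 A6 where A_def:
    "A1 = (a1 + 2 * s) / u"
    "A2 = (a2 - s * a1 + 3 * r - s^2) / u^2"
    "A3 = (a3 + r * a1 + 2 * t) / u^3"
    "A4 = (a4 - s * a3 + 2 * r * a2 - (t + r * s) * a1 + 3 * r^2 - 2 * s * t) / u^4"
    "A6 = (a6 + r * a4 + r^2 * a2 + r^3 - t * a3 - t^2 - r * t * a1) / u^6"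
  have eqs: "u^6 * A1 = u^5 * (a1 + 2 * s)"
    "u^6 * A2 = u^4 * (a2 - s * a1 + 3 * r - s^2)"
    "u^6 * A3 = u^3 * (a3 + r * a1 + 2 * t)"
    "u^6 * A4 = u^2 * (a4 - s * a3 + 2 * r * a2 - (t + r * s) * a1 + 3 * r^2 - 2 * s * t)"
    "u^6 * A6 = a6 + r * a4 + r^2 * a2 + r^3 - t * a3 - t^2 - r * t * a1"
    unfolding A_def by (rule cancel)+
  have "u^6 * weierstrass_poly (change_vars u r s t E) x y =
    u^6 * y^2 + (u^6 * A1) * x * y + (u^6 * A3) * y
      - (u^6 * x^3 + (u^6 * A2) * x^2 + (u^6 * A4) * x + u^6 * A6)"
    unfolding Weierstrass by (simp add: A_def algebra_simps)
  also have "\<dots> = weierstrass_poly E (u^2 * x + r) (u^3 * y + s * u^2 * x + t)"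
    unfolding eqs Weierstrass weierstrass_poly.simps
    by (simp add: algebra_simps eval_nat_numeral)
  finally show ?thesis ..
qed

definition isomorphic_curves :: "'a :: field weierstrass \<Rightarrow> 'a weierstrass \<Rightarrow> bool" where
  "isomorphic_curves E E' \<longleftrightarrow> (\<exists>u r s t. u \<noteq> 0 \<and> E' = change_vars u r s t E)"

text \<open>
  Curves over \<open>\<F>\<^sub>p\<close> are given by integer coefficients, read modulo \<open>p\<close>, and the point at
  infinity is \<^const>\<open>None\<close>.
\<close>

definition reduce_curve :: "nat \<Rightarrow> rat weierstrass \<Rightarrow> int weierstrass" where
  "reduce_curve p E = map_weierstrass (rat_mod p) E"

definition points_mod :: "nat \<Rightarrow> int weierstrass \<Rightarrow> (int \<times> int) option set" where
  "points_mod p E = insert None (Some `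
     {(x, y). x \<in> {0..<int p} \<and> y \<in> {0..<int p} \<and> [weierstrass_poly E x y = 0] (mod int p)})"

text \<open>Such a model is automatically a minimal Weierstrass equation at \<open>p\<close>.\<close>

definition good_model :: "nat \<Rightarrow> rat weierstrass \<Rightarrow> rat weierstrass \<Rightarrow> bool" where
  "good_model p E E' \<longleftrightarrow> isomorphic_curves E E' \<and>
     (\<forall>c \<in> set_weierstrass E'. p_integral p c) \<and>
     \<not> int p dvd discriminant (reduce_curve p E')"

definition good_reduction :: "nat \<Rightarrow> rat weierstrass \<Rightarrow> bool" where
  "good_reduction p E \<longleftrightarrow> (\<exists>E'. good_model p E E')"

text \<open>
  Any two good models at \<open>p\<close> are related by a change of variables with \<open>u\<close> a \<open>p\<close>-adic unit and
  \<open>r, s, t\<close> \<open>p\<close>-integral. Their reductions are therefore isomorphic over \<open>\<F>\<^sub>p\<close>, and the number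
  below does not depend on the chosen model.
\<close>

definition frobenius_trace :: "nat \<Rightarrow> rat weierstrass \<Rightarrow> int" where
  "frobenius_trace p E =
     int p + 1 - int (card (points_mod p (reduce_curve p (SOME E'. good_model p E E'))))"

end

(* Suppose that a_p(E) mod p comes from a linear recurrent sequence r. Splitting off the semisimple
   part of the shift operator shows r_p = c mod p with one fixed rational number c, for every large p
   having a degree one prime in a number field K_0 that contains the characteristic roots. The
   2-division points of E, halved j times, generate a field K_j obtained from K_0 by j rounds of
   adjoining square roots; if p has a degree one prime in K_j, then 4^j divides #E(F_p), which is shown
   by iterating the duplication map through two 2-isogenies. Since |a_p| <= p and a_p = c mod p, this
   forces 2^(2j - O(1)) to divide p - 1. However, K_j contains the roots of unity of order 2^M only for
   M <= j + O(1), so that a root of unity of maximal 2-power order in K_j is not a square there, and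
   there are infinitely many p with a degree one prime in K_j at which it is not a square either; for
   these p, the power of 2 in p - 1 is at most 2^(j + O(1)), a contradiction for large j. The existence
   of such p follows by comparing the density of degree one primes in K_j and in its quadratic
   extension, which is estimated by counting lattice points in orders, as in Mertens' theorem. *)

theory Submission
  imports Defs Complex_Main "HOL-Library.FuncSet"
    "Jordan_Normal_Form.Char_Poly" "Berlekamp_Zassenhaus.Finite_Field"
begin

text \<open>The number c is the value of the recurrence at a trivial Frobenius: at a prime of degree
  one every characteristic root a satisfies a^p = a. With c = u / v, the size of a_p turns the
  congruence into v a_p = u + p k with k in a bounded range, and a fixed power of 2 dividing both p
  - 1 and #E(F_p) leaves only k = 2 v - u, that is v #E(F_p) = (u - v) (p - 1). The contradiction is
  a mismatch of growth: each further halving contributes a factor 4 to #E(F_p), as the whole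
  2-torsion is divisible, whereas the adjoined square roots enlarge the group of 2-power roots of
  unity by a factor of at most 2. Only division by 2 enters, so curves with and without complex
  multiplication are treated alike. The obstacle is the supply of primes at which the power of 2 in
  p - 1 is known. A single quadratic extension settles it: if a non-square became a square modulo
  every large degree one prime, all of these would split in two, and the Mertens sum of ln p / p
  would double. Lower and upper bounds of 3/4 and 5/4 times ln N exclude this, since twice 3/4
  exceeds 5/4, and bounds of this quality can be proved in any order with a basis over the
  integers.\<close>

hide_const (open) Polynomial.order

section \<open>Orders in number fields and lattice points in their ideals\<close>

text \<open>An order in a number field, given as a subring of the complex numbers with a basis over
  the integers. It may fail to be integrally closed: adjoining one integral element to an order
  yields such a basis directly, and the finitely many primes where the order is not maximal are
  excluded later through the number \<open>D\<close> of \<open>ex_local_generator\<close>.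
  Normalizing \<open>w 0 = 1\<close> makes the integers the first coordinate axis.\<close>

locale number_order =
  fixes d :: nat and w :: "nat \<Rightarrow> complex"
  assumes d_pos: "0 < d" and w0: "w 0 = 1"
    and indep: "\<And>a :: nat \<Rightarrow> int. (\<Sum>i<d. of_int (a i) * w i) = 0 \<Longrightarrow> \<forall>i<d. a i = 0"
    and mult: "\<And>i j. i < d \<Longrightarrow> j < d \<Longrightarrow> \<exists>c :: nat \<Rightarrow> int. w i * w j = (\<Sum>k<d. of_int (c k) * w k)"
    and cofactor: "\<And>a :: nat \<Rightarrow> int. (\<Sum>i<d. of_int (a i) * w i) \<noteq> 0 \<Longrightarrow>
      \<exists>b :: nat \<Rightarrow> int. \<exists>n :: int. n \<noteq> 0 \<and> (\<Sum>i<d. of_int (a i) * w i) * (\<Sum>i<d. of_int (b i) * w i) = of_int n"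
begin

definition comb :: "(nat \<Rightarrow> int) \<Rightarrow> complex" where
  "comb a = (\<Sum>i<d. of_int (a i) * w i)"

definition Ord :: "complex set" where
  "Ord = range comb"

text \<open>Coordinates are determined only below \<open>d\<close>; the arbitrary values beyond are
  why the lemmas carry \<open>i < d\<close>.\<close>

definition cf :: "complex \<Rightarrow> nat \<Rightarrow> int" where
  "cf x = (SOME a. comb a = x)"

lemma comb_cf: "x \<in> Ord \<Longrightarrow> comb (cf x) = x"
  unfolding cf_def Ord_def by (metis (mono_tags) imageE someI)

lemma comb_eqD:
  assumes "comb a = comb b" "i < d"
  shows "a i = b i"
proof -
  have "(\<Sum>i<d. of_int (a i - b i) * w i) = comb a - comb b"
    by (simp add: comb_def algebra_simps sum_subtractf)
  with indep[of "\<lambda>i. a i - b i"] assms show ?thesis by simp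
qed

lemma comb_in_Ord [simp, intro]: "comb a \<in> Ord"
  by (simp add: Ord_def)

lemma cf_comb: "i < d \<Longrightarrow> cf (comb a) i = a i"
  by (rule comb_eqD[OF comb_cf]) auto

lemma comb_add: "comb a + comb b = comb (\<lambda>i. a i + b i)"
  by (simp add: comb_def algebra_simps sum.distrib)

lemma comb_diff: "comb a - comb b = comb (\<lambda>i. a i - b i)"
  by (simp add: comb_def algebra_simps sum_subtractf)

lemma comb_scale: "of_int n * comb a = comb (\<lambda>i. n * a i)"
  by (simp add: comb_def sum_distrib_left algebra_simps)

lemma Ord_add [intro]: "x \<in> Ord \<Longrightarrow> y \<in> Ord \<Longrightarrow> x + y \<in> Ord"
  by (auto simp: Ord_def comb_add)

lemma Ord_diff [intro]: "x \<in> Ord \<Longrightarrow> y \<in> Ord \<Longrightarrow> x - y \<in> Ord"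
  by (auto simp: Ord_def comb_diff)

lemma w_in_Ord [simp, intro]: 
  assumes "i < d" shows "w i \<in> Ord"
proof -
  have "comb (\<lambda>j. of_bool (j = i)) = w i"
    using assms by (simp add: comb_def)
  then show ?thesis by (metis comb_in_Ord)
qed

lemma zero_in_Ord [simp, intro]: "0 \<in> Ord"
  using comb_in_Ord[of "\<lambda>_. 0"] by (simp add: comb_def)

lemma one_in_Ord [simp, intro]: "1 \<in> Ord"
  using w_in_Ord[OF d_pos] by (simp add: w0)

lemma Ord_uminus [intro]: "x \<in> Ord \<Longrightarrow> - x \<in> Ord"
  using Ord_diff[of 0 x] by simp

lemma Ord_scale [intro]: "x \<in> Ord \<Longrightarrow> of_int n * x \<in> Ord"
  by (auto simp: Ord_def comb_scale)

lemma of_int_in_Ord [simp, intro]: "of_int n \<in> Ord"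
  using Ord_scale[OF one_in_Ord, of n] by simp

lemma of_nat_in_Ord [simp, intro]: "of_nat n \<in> Ord"
  using of_int_in_Ord[of "int n"] by simp

lemma Ord_sum [intro]: "(\<And>i. i \<in> A \<Longrightarrow> f i \<in> Ord) \<Longrightarrow> sum f A \<in> Ord"
  by (induction A rule: infinite_finite_induct) auto

lemma w_mult_in_Ord: "i < d \<Longrightarrow> j < d \<Longrightarrow> w i * w j \<in> Ord"
  using mult[of i j] by (auto simp: Ord_def comb_def)

lemma comb_mult: "comb a * comb b = (\<Sum>i<d. \<Sum>j<d. of_int (a i * b j) * (w i * w j))"
  by (simp add: comb_def sum_product algebra_simps)

lemma Ord_mult [intro]:
  assumes "x \<in> Ord" "y \<in> Ord"
  shows "x * y \<in> Ord"
proof -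
  obtain a b where "x = comb a" "y = comb b" using assms by (auto simp: Ord_def)
  moreover have "comb a * comb b \<in> Ord"
    unfolding comb_mult by (intro Ord_sum Ord_scale w_mult_in_Ord) auto
  ultimately show ?thesis by simp
qed

lemma Ord_prod [intro]: "(\<And>i. i \<in> A \<Longrightarrow> f i \<in> Ord) \<Longrightarrow> prod f A \<in> Ord"
  by (induction A rule: infinite_finite_induct) auto

lemma Ord_power [intro]: "x \<in> Ord \<Longrightarrow> x ^ n \<in> Ord"
  by (induction n) auto

lemma cf_add: "x \<in> Ord \<Longrightarrow> y \<in> Ord \<Longrightarrow> i < d \<Longrightarrow> cf (x + y) i = cf x i + cf y i"
  by (auto simp: Ord_def comb_add cf_comb)

lemma cf_diff: "x \<in> Ord \<Longrightarrow> y \<in> Ord \<Longrightarrow> i < d \<Longrightarrow> cf (x - y) i = cf x i - cf y i"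
  by (auto simp: Ord_def comb_diff cf_comb)

lemma cf_scale: "x \<in> Ord \<Longrightarrow> i < d \<Longrightarrow> cf (of_int n * x) i = n * cf x i"
  by (auto simp: Ord_def comb_scale cf_comb)

lemma cf_zero: "i < d \<Longrightarrow> cf 0 i = 0"
  using cf_comb[of i "\<lambda>_. 0"] by (simp add: comb_def)

lemma cf_sum: "(\<And>i. i \<in> A \<Longrightarrow> f i \<in> Ord) \<Longrightarrow> k < d \<Longrightarrow> cf (sum f A) k = (\<Sum>i\<in>A. cf (f i) k)"
  by (induction A rule: infinite_finite_induct) (auto simp: cf_zero cf_add Ord_sum)

lemma cf_w: "i < d \<Longrightarrow> j < d \<Longrightarrow> cf (w i) j = (if i = j then 1 else 0)"
proof -
  assume *: "i < d" "j < d"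
  have "comb (\<lambda>j. of_bool (j = i)) = w i"
    using * by (simp add: comb_def)
  with cf_comb[of j "\<lambda>j. of_bool (j = i)"] * show ?thesis by auto
qed

lemma cf_of_int: "j < d \<Longrightarrow> cf (of_int n) j = (if j = 0 then n else 0)"
  using cf_scale[of 1 j n] cf_w[of 0 j] d_pos by (auto simp: w0)

lemma Ord_eqI: "x \<in> Ord \<Longrightarrow> y \<in> Ord \<Longrightarrow> (\<And>i. i < d \<Longrightarrow> cf x i = cf y i) \<Longrightarrow> x = y"
  by (subst comb_cf[symmetric], assumption, subst (2) comb_cf[symmetric], assumption)
     (simp add: comb_def)

text \<open>The maximum norm of the coordinates plays the part of the archimedean absolute values;
  by \<open>ex_mult_const\<close> it is submultiplicative up to a factor.\<close>

definition bd :: "int \<Rightarrow> complex \<Rightarrow> bool" where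
  "bd B x \<longleftrightarrow> x \<in> Ord \<and> (\<forall>i<d. \<bar>cf x i\<bar> \<le> B)"

lemma bd_in_Ord: "bd B x \<Longrightarrow> x \<in> Ord" by (simp add: bd_def)

lemma bd_nonneg: "bd B x \<Longrightarrow> 0 \<le> B"
  using d_pos by (force simp: bd_def)

lemma bd_mono: "bd A x \<Longrightarrow> A \<le> B \<Longrightarrow> bd B x" by (force simp: bd_def)

lemma bd_add: "bd A x \<Longrightarrow> bd B y \<Longrightarrow> bd (A + B) (x + y)"
  unfolding bd_def by (auto simp: cf_add) (smt (verit))

lemma bd_scale: "bd A x \<Longrightarrow> bd (\<bar>n\<bar> * A) (of_int n * x)"
  unfolding bd_def by (auto simp: cf_scale abs_mult mult_left_mono)

lemma bd_sum: "finite A \<Longrightarrow> (\<And>i. i \<in> A \<Longrightarrow> bd (B i) (f i)) \<Longrightarrow> bd (sum B A) (sum f A)"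
  by (induction A rule: finite_induct) (auto simp: bd_add, auto simp: bd_def cf_zero)

lemma bd_one: "bd 1 1"
  using cf_w[of 0] d_pos by (auto simp: bd_def w0)

lemma bd_w: "i < d \<Longrightarrow> bd 1 (w i)"
  by (auto simp: bd_def cf_w)

lemma ex_bd: "x \<in> Ord \<Longrightarrow> \<exists>B. bd B x"
proof -
  assume "x \<in> Ord"
  then have "bd (\<Sum>i<d. \<bar>cf x i\<bar>) x"
    unfolding bd_def by (auto intro!: member_le_sum)
  then show ?thesis ..
qed

text \<open>Only finitely many products \<open>w i * w j\<close> have to be expanded, and
  \<open>G\<close> bounds their coordinates; the 1 added to the sum keeps \<open>C\<close>
  positive.\<close>

lemma ex_mult_const: "\<exists>C\<ge>1. \<forall>A B x y. bd A x \<longrightarrow> bd B y \<longrightarrow> bd (C * A * B) (x * y)"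
proof -
  have "\<forall>i\<in>{..<d}. \<forall>j\<in>{..<d}. \<exists>B. bd B (w i * w j)"
    using ex_bd w_mult_in_Ord by auto
  then obtain G where G: "\<And>i j. i < d \<Longrightarrow> j < d \<Longrightarrow> bd (G i j) (w i * w j)"
    by (metis lessThan_iff)
  define C where "C = 1 + (\<Sum>i<d. \<Sum>j<d. G i j)"
  have Gnn: "0 \<le> G i j" if "i < d" "j < d" for i j using bd_nonneg[OF G[OF that]] .
  have "C \<ge> 1" unfolding C_def using Gnn by (auto intro!: sum_nonneg)
  moreover have "bd (C * A * B) (x * y)" if xA: "bd A x" and yB: "bd B y" for A B x y
  proof -
    have x: "x = comb (cf x)" and y: "y = comb (cf y)" using xA yB by (auto simp: bd_def comb_cf)
    have "x * y = comb (cf x) * comb (cf y)" using x y by simp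
    also have "\<dots> = (\<Sum>i<d. \<Sum>j<d. of_int (cf x i * cf y j) * (w i * w j))"
      by (rule comb_mult)
    finally have xy: "x * y = \<dots>" .
    have "bd (\<Sum>i<d. \<Sum>j<d. A * B * G i j) (x * y)"
      unfolding xy
    proof (intro bd_sum finite_lessThan)
      fix i j assume ij: "i \<in> {..<d}" "j \<in> {..<d}"
      have "\<bar>cf x i * cf y j\<bar> \<le> A * B"
        using ij xA yB bd_nonneg[OF xA] by (auto simp: bd_def abs_mult intro!: mult_mono)
      then have "\<bar>cf x i * cf y j\<bar> * G i j \<le> A * B * G i j"
        using Gnn ij by (intro mult_right_mono) auto
      then show "bd (A * B * G i j) (of_int (cf x i * cf y j) * (w i * w j))"
        by (rule bd_mono[OF bd_scale[OF G], rotated 2]) (use ij in auto)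
    qed
    moreover have "(\<Sum>i<d. \<Sum>j<d. A * B * G i j) \<le> C * A * B"
    proof -
      have "(\<Sum>i<d. \<Sum>j<d. A * B * G i j) = A * B * (\<Sum>i<d. \<Sum>j<d. G i j)"
        by (simp only: sum_distrib_left)
      also have "\<dots> \<le> A * B * C"
        unfolding C_def using bd_nonneg[OF xA] bd_nonneg[OF yB] by (intro mult_left_mono) auto
      finally show ?thesis by (simp add: mult_ac)
    qed
    ultimately show ?thesis using bd_mono by blast
  qed
  ultimately show ?thesis by blast
qed

definition box :: "int \<Rightarrow> complex set" where
  "box X = {x. bd X x}"

lemma bij_betw_comb: 
  assumes "\<And>i. finite (F i)"
  shows "bij_betw comb (\<Pi>\<^sub>E i\<in>{..<d}. F i) {x \<in> Ord. \<forall>i<d. cf x i \<in> F i}"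
proof (rule bij_betwI)
  show "comb \<in> (\<Pi>\<^sub>E i\<in>{..<d}. F i) \<rightarrow> {x \<in> Ord. \<forall>i<d. cf x i \<in> F i}"
    by (simp add: Pi_iff PiE_iff cf_comb)
  show "(\<lambda>x. restrict (cf x) {..<d}) \<in> {x \<in> Ord. \<forall>i<d. cf x i \<in> F i} \<rightarrow> (\<Pi>\<^sub>E i\<in>{..<d}. F i)"
    by (simp add: Pi_iff PiE_iff)
  fix a assume a: "a \<in> (\<Pi>\<^sub>E i\<in>{..<d}. F i)"
  show "restrict (cf (comb a)) {..<d} = a"
  proof
    fix i show "restrict (cf (comb a)) {..<d} i = a i"
      using a by (cases "i < d") (simp_all add: cf_comb PiE_iff extensional_def)
  qed
next
  fix x assume x: "x \<in> {x \<in> Ord. \<forall>i<d. cf x i \<in> F i}"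
  have "comb (restrict (cf x) {..<d}) = comb (cf x)" by (simp add: comb_def)
  then show "comb (restrict (cf x) {..<d}) = x" using x by (simp add: comb_cf)
qed

lemma finite_cf_in: "(\<And>i. finite (F i)) \<Longrightarrow> finite {x \<in> Ord. \<forall>i<d. cf x i \<in> F i}"
  using bij_betw_finite[OF bij_betw_comb[of F]] finite_PiE[of "{..<d}" F] by blast

lemma card_cf_in: "(\<And>i. finite (F i)) \<Longrightarrow> card {x \<in> Ord. \<forall>i<d. cf x i \<in> F i} = (\<Prod>i<d. card (F i))"
  using bij_betw_same_card[OF bij_betw_comb[of F]] by (simp add: card_PiE)

lemma box_eq: "box X = {x \<in> Ord. \<forall>i<d. cf x i \<in> {-X..X}}"
  by (force simp: box_def bd_def abs_le_iff)

lemma finite_box [simp, intro]: "finite (box X)"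
  unfolding box_eq by (rule finite_cf_in) auto

lemma card_box: "X \<ge> 0 \<Longrightarrow> int (card (box X)) = (2 * X + 1) ^ d"
  unfolding box_eq by (subst card_cf_in) (auto simp: algebra_simps)

definition zideal :: "complex set \<Rightarrow> bool" where
  "zideal I \<longleftrightarrow> I \<subseteq> Ord \<and> 0 \<in> I \<and> (\<forall>x\<in>I. \<forall>y\<in>I. x + y \<in> I) \<and> (\<forall>r\<in>Ord. \<forall>x\<in>I. r * x \<in> I)"

lemma zidealD:
  assumes "zideal I"
  shows "I \<subseteq> Ord" "0 \<in> I" "\<And>x y. x \<in> I \<Longrightarrow> y \<in> I \<Longrightarrow> x + y \<in> I"
    "\<And>r x. r \<in> Ord \<Longrightarrow> x \<in> I \<Longrightarrow> r * x \<in> I" "\<And>r x. r \<in> Ord \<Longrightarrow> x \<in> I \<Longrightarrow> x * r \<in> I"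
  using assms by (auto simp: zideal_def mult.commute)

lemma zideal_uminus: "zideal I \<Longrightarrow> x \<in> I \<Longrightarrow> - x \<in> I"
  using zidealD(4)[of I "-1" x] by (auto intro!: Ord_uminus)

lemma zideal_diff: "zideal I \<Longrightarrow> x \<in> I \<Longrightarrow> y \<in> I \<Longrightarrow> x - y \<in> I"
  using zidealD(3)[of I x "- y"] zideal_uminus[of I y] by auto

lemma zideal_sum: "zideal I \<Longrightarrow> (\<And>i. i \<in> A \<Longrightarrow> f i \<in> I) \<Longrightarrow> sum f A \<in> I"
  by (induction A rule: infinite_finite_induct) (auto simp: zidealD)

lemma zideal_mem_cong: "zideal I \<Longrightarrow> x - y \<in> I \<Longrightarrow> x \<in> I \<longleftrightarrow> y \<in> I"
  using zidealD(3)[of I "x - y" y] zideal_diff[of I x "x - y"] by auto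

definition coset :: "complex set \<Rightarrow> complex \<Rightarrow> complex set" where
  "coset I x = {y \<in> Ord. y - x \<in> I}"

text \<open>\<open>card\<close> returns 0 for an infinite set of cosets. Counting statements
  therefore assume finiteness, which holds for every ideal containing a positive integer.\<close>

definition idx :: "complex set \<Rightarrow> nat" where
  "idx I = card (coset I ` Ord)"

lemma coset_eq_iff:
  assumes "zideal I" "x \<in> Ord" "y \<in> Ord"
  shows "coset I x = coset I y \<longleftrightarrow> x - y \<in> I"
proof
  assume "coset I x = coset I y"
  moreover have "x \<in> coset I x" using assms zidealD by (auto simp: coset_def)
  ultimately show "x - y \<in> I" by (auto simp: coset_def)
next
  assume *: "x - y \<in> I"
  have "z - x \<in> I \<longleftrightarrow> z - y \<in> I" for z
    by (rule zideal_mem_cong[OF assms(1)]) (use zideal_uminus[OF assms(1) *] in simp)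
  then show "coset I x = coset I y" by (auto simp: coset_def)
qed

lemma cosets_by_reps:
  assumes I: "zideal I" and F: "F \<subseteq> Ord" "\<And>x. x \<in> Ord \<Longrightarrow> \<exists>y\<in>F. y - x \<in> I"
  shows "coset I ` Ord = coset I ` F"
proof
  show "coset I ` Ord \<subseteq> coset I ` F"
  proof
    fix c assume "c \<in> coset I ` Ord"
    then obtain x where x: "x \<in> Ord" "c = coset I x" by blast
    then obtain y where "y \<in> F" "y - x \<in> I" using F by blast
    moreover from this have "coset I y = coset I x" using coset_eq_iff[OF I] x F(1) by blast
    ultimately show "c \<in> coset I ` F" using x by (metis imageI)
  qed
qed (use F in auto)

text \<open>Reduction of \<open>v\<close> modulo the sublattice spanned by the multiples
  \<open>u * w i\<close> of a single element. With \<open>u * u' = n\<close>, the quotient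
  \<open>v / u\<close> is \<open>v * u' / n\<close>; rounding its coordinates down leaves
  \<open>n * y = u * r\<close>, where the coordinates of \<open>r\<close> are below |n|, so the
  resulting bound for \<open>y\<close> does not depend on \<open>n\<close>.\<close>

lemma covering_by_element:
  assumes C: "C \<ge> 0" "\<And>A B x y. bd A x \<Longrightarrow> bd B y \<Longrightarrow> bd (C * A * B) (x * y)"
    and I: "zideal I" and u: "u \<in> I" "u \<noteq> 0" "bd B u" and v: "v \<in> Ord"
  shows "\<exists>y. y - v \<in> I \<and> bd (int d * C * B) y"
proof -
  have uO: "u \<in> Ord" using u by (simp add: bd_def)
  then obtain a where "u = comb a" by (auto simp: Ord_def)
  with u cofactor[of a] obtain u' n where n: "n \<noteq> 0" "u * u' = of_int n" and u': "u' \<in> Ord"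
    unfolding comb_def[symmetric] by blast
  define m where "m = cf (v * u')"
  have vm: "v * u' = comb m" unfolding m_def using v u' by (simp add: comb_cf Ord_mult)
  define y where "y = v - u * comb (\<lambda>i. m i div n)"
  have yO: "y \<in> Ord" unfolding y_def using v uO by auto
  have "of_int n * y = u * (v * u') - u * (of_int n * comb (\<lambda>i. m i div n))"
    using n by (simp add: y_def algebra_simps)
  also have "\<dots> = u * comb (\<lambda>i. m i mod n)"
    unfolding vm by (simp add: comb_scale comb_diff minus_mult_div_eq_mod flip: right_diff_distrib)
  also have "\<dots> = (\<Sum>i<d. of_int (m i mod n) * (u * w i))"
    by (simp add: comb_def sum_distrib_left algebra_simps)
  finally have ny: "of_int n * y = \<dots>" .
  have "bd (\<Sum>i<d. \<bar>n\<bar> * (C * B)) (of_int n * y)"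
    unfolding ny
  proof (intro bd_sum finite_lessThan)
    fix i assume "i \<in> {..<d}"
    then have b: "bd (C * B * 1) (u * w i)" using C(2)[OF u(3) bd_w] by auto
    have "\<bar>m i mod n\<bar> \<le> \<bar>n\<bar>" using abs_mod_less[OF n(1), of "m i"] by linarith
    then have "\<bar>m i mod n\<bar> * (C * B * 1) \<le> \<bar>n\<bar> * (C * B)"
      using C(1) bd_nonneg[OF u(3)] by (simp add: mult_right_mono)
    with bd_mono[OF bd_scale[OF b]] show "bd (\<bar>n\<bar> * (C * B)) (of_int (m i mod n) * (u * w i))" by blast
  qed
  then have b: "\<bar>cf (of_int n * y) i\<bar> \<le> (\<Sum>i<d. \<bar>n\<bar> * (C * B))" if "i < d" for i
    using that by (simp only: bd_def)
  have "bd (int d * C * B) y"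
    unfolding bd_def
  proof (intro conjI allI impI yO)
    fix i assume i: "i < d"
    have "\<bar>n\<bar> * \<bar>cf y i\<bar> \<le> \<bar>n\<bar> * (int d * C * B)"
      using b[OF i] by (simp only: cf_scale[OF yO i] abs_mult) (simp add: mult_ac)
    then show "\<bar>cf y i\<bar> \<le> int d * C * B" using n(1) by (simp only: mult_le_cancel_left)
  qed
  moreover have "y - v \<in> I"
    using zideal_uminus[OF I zidealD(5)[OF I comb_in_Ord u(1)]] by (simp add: y_def)
  ultimately show ?thesis by blast
qed

lemma finite_cosets:
  assumes I: "zideal I" and n: "of_int n \<in> I" "n > 0"
  shows "finite (coset I ` Ord)" "idx I \<le> nat n ^ d"
proof -
  define F where "F = {x \<in> Ord. \<forall>i<d. cf x i \<in> {0..<n}}"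
  have fF: "finite F" and cF: "card F = nat n ^ d"
    unfolding F_def using finite_cf_in[of "\<lambda>_. {0..<n}"] card_cf_in[of "\<lambda>_. {0..<n}"] by auto
  have "\<exists>y\<in>F. y - x \<in> I" if x: "x \<in> Ord" for x
  proof
    show "comb (\<lambda>i. cf x i mod n) \<in> F" using n by (auto simp: F_def cf_comb)
    have "x - comb (\<lambda>i. cf x i mod n) = of_int n * comb (\<lambda>i. cf x i div n)"
      by (subst comb_cf[OF x, symmetric]) (simp add: comb_scale comb_diff minus_mod_eq_mult_div)
    then have "x - comb (\<lambda>i. cf x i mod n) \<in> I" using zidealD(5)[OF I comb_in_Ord n(1)] by simp
    then show "comb (\<lambda>i. cf x i mod n) - x \<in> I" using zideal_uminus[OF I] by fastforce
  qed
  then have *: "coset I ` Ord = coset I ` F" by (intro cosets_by_reps[OF I]) (auto simp: F_def)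
  show "finite (coset I ` Ord)" unfolding * using fF by simp
  show "idx I \<le> nat n ^ d" unfolding idx_def * using card_image_le[OF fF] cF by metis
qed

text \<open>Pigeonhole: there are \<open>(s + 1) ^ d\<close> elements with all coordinates in
  \<open>{0..s}\<close>, more than there are cosets, and the difference of two of them in the same
  coset has coordinates of absolute value at most \<open>s\<close>.\<close>

lemma short_vector:
  assumes I: "zideal I" and fin: "finite (coset I ` Ord)" and q: "idx I < (s + 1) ^ d"
  shows "\<exists>u\<in>I. u \<noteq> 0 \<and> bd (int s) u"
proof -
  define F where "F = {x \<in> Ord. \<forall>i<d. cf x i \<in> {0..int s}}"
  have fF: "finite F" and cF: "card F = (s + 1) ^ d"
    unfolding F_def using finite_cf_in[of "\<lambda>_. {0..int s}"] card_cf_in[of "\<lambda>_. {0..int s}"] 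
    by (auto simp: nat_add_distrib)
  have "card (coset I ` F) \<le> idx I"
    unfolding idx_def by (rule card_mono[OF fin]) (auto simp: F_def)
  then have "\<not> inj_on (coset I) F" using q cF pigeonhole by (metis le_less_trans)
  then obtain x y where xy: "x \<in> F" "y \<in> F" "x \<noteq> y" "coset I x = coset I y"
    by (auto simp: inj_on_def)
  have "x - y \<in> I" using xy coset_eq_iff[OF I] by (auto simp: F_def)
  moreover have "bd (int s) (x - y)"
    using xy by (fastforce simp: F_def bd_def cf_diff)
  moreover have "x - y \<noteq> 0" using xy by simp
  ultimately show ?thesis by blast
qed

text \<open>The covering radius of an ideal of index \<open>q\<close> is \<open>O(q^(1/d))\<close>: a nonzero element of size
  \<open>q^(1/d)\<close> exists by the pigeonhole principle, and its multiples by the basis span.\<close>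

lemma ex_covering_const:
  "\<exists>C\<ge>1. (\<forall>I u B v. zideal I \<longrightarrow> u \<in> I \<longrightarrow> u \<noteq> 0 \<longrightarrow> bd B u \<longrightarrow> v \<in> Ord \<longrightarrow>
      (\<exists>y. y - v \<in> I \<and> bd (C * B) y)) \<and>
    (\<forall>A B x y. bd A x \<longrightarrow> bd B y \<longrightarrow> bd (C * A * B) (x * y))"
proof -
  obtain C where C: "C \<ge> 1" "\<And>A B x y. bd A x \<Longrightarrow> bd B y \<Longrightarrow> bd (C * A * B) (x * y)"
    using ex_mult_const by blast
  have "bd (int d * C * A * B) (x * y)" if "bd A x" "bd B y" for A B x y
  proof (rule bd_mono[OF C(2)[OF that]])
    have "1 * C * A * B \<le> int d * C * A * B"
      using d_pos C(1) bd_nonneg[OF that(1)] bd_nonneg[OF that(2)] by (intro mult_right_mono) auto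
    then show "C * A * B \<le> int d * C * A * B" by simp
  qed
  moreover have "int d * C \<ge> 1" using C(1) d_pos by (simp add: int_one_le_iff_zero_less)
  moreover have "\<exists>y. y - v \<in> I \<and> bd (int d * C * B) y"
    if "zideal I" "u \<in> I" "u \<noteq> 0" "bd B u" "v \<in> Ord" for I u B v
    using covering_by_element[OF _ C(2) that] C(1) by auto
  ultimately show ?thesis by (intro exI[of _ "int d * C"]) blast
qed

text \<open>Both bounds come from injections between finite sets. With a short representative
  \<open>\<delta> c\<close> of each coset, \<open>(c, x) \<mapsto> x + \<delta> c\<close> embeds
  cosets times points of \<open>u + I\<close> into the larger box, since the coset of the sum
  determines \<open>c\<close>. Conversely every \<open>z\<close> of the smaller box is moved into
  \<open>u + I\<close> by the representative of the coset of \<open>u - z\<close>, and the resulting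
  pair still determines \<open>z\<close>.\<close>

lemma coset_count:
  assumes I: "zideal I" and fin: "finite (coset I ` Ord)"
    and cover: "\<And>v. v \<in> Ord \<Longrightarrow> \<exists>y. y - v \<in> I \<and> bd R y" and u: "u \<in> Ord" and R: "R \<ge> 0"
  shows "X \<ge> 0 \<Longrightarrow> int (idx I) * int (card {x \<in> box X. x - u \<in> I}) \<le> (2 * (X + R) + 1) ^ d"
    and "X \<ge> R \<Longrightarrow> (2 * (X - R) + 1) ^ d \<le> int (idx I) * int (card {x \<in> box X. x - u \<in> I})"
proof -
  have "\<forall>c\<in>coset I ` Ord. \<exists>y. coset I y = c \<and> bd R y"
  proof
    fix c assume "c \<in> coset I ` Ord"
    then obtain v where v: "v \<in> Ord" "c = coset I v" by blast
    then obtain y where "y - v \<in> I" "bd R y" using cover by blast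
    moreover from this have "coset I y = c" using coset_eq_iff[OF I bd_in_Ord] v by simp
    ultimately show "\<exists>y. coset I y = c \<and> bd R y" by blast
  qed
  then obtain \<delta> where \<delta>: "\<And>c. c \<in> coset I ` Ord \<Longrightarrow> coset I (\<delta> c) = c"
      "\<And>c. c \<in> coset I ` Ord \<Longrightarrow> bd R (\<delta> c)" by metis
  let ?D = "(coset I ` Ord) \<times> {x \<in> box X. x - u \<in> I}"
  have finD: "finite ?D" using fin by (intro finite_cartesian_product finite_subset[OF _ finite_box[of X]]) auto
  have cardD: "int (card ?D) = int (idx I) * int (card {x \<in> box X. x - u \<in> I})"
    by (simp add: idx_def card_cartesian_product)
  show "int (idx I) * int (card {x \<in> box X. x - u \<in> I}) \<le> (2 * (X + R) + 1) ^ d" if X: "X \<ge> 0"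
  proof -
    have "inj_on (\<lambda>(c, x). x + \<delta> c) ?D"
    proof (rule inj_onI, clarify)
      fix a b x y assume *: "a \<in> Ord" "b \<in> Ord" "x \<in> box X" "y \<in> box X" "x - u \<in> I" "y - u \<in> I"
        and eq: "x + \<delta> (coset I a) = y + \<delta> (coset I b)"
      have "\<delta> (coset I a) - \<delta> (coset I b) = (y - u) - (x - u)" using eq by (simp add: algebra_simps)
      moreover have "(y - u) - (x - u) \<in> I" using * zideal_diff[OF I, of "y - u" "x - u"] by blast
      ultimately have "\<delta> (coset I a) - \<delta> (coset I b) \<in> I" by metis
      then have "coset I (\<delta> (coset I a)) = coset I (\<delta> (coset I b))"
        using coset_eq_iff[OF I bd_in_Ord[OF \<delta>(2)] bd_in_Ord[OF \<delta>(2)], of "coset I a" "coset I b"] *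
        by blast
      then have "coset I a = coset I b" using \<delta>(1) * by simp
      then show "coset I a = coset I b \<and> x = y" using eq by simp
    qed
    moreover have "(\<lambda>(c, x). x + \<delta> c) ` ?D \<subseteq> box (X + R)"
      using \<delta>(2) by (auto simp: box_def intro!: bd_add)
    ultimately have "card ?D \<le> card (box (X + R))" by (intro card_inj_on_le) auto
    then show ?thesis using card_box[of "X + R"] cardD X R by simp
  qed
  show "(2 * (X - R) + 1) ^ d \<le> int (idx I) * int (card {x \<in> box X. x - u \<in> I})" if X: "X \<ge> R"
  proof -
    let ?g = "\<lambda>z. (coset I (u - z), z + \<delta> (coset I (u - z)))"
    have "inj_on ?g (box (X - R))" by (rule inj_onI) auto
    moreover have "?g ` box (X - R) \<subseteq> ?D"
    proof clarify
      fix z assume z: "z \<in> box (X - R)"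
      have zO: "z \<in> Ord" and uz: "u - z \<in> Ord" using z u by (auto simp: box_def bd_def)
      have d1: "coset I (\<delta> (coset I (u - z))) = coset I (u - z)" and d2: "bd R (\<delta> (coset I (u - z)))"
        using \<delta> uz by auto
      have "\<delta> (coset I (u - z)) - (u - z) \<in> I"
        using coset_eq_iff[OF I bd_in_Ord[OF d2] uz] d1 by simp
      moreover have "bd (X - R + R) (z + \<delta> (coset I (u - z)))"
        using z d2 by (intro bd_add) (auto simp: box_def)
      ultimately show "coset I (u - z) \<in> coset I ` Ord \<and> z + \<delta> (coset I (u - z)) \<in> {x \<in> box X. x - u \<in> I}"
        using uz by (auto simp: box_def algebra_simps)
    qed
    ultimately have "card (box (X - R)) \<le> card ?D" using finD by (rule card_inj_on_le)
    then have "int (card (box (X - R))) \<le> int (card ?D)" by simp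
    then show ?thesis using card_box[of "X - R"] cardD X by simp
  qed
qed

end

section \<open>Determinants and norms\<close>

lemma det_cong_mod:
  fixes A B :: "int mat"
  assumes A: "A \<in> carrier_mat n n" and B: "B \<in> carrier_mat n n"
    and *: "\<And>i j. i < n \<Longrightarrow> j < n \<Longrightarrow> [A $$ (i,j) = B $$ (i,j)] (mod m)"
  shows "[det A = det B] (mod m)"
  unfolding det_def'[OF A] det_def'[OF B]
proof (intro cong_sum cong_mult cong_refl cong_prod *)
  fix p i assume "p \<in> {p. p permutes {0..<n}}" "i \<in> {0..<n}"
  then show "p i < n" using permutes_in_image[of p "{0..<n}" i] by auto
qed auto

lemma abs_det_le:
  fixes A :: "int mat"
  assumes A: "A \<in> carrier_mat n n" and *: "\<And>i j. i < n \<Longrightarrow> j < n \<Longrightarrow> \<bar>A $$ (i,j)\<bar> \<le> K"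
  shows "\<bar>det A\<bar> \<le> fact n * K ^ n"
proof -
  have "\<bar>det A\<bar> \<le> (\<Sum>p\<in>{p. p permutes {0..<n}}. \<bar>signof p * (\<Prod>i = 0..<n. A $$ (i, p i))\<bar>)"
    unfolding det_def'[OF A] by (rule sum_abs)
  also have "\<dots> \<le> (\<Sum>p\<in>{p. p permutes {0..<n}}. K ^ n)"
  proof (rule sum_mono)
    fix p assume p: "p \<in> {p. p permutes {0..<n}}"
    have "\<bar>signof p * (\<Prod>i = 0..<n. A $$ (i, p i))\<bar> = (\<Prod>i = 0..<n. \<bar>A $$ (i, p i)\<bar>)"
      by (simp add: abs_mult abs_prod sign_def)
    also have "\<dots> \<le> (\<Prod>i = 0..<n. K)"
      using p permutes_in_image[of p "{0..<n}"] * by (intro prod_mono) auto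
    finally show "\<bar>signof p * (\<Prod>i = 0..<n. A $$ (i, p i))\<bar> \<le> K ^ n" by simp
  qed
  also have "\<dots> = fact n * K ^ n" by (simp add: card_permutations[of _ n])
  finally show ?thesis .
qed

context number_order
begin

definition colmat :: "(nat \<Rightarrow> complex) \<Rightarrow> int mat" where
  "colmat f = mat d d (\<lambda>(i, j). cf (f j) i)"

text \<open>The norm as the determinant of multiplication by \<open>x\<close> in the basis
  \<open>w\<close>, an integer by construction.\<close>

definition nrm :: "complex \<Rightarrow> int" where
  "nrm x = det (colmat (\<lambda>j. x * w j))"

lemma colmat_carrier [simp, intro]: "colmat f \<in> carrier_mat d d"
  by (simp add: colmat_def)

lemma colmat_cong: "(\<And>j. j < d \<Longrightarrow> f j = g j) \<Longrightarrow> colmat f = colmat g"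
  by (auto simp: colmat_def)

lemma colmat_times:
  assumes f: "\<And>j. j < d \<Longrightarrow> f j \<in> Ord"
  shows "colmat f * mat d d (\<lambda>(i, j). G i j) = colmat (\<lambda>j. \<Sum>k<d. of_int (G k j) * f k)"
proof (rule eq_matI)
  fix i j assume "i < dim_row (colmat (\<lambda>j. \<Sum>k<d. of_int (G k j) * f k))"
    "j < dim_col (colmat (\<lambda>j. \<Sum>k<d. of_int (G k j) * f k))"
  then have ij: "i < d" "j < d" by (auto simp: colmat_def)
  have "cf (\<Sum>k<d. of_int (G k j) * f k) i = (\<Sum>k<d. cf (of_int (G k j) * f k) i)"
    using f ij by (intro cf_sum Ord_scale) auto
  also have "\<dots> = (\<Sum>k<d. G k j * cf (f k) i)"
    using f ij by (intro sum.cong refl cf_scale) auto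
  also have "\<dots> = (colmat f * mat d d (\<lambda>(i, j). G i j)) $$ (i, j)"
    using ij by (simp add: colmat_def scalar_prod_def atLeast0LessThan mult.commute)
  finally show "(colmat f * mat d d (\<lambda>(i, j). G i j)) $$ (i, j) =
      colmat (\<lambda>j. \<Sum>k<d. of_int (G k j) * f k) $$ (i, j)"
    using ij by (simp add: colmat_def)
qed (auto simp: colmat_def)

lemma Ord_expand: "x \<in> Ord \<Longrightarrow> (\<Sum>k<d. of_int (cf x k) * w k) = x"
  using comb_cf[of x] by (simp add: comb_def)

lemma colmat_mult:
  assumes "x \<in> Ord" "y \<in> Ord"
  shows "colmat (\<lambda>j. x * w j) * colmat (\<lambda>j. y * w j) = colmat (\<lambda>j. (x * y) * w j)"
proof -
  have "colmat (\<lambda>j. x * w j) * mat d d (\<lambda>(i, j). cf (y * w j) i) =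
      colmat (\<lambda>j. \<Sum>k<d. of_int (cf (y * w j) k) * (x * w k))"
    using assms by (intro colmat_times) auto
  also have "\<dots> = colmat (\<lambda>j. (x * y) * w j)"
  proof (rule colmat_cong)
    fix j assume j: "j < d"
    have "(\<Sum>k<d. of_int (cf (y * w j) k) * (x * w k)) = x * (\<Sum>k<d. of_int (cf (y * w j) k) * w k)"
      by (simp add: sum_distrib_left mult_ac)
    also have "(\<Sum>k<d. of_int (cf (y * w j) k) * w k) = y * w j"
      using j assms by (intro Ord_expand) auto
    finally show "(\<Sum>k<d. of_int (cf (y * w j) k) * (x * w k)) = (x * y) * w j" by (simp add: mult_ac)
  qed
  finally show ?thesis by (simp add: colmat_def)
qed

lemma nrm_mult: "x \<in> Ord \<Longrightarrow> y \<in> Ord \<Longrightarrow> nrm (x * y) = nrm x * nrm y"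
  unfolding nrm_def by (subst colmat_mult[symmetric]) (auto intro: det_mult)

lemma nrm_of_int: "nrm (of_int n) = n ^ d"
proof -
  have "colmat (\<lambda>j. of_int n * w j) = n \<cdot>\<^sub>m 1\<^sub>m d"
    by (rule eq_matI) (auto simp: colmat_def cf_w cf_scale)
  then show ?thesis unfolding nrm_def by simp
qed

text \<open>The adjugate of the multiplication matrix supplies the cofactor. Its column 0 suffices:
  because \<open>w 0 = 1\<close>, column 0 of the matrix product lists the coordinates of
  \<open>x * y\<close>.\<close>

lemma nrm_multiple:
  assumes "x \<in> Ord"
  shows "\<exists>y\<in>Ord. x * y = of_int (nrm x)"
proof -
  let ?M = "colmat (\<lambda>j. x * w j)"
  define G where "G = (\<lambda>i j. adj_mat ?M $$ (i, j))"
  have adj: "adj_mat ?M = mat d d (\<lambda>(i, j). G i j)"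
    using adj_mat(1)[OF colmat_carrier] by (intro eq_matI) (auto simp: G_def)
  have xw: "x * w j \<in> Ord" if "j < d" for j using assms that by auto
  have "colmat (\<lambda>j. \<Sum>k<d. of_int (G k j) * (x * w k)) = nrm x \<cdot>\<^sub>m 1\<^sub>m d"
    using adj_mat(2)[OF colmat_carrier, of "\<lambda>j. x * w j"] xw unfolding adj nrm_def
    by (subst colmat_times[symmetric]) auto
  then have *: "colmat (\<lambda>j. \<Sum>k<d. of_int (G k j) * (x * w k)) $$ (i, 0) = (nrm x \<cdot>\<^sub>m 1\<^sub>m d) $$ (i, 0)" for i
    by simp
  define y where "y = (\<Sum>k<d. of_int (G k 0) * w k)"
  have yO: "y \<in> Ord" unfolding y_def by (intro Ord_sum Ord_scale) auto
  have xy: "x * y = (\<Sum>k<d. of_int (G k 0) * (x * w k))"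
    by (simp add: y_def sum_distrib_left mult_ac)
  have "x * y = of_int (nrm x)"
  proof (rule Ord_eqI)
    fix i assume i: "i < d"
    then show "cf (x * y) i = cf (of_int (nrm x)) i"
      using *[of i] d_pos unfolding xy by (auto simp: colmat_def cf_of_int)
  qed (use yO assms in auto)
  with yO show ?thesis by blast
qed

lemma nrm_nonzero:
  assumes "x \<in> Ord" "x \<noteq> 0"
  shows "nrm x \<noteq> 0"
proof -
  obtain a where "x = comb a" using assms by (auto simp: Ord_def)
  with assms cofactor[of a] obtain b n where n: "n \<noteq> 0" "x * comb b = of_int n"
    unfolding comb_def[symmetric] by blast
  have "nrm x * nrm (comb b) = n ^ d"
    using nrm_mult[OF assms(1), of "comb b"] n(2) nrm_of_int by simp
  with n(1) show ?thesis by auto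
qed

text \<open>The matrix of multiplication by \<open>1 + n * y\<close> is the identity modulo
  \<open>n\<close>. This is how the norms of a whole family of elements are kept prime to finitely
  many unwanted primes.\<close>

lemma nrm_cong_one:
  assumes "y \<in> Ord"
  shows "[nrm (1 + of_int n * y) = 1] (mod n)"
proof -
  have "[det (colmat (\<lambda>j. (1 + of_int n * y) * w j)) = det (1\<^sub>m d :: int mat)] (mod n)"
  proof (rule det_cong_mod[OF colmat_carrier])
    fix i j assume ij: "i < d" "j < d"
    have "cf ((1 + of_int n * y) * w j) i = cf (w j + of_int n * (y * w j)) i"
      by (simp add: algebra_simps)
    also have "\<dots> = cf (w j) i + cf (of_int n * (y * w j)) i"
      using ij assms by (intro cf_add) auto
    also have "\<dots> = cf (w j) i + n * cf (y * w j) i"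
      using ij assms cf_scale[of "y * w j" i n] by auto
    finally show "[colmat (\<lambda>j. (1 + of_int n * y) * w j) $$ (i, j) = 1\<^sub>m d $$ (i, j)] (mod n)"
      using ij by (auto simp: colmat_def cf_w cong_iff_dvd_diff)
  qed auto
  then show ?thesis by (simp add: nrm_def)
qed

lemma nrm_in_ideal: "zideal I \<Longrightarrow> x \<in> I \<Longrightarrow> of_int (nrm x) \<in> I"
  using nrm_multiple[of x] zidealD[of I] by (metis subsetD)

lemma int_in_proper_ideal:
  assumes I: "zideal I" and p: "prime p" "of_nat p \<in> I" and 1: "1 \<notin> I" and n: "of_int n \<in> I"
  shows "int p dvd n"
proof (rule ccontr)
  assume "\<not> int p dvd n"
  then have "coprime (int p) n" using p prime_imp_coprime[of "int p" n] by simp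
  then obtain u v where uv: "u * int p + v * n = 1" using bezout_int[of "int p" n] by auto
  then have "(1::complex) = of_int (u * int p + v * n)" by simp
  also have "\<dots> = of_int u * of_nat p + of_int v * of_int n" by simp
  also have "\<dots> \<in> I" using p n by (intro zidealD(3,4)[OF I]) auto
  finally show False using 1 by simp
qed

lemma dvd_nrm_of_mem:
  assumes "zideal I" "prime p" "of_nat p \<in> I" "1 \<notin> I" "x \<in> I"
  shows "int p dvd nrm x"
  using int_in_proper_ideal[OF assms(1-4)] nrm_in_ideal[OF assms(1,5)] by blast

lemma ex_nrm_bound: "\<exists>C\<ge>1. \<forall>B x. bd B x \<longrightarrow> \<bar>nrm x\<bar> \<le> C * B ^ d"
proof -
  obtain C where C: "C \<ge> 1" "\<And>A B x y. bd A x \<Longrightarrow> bd B y \<Longrightarrow> bd (C * A * B) (x * y)"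
    using ex_mult_const by blast
  have "\<bar>nrm x\<bar> \<le> (fact d * C ^ d) * B ^ d" if x: "bd B x" for B x
  proof -
    have "\<bar>nrm x\<bar> \<le> fact d * (C * B) ^ d"
      unfolding nrm_def
    proof (rule abs_det_le[OF colmat_carrier])
      fix i j assume ij: "i < d" "j < d"
      have "bd (C * B * 1) (x * w j)" using C(2)[OF x bd_w[OF ij(2)]] .
      then show "\<bar>colmat (\<lambda>j. x * w j) $$ (i, j)\<bar> \<le> C * B"
        using ij by (simp add: colmat_def bd_def)
    qed
    then show ?thesis by (simp add: power_mult_distrib mult_ac)
  qed
  moreover have "(1::int) \<le> fact d * C ^ d"
    using C(1) by (metis fact_ge_1 int_one_le_iff_zero_less one_le_power zero_less_mult_iff zero_less_one_class.zero_less_one order_less_le_trans)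
  ultimately show ?thesis by blast
qed

text \<open>As a function of \<open>t\<close> the norm is a characteristic polynomial, that of
  multiplication by \<open>- x\<close>. Its complex roots show that the norm can be small only when
  \<open>t\<close> is close to one of \<open>d\<close> fixed numbers.\<close>

lemma nrm_shift_factor:
  assumes x: "x \<in> Ord"
  shows "\<exists>ls :: complex list. length ls = d \<and> (\<forall>t. of_int (nrm (of_int t + x)) = (\<Prod>l\<leftarrow>ls. of_int t - l))"
proof -
  define A :: "complex mat" where "A = - map_mat of_int (colmat (\<lambda>j. x * w j))"
  have A: "A \<in> carrier_mat d d" by (simp add: A_def)
  obtain ls where ls: "char_poly A = (\<Prod>l\<leftarrow>ls. [:- l, 1:])" "length ls = d"
    using char_poly_factorized[OF A] by blast
  have "of_int (nrm (of_int t + x)) = (\<Prod>l\<leftarrow>ls. of_int t - l)" for t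
  proof -
    have "map_mat of_int (colmat (\<lambda>j. (of_int t + x) * w j)) = - char_matrix A (of_int t)"
    proof (rule eq_matI)
      fix i j assume "i < dim_row (- char_matrix A (of_int t))" "j < dim_col (- char_matrix A (of_int t))"
      then have ij: "i < d" "j < d" by (auto simp: char_matrix_def A_def colmat_def)
      have "cf ((of_int t + x) * w j) i = cf (of_int t * w j + x * w j) i"
        by (simp add: algebra_simps)
      also have "\<dots> = t * cf (w j) i + cf (x * w j) i"
        using ij x by (subst cf_add) (auto simp: cf_scale)
      finally have *: "cf ((of_int t + x) * w j) i = \<dots>" .
      show "map_mat of_int (colmat (\<lambda>j. (of_int t + x) * w j)) $$ (i, j) = (- char_matrix A (of_int t)) $$ (i, j)"
        using ij by (auto simp: char_matrix_def A_def colmat_def * cf_w)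
    qed (auto simp: char_matrix_def A_def colmat_def)
    then have "of_int (nrm (of_int t + x)) = det (- char_matrix A (of_int t))"
      unfolding nrm_def by (simp flip: of_int_hom.hom_det)
    also have "\<dots> = poly (char_poly A) (of_int t)" using char_poly_matrix[OF A] by simp
    also have "\<dots> = (\<Prod>l\<leftarrow>ls. of_int t - l)" unfolding ls(1)
      by (induction ls) (auto simp: algebra_simps)
    finally show ?thesis .
  qed
  with ls(2) show ?thesis by blast
qed

text \<open>At the prime \<open>\<Lambda>\<close> of degree one the localization is generated by \<open>p\<close>, as witnessed by \<open>a\<close>.
  If \<open>x\<close> generates \<open>\<Lambda>\<close> locally and lies in no other prime above \<open>p\<close> then \<open>\<Lambda> = x Ord + p \<Lambda>\<close>,
  hence \<open>nrm x\<close> is \<open>p\<close> times a unit modulo \<open>p\<close>.\<close>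

lemma prime_sq_not_dvd_nrm:
  assumes p: "prime p" and L: "zideal L" "of_nat p \<in> L" "1 \<notin> L"
    and deg1: "\<And>y. y \<in> Ord \<Longrightarrow> \<exists>m. y - of_int m \<in> L"
    and a: "a \<in> Ord" "a \<notin> L" "\<And>y. y \<in> L \<Longrightarrow> \<exists>z\<in>Ord. a * y = of_nat p * z"
    and x: "x \<in> L" and only: "\<And>M. zideal M \<Longrightarrow> of_nat p \<in> M \<Longrightarrow> 1 \<notin> M \<Longrightarrow> x \<in> M \<Longrightarrow> M \<subseteq> L"
    and simple: "\<And>z. z \<in> Ord \<Longrightarrow> a * x = of_nat p * z \<Longrightarrow> z \<notin> L"
  shows "\<not> (int p)^2 dvd nrm x"
proof -
  have pos: "p > 0" using p prime_gt_0_nat by blast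
  have LO: "L \<subseteq> Ord" using L zidealD by blast
  have xO: "x \<in> Ord" using x LO by blast
  define J where "J = {x * u + of_nat p * m | u m. u \<in> Ord \<and> m \<in> L}"
  have J: "zideal J"
    unfolding zideal_def
  proof (intro conjI ballI)
    show "J \<subseteq> Ord" unfolding J_def using xO LO by auto
    show "0 \<in> J" unfolding J_def using zidealD(2)[OF L(1)] by (intro CollectI exI[of _ 0]) auto
  next
    fix u v assume "u \<in> J" "v \<in> J"
    then obtain a b a' b' where ab: "u = x * a + of_nat p * b" "v = x * a' + of_nat p * b'"
      "a \<in> Ord" "b \<in> L" "a' \<in> Ord" "b' \<in> L" unfolding J_def by blast
    then have "u + v = x * (a + a') + of_nat p * (b + b')" by (simp add: algebra_simps)
    moreover have "a + a' \<in> Ord" "b + b' \<in> L" using ab zidealD(3)[OF L(1)] by auto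
    ultimately show "u + v \<in> J" unfolding J_def by blast
  next
    fix r u assume r: "r \<in> Ord" and "u \<in> J"
    then obtain a b where ab: "u = x * a + of_nat p * b" "a \<in> Ord" "b \<in> L" unfolding J_def by blast
    then have "r * u = x * (r * a) + of_nat p * (r * b)" by (simp add: algebra_simps)
    moreover have "r * a \<in> Ord" "r * b \<in> L" using ab r zidealD(4)[OF L(1)] by auto
    ultimately show "r * u \<in> J" unfolding J_def by blast
  qed
  obtain z where z: "z \<in> Ord" "a * x = of_nat p * z" using a(3)[OF x] by blast
  with simple have zL: "z \<notin> L" by blast
  obtain m where m: "z - of_int m \<in> L" using deg1 z by blast
  have "\<not> int p dvd m"
  proof
    assume "int p dvd m"
    then obtain k where "m = int p * k" by auto
    then have "of_int m = of_int k * (of_nat p :: complex)" by simp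
    then have "of_int m \<in> L" using zidealD(4)[OF L(1) _ L(2)] by auto
    then show False using zL m zideal_mem_cong[OF L(1)] by blast
  qed
  then have "coprime m (int p)" using p prime_imp_coprime by (metis coprime_commute prime_nat_int_transfer)
  then obtain b where b: "[m * b = 1] (mod int p)" using cong_solve_coprime_int by blast
  then obtain k where k: "m * b = 1 + int p * k"
    by (metis add.commute cong_iff_lin cong_sym)
  have bz: "1 - of_int b * z \<in> L"
  proof -
    have "(of_int (m * b) :: complex) = of_int (1 + int p * k)" using k by simp
    then have e: "1 - of_int b * z = of_int (- b) * (z - of_int m) - of_int k * of_nat p"
      by (simp add: algebra_simps)
    have "of_int (- b) * (z - of_int m) \<in> L" "of_int k * of_nat p \<in> L"
      using m L(2) zidealD(4)[OF L(1) of_int_in_Ord] by blast+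
    then show ?thesis unfolding e by (rule zideal_diff[OF L(1)])
  qed
  have pJ: "of_nat p \<in> J"
  proof -
    have "of_nat p = x * (a * of_int b) + of_nat p * (1 - of_int b * z)"
      using z(2) by (simp add: algebra_simps)
    moreover have "a * of_int b \<in> Ord" using a(1) by auto
    ultimately show ?thesis unfolding J_def using bz by blast
  qed
  \<comment> \<open>The transporter of \<open>L\<close> into \<open>J\<close>. It contains
    \<open>p\<close> and \<open>x\<close>, so if it were proper then \<open>only\<close> would place
    it inside \<open>L\<close>; but it also contains \<open>a\<close>, which lies outside
    \<open>L\<close>.\<close>
  define A where "A = {y \<in> Ord. \<forall>l\<in>L. y * l \<in> J}"
  have A: "zideal A"
    unfolding zideal_def A_def
    using J zidealD[OF J] LO by (auto simp: distrib_right mult.assoc)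
  have "1 \<in> A"
  proof (rule ccontr)
    assume 1: "1 \<notin> A"
    have "of_nat p \<in> A" unfolding A_def using pJ zidealD(5)[OF J] LO by auto
    moreover have "x \<in> A"
      unfolding A_def
    proof (intro CollectI conjI ballI xO)
      fix l assume "l \<in> L"
      then show "x * l \<in> J" unfolding J_def using LO zidealD(2)[OF L(1)]
        by (intro CollectI exI[of _ l] exI[of _ 0]) auto
    qed
    ultimately have "A \<subseteq> L" using only A 1 by blast
    moreover have "a \<in> A"
      unfolding A_def
    proof (intro CollectI conjI ballI a(1))
      fix l assume "l \<in> L"
      then obtain z where "z \<in> Ord" "a * l = of_nat p * z" using a(3) by blast
      then show "a * l \<in> J" using zidealD(5)[OF J _ pJ] by simp
    qed
    ultimately show False using a(2) by blast
  qed
  then have LJ: "L \<subseteq> J" unfolding A_def by auto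
  \<comment> \<open>the integral basis of \<open>L\<close>\<close>
  have "\<forall>j. \<exists>r. j < d \<longrightarrow> w j - of_int r \<in> L" using deg1 by blast
  then obtain r where r: "\<And>j. j < d \<Longrightarrow> w j - of_int (r j) \<in> L" by metis
  define lam where "lam j = (if j = 0 then of_nat p else w j - of_int (r j))" for j
  have lamL: "lam j \<in> L" if "j < d" for j using that r L(2) by (auto simp: lam_def)
  have span: "\<exists>g :: nat \<Rightarrow> int. y = (\<Sum>i<d. of_int (g i) * lam i)" if y: "y \<in> L" for y
  proof -
    have yO: "y \<in> Ord" using y LO by blast
    \<comment> \<open>The integer part of \<open>y\<close> after rewriting \<open>w i\<close> as
      \<open>lam i + r i\<close>. It lies in \<open>L\<close>, so it is a multiple of
      \<open>p\<close>, that is of \<open>lam 0\<close>.\<close>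
    define t where "t = cf y 0 + (\<Sum>i\<in>{1..<d}. cf y i * r i)"
    have split: "{..<d} = insert 0 {1..<d}" using d_pos by auto
    have ey: "y = of_int t + (\<Sum>i\<in>{1..<d}. of_int (cf y i) * lam i)"
    proof -
      have "y = (\<Sum>i<d. of_int (cf y i) * w i)" using Ord_expand[OF yO] by simp
      also have "\<dots> = of_int (cf y 0) + (\<Sum>i\<in>{1..<d}. of_int (cf y i) * w i)"
        unfolding split by (subst sum.insert) (auto simp: w0)
      also have "(\<Sum>i\<in>{1..<d}. of_int (cf y i) * w i) =
          (\<Sum>i\<in>{1..<d}. of_int (cf y i) * lam i) + (\<Sum>i\<in>{1..<d}. of_int (cf y i * r i))"
        unfolding sum.distrib[symmetric] by (intro sum.cong) (auto simp: lam_def algebra_simps)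
      finally show ?thesis by (simp only: t_def of_int_add of_int_sum add_ac)
    qed
    have "(\<Sum>i\<in>{1..<d}. of_int (cf y i) * lam i) \<in> L"
      by (intro zideal_sum[OF L(1)] zidealD(4)[OF L(1)] lamL) auto
    moreover have "of_int t = y - (\<Sum>i\<in>{1..<d}. of_int (cf y i) * lam i)" using ey by (metis add_diff_cancel_right')
    ultimately have "of_int t \<in> L" using zideal_diff[OF L(1) y] by metis
    then obtain s where s: "t = int p * s" using int_in_proper_ideal[OF L(1) p L(2,3)] by blast
    have "(\<Sum>i<d. of_int (((cf y)(0 := s)) i) * lam i) = of_int s * of_nat p + (\<Sum>i\<in>{1..<d}. of_int (cf y i) * lam i)"
      unfolding split by (subst sum.insert) (auto simp: lam_def)
    then have "y = (\<Sum>i<d. of_int (((cf y)(0 := s)) i) * lam i)" using ey s by (simp add: mult.commute)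
    then show ?thesis by blast
  qed
  define g where "g y = (SOME g :: nat \<Rightarrow> int. y = (\<Sum>i<d. of_int (g i) * lam i))" for y
  have g: "y = (\<Sum>i<d. of_int (g y i) * lam i)" if "y \<in> L" for y
    unfolding g_def by (rule someI_ex[OF span[OF that]])
  have lamO: "lam j \<in> Ord" if "j < d" for j using lamL[OF that] LO by blast
  define U where "U = mat d d (\<lambda>(i, j). g (x * w j) i)"
  have U: "U \<in> carrier_mat d d" by (simp add: U_def)
  have MU: "colmat (\<lambda>j. x * w j) = colmat lam * U"
    unfolding U_def by (subst colmat_times[OF lamO]) 
      (auto intro!: colmat_cong g zidealD(5)[OF L(1) _ x])
  have detB: "det (colmat lam) = int p"
  proof -
    have cf_lam: "cf (lam j) i = (if j = 0 then if i = 0 then int p else 0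
        else (if i = j then 1 else 0) - (if i = 0 then r j else 0))" if "i < d" "j < d" for i j
      using that cf_of_int[of i "int p"] by (auto simp: lam_def cf_diff cf_w cf_of_int)
    have "upper_triangular (colmat lam)"
      by (auto simp: colmat_def cf_lam)
    then have "det (colmat lam) = prod_list (diag_mat (colmat lam))"
      by (rule det_upper_triangular[OF _ colmat_carrier])
    also have "\<dots> = (\<Prod>i = 0..<d. colmat lam $$ (i, i))"
      by (simp add: prod_list_diag_prod colmat_def)
    also have "\<dots> = (\<Prod>i = 0..<d. if i = 0 then int p else 1)"
      by (intro prod.cong) (auto simp: colmat_def cf_lam)
    also have "\<dots> = int p" using d_pos by (subst prod.delta) auto
    finally show ?thesis .
  qed
  have "\<forall>j. \<exists>u m. j < d \<longrightarrow> u \<in> Ord \<and> m \<in> L \<and> lam j = x * u + of_nat p * m"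
    using lamL LJ unfolding J_def by blast
  then obtain u m where um: "\<And>j. j < d \<Longrightarrow> u j \<in> Ord \<and> m j \<in> L \<and> lam j = x * u j + of_nat p * m j"
    by metis
  define C where "C = mat d d (\<lambda>(i, j). cf (u j) i)"
  define N where "N = mat d d (\<lambda>(i, j). g (m j) i)"
  have C: "C \<in> carrier_mat d d" and N: "N \<in> carrier_mat d d" by (auto simp: C_def N_def)
  \<comment> \<open>In the basis \<open>lam\<close> of \<open>L\<close>, \<open>U\<close> describes
    the multiples \<open>x * w j\<close>, while \<open>C\<close> and \<open>N\<close> describe
    \<open>lam j\<close> as a multiple of \<open>x\<close> plus an element of \<open>p L\<close>.
    Cancelling the determinant \<open>p\<close> of \<open>lam\<close> leaves
    \<open>det U * det C = 1\<close> modulo \<open>p\<close>, and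
    \<open>nrm x = p * det U\<close>.\<close>
  have "colmat lam = colmat lam * (U * C) + colmat (\<lambda>j. of_nat p * m j)"
  proof -
    have "colmat lam * (U * C) = colmat (\<lambda>j. x * w j) * C"
      using U C by (simp add: MU assoc_mult_mat[of _ d d _ d _ d])
    also have "\<dots> = colmat (\<lambda>j. \<Sum>k<d. of_int (cf (u j) k) * (x * w k))"
      unfolding C_def using xO by (intro colmat_times) auto
    also have "\<dots> = colmat (\<lambda>j. x * u j)"
    proof (rule colmat_cong)
      fix j assume j: "j < d"
      have "(\<Sum>k<d. of_int (cf (u j) k) * (x * w k)) = x * (\<Sum>k<d. of_int (cf (u j) k) * w k)"
        by (simp add: sum_distrib_left mult_ac)
      then show "(\<Sum>k<d. of_int (cf (u j) k) * (x * w k)) = x * u j"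
        using Ord_expand[of "u j"] um[OF j] by simp
    qed
    finally have e: "colmat lam * (U * C) = colmat (\<lambda>j. x * u j)" .
    show ?thesis unfolding e
    proof (rule eq_matI)
      fix i j assume "i < dim_row (colmat (\<lambda>j. x * u j) + colmat (\<lambda>j. of_nat p * m j))"
        "j < dim_col (colmat (\<lambda>j. x * u j) + colmat (\<lambda>j. of_nat p * m j))"
      then have ij: "i < d" "j < d" by (auto simp: colmat_def)
      have "x * u j \<in> Ord" "of_nat p * m j \<in> Ord" using um[OF ij(2)] xO LO by auto
      then have "cf (lam j) i = cf (x * u j) i + cf (of_nat p * m j) i"
        using um[OF ij(2)] cf_add ij by simp
      then show "colmat lam $$ (i, j) = (colmat (\<lambda>j. x * u j) + colmat (\<lambda>j. of_nat p * m j)) $$ (i, j)"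
        using ij by (simp add: colmat_def)
    qed (auto simp: colmat_def)
  qed
  also have "colmat (\<lambda>j. of_nat p * m j) = colmat lam * (int p \<cdot>\<^sub>m N)"
  proof -
    have "int p \<cdot>\<^sub>m N = mat d d (\<lambda>(i, j). int p * g (m j) i)" by (rule eq_matI) (auto simp: N_def)
    then have "colmat lam * (int p \<cdot>\<^sub>m N) = colmat (\<lambda>j. \<Sum>k<d. of_int (int p * g (m j) k) * lam k)"
      using colmat_times[where f = lam and G = "\<lambda>i j. int p * g (m j) i", OF lamO] by simp
    also have "\<dots> = colmat (\<lambda>j. of_nat p * m j)"
    proof (rule colmat_cong)
      fix j assume j: "j < d"
      have "(\<Sum>k<d. of_int (int p * g (m j) k) * lam k) = of_nat p * (\<Sum>k<d. of_int (g (m j) k) * lam k)"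
        by (simp add: sum_distrib_left mult_ac)
      then show "(\<Sum>k<d. of_int (int p * g (m j) k) * lam k) = of_nat p * m j"
        using g[of "m j"] um[OF j] by simp
    qed
    finally show ?thesis by simp
  qed
  also have "colmat lam * (U * C) + colmat lam * (int p \<cdot>\<^sub>m N) = colmat lam * (U * C + int p \<cdot>\<^sub>m N)"
    using U C N by (intro mult_add_distrib_mat[symmetric, of _ d d _ d]) auto
  finally have "det (colmat lam) = det (colmat lam * (U * C + int p \<cdot>\<^sub>m N))" by (rule arg_cong)
  also have "\<dots> = det (colmat lam) * det (U * C + int p \<cdot>\<^sub>m N)"
    using U C N by (intro det_mult[of _ d]) auto
  finally have "det (U * C + int p \<cdot>\<^sub>m N) = 1" unfolding detB using pos by simp
  moreover have "[det (U * C + int p \<cdot>\<^sub>m N) = det (U * C)] (mod int p)"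
    using U C N by (intro det_cong_mod[of _ d]) (auto simp: cong_iff_dvd_diff)
  moreover have "det (U * C) = det U * det C" using U C by (rule det_mult)
  ultimately have "[det U * det C = 1] (mod int p)" by (simp add: cong_sym_eq)
  then have "\<not> int p dvd det U"
    using p by (metis cong_dvd_iff dvd_mult2 not_prime_unit prime_nat_int_transfer)
  moreover have "nrm x = int p * det U"
    unfolding nrm_def MU using U detB by (subst det_mult[of _ d]) auto
  ultimately show ?thesis using pos by (simp add: power2_eq_square)
qed

end

section \<open>Ideals above a rational prime\<close>

context number_order
begin

definition above :: "nat \<Rightarrow> complex set \<Rightarrow> bool" where
  "above p I \<longleftrightarrow> zideal I \<and> of_nat p \<in> I \<and> 1 \<notin> I"

definition maxideal :: "nat \<Rightarrow> complex set \<Rightarrow> bool" where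
  "maxideal p M \<longleftrightarrow> above p M \<and> (\<forall>I. above p I \<longrightarrow> M \<subseteq> I \<longrightarrow> I = M)"

text \<open>The residue field is the prime field: integers represent all residues. Such an ideal is
  automatically maximal, see \<open>deg1_imp_maxideal\<close>.\<close>

definition deg1 :: "nat \<Rightarrow> complex set \<Rightarrow> bool" where
  "deg1 p I \<longleftrightarrow> above p I \<and> (\<forall>y\<in>Ord. \<exists>m. y - of_int m \<in> I)"

lemma maxidealD: "maxideal p M \<Longrightarrow> above p M" by (simp add: maxideal_def)

lemma zideal_add_principal:
  assumes I: "zideal I" and x: "x \<in> Ord"
  shows "zideal {y + r * x | y r. y \<in> I \<and> r \<in> Ord}"
  unfolding zideal_def
proof (intro conjI ballI)
  show "{y + r * x | y r. y \<in> I \<and> r \<in> Ord} \<subseteq> Ord" using x zidealD(1)[OF I] by auto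
  show "0 \<in> {y + r * x | y r. y \<in> I \<and> r \<in> Ord}"
    using zidealD(2)[OF I] by (intro CollectI exI[of _ 0]) auto
next
  fix u v assume "u \<in> {y + r * x | y r. y \<in> I \<and> r \<in> Ord}" "v \<in> {y + r * x | y r. y \<in> I \<and> r \<in> Ord}"
  then obtain y r y' r' where *: "u = y + r * x" "v = y' + r' * x" "y \<in> I" "r \<in> Ord" "y' \<in> I" "r' \<in> Ord"
    by blast
  then have "u + v = (y + y') + (r + r') * x" by (simp add: algebra_simps)
  moreover have "y + y' \<in> I" "r + r' \<in> Ord" using * zidealD(3)[OF I] by auto
  ultimately show "u + v \<in> {y + r * x | y r. y \<in> I \<and> r \<in> Ord}" by blast
next
  fix s u assume s: "s \<in> Ord" and "u \<in> {y + r * x | y r. y \<in> I \<and> r \<in> Ord}"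
  then obtain y r where *: "u = y + r * x" "y \<in> I" "r \<in> Ord" by blast
  then have "s * u = s * y + (s * r) * x" by (simp add: algebra_simps)
  moreover have "s * y \<in> I" "s * r \<in> Ord" using * s zidealD(4)[OF I] by auto
  ultimately show "s * u \<in> {y + r * x | y r. y \<in> I \<and> r \<in> Ord}" by blast
qed

text \<open>An ideal containing \<open>p\<close> is a union of cosets of \<open>p Ord\<close>, so it
  is known once its elements with reduced coordinates are known. There are finitely many of these,
  and \<open>ex_maxideal\<close> obtains a maximal ideal by maximizing their number.\<close>

lemma ideal_determined_by_residues:
  assumes I: "zideal I" "of_nat p \<in> I" and J: "zideal J" "of_nat p \<in> J" and p: "p > 0"
    and *: "I \<inter> {x \<in> Ord. \<forall>i<d. cf x i \<in> {0..<int p}} \<subseteq> J"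
  shows "I \<subseteq> J"
proof
  fix x assume x: "x \<in> I"
  then have xO: "x \<in> Ord" using zidealD(1)[OF I(1)] by blast
  define y where "y = comb (\<lambda>i. cf x i mod int p)"
  have "x - y = of_nat p * comb (\<lambda>i. cf x i div int p)"
    using comb_scale[of "int p" "\<lambda>i. cf x i div int p"]
    unfolding y_def by (subst comb_cf[OF xO, symmetric]) (simp add: comb_diff minus_mod_eq_mult_div)
  then have d: "x - y \<in> I" "x - y \<in> J"
    using zidealD(5)[OF I(1) comb_in_Ord I(2)] zidealD(5)[OF J(1) comb_in_Ord J(2)] by simp_all
  have "y \<in> I" using d(1) x zideal_mem_cong[OF I(1)] by blast
  moreover have "y \<in> {x \<in> Ord. \<forall>i<d. cf x i \<in> {0..<int p}}"
    using p by (simp add: y_def cf_comb)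
  ultimately have "y \<in> J" using * by blast
  then show "x \<in> J" using d(2) zideal_mem_cong[OF J(1)] by blast
qed

lemma ex_maxideal:
  assumes p: "p > 0" and I: "above p I"
  shows "\<exists>M. maxideal p M \<and> I \<subseteq> M"
proof -
  define F where "F = {x \<in> Ord. \<forall>i<d. cf x i \<in> {0..<int p}}"
  have finF: "finite F" unfolding F_def by (rule finite_cf_in) auto
  have "\<exists>M. (above p M \<and> I \<subseteq> M) \<and> (\<forall>J. above p J \<and> I \<subseteq> J \<longrightarrow> card (J \<inter> F) \<le> card (M \<inter> F))"
    by (rule ex_has_greatest_nat[of _ I _ "Suc (card F)"])
       (use I in \<open>auto simp: less_Suc_eq_le intro: card_mono[OF finF]\<close>)
  then obtain M where M: "above p M" "I \<subseteq> M" and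
    max: "\<And>J. above p J \<Longrightarrow> I \<subseteq> J \<Longrightarrow> card (J \<inter> F) \<le> card (M \<inter> F)" by blast
  have "J = M" if J: "above p J" "M \<subseteq> J" for J
  proof -
    have "card (J \<inter> F) \<le> card (M \<inter> F)" using max J M by blast
    moreover have "M \<inter> F \<subseteq> J \<inter> F" using J by blast
    ultimately have "M \<inter> F = J \<inter> F" using finF by (intro card_seteq) auto
    then have "J \<subseteq> M"
      using J M p by (intro ideal_determined_by_residues[of J p M]) (auto simp: above_def F_def)
    with J show ?thesis by blast
  qed
  with M show ?thesis unfolding maxideal_def by blast
qed

lemma maxideal_prime:
  assumes M: "maxideal p M" and x: "x \<in> Ord" "x \<notin> M" and y: "y \<in> Ord" "y \<notin> M"
  shows "x * y \<notin> M"
proof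
  assume xy: "x * y \<in> M"
  have I: "zideal M" "of_nat p \<in> M" using M by (auto simp: maxideal_def above_def)
  define J where "J = {m + r * x | m r. m \<in> M \<and> r \<in> Ord}"
  have J: "zideal J" unfolding J_def by (rule zideal_add_principal[OF I(1) x(1)])
  have MJ: "M \<subseteq> J" unfolding J_def by (force intro: exI[of _ 0])
  have "x \<in> J" unfolding J_def using zidealD(2)[OF I(1)] by (intro CollectI exI[of _ 0] exI[of _ 1]) auto
  then have "1 \<in> J" using M J MJ I(2) x(2) unfolding maxideal_def above_def by blast
  then obtain m r where mr: "1 = m + r * x" "m \<in> M" "r \<in> Ord" unfolding J_def by blast
  have "y = y * m + r * (x * y)"
    by (subst mult_1_right[of y, symmetric], subst mr(1)) (simp add: algebra_simps)
  also have "\<dots> \<in> M"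
    using zidealD(3)[OF I(1) zidealD(4)[OF I(1) y(1) mr(2)] zidealD(4)[OF I(1) mr(3) xy]] .
  finally show False using y by blast
qed

lemma maxideal_prod:
  assumes M: "maxideal p M" and x: "\<And>i. i \<in> A \<Longrightarrow> x i \<in> Ord \<and> x i \<notin> M"
  shows "prod x A \<notin> M"
  using x
proof (induction A rule: infinite_finite_induct)
  case (insert i A)
  then show ?case using maxideal_prime[OF M, of "x i" "prod x A"] by (auto intro: Ord_prod)
qed (use M in \<open>auto simp: maxideal_def above_def\<close>)

lemma idx_ge:
  assumes I: "zideal I" and fin: "finite (coset I ` Ord)" and f: "\<And>t. t \<in> T \<Longrightarrow> f t \<in> Ord"
    and inj: "\<And>s t. s \<in> T \<Longrightarrow> t \<in> T \<Longrightarrow> f s - f t \<in> I \<Longrightarrow> s = t"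
  shows "card T \<le> idx I"
proof -
  have "inj_on (\<lambda>t. coset I (f t)) T"
    using inj f by (auto simp: inj_on_def coset_eq_iff[OF I])
  moreover have "(\<lambda>t. coset I (f t)) ` T \<subseteq> coset I ` Ord" using f by blast
  ultimately show ?thesis unfolding idx_def using fin by (metis card_inj_on_le)
qed

lemma zideal_pmult: "zideal {of_nat p * y | y. y \<in> Ord}"
  unfolding zideal_def
proof (intro conjI ballI)
  fix u v assume "u \<in> {of_nat p * y | y. y \<in> Ord}" "v \<in> {of_nat p * y | y. y \<in> Ord}"
  then show "u + v \<in> {of_nat p * y | y. y \<in> Ord}" by (auto simp flip: distrib_left)
next
  fix r u assume "r \<in> Ord" "u \<in> {of_nat p * y | y. y \<in> Ord}"
  then obtain y where y: "r * u = of_nat p * (r * y)" "y \<in> Ord" by (auto simp: mult_ac)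
  then show "r * u \<in> {of_nat p * y | y. y \<in> Ord}" using \<open>r \<in> Ord\<close> by blast
qed (auto intro: exI[of _ 0])

lemma int_in_above: "prime p \<Longrightarrow> above p M \<Longrightarrow> of_int n \<in> M \<longleftrightarrow> int p dvd n"
proof
  assume p: "prime p" and M: "above p M" and "int p dvd n"
  then obtain k where "n = int p * k" by auto
  then have "of_int n = of_int k * (of_nat p :: complex)" by simp
  then show "of_int n \<in> M" using M zidealD(4)[of M "of_int k" "of_nat p"] by (auto simp: above_def)
qed (auto simp: above_def intro: int_in_proper_ideal)

lemma small_dvd_diff: "int p dvd i - j \<Longrightarrow> i \<in> {0..<int p} \<Longrightarrow> j \<in> {0..<int p} \<Longrightarrow> i = j"
  by (metis atLeastLessThan_iff mod_eq_dvd_iff mod_pos_pos_trivial)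

text \<open>Chinese remainders: for each \<open>M\<close> in a finite set \<open>S\<close> of
  maximal ideals, \<open>x M\<close> is a product that lies in every member of \<open>S\<close>
  except \<open>M\<close>. Combinations with coefficients in \<open>{0..<p}\<close> are then
  incongruent modulo \<open>p Ord\<close>, whose index is at most \<open>p ^ d\<close>.\<close>

lemma card_maxideals:
  assumes p: "prime p"
  shows "finite {M. maxideal p M}" "card {M. maxideal p M} \<le> d"
proof -
  have pos: "p > 0" and p1: "p > 1" using p prime_gt_0_nat prime_gt_1_nat by auto
  have main: "card S \<le> d" if S: "finite S" "S \<subseteq> {M. maxideal p M}" for S
  proof -
    have ex: "\<exists>y\<in>N. y \<notin> M" if "M \<in> S" "N \<in> S" "M \<noteq> N" for M N
      using S that unfolding maxideal_def by blast
    then obtain y where y: "\<And>M N. M \<in> S \<Longrightarrow> N \<in> S \<Longrightarrow> M \<noteq> N \<Longrightarrow> y M N \<in> N \<and> y M N \<notin> M"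
      by metis
    have Sz: "zideal M" "M \<subseteq> Ord" if "M \<in> S" for M
      using S that zidealD(1)[of M] by (auto simp: maxideal_def above_def)
    define x where "x M = (\<Prod>N\<in>S - {M}. y M N)" for M
    have xO: "x M \<in> Ord" if "M \<in> S" for M
      unfolding x_def using y that Sz(2) by (intro Ord_prod) blast
    have xn: "x M \<notin> M" if "M \<in> S" for M
      unfolding x_def using S that y Sz(2) by (intro maxideal_prod[of p]) blast+
    have xi: "x M \<in> N" if "M \<in> S" "N \<in> S" "M \<noteq> N" for M N
    proof -
      have "x M = y M N * (\<Prod>N\<in>S - {M} - {N}. y M N)"
        unfolding x_def using S that by (intro prod.remove) auto
      moreover have "(\<Prod>N\<in>S - {M} - {N}. y M N) \<in> Ord"
        using y that Sz(2) by (intro Ord_prod) blast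
      ultimately show ?thesis using zidealD(5)[OF Sz(1)[OF that(2)]] y[OF that] by simp
    qed
    let ?P = "{of_nat p * y | y. y \<in> Ord}"
    have finP: "finite (coset ?P ` Ord)" "idx ?P \<le> p ^ d"
      using finite_cosets[OF zideal_pmult, of "int p" p] pos by (auto intro!: exI[of _ 1])
    have "card (S \<rightarrow>\<^sub>E {0..<int p}) \<le> idx ?P"
    proof (rule idx_ge[OF zideal_pmult finP(1), where f = "\<lambda>t. \<Sum>M\<in>S. of_int (t M) * x M"])
      show "(\<Sum>M\<in>S. of_int (t M) * x M) \<in> Ord" for t using xO by (intro Ord_sum Ord_scale) auto
      fix s t assume st: "s \<in> S \<rightarrow>\<^sub>E {0..<int p}" "t \<in> S \<rightarrow>\<^sub>E {0..<int p}"
        and "(\<Sum>M\<in>S. of_int (s M) * x M) - (\<Sum>M\<in>S. of_int (t M) * x M) \<in> ?P"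
      then obtain z where z: "z \<in> Ord" "(\<Sum>M\<in>S. of_int (s M) * x M) - (\<Sum>M\<in>S. of_int (t M) * x M) = of_nat p * z"
        by blast
      show "s = t"
      proof (rule PiE_ext[OF st])
        fix M assume M: "M \<in> S"
        have mx: "maxideal p M" using S M by blast
        have "(\<Sum>N\<in>S. of_int (s N - t N) * x N) = of_nat p * z"
          using z(2) by (simp add: sum_subtractf algebra_simps)
        also have "\<dots> \<in> M" using mx z(1) Sz(1)[OF M] by (auto simp: maxideal_def above_def zidealD(5))
        finally have "(\<Sum>N\<in>S. of_int (s N - t N) * x N) \<in> M" .
        moreover have "(\<Sum>N\<in>S. of_int (s N - t N) * x N) =
            of_int (s M - t M) * x M + (\<Sum>N\<in>S - {M}. of_int (s N - t N) * x N)"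
          using S(1) M by (rule sum.remove)
        moreover have "(\<Sum>N\<in>S - {M}. of_int (s N - t N) * x N) \<in> M"
        proof (rule zideal_sum[OF Sz(1)[OF M]])
          fix N assume "N \<in> S - {M}"
          then have "x N \<in> M" using xi M by blast
          then show "of_int (s N - t N) * x N \<in> M" using zidealD(4)[OF Sz(1)[OF M] of_int_in_Ord] by blast
        qed
        ultimately have "of_int (s M - t M) * x M \<in> M"
          using zideal_mem_cong[OF Sz(1)[OF M], of "of_int (s M - t M) * x M +
            (\<Sum>N\<in>S - {M}. of_int (s N - t N) * x N)" "of_int (s M - t M) * x M"]
          by (simp only: add_diff_cancel_left')
        then have "of_int (s M - t M) \<in> M"
          using maxideal_prime[OF mx of_int_in_Ord _ xO[OF M] xn[OF M]] by blast
        then have "int p dvd s M - t M" using int_in_above[OF p maxidealD[OF mx]] by blast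
        moreover have "s M \<in> {0..<int p}" "t M \<in> {0..<int p}" using st M by blast+
        ultimately show "s M = t M" by (rule small_dvd_diff)
      qed
    qed
    then have "p ^ card S \<le> p ^ d" using finP(2) S(1) by (simp add: card_funcsetE)
    then show ?thesis using p1 by simp
  qed
  show fin: "finite {M. maxideal p M}"
    using main infinite_arbitrarily_large[of "{M. maxideal p M}" "Suc d"] by (metis not_less_eq_eq order_refl)
  show "card {M. maxideal p M} \<le> d" using main[OF fin] by blast
qed

lemma deg1_imp_maxideal:
  assumes p: "prime p" and L: "deg1 p L"
  shows "maxideal p L"
  unfolding maxideal_def
proof (intro conjI allI impI)
  show aL: "above p L" using L by (simp add: deg1_def)
  fix I assume I: "above p I" "L \<subseteq> I"
  show "I = L"
  proof
    show "I \<subseteq> L"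
    proof
      fix y assume y: "y \<in> I"
      then have "y \<in> Ord" using I zidealD(1) by (auto simp: above_def)
      then obtain m where m: "y - of_int m \<in> L" using L by (auto simp: deg1_def)
      then have "of_int m \<in> I" using I y zideal_mem_cong[of I] by (auto simp: above_def)
      then have "of_int m \<in> L" using int_in_above[OF p] I(1) aL by blast
      then show "y \<in> L" using m aL zideal_mem_cong[of L] by (auto simp: above_def)
    qed
  qed (use I in blast)
qed

lemma finite_cosets_above:
  assumes "zideal I" "of_nat n \<in> I" "n > 0"
  shows "finite (coset I ` Ord)"
  using finite_cosets(1)[of I "int n"] assms by simp

lemma idx_ge_p2:
  assumes p: "prime p" and I: "zideal I" "of_nat n \<in> I" "n > 0" and x: "x \<in> Ord"
    and *: "\<And>i j. of_int i + of_int j * x \<in> I \<Longrightarrow> int p dvd i \<and> int p dvd j"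
  shows "p ^ 2 \<le> idx I"
proof -
  have "card ({0..<int p} \<times> {0..<int p}) \<le> idx I"
  proof (rule idx_ge[OF I(1) finite_cosets_above[OF I], where f = "\<lambda>(i, j). of_int i + of_int j * x"])
    fix s t assume st: "s \<in> {0..<int p} \<times> {0..<int p}" "t \<in> {0..<int p} \<times> {0..<int p}"
      "(case s of (i, j) \<Rightarrow> of_int i + of_int j * x) - (case t of (i, j) \<Rightarrow> of_int i + of_int j * x) \<in> I"
    obtain i j k l where ij: "s = (i, j)" "t = (k, l)" by (cases s, cases t)
    have "of_int (i - k) + of_int (j - l) * x \<in> I" using st(3) by (simp add: ij algebra_simps)
    then show "s = t" using *[of "i - k" "j - l"] st ij small_dvd_diff by auto
  qed (use x in auto)
  then show ?thesis by (simp add: power2_eq_square)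
qed

text \<open>Take \<open>x\<close> congruent to no integer. Then 1 and \<open>x\<close> are
  independent over the prime field: a relation with \<open>j\<close> prime to \<open>p\<close> could
  be solved for \<open>x\<close>.\<close>

lemma not_deg1_idx:
  assumes p: "prime p" and I: "above p I" and n1: "\<not> deg1 p I"
  shows "p ^ 2 \<le> idx I"
proof -
  have Iz: "zideal I" "of_nat p \<in> I" using I by (auto simp: above_def)
  obtain x where x: "x \<in> Ord" "\<And>m. x - of_int m \<notin> I" using n1 I by (auto simp: deg1_def)
  have dj: "int p dvd j" if ij: "of_int i + of_int j * x \<in> I" for i j
  proof (rule ccontr)
    assume "\<not> int p dvd j"
    then have "coprime j (int p)" using p prime_imp_coprime[of "int p" j] by (simp add: coprime_commute)
    then obtain b where "[j * b = 1] (mod int p)" using cong_solve_coprime_int by blast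
    then obtain k where k: "j * b = 1 + int p * k" by (metis add.commute cong_iff_lin cong_sym)
    then have k': "(of_int j * of_int b :: complex) = 1 + of_nat p * of_int k"
      by (metis of_int_1 of_int_add of_int_mult of_int_of_nat_eq)
    have "of_int b * (of_int i + of_int j * x) = of_int (i * b) + (of_int j * of_int b) * x"
      by (simp add: algebra_simps)
    then have "x - of_int (- (i * b)) = of_int b * (of_int i + of_int j * x) - (of_int k * x) * of_nat p"
      unfolding k' by (simp add: algebra_simps)
    moreover have "of_int b * (of_int i + of_int j * x) \<in> I" using zidealD(4)[OF Iz(1) of_int_in_Ord ij] .
    moreover have "(of_int k * x) * of_nat p \<in> I" using zidealD(4)[OF Iz(1) _ Iz(2)] x(1) by auto
    ultimately have "x - of_int (- (i * b)) \<in> I" using zideal_diff[OF Iz(1)] by metis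
    then show False using x(2) by blast
  qed
  show ?thesis
  proof (rule idx_ge_p2[OF p Iz _ x(1)])
    show "p > 0" using p prime_gt_0_nat by blast
    fix i j assume ij: "of_int i + of_int j * x \<in> I"
    then obtain k where "j = int p * k" using dj by blast
    then have e: "of_int j * x = (of_int k * x) * of_nat p" by simp
    have "of_int j * x \<in> I" unfolding e by (rule zidealD(4)[OF Iz(1) Ord_scale[OF x(1)] Iz(2)])
    then have "of_int i \<in> I" using zideal_diff[OF Iz(1) ij, of "of_int j * x"] by simp
    then show "int p dvd i \<and> int p dvd j" using dj[OF ij] int_in_above[OF p I] by blast
  qed
qed

lemma zideal_Int: "zideal I \<Longrightarrow> zideal J \<Longrightarrow> zideal (I \<inter> J)"
  by (auto simp: zideal_def)

text \<open>An element \<open>y\<close> of \<open>N\<close> outside \<open>M\<close> is independent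
  of 1 modulo the intersection: reduction modulo \<open>N\<close> shows that the integer part of a
  relation is divisible by \<open>p\<close>, reduction modulo \<open>M\<close> then treats the
  coefficient of \<open>y\<close>.\<close>

lemma pair_idx:
  assumes p: "prime p" and M: "maxideal p M" and N: "maxideal p N" and MN: "M \<noteq> N"
  shows "p ^ 2 \<le> idx (M \<inter> N)"
proof -
  have z: "zideal M" "zideal N" "of_nat p \<in> M" "of_nat p \<in> N" using M N by (auto simp: maxideal_def above_def)
  obtain y where y: "y \<in> N" "y \<notin> M" using M N MN unfolding maxideal_def by blast
  then have yO: "y \<in> Ord" using zidealD(1)[OF z(2)] by blast
  show ?thesis
  proof (rule idx_ge_p2[OF p zideal_Int[OF z(1,2)] _ _ yO])
    show "of_nat p \<in> M \<inter> N" "p > 0" using z p prime_gt_0_nat by auto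
    fix i j assume ij: "of_int i + of_int j * y \<in> M \<inter> N"
    have "of_int j * y \<in> N" using zidealD(4)[OF z(2) of_int_in_Ord y(1)] .
    then have "of_int i \<in> N" using ij zideal_diff[OF z(2), of "of_int i + of_int j * y" "of_int j * y"] by simp
    then have pi: "int p dvd i" using int_in_above[OF p maxidealD[OF N]] by blast
    then have "of_int i \<in> M" using int_in_above[OF p maxidealD[OF M]] by blast
    then have "of_int j * y \<in> M" using ij zideal_diff[OF z(1), of "of_int i + of_int j * y" "of_int i"] by simp
    then have "of_int j \<in> M" using maxideal_prime[OF M of_int_in_Ord _ yO y(2)] by blast
    then show "int p dvd i \<and> int p dvd j" using pi int_in_above[OF p maxidealD[OF M]] by blast
  qed
qed

text \<open>The elements vanishing to second order at \<open>L\<close>. For \<open>a\<close> as in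
  \<open>ex_local_generator\<close>, \<open>p\<close> generates \<open>L\<close> in the localization
  and \<open>a * y / p\<close> is, up to a unit, the quotient of \<open>y\<close> by this generator;
  it has to lie in \<open>L\<close> once more.\<close>

definition second_nbhd :: "nat \<Rightarrow> complex set \<Rightarrow> complex \<Rightarrow> complex set" where
  "second_nbhd p L a = {y \<in> L. \<exists>z\<in>L. a * y = of_nat p * z}"

lemma second_nbhd_ideal:
  assumes L: "above p L"
  shows "zideal (second_nbhd p L a)"
proof -
  have z: "zideal L" using L by (simp add: above_def)
  show ?thesis
    unfolding zideal_def second_nbhd_def
  proof (intro conjI ballI)
    show "{y \<in> L. \<exists>z\<in>L. a * y = of_nat p * z} \<subseteq> Ord" using zidealD(1)[OF z] by blast
    show "0 \<in> {y \<in> L. \<exists>z\<in>L. a * y = of_nat p * z}" using zidealD(2)[OF z] by (auto intro!: bexI[of _ 0])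
  next
    fix u v assume "u \<in> {y \<in> L. \<exists>z\<in>L. a * y = of_nat p * z}" "v \<in> {y \<in> L. \<exists>z\<in>L. a * y = of_nat p * z}"
    then obtain z1 z2 where "u \<in> L" "v \<in> L" "z1 \<in> L" "z2 \<in> L" "a * u = of_nat p * z1" "a * v = of_nat p * z2" by blast
    then show "u + v \<in> {y \<in> L. \<exists>z\<in>L. a * y = of_nat p * z}"
      using zidealD(3)[OF z] by (auto intro!: bexI[of _ "z1 + z2"] simp: distrib_left)
  next
    fix r u assume r: "r \<in> Ord" and "u \<in> {y \<in> L. \<exists>z\<in>L. a * y = of_nat p * z}"
    then obtain z1 where "u \<in> L" "z1 \<in> L" "a * u = of_nat p * z1" by blast
    moreover from this have "a * (r * u) = of_nat p * (r * z1)" by (simp add: mult.left_commute)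
    ultimately show "r * u \<in> {y \<in> L. \<exists>z\<in>L. a * y = of_nat p * z}"
      using zidealD(4)[OF z r] by (auto intro!: bexI[of _ "r * z1"])
  qed
qed

lemma second_nbhd_p2: "above p L \<Longrightarrow> a \<in> Ord \<Longrightarrow> of_nat (p * p) \<in> second_nbhd p L a"
  unfolding second_nbhd_def above_def 
  by (auto intro!: zidealD(4) bexI[of _ "a * of_nat p"] simp: mult_ac)

text \<open>All integers in this ideal are multiples of \<open>p ^ 2\<close>, so
  \<open>0, ..., p ^ 2 - 1\<close> are incongruent modulo it.\<close>

lemma second_nbhd_idx:
  assumes p: "prime p" and L: "deg1 p L" and a: "a \<in> Ord" "a \<notin> L"
  shows "p ^ 2 \<le> idx (second_nbhd p L a)"
proof -
  have aL: "above p L" using L by (simp add: deg1_def)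
  have I: "zideal (second_nbhd p L a)" by (rule second_nbhd_ideal[OF aL])
  have fin: "finite (coset (second_nbhd p L a) ` Ord)"
    using finite_cosets_above[OF I second_nbhd_p2[OF aL a(1)]] p prime_gt_0_nat by simp
  have dvd: "int p ^ 2 dvd n" if n: "of_int n \<in> second_nbhd p L a" for n
  proof -
    have "of_int n \<in> L" using n by (simp add: second_nbhd_def)
    then obtain k where k: "n = int p * k" using int_in_above[OF p aL] by blast
    from n obtain z where z: "z \<in> L" "a * of_int n = of_nat p * z" by (auto simp: second_nbhd_def)
    then have "of_nat p * (a * of_int k) = of_nat p * z" by (simp add: k algebra_simps)
    then have "a * of_int k = z" using p prime_gt_0_nat by simp
    then have "a * of_int k \<in> L" using z by simp
    then have "of_int k \<in> L"
      using maxideal_prime[OF deg1_imp_maxideal[OF p L] a of_int_in_Ord] by blast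
    then have "int p dvd k" using int_in_above[OF p aL] by blast
    then show ?thesis by (simp add: k power2_eq_square)
  qed
  have "card {0..<int (p ^ 2)} \<le> idx (second_nbhd p L a)"
  proof (rule idx_ge[OF I fin, where f = of_int])
    fix s t assume st: "s \<in> {0..<int (p ^ 2)}" "t \<in> {0..<int (p ^ 2)}" 
      "of_int s - of_int t \<in> second_nbhd p L a"
    then have "int (p ^ 2) dvd s - t" using dvd[of "s - t"] by simp
    with st show "s = t" using small_dvd_diff[of "p ^ 2" s t] by blast
  qed auto
  then show ?thesis by (metis card_atLeastZeroLessThan_int nat_int)
qed

end

section \<open>Local generators and uniform counting constants\<close>

context number_order
begin

text \<open>The vector of basis elements is an eigenvector, with eigenvalue \<open>x\<close>, of the
  transposed matrix of multiplication by \<open>x\<close>; it is nonzero because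
  \<open>w 0 = 1\<close>. The characteristic polynomial of that integer matrix serves.\<close>

lemma ex_int_poly_root:
  assumes x: "x \<in> Ord"
  shows "\<exists>F :: int poly. F \<noteq> 0 \<and> poly (map_poly of_int F) x = 0"
proof -
  define M where "M = colmat (\<lambda>j. x * w j)"
  define A :: "int mat" where "A = transpose_mat M"
  have A: "A \<in> carrier_mat d d" by (simp add: A_def M_def)
  define B :: "complex mat" where "B = map_mat of_int A"
  have B: "B \<in> carrier_mat d d" using A by (simp add: B_def)
  define v where "v = vec d w"
  have "B *\<^sub>v v = x \<cdot>\<^sub>v v"
  proof (rule eq_vecI)
    fix j assume "j < dim_vec (x \<cdot>\<^sub>v v)"
    then have j: "j < d" by (simp add: v_def)
    have "(B *\<^sub>v v) $ j = (\<Sum>i<d. of_int (cf (x * w j) i) * w i)"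
      using j by (simp add: B_def A_def M_def v_def colmat_def scalar_prod_def atLeast0LessThan)
    also have "\<dots> = x * w j" using x j by (intro Ord_expand) auto
    finally show "(B *\<^sub>v v) $ j = (x \<cdot>\<^sub>v v) $ j" using j by (simp add: v_def)
  qed (use B in \<open>auto simp: v_def\<close>)
  moreover have "v \<noteq> 0\<^sub>v d"
  proof
    assume "v = 0\<^sub>v d"
    then have "v $ 0 = 0\<^sub>v d $ 0" by simp
    then show False using d_pos by (simp add: v_def w0)
  qed
  ultimately have "eigenvector B v x" using B by (auto simp: eigenvector_def v_def)
  then have "eigenvalue B x" unfolding eigenvalue_def by blast
  then have "poly (char_poly B) x = 0" using eigenvalue_root_char_poly[OF B] by blast
  then have "poly (map_poly of_int (char_poly A)) x = 0"
    unfolding B_def of_int_hom.char_poly_hom[OF A] .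
  moreover have "char_poly A \<noteq> 0" using degree_monic_char_poly[OF A] d_pos by auto
  ultimately show ?thesis by blast
qed

lemma poly_in_Ord: "x \<in> Ord \<Longrightarrow> poly (map_poly of_int F) x \<in> Ord"
  by (induction F) (auto simp: map_poly_pCons)

text \<open>Among the nonzero integer polynomials vanishing at \<open>x\<close> one of least degree
  is taken. Its derivative is nonzero and of smaller degree, so it cannot vanish at
  \<open>x\<close>.\<close>

lemma ex_separable_int_poly:
  assumes x: "x \<in> Ord"
  shows "\<exists>F :: int poly. poly (map_poly of_int F) x = 0 \<and> poly (map_poly of_int (pderiv F)) x \<noteq> 0"
proof -
  define P where "P = (\<lambda>F :: int poly. F \<noteq> 0 \<and> poly (map_poly of_int F) x = 0)"
  obtain F where F: "P F" and min: "\<And>G. P G \<Longrightarrow> degree F \<le> degree G"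
    using ex_has_least_nat[of P _ degree] ex_int_poly_root[OF x] unfolding P_def by blast
  have "degree F \<noteq> 0"
  proof
    assume "degree F = 0"
    then obtain c where "F = [:c:]" by (rule degree_eq_zeroE)
    with F show False by (auto simp: P_def map_poly_pCons)
  qed
  then have "pderiv F \<noteq> 0" "degree (pderiv F) < degree F"
    by (auto simp: pderiv_eq_0_iff degree_pderiv)
  then have "\<not> P (pderiv F)" using min by (meson not_le)
  with \<open>pderiv F \<noteq> 0\<close> F show ?thesis unfolding P_def by blast
qed

text \<open>If \<open>F(x) = 0\<close> and \<open>F(X) - F(r) = (X - r) G(X)\<close> then \<open>G(x) (x - r) = - F(r)\<close> is a multiple
  of \<open>p\<close> as soon as \<open>x \<equiv> r\<close> modulo \<open>L\<close>, while \<open>G(x) \<equiv> F'(x)\<close> is nonzero modulo \<open>L\<close>.\<close>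

lemma local_generator_aux:
  assumes p: "prime p" and L: "deg1 p L" and x: "x \<in> Ord" and r: "x - of_int r \<in> L"
    and F: "poly (map_poly of_int F) x = 0" and nd: "\<not> int p dvd nrm (poly (map_poly of_int (pderiv F)) x)"
  shows "\<exists>a\<in>Ord. a \<notin> L \<and> (\<exists>z\<in>Ord. a * (x - of_int r) = of_nat p * z)"
proof -
  have aL: "above p L" and z: "zideal L" using L by (auto simp: deg1_def above_def)
  define G where "G = synthetic_div F r"
  let ?h = "map_poly (of_int :: int \<Rightarrow> complex)"
  define c where "c = poly F r"
  have FG: "F = [:- r, 1:] * G + [:c:]"
    unfolding G_def c_def using synthetic_div_correct'[of r F] by simp
  have h_add: "?h (P + Q) = ?h P + ?h Q" for P Q by (rule of_int_poly_hom.hom_add)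
  have h_mult: "?h (P * Q) = ?h P * ?h Q" for P Q by (rule of_int_poly_hom.hom_mult)
  have "?h F = ?h [:- r, 1:] * ?h G + ?h [:c:]"
    by (subst FG) (simp only: h_add h_mult)
  then have "poly (?h F) x = poly (?h [:- r, 1:]) x * poly (?h G) x + poly (?h [:c:]) x"
    by (simp only: poly_mult poly_add)
  then have "(x - of_int r) * poly (?h G) x + of_int c = 0"
    using F by (simp add: of_int_hom.map_poly_pCons_hom)
  then have eq: "poly (?h G) x * (x - of_int r) = - of_int c"
    by (simp add: mult.commute add_eq_0_iff2)
  have GO: "poly (?h G) x \<in> Ord" by (rule poly_in_Ord[OF x])
  have "of_int (- c) \<in> L" using zidealD(4)[OF z GO r] eq by simp
  then obtain k where k: "- c = int p * k" using int_in_above[OF p aL] by blast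
  have "poly (?h G) x * (x - of_int r) = of_nat p * of_int k"
    unfolding eq using k by (metis of_int_minus of_int_mult of_int_of_nat_eq)
  moreover have "poly (?h G) x \<notin> L"
  proof
    assume GL: "poly (?h G) x \<in> L"
    have "pderiv F = G + [:- r, 1:] * pderiv G"
      by (subst FG) (simp only: pderiv_add pderiv_mult, simp add: pderiv_pCons)
    then have "?h (pderiv F) = ?h G + ?h [:- r, 1:] * ?h (pderiv G)" by (simp only: h_add h_mult)
    then have "poly (?h (pderiv F)) x = poly (?h G) x + poly (?h [:- r, 1:]) x * poly (?h (pderiv G)) x"
      by (simp only: poly_mult poly_add)
    then have "poly (?h (pderiv F)) x = poly (?h G) x + (x - of_int r) * poly (?h (pderiv G)) x"
      by (simp add: map_poly_pCons)
    moreover have "(x - of_int r) * poly (?h (pderiv G)) x \<in> L"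
      using zidealD(5)[OF z poly_in_Ord[OF x] r] .
    ultimately have "poly (?h (pderiv F)) x \<in> L" using zidealD(3)[OF z GL] by simp
    then show False using nd dvd_nrm_of_mem[OF z p] aL by (auto simp: above_def)
  qed
  ultimately show ?thesis using GO by (intro bexI[of _ "poly (?h G) x"]) auto
qed

text \<open>Away from finitely many primes, \<open>p\<close> generates the localization at a prime
  of degree one. Together with \<open>p\<close>, the elements \<open>w i - r i\<close> generate
  \<open>L\<close>, and \<open>local_generator_aux\<close> handles each of them as long as
  \<open>p\<close> does not divide the norm of the derivative of \<open>F i\<close> at
  \<open>w i\<close>; \<open>D\<close> collects these norms.\<close>

lemma ex_local_generator:
  "\<exists>D>0. \<forall>p L. prime p \<longrightarrow> \<not> p dvd D \<longrightarrow> deg1 p L \<longrightarrow>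
     (\<exists>a\<in>Ord. a \<notin> L \<and> (\<forall>y\<in>L. \<exists>z\<in>Ord. a * y = of_nat p * z))"
proof -
  have "\<forall>i. \<exists>F :: int poly. i < d \<longrightarrow> poly (map_poly of_int F) (w i) = 0 \<and>
      poly (map_poly of_int (pderiv F)) (w i) \<noteq> 0"
    using ex_separable_int_poly[OF w_in_Ord] by blast
  then obtain F :: "nat \<Rightarrow> int poly" where F: "\<And>i. i < d \<Longrightarrow> poly (map_poly of_int (F i)) (w i) = 0"
    "\<And>i. i < d \<Longrightarrow> poly (map_poly of_int (pderiv (F i))) (w i) \<noteq> 0" by metis
  define e where "e i = nrm (poly (map_poly of_int (pderiv (F i))) (w i))" for i
  define D where "D = (\<Prod>i<d. nat \<bar>e i\<bar>)"
  have "D > 0" unfolding D_def e_def using nrm_nonzero[OF poly_in_Ord[OF w_in_Ord] F(2)]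
    by (auto intro!: prod_pos)
  moreover have "\<exists>a\<in>Ord. a \<notin> L \<and> (\<forall>y\<in>L. \<exists>z\<in>Ord. a * y = of_nat p * z)"
    if p: "prime p" and pD: "\<not> p dvd D" and L: "deg1 p L" for p L
  proof -
    have aL: "above p L" and z: "zideal L" using L by (auto simp: deg1_def above_def)
    have nd: "\<not> int p dvd e i" if "i < d" for i
    proof
      assume "int p dvd e i"
      then have "p dvd nat \<bar>e i\<bar>" by (simp flip: int_dvd_int_iff)
      also have "\<dots> dvd D" unfolding D_def using that by (intro dvd_prodI) auto
      finally show False using pD by simp
    qed
    have "\<forall>i. \<exists>r a z. i < d \<longrightarrow> w i - of_int r \<in> L \<and> a \<in> Ord \<and> a \<notin> L \<and> z \<in> Ord \<and> 
      a * (w i - of_int r) = of_nat p * z"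
    proof
      fix i
      show "\<exists>r a z. i < d \<longrightarrow> w i - of_int r \<in> L \<and> a \<in> Ord \<and> a \<notin> L \<and> z \<in> Ord \<and> 
        a * (w i - of_int r) = of_nat p * z"
      proof (cases "i < d")
        case True
        then obtain r where r: "w i - of_int r \<in> L" using L by (auto simp: deg1_def)
        from local_generator_aux[OF p L w_in_Ord[OF True] r F(1)[OF True]] nd[OF True]
        show ?thesis using r unfolding e_def by blast
      qed auto
    qed
    then obtain r a Z where raz: "\<And>i. i < d \<Longrightarrow> w i - of_int (r i) \<in> L" "\<And>i. i < d \<Longrightarrow> a i \<in> Ord"
      "\<And>i. i < d \<Longrightarrow> a i \<notin> L" "\<And>i. i < d \<Longrightarrow> Z i \<in> Ord"
      "\<And>i. i < d \<Longrightarrow> a i * (w i - of_int (r i)) = of_nat p * Z i" by metis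
    \<comment> \<open>A product of multipliers outside the prime ideal \<open>L\<close> is again
      outside \<open>L\<close>, and it works for all \<open>i\<close> at once.\<close>
    define A where "A = (\<Prod>i<d. a i)"
    have AO: "A \<in> Ord" unfolding A_def using raz(2) by (intro Ord_prod) auto
    have AL: "A \<notin> L" unfolding A_def using raz(2,3) by (intro maxideal_prod[OF deg1_imp_maxideal[OF p L]]) auto
    have Ai: "\<exists>z\<in>Ord. A * (w i - of_int (r i)) = of_nat p * z" if i: "i < d" for i
    proof -
      have "A = a i * (\<Prod>j\<in>{..<d} - {i}. a j)" unfolding A_def using i by (intro prod.remove) auto
      then have "A * (w i - of_int (r i)) = (\<Prod>j\<in>{..<d} - {i}. a j) * (a i * (w i - of_int (r i)))"
        by (simp only: mult_ac)
      also have "\<dots> = of_nat p * ((\<Prod>j\<in>{..<d} - {i}. a j) * Z i)" unfolding raz(5)[OF i] by (simp only: mult_ac)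
      finally have "A * (w i - of_int (r i)) = of_nat p * ((\<Prod>j\<in>{..<d} - {i}. a j) * Z i)" .
      moreover have "(\<Prod>j\<in>{..<d} - {i}. a j) * Z i \<in> Ord" using raz(2,4) i by (intro Ord_mult Ord_prod) auto
      ultimately show ?thesis by blast
    qed
    then obtain Y where Y: "\<And>i. i < d \<Longrightarrow> Y i \<in> Ord \<and> A * (w i - of_int (r i)) = of_nat p * Y i" by metis
    have "\<exists>z\<in>Ord. A * y = of_nat p * z" if y: "y \<in> L" for y
    proof -
      have yO: "y \<in> Ord" using y zidealD(1)[OF z] by blast
      define t where "t = (\<Sum>i<d. cf y i * r i)"
      have "y = (\<Sum>i<d. of_int (cf y i) * w i)" using Ord_expand[OF yO] by simp
      then have ey: "y - of_int t = (\<Sum>i<d. of_int (cf y i) * (w i - of_int (r i)))"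
        by (simp add: t_def algebra_simps sum_subtractf)
      also have "\<dots> \<in> L" using raz(1) by (intro zideal_sum[OF z] zidealD(4)[OF z]) auto
      finally have "of_int t \<in> L" using zideal_diff[OF z y, of "y - of_int t"] by simp
      then obtain k where k: "t = int p * k" using int_in_above[OF p aL] by blast
      have "A * (y - of_int t) = (\<Sum>i<d. of_int (cf y i) * (A * (w i - of_int (r i))))"
        unfolding ey by (simp only: sum_distrib_left mult.left_commute)
      also have "\<dots> = (\<Sum>i<d. of_nat p * (of_int (cf y i) * Y i))"
        by (intro sum.cong refl) (use Y in \<open>simp add: mult.left_commute\<close>)
      finally have "A * (y - of_int t) = of_nat p * (\<Sum>i<d. of_int (cf y i) * Y i)"
        by (simp only: sum_distrib_left)
      moreover have "A * y = A * (y - of_int t) + of_nat p * (A * of_int k)" by (simp add: k algebra_simps)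
      ultimately have "A * y = of_nat p * ((\<Sum>i<d. of_int (cf y i) * Y i) + A * of_int k)"
        by (simp only: distrib_left)
      moreover have "(\<Sum>i<d. of_int (cf y i) * Y i) + A * of_int k \<in> Ord"
        using Y AO by (intro Ord_add Ord_sum Ord_scale Ord_mult) auto
      ultimately show ?thesis by blast
    qed
    with AO AL show ?thesis by blast
  qed
  ultimately show ?thesis by blast
qed

text \<open>Every coset meets the box whose size is the covering radius. Applied to an ideal
  containing a given small element, this limits the primes \<open>p\<close> for which that element
  can lie in one of the \<open>square_ideals\<close>.\<close>

lemma idx_le_of_mem:
  assumes C: "\<And>I u B v. zideal I \<Longrightarrow> u \<in> I \<Longrightarrow> u \<noteq> 0 \<Longrightarrow> bd B u \<Longrightarrow> v \<in> Ord \<Longrightarrow> \<exists>y. y - v \<in> I \<and> bd (C * B) y"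
    and C1: "C \<ge> 1" and I: "zideal I" and u: "u \<in> I" "u \<noteq> 0" "bd B u"
  shows "int (idx I) \<le> (2 * (C * B) + 1) ^ d"
proof -
  have "coset I ` Ord = coset I ` box (C * B)"
  proof (rule cosets_by_reps[OF I])
    show "box (C * B) \<subseteq> Ord" by (auto simp: box_def bd_def)
    show "\<exists>y\<in>box (C * B). y - x \<in> I" if "x \<in> Ord" for x
      using C[OF I u that] by (auto simp: box_def)
  qed
  then have "idx I \<le> card (box (C * B))" unfolding idx_def by (simp add: card_image_le)
  moreover have "C * B \<ge> 0" using C1 bd_nonneg[OF u(3)] by simp
  ultimately show ?thesis using card_box by (metis of_nat_mono)
qed

lemma nth_root_floor: "(q :: nat) > 0 \<Longrightarrow> \<exists>s. s ^ d \<le> q \<and> q < (s + 1) ^ d"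
proof -
  assume q: "q > 0"
  define s where "s = Max {s. s ^ d \<le> q}"
  have bnd: "s \<le> q" if "s ^ d \<le> q" for s
    using that self_le_power[of s d] d_pos by (cases "s = 0") (auto intro: order_trans)
  have fin: "finite {s. s ^ d \<le> q}" by (rule finite_subset[of _ "{..q}"]) (use bnd in auto)
  have "{s. s ^ d \<le> q} \<noteq> {}" using q d_pos by (auto intro: exI[of _ 0] simp: zero_power)
  then have "s ^ d \<le> q" using Max_in[OF fin] by (simp add: s_def)
  moreover have "\<not> (s + 1) ^ d \<le> q"
    using Max_ge[OF fin, of "s + 1"] by (auto simp: s_def)
  ultimately show ?thesis by auto
qed

lemma idx_pos: "zideal I \<Longrightarrow> finite (coset I ` Ord) \<Longrightarrow> idx I > 0"
  unfolding idx_def using one_in_Ord by (auto simp: card_gt_0_iff)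

text \<open>Since the covering radius is \<open>C s\<close> with \<open>s \<approx> q^(1/d)\<close>, a box of side \<open>2 X + 1\<close> contains
  \<open>(2 X + 1)^d / q\<close> points of each coset, up to a boundary error.\<close>

definition count_bound :: "int \<Rightarrow> complex set \<Rightarrow> bool" where
  "count_bound C I \<longleftrightarrow> (\<exists>s :: nat. s ^ d \<le> idx I \<and>
      (\<forall>X u. u \<in> Ord \<longrightarrow> X \<ge> 0 \<longrightarrow>
         int (idx I) * int (card {x \<in> box X. x - u \<in> I}) \<le> (2 * (X + C * int s) + 1) ^ d \<and>
         (C * int s \<le> X \<longrightarrow> (2 * (X - C * int s) + 1) ^ d \<le> int (idx I) * int (card {x \<in> box X. x - u \<in> I}))))"

lemma count_boundE:
  assumes "count_bound C I" "u \<in> Ord" "X \<ge> 0"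
  obtains s :: nat where "s ^ d \<le> idx I"
    "int (idx I) * int (card {x \<in> box X. x - u \<in> I}) \<le> (2 * (X + C * int s) + 1) ^ d"
    "C * int s \<le> X \<Longrightarrow> (2 * (X - C * int s) + 1) ^ d \<le> int (idx I) * int (card {x \<in> box X. x - u \<in> I})"
proof -
  from assms(1) obtain s :: nat where s: "s ^ d \<le> idx I" and r: "\<forall>X u. u \<in> Ord \<longrightarrow> X \<ge> 0 \<longrightarrow>
         int (idx I) * int (card {x \<in> box X. x - u \<in> I}) \<le> (2 * (X + C * int s) + 1) ^ d \<and>
         (C * int s \<le> X \<longrightarrow> (2 * (X - C * int s) + 1) ^ d \<le> int (idx I) * int (card {x \<in> box X. x - u \<in> I}))"
    unfolding count_bound_def by (elim exE conjE)
  from r[rule_format, OF assms(2,3)] s show ?thesis by (intro that) auto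
qed

lemma ex_count_const:
  "\<exists>C\<ge>1. \<forall>I. zideal I \<longrightarrow> finite (coset I ` Ord) \<longrightarrow> count_bound C I \<and>
    (\<forall>u B. u \<in> I \<longrightarrow> u \<noteq> 0 \<longrightarrow> bd B u \<longrightarrow> int (idx I) \<le> (2 * (C * B) + 1) ^ d)"
proof -
  obtain C where C: "C \<ge> 1" "\<And>I u B v. zideal I \<Longrightarrow> u \<in> I \<Longrightarrow> u \<noteq> 0 \<Longrightarrow> bd B u \<Longrightarrow> v \<in> Ord \<Longrightarrow>
      \<exists>y. y - v \<in> I \<and> bd (C * B) y"
    using ex_covering_const by blast
  show ?thesis
  proof (intro exI[of _ C] conjI C(1) allI impI)
    fix I assume I: "zideal I" and fin: "finite (coset I ` Ord)"
    obtain s where s: "s ^ d \<le> idx I" "idx I < (s + 1) ^ d" using nth_root_floor idx_pos[OF I fin] by blast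
    obtain u0 where u0: "u0 \<in> I" "u0 \<noteq> 0" "bd (int s) u0" using short_vector[OF I fin s(2)] by blast
    have R: "C * int s \<ge> 0" using C(1) by simp
    have cov: "\<And>v. v \<in> Ord \<Longrightarrow> \<exists>y. y - v \<in> I \<and> bd (C * int s) y" using C(2)[OF I u0] .
    show "count_bound C I"
      unfolding count_bound_def
      using coset_count[OF I fin cov _ R] s(1) by blast
    fix u B assume "u \<in> I" "u \<noteq> 0" "bd B u"
    then show "int (idx I) \<le> (2 * (C * B) + 1) ^ d" using idx_le_of_mem[of C I u B] C I by blast
  qed
qed

end

section \<open>Elementary sums over rational primes\<close>

lemma sum_ln_prime_divisors_le:
  assumes "finite P" "\<And>p. p \<in> P \<Longrightarrow> prime (p :: nat)" "\<And>p. p \<in> P \<Longrightarrow> int p dvd n" "n \<noteq> 0"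
  shows "(\<Sum>p\<in>P. ln (real p)) \<le> ln (real_of_int \<bar>n\<bar>)"
proof -
  have "int (\<Prod>P) dvd n"
    using assms(1-3)
  proof (induction P rule: finite_induct)
    case (insert p P)
    have "coprime p (\<Prod>P)"
      using insert by (intro prod_coprime_right) (auto intro!: primes_coprime)
    then have "coprime (int p) (int (\<Prod>P))" by (simp only: coprime_int_iff)
    then have "int p * int (\<Prod>P) dvd n" using insert by (intro divides_mult) auto
    then show ?case using insert by simp
  qed auto
  then have "real (\<Prod>P) \<le> real_of_int \<bar>n\<bar>"
    using assms(4) dvd_imp_le_int[of n "int (\<Prod>P)"] by linarith
  moreover have "ln (real (\<Prod>P)) = (\<Sum>p\<in>P. ln (real p))"
  proof -
    have "real (\<Prod>P) = (\<Prod>p\<in>P. real p)" by simp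
    then show ?thesis using assms(1,2) by (simp only:) (intro ln_prod, auto dest: prime_gt_0_nat)
  qed
  moreover have "real (\<Prod>P) > 0" using assms(2) prime_gt_0_nat by (auto intro!: prod_pos)
  ultimately show ?thesis by (metis ln_mono)
qed

lemma ln_le_two_sqrt: "(x :: real) \<ge> 1 \<Longrightarrow> ln x \<le> 2 * sqrt x"
  using ln_le_minus_one[of "sqrt x"] by (simp add: ln_sqrt)

text \<open>From \<open>ln n <= 2 sqrt n\<close> the terms are at most \<open>2 / n^(3/2)\<close>,
  and the telescoping differences \<open>4 (1 / sqrt (n - 1) - 1 / sqrt n)\<close> dominate
  them.\<close>

lemma sum_ln_div_square_le:
  "(\<Sum>p | prime p \<and> p \<le> N. ln (real p) / real p ^ 2) \<le> 4"
proof -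
  have "(\<Sum>n\<in>{1<..N}. ln (real n) / real n ^ 2) \<le> 4 * (1 - 1 / sqrt (real N))" if "1 \<le> N" for N
    using that
  proof (induction N rule: dec_induct)
    case (step n)
    define a b where "a = sqrt (real n)" and "b = sqrt (real (Suc n))"
    have ab: "a > 0" "b > 0" "b ^ 2 = a ^ 2 + 1" "a \<le> b" "real (Suc n) = b ^ 2"
      using step by (auto simp: a_def b_def)
    have "ln (real (Suc n)) / real (Suc n) ^ 2 \<le> 2 * b / (b ^ 2) ^ 2"
      using ln_le_two_sqrt[of "real (Suc n)"] ab(2,5)
      by (subst (2) ab(5), intro divide_right_mono) (simp_all add: b_def)
    also have "\<dots> = 2 / (b * b * b)" using ab(2) by (simp add: power2_eq_square)
    also have "\<dots> \<le> 4 * (1 / a - 1 / b)"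
    proof -
      have "1 / a - 1 / b = (b - a) / (a * b)" using ab by (simp add: field_simps)
      also have "\<dots> = ((b - a) * (a + b)) / (a * b * (a + b))" using ab by simp
      also have "(b - a) * (a + b) = 1" using ab(3) by (simp add: algebra_simps power2_eq_square)
      finally have e: "1 / a - 1 / b = 1 / (a * b * (a + b))" .
      have "a * b * (a + b) \<le> b * b * (b + b)" using ab by (intro mult_mono) auto
      then have "1 / (b * b * (b + b)) \<le> 1 / (a * b * (a + b))" using ab by (intro divide_left_mono) auto
      then have "4 * (1 / (b * b * (b + b))) \<le> 4 * (1 / a - 1 / b)" unfolding e by linarith
      moreover have "4 * (1 / (b * b * (b + b))) = 2 / (b * b * b)" using ab by (simp add: field_simps)
      ultimately show ?thesis by linarith
    qed
    finally have "ln (real (Suc n)) / real (Suc n) ^ 2 \<le> 4 * (1 / a - 1 / b)" .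
    moreover have "{1<..Suc n} = insert (Suc n) {1<..n}" using step by auto
    ultimately show ?case using step by (simp add: a_def b_def)
  qed simp
  note bound = this
  have "(\<Sum>n\<in>{1<..N}. ln (real n) / real n ^ 2) \<le> 4"
  proof (cases "1 \<le> N")
    case True
    have "4 * (1 - 1 / sqrt (real N)) \<le> 4" by simp
    with bound[OF True] show ?thesis by linarith
  qed simp
  moreover have "(\<Sum>p | prime p \<and> p \<le> N. ln (real p) / real p ^ 2) \<le> (\<Sum>n\<in>{1<..N}. ln (real n) / real n ^ 2)"
    by (rule sum_mono2) (auto dest: prime_gt_1_nat)
  ultimately show ?thesis by linarith
qed

lemma sum_inverse_square_tail:
  assumes "z \<ge> 1"
  shows "(\<Sum>p\<in>{z<..N}. 1 / real p ^ 2) \<le> 1 / real z"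
proof -
  have "(\<Sum>p\<in>{z<..N}. 1 / real p ^ 2) \<le> 1 / real z - 1 / real N" if "z \<le> N" for N
    using that
  proof (induction N rule: dec_induct)
    case (step n)
    have "{z<..Suc n} = insert (Suc n) {z<..n}" using step by auto
    moreover have "1 / real (Suc n) ^ 2 \<le> 1 / real n - 1 / real (Suc n)"
    proof -
      have "1 / real n - 1 / real (Suc n) = 1 / (real n * real (Suc n))" using step assms by (simp add: field_simps)
      also have "\<dots> \<ge> 1 / (real (Suc n) * real (Suc n))"
        using step assms by (intro divide_left_mono mult_right_mono mult_pos_pos) auto
      finally show ?thesis by (simp only: power2_eq_square)
    qed
    ultimately show ?case using step by simp
  qed simp
  from this[of N] show ?thesis by (cases "z \<le> N") (auto intro: order_trans)
qed

text \<open>Chebyshev's argument: the product of the primes in the range divides the central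
  binomial coefficient, which is at most \<open>4 ^ m\<close>; the denominators exceed
  \<open>m\<close>, which cancels the factor \<open>m\<close> in its logarithm.\<close>

lemma sum_ln_primes_dyadic: "(\<Sum>p | prime p \<and> m < p \<and> p \<le> 2 * m. ln (real p) / real p) \<le> ln 4"
proof (cases "m = 0")
  case False
  let ?P = "{p. prime p \<and> m < p \<and> p \<le> 2 * m}"
  have fin: "finite ?P" by (rule finite_subset[of _ "{..2*m}"]) auto
  have dvd: "int p dvd int ((2 * m) choose m)" if "p \<in> ?P" for p
  proof -
    have p: "prime p" "m < p" "p \<le> 2 * m" using that by auto
    have "fact m * fact m * ((2 * m) choose m) = (fact (2 * m) :: nat)"
      using binomial_fact_lemma[of m "2 * m"] by (simp add: mult_2)
    moreover have "p dvd fact (2 * m)" using p by (simp add: prime_dvd_fact_iff)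
    moreover have "\<not> p dvd fact m" using p by (simp add: prime_dvd_fact_iff)
    ultimately have "p dvd (2 * m) choose m" using p(1) by (metis prime_dvd_mult_iff)
    then show ?thesis by simp
  qed
  have pos: "(2 * m) choose m > 0" by simp
  have "(\<Sum>p\<in>?P. ln (real p)) \<le> ln (real_of_int \<bar>int ((2 * m) choose m)\<bar>)"
    using fin dvd pos by (intro sum_ln_prime_divisors_le) auto
  also have "\<dots> = ln (real ((2 * m) choose m))" by simp
  also have "\<dots> \<le> ln (real (2 ^ (2 * m)))"
    using pos binomial_le_pow2[of "2 * m" m] by (intro ln_mono of_nat_mono) auto
  also have "\<dots> = real m * ln 4" by (simp add: ln_realpow power_mult)
  finally have *: "(\<Sum>p\<in>?P. ln (real p)) \<le> real m * ln 4" .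
  have "(\<Sum>p\<in>?P. ln (real p) / real p) \<le> (\<Sum>p\<in>?P. ln (real p) / real m)"
    using False by (intro sum_mono divide_left_mono) auto
  also have "\<dots> \<le> ln 4" using * False by (simp add: sum_divide_distrib[symmetric] field_simps)
  finally show ?thesis .
qed auto

text \<open>Covering by dyadic blocks, each contributing at most \<open>ln 4 = 2 ln 2\<close>;
  rounding their number up costs the extra \<open>ln 4\<close>. The factor 2 is harmless since the
  bound is applied where \<open>ln (B / A)\<close> is, up to a constant, a small multiple of
  \<open>ln N\<close>.\<close>

lemma sum_ln_primes_between:
  assumes A: "A \<ge> 1" and AB: "A \<le> B"
  shows "(\<Sum>p | prime p \<and> A < p \<and> p \<le> B. ln (real p) / real p) \<le> 2 * ln (real B / real A) + ln 4"
proof -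
  have step: "(\<Sum>p | prime p \<and> A < p \<and> p \<le> 2 ^ k * A. ln (real p) / real p) \<le> real k * ln 4" for k
  proof (induction k)
    case (Suc k)
    have "(\<Sum>p | prime p \<and> A < p \<and> p \<le> 2 ^ Suc k * A. ln (real p) / real p) \<le>
      (\<Sum>p\<in>{p. prime p \<and> A < p \<and> p \<le> 2 ^ k * A} \<union> {p. prime p \<and> 2 ^ k * A < p \<and> p \<le> 2 * (2 ^ k * A)}. ln (real p) / real p)"
    proof (rule sum_mono2)
      show "finite ({p. prime p \<and> A < p \<and> p \<le> 2 ^ k * A} \<union> {p. prime p \<and> 2 ^ k * A < p \<and> p \<le> 2 * (2 ^ k * A)})"
        by (rule finite_subset[of _ "{..2 * (2 ^ k * A)}"]) auto
    qed (use prime_ge_1_nat in auto)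
    also have "\<dots> = (\<Sum>p | prime p \<and> A < p \<and> p \<le> 2 ^ k * A. ln (real p) / real p) +
      (\<Sum>p | prime p \<and> 2 ^ k * A < p \<and> p \<le> 2 * (2 ^ k * A). ln (real p) / real p)"
      by (rule sum.union_disjoint) (auto intro: finite_subset[of _ "{..2 * (2 ^ k * A)}"])
    also have "\<dots> \<le> real k * ln 4 + ln 4" using Suc sum_ln_primes_dyadic[of "2 ^ k * A"] by simp
    finally show ?case by (simp add: algebra_simps)
  next
    case 0
    have "{p. prime p \<and> A < p \<and> p \<le> 2 ^ 0 * A} = {}" by auto
    then show ?case by (simp only: sum.empty of_nat_0 mult_zero_left order_refl)
  qed
  define r where "r = log 2 (real B / real A)"
  have r0: "r \<ge> 0" unfolding r_def using A AB by (simp add: zero_le_log_cancel_iff)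
  define k where "k = nat \<lceil>r\<rceil>"
  have k: "r \<le> real k" "real k \<le> r + 1" unfolding k_def using r0 by linarith+
  have "real B / real A = 2 powr r" unfolding r_def using A AB by simp
  also have "\<dots> \<le> 2 powr real k" using k by simp
  finally have "real B \<le> real (2 ^ k * A)" using A by (simp add: field_simps powr_realpow)
  then have "B \<le> 2 ^ k * A" using of_nat_le_iff by blast
  then have "(\<Sum>p | prime p \<and> A < p \<and> p \<le> B. ln (real p) / real p) \<le>
      (\<Sum>p | prime p \<and> A < p \<and> p \<le> 2 ^ k * A. ln (real p) / real p)"
    by (intro sum_mono2) (use prime_ge_1_nat in \<open>auto intro: finite_subset[of _ "{..2 ^ k * A}"]\<close>)
  also have "\<dots> \<le> real k * ln 4" by (rule step)
  also have "\<dots> \<le> (r + 1) * ln 4" using k by (intro mult_right_mono) auto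
  also have "\<dots> = 2 * ln (real B / real A) + ln 4"
  proof -
    have "ln (4 :: real) = 2 * ln 2" using ln_realpow[of 2 2] by simp
    then show ?thesis by (simp add: r_def log_def algebra_simps)
  qed
  finally show ?thesis .
qed

lemma card_ints_near:
  fixes c r :: real
  assumes "r \<ge> 0"
  shows "finite {b :: int. \<bar>real_of_int b - c\<bar> < r}" "real (card {b :: int. \<bar>real_of_int b - c\<bar> < r}) \<le> 2 * r + 1"
proof -
  have sub: "{b :: int. \<bar>real_of_int b - c\<bar> < r} \<subseteq> {\<lceil>c - r\<rceil>..\<lfloor>c + r\<rfloor>}"
    by (auto simp: abs_less_iff ceiling_le_iff le_floor_iff)
  show "finite {b :: int. \<bar>real_of_int b - c\<bar> < r}" by (rule finite_subset[OF sub]) auto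
  have "card {b :: int. \<bar>real_of_int b - c\<bar> < r} \<le> nat (\<lfloor>c + r\<rfloor> - \<lceil>c - r\<rceil> + 1)"
    using card_mono[OF _ sub] by simp
  then show "real (card {b :: int. \<bar>real_of_int b - c\<bar> < r}) \<le> 2 * r + 1" using assms by linarith
qed

section \<open>Upper bound for the primes of degree one\<close>

context number_order
begin

definition rho :: "nat \<Rightarrow> nat" where
  "rho p = card {L. deg1 p L}"

text \<open>A Mertens sum over primes of degree one. Its true size is \<open>ln N\<close> up to a
  bounded error; what is proved are the coefficients 5/4 and 3/4, the same for every order, so that
  two orders of different rank can be compared.\<close>

definition prime_mass :: "nat \<Rightarrow> real" where
  "prime_mass N = (\<Sum>p | prime p \<and> p \<le> N. real (rho p) * ln (real p) / real p)"

lemma finite_deg1: "prime p \<Longrightarrow> finite {L. deg1 p L}"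
  by (rule finite_subset[OF _ card_maxideals(1)]) (auto intro: deg1_imp_maxideal)

lemma rho_le: "prime p \<Longrightarrow> rho p \<le> d"
  unfolding rho_def
  by (rule order_trans[OF card_mono[OF card_maxideals(1)] card_maxideals(2)]) (auto intro: deg1_imp_maxideal)

lemma finite_primes_le: "finite {p :: nat. prime p \<and> p \<le> N}"
  by (rule finite_subset[of _ "{..N}"]) auto

lemma prime_mass_mono: "M \<le> N \<Longrightarrow> prime_mass M \<le> prime_mass N"
  unfolding prime_mass_def
  by (rule sum_mono2[OF finite_primes_le]) (auto dest: prime_ge_1_nat)

lemma prime_mass_nonneg: "prime_mass N \<ge> 0"
  unfolding prime_mass_def by (rule sum_nonneg) (auto dest: prime_ge_1_nat)

lemma deg1_idx:
  assumes p: "prime p" and L: "deg1 p L"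
  shows "idx L = p"
proof -
  have aL: "above p L" and z: "zideal L" "of_nat p \<in> L" using L by (auto simp: deg1_def above_def)
  have pos: "p > 0" using p prime_gt_0_nat by blast
  have "coset L ` Ord = coset L ` (of_int ` {0..<int p})"
  proof (rule cosets_by_reps[OF z(1)])
    fix x assume "x \<in> Ord"
    then obtain m where m: "x - of_int m \<in> L" using L by (auto simp: deg1_def)
    have e: "of_int (m mod int p) - x = of_int (m mod int p - m) - (x - of_int m)" by simp
    have "int p dvd m mod int p - m" by (simp add: mod_eq_dvd_iff[symmetric])
    then have "of_int (m mod int p - m) \<in> L" using int_in_above[OF p aL] by blast
    from zideal_diff[OF z(1) this m] have "of_int (m mod int p) - x \<in> L" unfolding e .
    then show "\<exists>y\<in>of_int ` {0..<int p}. y - x \<in> L" using pos by (intro bexI[of _ "of_int (m mod int p)"]) auto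
  qed auto
  then have "idx L \<le> card {0..<int p}"
    unfolding idx_def by (metis card_image_le finite_atLeastLessThan_int finite_imageI order_trans)
  moreover have "card {0..<int p} \<le> idx L"
  proof (rule idx_ge[OF z(1) finite_cosets_above[OF z pos], where f = of_int])
    fix s t assume "s \<in> {0..<int p}" "t \<in> {0..<int p}" "of_int s - of_int t \<in> L"
    moreover from this have "int p dvd s - t" using int_in_above[OF p aL, of "s - t"] by simp
    ultimately show "s = t" using small_dvd_diff by blast
  qed auto
  ultimately show ?thesis by simp
qed

text \<open>Valid for ideals of any index, also larger than the box. The bound
  \<open>(a + b) ^ d <= 2 ^ d (a ^ d + b ^ d)\<close> separates volume and boundary, and the
  boundary is at most a constant times the index, whence the summand 1. Allowing any
  \<open>q <= idx I\<close> makes a lower bound for the index sufficient.\<close>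

lemma ex_count_upper_const:
  "\<exists>K\<ge>1. \<forall>I u X q. zideal I \<longrightarrow> finite (coset I ` Ord) \<longrightarrow> u \<in> Ord \<longrightarrow> X \<ge> 0 \<longrightarrow> 0 < q \<longrightarrow> q \<le> idx I \<longrightarrow>
     real (card {x \<in> box X. x - u \<in> I}) \<le> K * (real (card (box X)) / real q + 1)"
proof -
  obtain C where C: "C \<ge> 1" "\<And>I. zideal I \<Longrightarrow> finite (coset I ` Ord) \<Longrightarrow> count_bound C I"
    using ex_count_const by blast
  define K where "K = (4 * real_of_int C) ^ d"
  have K2: "2 ^ d \<le> K" unfolding K_def using C(1) by (intro power_mono) auto
  have "K \<ge> 1" unfolding K_def using C(1) by (intro one_le_power) auto
  moreover have "real (card {x \<in> box X. x - u \<in> I}) \<le> K * (real (card (box X)) / real q + 1)"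
    if I: "zideal I" "finite (coset I ` Ord)" and u: "u \<in> Ord" and X: "X \<ge> 0" and q: "0 < q" "q \<le> idx I" for I u X q
  proof -
    obtain s :: nat where s: "s ^ d \<le> idx I" 
      "int (idx I) * int (card {x \<in> box X. x - u \<in> I}) \<le> (2 * (X + C * int s) + 1) ^ d"
      by (rule count_boundE[OF C(2)[OF I] u X])
    let ?n = "real (card {x \<in> box X. x - u \<in> I})" and ?q = "real (idx I)"
    define a b where "a = 2 * real_of_int X + 1" and "b = 2 * real_of_int C * real s"
    have ab: "a \<ge> 0" "b \<ge> 0" using X C(1) by (auto simp: a_def b_def)
    have "?q * ?n = real_of_int (int (idx I) * int (card {x \<in> box X. x - u \<in> I}))" by simp
    also have "\<dots> \<le> real_of_int ((2 * (X + C * int s) + 1) ^ d)" using s(2) by (simp only: of_int_le_iff)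
    also have "\<dots> = (a + b) ^ d" by (simp add: a_def b_def algebra_simps)
    also have "\<dots> \<le> (2 * max a b) ^ d" using ab by (intro power_mono) auto
    also have "\<dots> = 2 ^ d * (max a b) ^ d" by (simp add: power_mult_distrib)
    also have "\<dots> \<le> 2 ^ d * (a ^ d + b ^ d)" using ab by (intro mult_left_mono) (auto simp: max_def)
    also have "a ^ d = real (card (box X))"
      using arg_cong[OF card_box[OF X], of real_of_int] by (simp add: a_def)
    also have "b ^ d \<le> (2 * real_of_int C) ^ d * ?q"
    proof -
      have "real (s ^ d) \<le> ?q" using s(1) by (simp only: of_nat_le_iff)
      then show ?thesis unfolding b_def power_mult_distrib using C(1) by (intro mult_left_mono) auto
    qed
    finally have "?q * ?n \<le> 2 ^ d * real (card (box X)) + 2 ^ d * (2 * real_of_int C) ^ d * ?q"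
      by (simp add: algebra_simps)
    also have "2 ^ d * (2 * real_of_int C) ^ d = K" by (simp only: K_def power_mult_distrib[symmetric] mult.assoc[symmetric]) simp
    also have "2 ^ d * real (card (box X)) \<le> K * real (card (box X))" using K2 by (intro mult_right_mono) auto
    finally have "?q * ?n \<le> K * real (card (box X)) + K * ?q" by simp
    then have "?n \<le> K * (real (card (box X)) / ?q + 1)" using q by (simp add: field_simps)
    also have "\<dots> \<le> K * (real (card (box X)) / real q + 1)"
      using q \<open>K \<ge> 1\<close> by (intro mult_left_mono add_right_mono divide_left_mono) auto
    finally show ?thesis .
  qed
  ultimately show ?thesis by blast
qed

lemma card_box_pos: 
  assumes "X \<ge> 0"
  shows "card (box X) > 0"
proof -
  have "(2 * X + 1) ^ d > 0" using assms by simp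
  then show ?thesis using card_box[OF assms] by linarith
qed

text \<open>Second Bonferroni inequality, with ordered pairs.\<close>

lemma bonferroni:
  assumes S: "finite S" and B: "finite B"
  shows "(\<Sum>L\<in>S. real (card (L \<inter> B))) - (\<Sum>(L, M) \<in> {(L, M) \<in> S \<times> S. L \<noteq> M}. real (card (L \<inter> M \<inter> B)))
    \<le> real (card {x \<in> B. \<exists>L\<in>S. x \<in> L})"
proof -
  have c1: "real (card (L \<inter> B)) = (\<Sum>x\<in>B. of_bool (x \<in> L))" for L
    using B by (simp add: Int_commute)
  have c2: "real (card (L \<inter> M \<inter> B)) = (\<Sum>x\<in>B. of_bool (x \<in> L) * of_bool (x \<in> M))" for L M
    using B by (simp add: Int_commute Int_def conj_commute flip: of_bool_conj)
  have c3: "real (card {x \<in> B. \<exists>L\<in>S. x \<in> L}) = (\<Sum>x\<in>B. of_bool (\<exists>L\<in>S. x \<in> L))"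
    using B by (simp add: Int_def)
  have pairs: "{(L, M) \<in> S \<times> S. L \<noteq> M} = S \<times> S - (\<lambda>L. (L, L)) ` S" by auto
  have "(\<Sum>L\<in>S. of_bool (x \<in> L)) - (\<Sum>(L, M) \<in> {(L, M) \<in> S \<times> S. L \<noteq> M}. of_bool (x \<in> L) * of_bool (x \<in> M))
    \<le> (of_bool (\<exists>L\<in>S. x \<in> L) :: real)" for x
  proof -
    define k :: real where "k = (\<Sum>L\<in>S. of_bool (x \<in> L))"
    have kc: "k = real (card {L \<in> S. x \<in> L})" unfolding k_def using S by (simp add: Int_def)
    have "(\<Sum>(L, M) \<in> {(L, M) \<in> S \<times> S. L \<noteq> M}. of_bool (x \<in> L) * of_bool (x \<in> M)) =
      (\<Sum>(L, M) \<in> S \<times> S. of_bool (x \<in> L) * of_bool (x \<in> M)) - (\<Sum>(L, M) \<in> (\<lambda>L. (L, L)) ` S. (of_bool (x \<in> L) * of_bool (x \<in> M) :: real))"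
      unfolding pairs using S by (intro sum_diff) auto
    also have "(\<Sum>(L, M) \<in> S \<times> S. (of_bool (x \<in> L) * of_bool (x \<in> M) :: real)) = k * k"
      unfolding k_def sum_product by (simp add: sum.cartesian_product)
    also have "(\<Sum>(L, M) \<in> (\<lambda>L. (L, L)) ` S. (of_bool (x \<in> L) * of_bool (x \<in> M) :: real)) = k"
      unfolding k_def by (subst sum.reindex) (auto simp: inj_on_def intro!: sum.cong)
    finally have e: "(\<Sum>(L, M) \<in> {(L, M) \<in> S \<times> S. L \<noteq> M}. of_bool (x \<in> L) * of_bool (x \<in> M)) = k * k - k" .
    show ?thesis
    proof (cases "\<exists>L\<in>S. x \<in> L")
      case True
      then have "{L \<in> S. x \<in> L} \<noteq> {}" by blast
      then have "card {L \<in> S. x \<in> L} \<ge> 1" using S by (simp add: Suc_le_eq card_gt_0_iff)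
      then have "k \<ge> 1" unfolding kc by simp
      have "k - (k * k - k) \<le> 1" using zero_le_power2[of "k - 1"] by (simp add: power2_eq_square algebra_simps)
      then show ?thesis unfolding e k_def[symmetric] using True by simp
    next
      case False
      then have "{L \<in> S. x \<in> L} = {}" by blast
      then have "k = 0" unfolding kc by (simp only: card.empty of_nat_0)
      then show ?thesis unfolding e k_def[symmetric] by simp
    qed
  qed
  then have "(\<Sum>x\<in>B. (\<Sum>L\<in>S. of_bool (x \<in> L)) - (\<Sum>(L, M) \<in> {(L, M) \<in> S \<times> S. L \<noteq> M}. of_bool (x \<in> L) * of_bool (x \<in> M)))
    \<le> (\<Sum>x\<in>B. (of_bool (\<exists>L\<in>S. x \<in> L) :: real))" by (intro sum_mono)
  also have "(\<Sum>x\<in>B. (\<Sum>L\<in>S. of_bool (x \<in> L)) - (\<Sum>(L, M) \<in> {(L, M) \<in> S \<times> S. L \<noteq> M}. of_bool (x \<in> L) * of_bool (x \<in> M))) =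
     (\<Sum>x\<in>B. \<Sum>L\<in>S. of_bool (x \<in> L)) - (\<Sum>x\<in>B. \<Sum>(L, M) \<in> {(L, M) \<in> S \<times> S. L \<noteq> M}. (of_bool (x \<in> L) * of_bool (x \<in> M) :: real))"
    by (rule sum_subtractf)
  also have "(\<Sum>x\<in>B. \<Sum>L\<in>S. of_bool (x \<in> L)) = (\<Sum>L\<in>S. real (card (L \<inter> B)))"
    unfolding c1 by (rule sum.swap)
  also have "(\<Sum>x\<in>B. \<Sum>(L, M) \<in> {(L, M) \<in> S \<times> S. L \<noteq> M}. (of_bool (x \<in> L) * of_bool (x \<in> M) :: real)) =
     (\<Sum>(L, M) \<in> {(L, M) \<in> S \<times> S. L \<noteq> M}. real (card (L \<inter> M \<inter> B)))"
    unfolding c2 by (subst sum.swap) (simp add: case_prod_beta)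
  finally show ?thesis unfolding c3 .
qed

text \<open>Double counting of the pairs of a nonzero \<open>x\<close> in the box and a prime
  \<open>p\<close> such that some degree one \<open>L\<close> above \<open>p\<close> contains
  \<open>x\<close>, weighted by \<open>ln p\<close>. For fixed \<open>x\<close> these primes divide
  \<open>nrm x\<close>, so the weights add up to at most \<open>ln |nrm x|\<close>. Each
  \<open>p\<close> is counted once even when several \<open>L\<close> contain \<open>x\<close>, so
  for fixed \<open>p\<close> the count is bounded below by \<open>bonferroni\<close>; the
  intersections of two ideals have index at least \<open>p ^ 2\<close> and contribute a convergent
  sum, apart from the summand 1 in \<open>kappa\<close>.\<close>

lemma prime_mass_upper_aux:
  assumes K: "K \<ge> 1" and kappa: "\<And>I u X q. zideal I \<Longrightarrow> finite (coset I ` Ord) \<Longrightarrow> u \<in> Ord \<Longrightarrow> X \<ge> 0 \<Longrightarrow> 0 < q \<Longrightarrow> q \<le> idx I \<Longrightarrow>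
     real (card {x \<in> box X. x - u \<in> I}) \<le> K * (real (card (box X)) / real q + 1)"
    and C: "\<And>B x. bd B x \<Longrightarrow> \<bar>nrm x\<bar> \<le> C * B ^ d" "C \<ge> 1"
    and X: "X \<ge> 1"
    and low: "\<And>p L. prime p \<Longrightarrow> p \<le> N \<Longrightarrow> deg1 p L \<Longrightarrow> real (card (L \<inter> box X)) \<ge> (9/10) * real (card (box X)) / real p"
  shows "(9/10) * prime_mass N \<le> ln (real_of_int C) + real d * ln (real_of_int X) + 4 * real d ^ 2 * K +
      (real d ^ 2 * K + 1) * real N * ln (real N) / real (card (box X))"
proof -
  define B where "B = real (card (box X))"
  have B: "B > 0" unfolding B_def using card_box_pos X by simp
  define A where "A p = {x \<in> box X. \<exists>L\<in>{L. deg1 p L}. x \<in> L}" for p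
  define P where "P = {p :: nat. prime p \<and> p \<le> N}"
  have finP: "finite P" unfolding P_def by (rule finite_primes_le)
  \<comment> \<open>The zero element has norm 0 and is left out, at a cost of 1 for each
    \<open>p\<close>.\<close>
  have Apos: "real (card (A p)) - 1 \<le> real (card (A p - {0}))" for p
    using card_Diff1_le[of "A p" 0] by (cases "0 \<in> A p") (auto simp: A_def card_Diff_singleton)
  have upper: "(\<Sum>p\<in>P. ln (real p) * real (card (A p - {0}))) \<le> B * (ln (real_of_int C) + real d * ln (real_of_int X))"
  proof -
    have "(\<Sum>p\<in>P. ln (real p) * real (card (A p - {0}))) = (\<Sum>p\<in>P. \<Sum>x\<in>box X - {0}. if x \<in> A p then ln (real p) else 0)"
    proof (intro sum.cong refl)
      fix p
      have "(\<Sum>x\<in>box X - {0}. if x \<in> A p then ln (real p) else 0) = (\<Sum>x\<in>A p - {0}. ln (real p))"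
        by (rule sum.mono_neutral_cong_right) (auto simp: A_def)
      then show "ln (real p) * real (card (A p - {0})) = (\<Sum>x\<in>box X - {0}. if x \<in> A p then ln (real p) else 0)"
        by simp
    qed
    also have "\<dots> = (\<Sum>x\<in>box X - {0}. \<Sum>p\<in>P. if x \<in> A p then ln (real p) else 0)" by (rule sum.swap)
    also have "\<dots> \<le> (\<Sum>x\<in>box X - {0}. ln (real_of_int C) + real d * ln (real_of_int X))"
    proof (rule sum_mono)
      fix x assume x: "x \<in> box X - {0}"
      then have xb: "bd X x" "x \<in> Ord" "x \<noteq> 0" by (auto simp: box_def bd_def)
      have nz: "nrm x \<noteq> 0" by (rule nrm_nonzero[OF xb(2,3)])
      have "(\<Sum>p\<in>P. if x \<in> A p then ln (real p) else 0) = (\<Sum>p\<in>{p \<in> P. x \<in> A p}. ln (real p))"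
        using finP by (simp add: sum.inter_filter)
      also have "\<dots> \<le> ln (real_of_int \<bar>nrm x\<bar>)"
        using finP nz by (intro sum_ln_prime_divisors_le)
           (auto simp: P_def A_def deg1_def above_def intro: dvd_nrm_of_mem)
      also have "\<dots> \<le> ln (real_of_int (C * X ^ d))"
        using C(1)[OF xb(1)] nz by (intro ln_mono) (auto simp only: of_int_le_iff of_int_0_less_iff zero_less_abs_iff)
      also have "\<dots> = ln (real_of_int C) + real d * ln (real_of_int X)"
        using C(2) X by (simp add: ln_mult ln_realpow)
      finally show "(\<Sum>p\<in>P. if x \<in> A p then ln (real p) else 0) \<le> ln (real_of_int C) + real d * ln (real_of_int X)" .
    qed
    also have "\<dots> = real (card (box X - {0})) * (ln (real_of_int C) + real d * ln (real_of_int X))" by simp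
    also have "\<dots> \<le> B * (ln (real_of_int C) + real d * ln (real_of_int X))"
      unfolding B_def using C(2) X by (intro mult_right_mono of_nat_mono card_mono) auto
    finally show ?thesis .
  qed
  have lower: "(9/10) * B * real (rho p) / real p - real d ^ 2 * K * (B / real p ^ 2 + 1) - 1 \<le> real (card (A p - {0}))"
    if pP: "p \<in> P" for p
  proof -
    have p: "prime p" "p \<le> N" using pP by (auto simp: P_def)
    let ?S = "{L. deg1 p L}"
    let ?T = "{(L, M) \<in> ?S \<times> ?S. L \<noteq> M}"
    have finS: "finite ?S" by (rule finite_deg1[OF p(1)])
    have "(\<Sum>L\<in>?S. (9/10) * B / real p) \<le> (\<Sum>L\<in>?S. real (card (L \<inter> box X)))"
      using low[OF p] unfolding B_def by (intro sum_mono) auto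
    then have 1: "(9/10) * B * real (rho p) / real p \<le> (\<Sum>L\<in>?S. real (card (L \<inter> box X)))"
      by (simp add: rho_def mult_ac)
    have "(\<Sum>(L, M) \<in> ?T. real (card (L \<inter> M \<inter> box X))) \<le> (\<Sum>(L, M) \<in> ?T. K * (B / real p ^ 2 + 1))"
    proof (rule sum_mono)
      fix t assume "t \<in> ?T"
      then obtain L M where t: "t = (L, M)" "deg1 p L" "deg1 p M" "L \<noteq> M" by auto
      have LM: "zideal L" "zideal M" "of_nat p \<in> L" "of_nat p \<in> M" using t by (auto simp: deg1_def above_def)
      have q: "p ^ 2 \<le> idx (L \<inter> M)"
        using t by (intro pair_idx[OF p(1)] deg1_imp_maxideal[OF p(1)]) auto
      have "real (card {x \<in> box X. x - 0 \<in> L \<inter> M}) \<le> K * (real (card (box X)) / real (p ^ 2) + 1)"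
        using q X LM prime_gt_0_nat[OF p(1)]
        by (intro kappa zideal_Int finite_cosets_above[of "L \<inter> M" p]) auto
      moreover have "{x \<in> box X. x - 0 \<in> L \<inter> M} = L \<inter> M \<inter> box X" by auto
      ultimately show "(case t of (L, M) \<Rightarrow> real (card (L \<inter> M \<inter> box X))) \<le> (case t of (L, M) \<Rightarrow> K * (B / real p ^ 2 + 1))"
        by (simp add: t(1) B_def)
    qed
    also have "\<dots> = real (card ?T) * (K * (B / real p ^ 2 + 1))" by (simp add: case_prod_beta)
    also have "\<dots> \<le> real d ^ 2 * (K * (B / real p ^ 2 + 1))"
    proof (rule mult_right_mono)
      have "card ?T \<le> card (?S \<times> ?S)" by (rule card_mono) (use finS in auto)
      also have "\<dots> = rho p ^ 2" by (simp add: card_cartesian_product rho_def power2_eq_square)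
      also have "\<dots> \<le> d ^ 2" by (intro power_mono rho_le p) auto
      finally show "real (card ?T) \<le> real d ^ 2" by (simp flip: of_nat_power)
      show "0 \<le> K * (B / real p ^ 2 + 1)" using K B by simp
    qed
    finally have 2: "(\<Sum>(L, M) \<in> ?T. real (card (L \<inter> M \<inter> box X))) \<le> real d ^ 2 * K * (B / real p ^ 2 + 1)" by simp
    show ?thesis using 1 2 bonferroni[OF finS finite_box, of X] Apos[of p] unfolding A_def by linarith
  qed
  have "(\<Sum>p\<in>P. ln (real p) * ((9/10) * B * real (rho p) / real p - real d ^ 2 * K * (B / real p ^ 2 + 1) - 1))
    \<le> (\<Sum>p\<in>P. ln (real p) * real (card (A p - {0})))"
    using lower by (intro sum_mono mult_left_mono) (auto simp: P_def dest: prime_ge_1_nat)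
  also note upper
  finally have main: "(\<Sum>p\<in>P. ln (real p) * ((9/10) * B * real (rho p) / real p - real d ^ 2 * K * (B / real p ^ 2 + 1) - 1))
    \<le> B * (ln (real_of_int C) + real d * ln (real_of_int X))" .
  have "(\<Sum>p\<in>P. ln (real p) * ((9/10) * B * real (rho p) / real p - real d ^ 2 * K * (B / real p ^ 2 + 1) - 1)) =
    (9/10) * B * prime_mass N - real d ^ 2 * K * B * (\<Sum>p\<in>P. ln (real p) / real p ^ 2) - (real d ^ 2 * K + 1) * (\<Sum>p\<in>P. ln (real p))"
    unfolding prime_mass_def P_def[symmetric] sum_distrib_left sum_subtractf[symmetric]
    by (intro sum.cong refl) (simp add: algebra_simps)
  also have "\<dots> \<ge> (9/10) * B * prime_mass N - real d ^ 2 * K * B * 4 - (real d ^ 2 * K + 1) * (real N * ln (real N))"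
  proof (intro diff_mono order_refl mult_left_mono)
    show "(\<Sum>p\<in>P. ln (real p) / real p ^ 2) \<le> 4" unfolding P_def by (rule sum_ln_div_square_le)
    have "(\<Sum>p\<in>P. ln (real p)) \<le> (\<Sum>p\<in>{1..N}. ln (real p))"
      unfolding P_def by (rule sum_mono2) (auto dest: prime_ge_1_nat)
    also have "\<dots> \<le> (\<Sum>p\<in>{1..N}. ln (real N))" by (intro sum_mono) auto
    finally show "(\<Sum>p\<in>P. ln (real p)) \<le> real N * ln (real N)" by simp
  qed (use K B in auto)
  finally have "(9/10) * B * prime_mass N \<le> B * (ln (real_of_int C) + real d * ln (real_of_int X)) + real d ^ 2 * K * B * 4 + (real d ^ 2 * K + 1) * (real N * ln (real N))"
    using main by linarith
  then have "((9/10) * B * prime_mass N) / B \<le> (B * (ln (real_of_int C) + real d * ln (real_of_int X)) + real d ^ 2 * K * B * 4 + (real d ^ 2 * K + 1) * (real N * ln (real N))) / B"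
    using B by (intro divide_right_mono) auto
  then show ?thesis using B unfolding B_def[symmetric] by (simp add: add_divide_distrib mult_ac)
qed

theorem prime_mass_upper: "\<exists>c. \<forall>N\<ge>1. prime_mass N \<le> (5/4) * ln (real N) + c"
proof -
  obtain K where K: "K \<ge> 1" "\<And>I u X q. zideal I \<Longrightarrow> finite (coset I ` Ord) \<Longrightarrow> u \<in> Ord \<Longrightarrow> X \<ge> 0 \<Longrightarrow> 0 < q \<Longrightarrow> q \<le> idx I \<Longrightarrow>
     real (card {x \<in> box X. x - u \<in> I}) \<le> K * (real (card (box X)) / real q + 1)"
    using ex_count_upper_const by blast
  obtain C where C: "C \<ge> 1" "\<And>B x. bd B x \<Longrightarrow> \<bar>nrm x\<bar> \<le> C * B ^ d" using ex_nrm_bound by blast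
  obtain R where R: "R \<ge> 1" "\<And>I. zideal I \<Longrightarrow> finite (coset I ` Ord) \<Longrightarrow> count_bound R I"
    using ex_count_const by blast
  \<comment> \<open>Shrinking the side of the box by the factor \<open>1 - \<eta>\<close> costs a
    tenth of its volume.\<close>
  define \<eta> :: real where "\<eta> = 1 - (9/10) powr (1 / real d)"
  have eta: "0 < \<eta>" "\<eta> < 1" "(1 - \<eta>) ^ d = 9/10"
  proof -
    have "(9/10::real) powr (1 / real d) < 1 powr (1 / real d)" using d_pos by (intro powr_less_mono2) auto
    then show "0 < \<eta>" by (simp add: \<eta>_def)
    show "\<eta> < 1" by (simp add: \<eta>_def)
    show "(1 - \<eta>) ^ d = 9/10" using d_pos by (simp add: \<eta>_def powr_power)
  qed
  \<comment> \<open>The box has side about \<open>N^\<beta>\<close>, slightly more than the covering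
    radius of order \<open>N^(1/d)\<close> of an ideal of index at most \<open>N\<close>. The excess
    \<open>N^(1/(8 d))\<close> beats all constants, and the price is
    \<open>d ln X = (9/8) ln N\<close> up to a constant; the loss of 9/10 in the counts turns this
    into the coefficient 5/4.\<close>
  define \<beta> where "\<beta> = 9 / (8 * real d)"
  obtain N0 :: nat where N0: "\<And>N. N \<ge> N0 \<Longrightarrow> real_of_int R / \<eta> \<le> real N powr (1 / (8 * real d))"
  proof -
    define t where "t = real_of_int R / \<eta>"
    have t: "t \<ge> 0" using R(1) eta by (simp add: t_def)
    have "t \<le> real N powr (1 / (8 * real d))" if N: "N \<ge> nat \<lceil>t ^ (8 * d)\<rceil> + 1" for N
    proof (cases "t = 0")
      case False
      have "t = (t ^ (8 * d)) powr (1 / (8 * real d))"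
        using t False d_pos by (simp add: powr_powr flip: powr_realpow)
      also have "\<dots> \<le> real N powr (1 / (8 * real d))"
        using N t by (intro powr_mono2) (auto, linarith)
      finally show ?thesis .
    qed simp
    then show ?thesis using that unfolding t_def by blast
  qed
  have main: "prime_mass N \<le> (5/4) * ln (real N) + (10/9) * (ln (real_of_int C) + real d * ln 2 + 4 * real d ^ 2 * K + (real d ^ 2 * K + 1) * 8)"
    if N: "N \<ge> N0" "N \<ge> 1" for N
  proof -
    define X where "X = \<lceil>real N powr \<beta>\<rceil>"
    have g1: "real N powr \<beta> \<ge> 1" using N d_pos by (intro ge_one_powr_ge_zero) (auto simp: \<beta>_def)
    have X: "X \<ge> 1" "real N powr \<beta> \<le> real_of_int X" "real_of_int X \<le> 2 * real N powr \<beta>"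
      unfolding X_def using g1 by linarith+
    have low: "real (card (L \<inter> box X)) \<ge> (9/10) * real (card (box X)) / real p" if p: "prime p" "p \<le> N" "deg1 p L" for p L
    proof -
      have z: "zideal L" "of_nat p \<in> L" using p by (auto simp: deg1_def above_def)
      have pos: "p > 0" using p prime_gt_0_nat by blast
      have idxp: "idx L = p" by (rule deg1_idx[OF p(1,3)])
      obtain s :: nat where s: "s ^ d \<le> p" and cnt: "R * int s \<le> X \<Longrightarrow> (2 * (X - R * int s) + 1) ^ d \<le> int p * int (card {x \<in> box X. x - 0 \<in> L})"
        using X(1) idxp by (auto intro: count_boundE[OF R(2)[OF z(1) finite_cosets_above[OF z pos]] zero_in_Ord, of X])
      have "real s ^ d \<le> real N" using s p(2) by (metis of_nat_le_iff of_nat_power order_trans)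
      then have "(real s ^ d) powr (1 / real d) \<le> real N powr (1 / real d)" by (intro powr_mono2) auto
      moreover have "(real s ^ d) powr (1 / real d) = real s"
        using d_pos by (cases "s = 0") (auto simp: powr_powr zero_power simp flip: powr_realpow)
      ultimately have "real s \<le> real N powr (1 / real d)" by simp
      have "real_of_int R * real s \<le> (\<eta> * real N powr (1 / (8 * real d))) * real N powr (1 / real d)"
        using N0[OF N(1)] eta R(1) \<open>real s \<le> real N powr (1 / real d)\<close> by (intro mult_mono) (auto simp: field_simps)
      also have "\<dots> = \<eta> * real N powr (1 / (8 * real d) + 1 / real d)" by (simp only: powr_add mult.assoc)
      also have "1 / (8 * real d) + 1 / real d = \<beta>" using d_pos by (simp add: \<beta>_def field_simps)
      also have "\<eta> * real N powr \<beta> \<le> \<eta> * real_of_int X" using X eta by (intro mult_left_mono) auto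
      finally have Rs: "real_of_int R * real s \<le> \<eta> * real_of_int X" .
      also have "\<dots> \<le> 1 * real_of_int X" using eta X(1) by (intro mult_right_mono) auto
      finally have "real_of_int (R * int s) \<le> real_of_int X" by simp
      then have RX: "R * int s \<le> X" by (simp only: of_int_le_iff)
      have "(9/10) * real (card (box X)) = ((1 - \<eta>) * (2 * real_of_int X + 1)) ^ d"
        using arg_cong[OF card_box[of X], of real_of_int] X(1) eta(3) by (simp add: power_mult_distrib)
      also have "\<dots> \<le> (2 * (real_of_int X - real_of_int R * real s) + 1) ^ d"
      proof (rule power_mono)
        show "0 \<le> (1 - \<eta>) * (2 * real_of_int X + 1)" using eta X(1) by (intro mult_nonneg_nonneg) auto
        show "(1 - \<eta>) * (2 * real_of_int X + 1) \<le> 2 * (real_of_int X - real_of_int R * real s) + 1"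
          using Rs eta by (simp add: algebra_simps)
      qed
      also have "\<dots> = real_of_int ((2 * (X - R * int s) + 1) ^ d)" by simp
      also have "\<dots> \<le> real_of_int (int p * int (card {x \<in> box X. x - 0 \<in> L}))"
        using cnt[OF RX] by (simp only: of_int_le_iff)
      also have "\<dots> = real p * real (card (L \<inter> box X))" by (simp add: Int_def conj_commute)
      finally show ?thesis using pos by (simp add: field_simps)
    qed
    have 1: "(9/10) * prime_mass N \<le> ln (real_of_int C) + real d * ln (real_of_int X) + 4 * real d ^ 2 * K +
      (real d ^ 2 * K + 1) * real N * ln (real N) / real (card (box X))"
    proof (rule prime_mass_upper_aux)
      show "K \<ge> 1" "C \<ge> 1" "X \<ge> 1" by fact+
      show "\<And>I u X q. zideal I \<Longrightarrow> finite (coset I ` Ord) \<Longrightarrow> u \<in> Ord \<Longrightarrow> X \<ge> 0 \<Longrightarrow> 0 < q \<Longrightarrow> q \<le> idx I \<Longrightarrow>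
        real (card {x \<in> box X. x - u \<in> I}) \<le> K * (real (card (box X)) / real q + 1)" by (rule K(2))
      show "\<And>B x. bd B x \<Longrightarrow> \<bar>nrm x\<bar> \<le> C * B ^ d" by (rule C(2))
      show "\<And>p L. prime p \<Longrightarrow> p \<le> N \<Longrightarrow> deg1 p L \<Longrightarrow> real (card (L \<inter> box X)) \<ge> (9/10) * real (card (box X)) / real p"
        by (rule low)
    qed
    have "ln (real_of_int X) \<le> ln (2 * real N powr \<beta>)" using X g1 by (intro ln_mono) auto
    also have "\<dots> = ln 2 + \<beta> * ln (real N)" using N by (simp add: ln_mult ln_powr)
    finally have "real d * ln (real_of_int X) \<le> real d * (ln 2 + \<beta> * ln (real N))" by (intro mult_left_mono) auto
    then have 2: "real d * ln (real_of_int X) \<le> real d * ln 2 + (9/8) * ln (real N)"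
      using d_pos by (simp add: \<beta>_def algebra_simps)
    \<comment> \<open>The box has at least \<open>N^(9/8)\<close> elements, which leaves room for
      \<open>ln N <= 8 N^(1/8)\<close>.\<close>
    have 3: "real N * ln (real N) / real (card (box X)) \<le> 8"
    proof -
      have "ln (real N powr (1/8)) \<le> real N powr (1/8)" using N ln_le_minus_one[of "real N powr (1/8)"] by simp
      then have l: "ln (real N) \<le> 8 * real N powr (1/8)" using N by (simp add: ln_powr)
      have "real N * ln (real N) \<le> real N powr 1 * (8 * real N powr (1/8))"
        using l N by (simp add: mult_left_mono)
      also have "\<dots> = 8 * (real N powr 1 * real N powr (1/8))" by (simp only: mult_ac)
      also have "real N powr 1 * real N powr (1/8) = real N powr (9/8)" by (subst powr_add[symmetric]) simp
      also have "real N powr (9/8) = (real N powr \<beta>) ^ d"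
        using d_pos N by (simp add: powr_power \<beta>_def)
      also have "(real N powr \<beta>) ^ d \<le> (2 * real_of_int X + 1) ^ d" using X by (intro power_mono) auto
      also have "\<dots> = real (card (box X))" using arg_cong[OF card_box[of X], of real_of_int] X(1) by simp
      finally show ?thesis using card_box_pos[of X] X(1) by (simp add: field_simps)
    qed
    have "(real d ^ 2 * K + 1) * (real N * ln (real N) / real (card (box X))) \<le> (real d ^ 2 * K + 1) * 8"
      using 3 K(1) by (intro mult_left_mono) auto
    then have "(real d ^ 2 * K + 1) * real N * ln (real N) / real (card (box X)) \<le> (real d ^ 2 * K + 1) * 8"
      by (simp add: mult.assoc)
    moreover have "m \<le> (5/4) * l + (10/9) * (a + y + b + g)"
      if "(9/10) * m \<le> a + x + b + f" "x \<le> y + (9/8) * l" "f \<le> g" for m a x b f y l g :: real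
      using that by (simp add: field_simps)
    ultimately show ?thesis using 1 2 by blast
  qed
  define c where "c = max ((10/9) * (ln (real_of_int C) + real d * ln 2 + 4 * real d ^ 2 * K + (real d ^ 2 * K + 1) * 8)) (prime_mass N0)"
  have "prime_mass N \<le> (5/4) * ln (real N) + c" if N: "N \<ge> 1" for N
  proof (cases "N \<ge> N0")
    case True
    from main[OF True N] show ?thesis unfolding c_def by (rule order_trans) (intro add_left_mono max.cobounded1)
  next
    case False
    then have "prime_mass N \<le> prime_mass N0" by (intro prime_mass_mono) auto
    moreover have "ln (real N) \<ge> 0" using N by simp
    moreover have "prime_mass N0 \<le> c" by (simp add: c_def)
    ultimately show ?thesis by linarith
  qed
  then show ?thesis by blast
qed

end

section \<open>Lower bound for the primes of degree one\<close>

context number_order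
begin

text \<open>Only the coordinate of \<open>w 0 = 1\<close> is varied, the others forming
  \<open>y\<close>. As a function of this integer \<open>b\<close> the norm is a product of
  \<open>d\<close> linear factors, so a norm below \<open>r ^ d\<close> makes some factor smaller
  than \<open>r\<close> and puts \<open>b\<close> within \<open>r / Q <= r\<close> of one of
  \<open>d\<close> real numbers. That leaves at most \<open>d (2 r + 1)\<close> of the
  \<open>2 X + 1\<close> values of \<open>b\<close>.\<close>

lemma small_norm_count:
  fixes r :: real
  assumes Q: "Q \<ge> 1" and X: "X \<ge> 1" and r: "r \<ge> 0"
  shows "real (card {x \<in> box X. real_of_int \<bar>nrm (1 + of_int Q * x)\<bar> < r ^ d}) * (2 * real_of_int X + 1)
    \<le> real (card (box X)) * (real d * (2 * r + 1))"
proof -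
  define F where "F = {y \<in> Ord. \<forall>i<d. cf y i \<in> (if i = 0 then {0} else {-X..X})}"
  have finF: "finite F" unfolding F_def by (rule finite_cf_in) auto
  have "card F = (\<Prod>i<d. card (if i = 0 then {0} else {-X..X}))"
    unfolding F_def by (rule card_cf_in) auto
  also have "\<dots> = (\<Prod>i<d. if i = 0 then 1 else nat (2 * X + 1))"
    by (intro prod.cong refl) auto
  also have "{..<d} = insert 0 {1..<d}" using d_pos by auto
  also have "(\<Prod>i\<in>insert 0 {1..<d}. if i = 0 then 1 else nat (2 * X + 1)) = (\<Prod>i\<in>{1..<d}. nat (2 * X + 1))"
    by (subst prod.insert) (auto intro!: prod.cong)
  finally have cF: "card F = nat (2 * X + 1) ^ (d - 1)" by simp
  have cB: "real (card (box X)) = real (card F) * (2 * real_of_int X + 1)"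
  proof -
    have "real (card (box X)) = (2 * real_of_int X + 1) ^ d"
      using arg_cong[OF card_box[of X], of real_of_int] X by simp
    also have "\<dots> = (2 * real_of_int X + 1) ^ (d - 1) * (2 * real_of_int X + 1)"
      using d_pos by (metis Suc_pred power_Suc2 One_nat_def)
    also have "(2 * real_of_int X + 1) ^ (d - 1) = real (card F)"
      unfolding cF using X by (simp add: of_nat_nat)
    finally show ?thesis .
  qed
  define bad where "bad y = {b :: int. real_of_int \<bar>nrm (1 + of_int Q * (y + of_int b))\<bar> < r ^ d}" for y
  have bad: "finite (bad y) \<and> real (card (bad y)) \<le> real d * (2 * r + 1)" if y: "y \<in> F" for y
  proof -
    have yO: "1 + of_int Q * y \<in> Ord" using y by (auto simp: F_def)
    obtain ls :: "complex list" where ls: "length ls = d"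
      "\<And>t. of_int (nrm (of_int t + (1 + of_int Q * y))) = (\<Prod>l\<leftarrow>ls. of_int t - l)"
      using nrm_shift_factor[OF yO] by blast
    let ?N = "\<lambda>l. {b :: int. \<bar>real_of_int b - Re l / real_of_int Q\<bar> < r}"
    have sub: "bad y \<subseteq> (\<Union>l\<in>set ls. ?N l)"
    proof
      fix b assume "b \<in> bad y"
      then have b: "real_of_int \<bar>nrm (of_int (Q * b) + (1 + of_int Q * y))\<bar> < r ^ d"
        by (simp add: bad_def algebra_simps)
      have "\<exists>l\<in>set ls. cmod (of_int (Q * b) - l) < r"
      proof (rule ccontr)
        assume "\<not> ?thesis"
        then have "\<forall>l\<in>set ls. r \<le> cmod (of_int (Q * b) - l)" by force
        then have "r ^ length ls \<le> cmod (\<Prod>l\<leftarrow>ls. of_int (Q * b) - l)"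
          using r by (induction ls) (auto simp: norm_mult intro!: mult_mono)
        also have "\<dots> = cmod (of_int (nrm (of_int (Q * b) + (1 + of_int Q * y))))"
          using ls(2)[of "Q * b"] by simp
        also have "\<dots> = real_of_int \<bar>nrm (of_int (Q * b) + (1 + of_int Q * y))\<bar>"
          by (simp only: norm_of_int of_int_abs)
        finally show False using b ls(1) by simp
      qed
      then obtain l where l: "l \<in> set ls" "cmod (of_int (Q * b) - l) < r" by blast
      have "real_of_int Q * \<bar>real_of_int b - Re l / real_of_int Q\<bar> = \<bar>Re (of_int (Q * b) - l)\<bar>"
        using Q by (simp add: abs_if field_simps)
      also have "\<dots> \<le> cmod (of_int (Q * b) - l)" by (rule abs_Re_le_cmod)
      finally have *: "real_of_int Q * \<bar>real_of_int b - Re l / real_of_int Q\<bar> < r" using l by linarith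
      have "1 * \<bar>real_of_int b - Re l / real_of_int Q\<bar> \<le> real_of_int Q * \<bar>real_of_int b - Re l / real_of_int Q\<bar>"
        using Q by (intro mult_right_mono) auto
      from le_less_trans[OF this *] have "\<bar>real_of_int b - Re l / real_of_int Q\<bar> < r" by simp
      then show "b \<in> (\<Union>l\<in>set ls. ?N l)" using l by blast
    qed
    have fin: "finite (\<Union>l\<in>set ls. ?N l)" using card_ints_near(1)[OF r] by blast
    have "real (card (bad y)) \<le> real (card (\<Union>l\<in>set ls. ?N l))"
      using card_mono[OF fin sub] by simp
    also have "\<dots> \<le> real (\<Sum>l\<in>set ls. card (?N l))" by (intro of_nat_mono card_UN_le) auto
    also have "\<dots> \<le> (\<Sum>l\<in>set ls. 2 * r + 1)"
      unfolding of_nat_sum by (intro sum_mono card_ints_near(2)[OF r])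
    also have "\<dots> = real (card (set ls)) * (2 * r + 1)" by simp
    also have "\<dots> \<le> real d * (2 * r + 1)"
      using card_length[of ls] ls(1) r by (intro mult_right_mono) auto
    finally show ?thesis using finite_subset[OF sub fin] by blast
  qed
  have sub: "{x \<in> box X. real_of_int \<bar>nrm (1 + of_int Q * x)\<bar> < r ^ d} \<subseteq> (\<Union>y\<in>F. (\<lambda>b. y + of_int b) ` bad y)"
  proof
    fix x assume x: "x \<in> {x \<in> box X. real_of_int \<bar>nrm (1 + of_int Q * x)\<bar> < r ^ d}"
    define y where "y = x - of_int (cf x 0)"
    have xO: "x \<in> Ord" using x by (auto simp: box_def bd_def)
    have "y \<in> F"
      using x xO by (auto simp: F_def y_def cf_diff cf_of_int box_eq)
    moreover have "x = y + of_int (cf x 0)" by (simp add: y_def)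
    moreover from this have "cf x 0 \<in> bad y" using x by (simp add: bad_def)
    ultimately show "x \<in> (\<Union>y\<in>F. (\<lambda>b. y + of_int b) ` bad y)" by blast
  qed
  have "card {x \<in> box X. real_of_int \<bar>nrm (1 + of_int Q * x)\<bar> < r ^ d} \<le> card (\<Union>y\<in>F. (\<lambda>b. y + of_int b) ` bad y)"
    by (rule card_mono[OF _ sub]) (use finF bad in auto)
  also have "\<dots> \<le> (\<Sum>y\<in>F. card ((\<lambda>b. y + of_int b) ` bad y))" by (rule card_UN_le[OF finF])
  also have "\<dots> \<le> (\<Sum>y\<in>F. card (bad y))" using bad by (intro sum_mono card_image_le) auto
  finally have "real (card {x \<in> box X. real_of_int \<bar>nrm (1 + of_int Q * x)\<bar> < r ^ d}) \<le> (\<Sum>y\<in>F. real (card (bad y)))"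
    by (metis of_nat_le_iff of_nat_sum)
  also have "\<dots> \<le> (\<Sum>y\<in>F. real d * (2 * r + 1))" using bad by (intro sum_mono) auto
  also have "\<dots> = real (card F) * (real d * (2 * r + 1))" by simp
  finally have *: "real (card {x \<in> box X. real_of_int \<bar>nrm (1 + of_int Q * x)\<bar> < r ^ d}) \<le> real (card F) * (real d * (2 * r + 1))" .
  have "real (card {x \<in> box X. real_of_int \<bar>nrm (1 + of_int Q * x)\<bar> < r ^ d}) * (2 * real_of_int X + 1)
    \<le> (real (card F) * (real d * (2 * r + 1))) * (2 * real_of_int X + 1)"
    using X by (intro mult_right_mono[OF *]) auto
  then show ?thesis unfolding cB by (simp only: mult_ac)
qed

text \<open>With \<open>b\<close> inverse to \<open>Q\<close> modulo \<open>m\<close>, the condition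
  says that \<open>x\<close> is congruent to \<open>- b\<close>. Counts of the elements
  \<open>1 + Q * x\<close> in \<open>I\<close> thereby become counts in a coset.\<close>

lemma coset_of_residue_one:
  assumes I: "zideal I" and m: "of_int m \<in> I" "coprime Q m"
  shows "\<exists>u\<in>Ord. \<forall>x\<in>Ord. 1 + of_int Q * x \<in> I \<longleftrightarrow> x - u \<in> I"
proof -
  obtain b where "[Q * b = 1] (mod m)" using cong_solve_coprime_int[OF m(2)] by blast
  then obtain k where k: "Q * b = 1 + m * k" by (metis add.commute cong_iff_lin cong_sym)
  then have k': "(of_int Q * of_int b :: complex) = 1 + of_int m * of_int k"
    by (metis of_int_1 of_int_add of_int_mult)
  have "1 + of_int Q * x \<in> I \<longleftrightarrow> x - of_int (- b) \<in> I" if x: "x \<in> Ord" for x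
  proof -
    have e: "of_int Q * (x + of_int b) = (1 + of_int Q * x) + of_int k * of_int m"
      using k' by (simp add: algebra_simps)
    have mk: "of_int k * of_int m \<in> I" using zidealD(4)[OF I of_int_in_Ord m(1)] .
    have "1 + of_int Q * x \<in> I \<longleftrightarrow> of_int Q * (x + of_int b) \<in> I"
      unfolding e using zideal_mem_cong[OF I, of "(1 + of_int Q * x) + of_int k * of_int m" "1 + of_int Q * x"] mk
      by simp
    also have "\<dots> \<longleftrightarrow> x + of_int b \<in> I"
    proof
      assume *: "of_int Q * (x + of_int b) \<in> I"
      have "of_int b * (of_int Q * (x + of_int b)) = (of_int Q * of_int b) * (x + of_int b)" by (simp only: mult_ac)
      also have "\<dots> = (x + of_int b) + (of_int k * (x + of_int b)) * of_int m" unfolding k' by (simp add: algebra_simps)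
      finally have "(x + of_int b) + (of_int k * (x + of_int b)) * of_int m \<in> I"
        using zidealD(4)[OF I of_int_in_Ord *, of b] by simp
      moreover have "(of_int k * (x + of_int b)) * of_int m \<in> I"
        by (intro zidealD(4)[OF I _ m(1)] Ord_scale Ord_add x of_int_in_Ord)
      ultimately show "x + of_int b \<in> I"
        using zideal_diff[OF I, of "(x + of_int b) + (of_int k * (x + of_int b)) * of_int m"] by fastforce
    qed (use zidealD(4)[OF I of_int_in_Ord] in blast)
    finally show ?thesis by simp
  qed
  then show ?thesis by (intro bexI[of _ "of_int (- b)"]) auto
qed

definition generator_at :: "nat \<Rightarrow> complex set \<Rightarrow> complex" where
  "generator_at p L = (SOME a. a \<in> Ord \<and> a \<notin> L \<and> (\<forall>y\<in>L. \<exists>z\<in>Ord. a * y = of_nat p * z))"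

text \<open>Elements outside these ideals have norm not divisible by \<open>p\<^sup>2\<close>, at the unramified primes.\<close>

definition square_ideals :: "nat \<Rightarrow> complex set set" where
  "square_ideals p = {M. maxideal p M \<and> \<not> deg1 p M} \<union>
     (\<lambda>(M, N). M \<inter> N) ` {(M, N). deg1 p M \<and> deg1 p N \<and> M \<noteq> N} \<union>
     (\<lambda>L. second_nbhd p L (generator_at p L)) ` {L. deg1 p L}"

lemma square_ideals_card:
  assumes p: "prime p"
  shows "finite (square_ideals p)" "card (square_ideals p) \<le> 3 * d ^ 2"
proof -
  let ?A = "{M. maxideal p M \<and> \<not> deg1 p M}" and ?L = "{L. deg1 p L}"
  let ?B = "{(M, N). deg1 p M \<and> deg1 p N \<and> M \<noteq> N}"
  have A: "?A \<subseteq> {M. maxideal p M}" by auto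
  have fA: "finite ?A" "card ?A \<le> d"
    using finite_subset[OF A card_maxideals(1)[OF p]]
      order_trans[OF card_mono[OF card_maxideals(1)[OF p] A] card_maxideals(2)[OF p]] by auto
  have fL: "finite ?L" "card ?L \<le> d" using finite_deg1[OF p] rho_le[OF p] by (auto simp: rho_def)
  have B: "?B \<subseteq> ?L \<times> ?L" by auto
  have fB: "finite ?B" by (rule finite_subset[OF B]) (use fL in auto)
  have "card ?B \<le> card ?L * card ?L" using card_mono[OF _ B] fL by (simp add: card_cartesian_product)
  also have "\<dots> \<le> d * d" using fL by (intro mult_mono) auto
  finally have cB: "card ?B \<le> d ^ 2" by (simp add: power2_eq_square)
  show "finite (square_ideals p)" unfolding square_ideals_def using fA fB fL by auto
  have "card (square_ideals p) \<le> card ?A + card ((\<lambda>(M, N). M \<inter> N) ` ?B) +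
      card ((\<lambda>L. second_nbhd p L (generator_at p L)) ` ?L)"
    unfolding square_ideals_def by (intro order_trans[OF card_Un_le] add_right_mono card_Un_le)
  also have "\<dots> \<le> d + d ^ 2 + d"
    using fA(2) order_trans[OF card_image_le[OF fB] cB] order_trans[OF card_image_le[OF fL(1)] fL(2)]
    by (intro add_mono) auto
  also have "\<dots> \<le> 3 * d ^ 2" using d_pos self_le_power[of d 2] by auto
  finally show "card (square_ideals p) \<le> 3 * d ^ 2" .
qed

context
  fixes D :: nat
  assumes gen: "\<And>p L. prime p \<Longrightarrow> \<not> p dvd D \<Longrightarrow> deg1 p L \<Longrightarrow>
     (\<exists>a\<in>Ord. a \<notin> L \<and> (\<forall>y\<in>L. \<exists>z\<in>Ord. a * y = of_nat p * z))"
begin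

lemma generator_at:
  assumes "prime p" "\<not> p dvd D" "deg1 p L"
  shows "generator_at p L \<in> Ord" "generator_at p L \<notin> L"
    "\<And>y. y \<in> L \<Longrightarrow> \<exists>z\<in>Ord. generator_at p L * y = of_nat p * z"
proof -
  have "\<exists>a. a \<in> Ord \<and> a \<notin> L \<and> (\<forall>y\<in>L. \<exists>z\<in>Ord. a * y = of_nat p * z)" using gen[OF assms] by blast
  from someI_ex[OF this] show "generator_at p L \<in> Ord" "generator_at p L \<notin> L"
    "\<And>y. y \<in> L \<Longrightarrow> \<exists>z\<in>Ord. generator_at p L * y = of_nat p * z" unfolding generator_at_def by blast+
qed

lemma square_idealsD:
  assumes p: "prime p" "\<not> p dvd D" and I: "I \<in> square_ideals p"
  shows "zideal I" "of_nat (p * p) \<in> I" "p ^ 2 \<le> idx I"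
proof -
  have pp: "of_nat (p * p) \<in> J" if "zideal J" "of_nat p \<in> J" for J
    using zidealD(4)[OF that(1) _ that(2), of "of_nat p"] by simp
  consider (1) "maxideal p I" "\<not> deg1 p I" | (2) M N where "I = M \<inter> N" "deg1 p M" "deg1 p N" "M \<noteq> N"
    | (3) L where "I = second_nbhd p L (generator_at p L)" "deg1 p L"
    using I unfolding square_ideals_def by auto
  then have "zideal I \<and> of_nat (p * p) \<in> I \<and> p ^ 2 \<le> idx I"
  proof cases
    case 1
    then have "above p I" by (simp add: maxideal_def)
    then show ?thesis using not_deg1_idx[OF p(1) _ 1(2)] pp by (auto simp: above_def)
  next
    case 2
    have "zideal M" "zideal N" "of_nat p \<in> M" "of_nat p \<in> N" using 2 by (auto simp: deg1_def above_def)
    moreover have "p ^ 2 \<le> idx I" unfolding 2(1)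
      by (rule pair_idx[OF p(1) deg1_imp_maxideal[OF p(1) 2(2)] deg1_imp_maxideal[OF p(1) 2(3)] 2(4)])
    ultimately show ?thesis using pp zideal_Int unfolding 2(1) by blast
  next
    case 3
    have "above p L" using 3 by (simp add: deg1_def)
    then show ?thesis unfolding 3(1)
      using second_nbhd_ideal second_nbhd_p2[OF _ generator_at(1)[OF p 3(2)]]
        second_nbhd_idx[OF p(1) 3(2) generator_at(1,2)[OF p 3(2)]] by blast
  qed
  then show "zideal I" "of_nat (p * p) \<in> I" "p ^ 2 \<le> idx I" by auto
qed

text \<open>If the ideal generated by \<open>p\<close> and \<open>y\<close> were the whole order,
  some multiple of \<open>y\<close> would be 1 modulo \<open>p\<close> and have norm prime to
  \<open>p\<close>. A maximal ideal containing both has degree one, is the only maximal ideal above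
  \<open>p\<close> containing \<open>y\<close>, and \<open>y\<close> vanishes there to first order
  only, each time because \<open>y\<close> avoids the \<open>square_ideals\<close>.\<close>

lemma simple_norm:
  assumes p: "prime p" "\<not> p dvd D" and y: "y \<in> Ord" and dvd: "int p dvd nrm y"
    and nb: "\<And>I. I \<in> square_ideals p \<Longrightarrow> y \<notin> I"
  shows "\<exists>L. deg1 p L \<and> y \<in> L" "\<not> (int p) ^ 2 dvd nrm y"
proof -
  have pos: "p > 0" using p prime_gt_0_nat by blast
  let ?P = "{of_nat p * z | z. z \<in> Ord}"
  let ?I = "{u + r * y | u r. u \<in> ?P \<and> r \<in> Ord}"
  have I: "zideal ?I" by (rule zideal_add_principal[OF zideal_pmult y])
  have 0: "0 \<in> ?P" by (auto intro: exI[of _ 0])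
  have "1 \<notin> ?I"
  proof
    assume "1 \<in> ?I"
    then obtain z r where zr: "1 = of_nat p * z + r * y" "z \<in> Ord" "r \<in> Ord" by blast
    then have e: "r * y = 1 + of_int (int p) * (- z)" by (simp add: algebra_simps)
    have "[nrm (r * y) = 1] (mod int p)" unfolding e by (rule nrm_cong_one) (use zr in auto)
    moreover have "int p dvd nrm (r * y)" using dvd nrm_mult[OF zr(3) y] by simp
    ultimately have "int p dvd 1" by (metis cong_dvd_iff)
    then show False using p by (auto dest: prime_gt_1_nat)
  qed
  moreover have "of_nat p \<in> ?I"
    using zero_in_Ord by (intro CollectI exI[of _ "of_nat p"] exI[of _ 0]) (auto intro!: exI[of _ 1])
  ultimately have "above p ?I" using I by (simp add: above_def)
  then obtain M where M: "maxideal p M" "?I \<subseteq> M" using ex_maxideal[OF pos] by blast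
  have "y \<in> ?I" using 0 by (intro CollectI exI[of _ 0] exI[of _ 1]) auto
  then have yM: "y \<in> M" using M by blast
  have d1: "deg1 p M" using nb[of M] M(1) yM unfolding square_ideals_def by blast
  show "\<exists>L. deg1 p L \<and> y \<in> L" using d1 yM by blast
  have aM: "zideal M" "of_nat p \<in> M" "1 \<notin> M" using M(1) by (auto simp: maxideal_def above_def)
  note g = generator_at[OF p d1]
  show "\<not> (int p) ^ 2 dvd nrm y"
  proof (rule prime_sq_not_dvd_nrm[OF p(1) aM _ g yM])
    show "\<exists>m. y - of_int m \<in> M" if "y \<in> Ord" for y using d1 that by (auto simp: deg1_def)
    fix J assume J: "zideal J" "of_nat p \<in> J" "1 \<notin> J" "y \<in> J"
    then obtain M' where M': "maxideal p M'" "J \<subseteq> M'" using ex_maxideal[OF pos] by (auto simp: above_def)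
    have "deg1 p M'" using nb[of M'] M' J(4) unfolding square_ideals_def by blast
    then have "M' = M" using nb[of "M' \<inter> M"] d1 yM M'(2) J(4) unfolding square_ideals_def by fastforce
    then show "J \<subseteq> M" using M' by blast
  next
    fix z assume z: "z \<in> Ord" "generator_at p M * y = of_nat p * z"
    show "z \<notin> M"
    proof
      assume "z \<in> M"
      then have "y \<in> second_nbhd p M (generator_at p M)" using z yM by (auto simp: second_nbhd_def)
      then show False using nb[of "second_nbhd p M (generator_at p M)"] d1 unfolding square_ideals_def by blast
    qed
  qed
qed

text \<open>Where \<open>y\<close> avoids the \<open>square_ideals\<close>, a prime factor
  \<open>p\<close> of the norm divides it exactly once and is paid for by a prime of degree one
  containing \<open>y\<close>. For the remaining \<open>p\<close> the whole of \<open>ln T\<close>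
  is charged, which is affordable because they are rare on average.\<close>

lemma ln_norm_le:
  assumes y: "y \<in> Ord" and cop: "coprime (nrm y) (int D)" and n0: "nrm y \<noteq> 0" and T: "\<bar>nrm y\<bar> \<le> int T"
  shows "ln (real_of_int \<bar>nrm y\<bar>) \<le>
    (\<Sum>p\<in>prime_factors (nat \<bar>nrm y\<bar>). ln (real p) * real (card {L. deg1 p L \<and> y \<in> L}) +
        (if \<exists>I\<in>square_ideals p. y \<in> I then ln (real T) else 0))"
proof -
  define n where "n = nat \<bar>nrm y\<bar>"
  have n: "n > 0" "n \<le> T" "int n = \<bar>nrm y\<bar>" using n0 T by (auto simp: n_def)
  have "real n = (\<Prod>p\<in>prime_factors n. real (p ^ multiplicity p n))"
    using prod_prime_factors[of n] n(1) by (metis normalize_nat_def id_apply of_nat_prod neq0_conv)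
  then have "ln (real n) = (\<Sum>p\<in>prime_factors n. ln (real (p ^ multiplicity p n)))"
    by (simp only:) (intro ln_prod, auto simp: prime_factors_gt_0_nat)
  also have "\<dots> \<le> (\<Sum>p\<in>prime_factors n. ln (real p) * real (card {L. deg1 p L \<and> y \<in> L}) +
        (if \<exists>I\<in>square_ideals p. y \<in> I then ln (real T) else 0))"
  proof (rule sum_mono)
    fix p assume pn: "p \<in> prime_factors n"
    then have p: "prime p" "p dvd n" by auto
    have lp: "ln (real p) \<ge> 0" using prime_ge_1_nat[OF p(1)] by simp
    have pd: "int p dvd nrm y" using p(2) n(3) by (metis dvd_abs_iff int_dvd_int_iff)
    have pD: "\<not> p dvd D"
    proof
      assume "p dvd D"
      then have "int p dvd int D" by simp
      with cop pd have "is_unit (int p)" by (rule coprime_common_divisor)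
      then show False using p(1) by (auto dest: prime_gt_1_nat)
    qed
    show "ln (real (p ^ multiplicity p n)) \<le> ln (real p) * real (card {L. deg1 p L \<and> y \<in> L}) +
        (if \<exists>I\<in>square_ideals p. y \<in> I then ln (real T) else 0)"
    proof (cases "\<exists>I\<in>square_ideals p. y \<in> I")
      case True
      have "p ^ multiplicity p n \<le> n" using n(1) multiplicity_dvd[of p n] by (intro dvd_imp_le) auto
      then have "real (p ^ multiplicity p n) \<le> real T" using n(2) by linarith
      moreover have "real (p ^ multiplicity p n) > 0" using prime_gt_0_nat[OF p(1)] by simp
      ultimately have "ln (real (p ^ multiplicity p n)) \<le> ln (real T)" by (rule ln_mono)
      then show ?thesis using True lp by (simp only: if_True) (intro add_increasing mult_nonneg_nonneg, auto)
    next
      case False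
      then have nb: "\<And>I. I \<in> square_ideals p \<Longrightarrow> y \<notin> I" by blast
      obtain L where L: "deg1 p L" "y \<in> L" using simple_norm(1)[OF p(1) pD y pd nb] by blast
      have "\<not> p ^ 2 dvd n"
      proof
        assume "p ^ 2 dvd n"
        then have "int (p ^ 2) dvd \<bar>nrm y\<bar>" unfolding n(3)[symmetric] by (simp only: int_dvd_int_iff)
        then show False using simple_norm(2)[OF p(1) pD y pd nb] by simp
      qed
      then have "multiplicity p n < 2" by (meson multiplicity_dvd' not_le)
      then have "ln (real (p ^ multiplicity p n)) \<le> ln (real p) * 1"
        using lp by (cases "multiplicity p n") auto
      also have "finite {L. deg1 p L \<and> y \<in> L}" by (rule finite_subset[OF _ finite_deg1[OF p(1)]]) auto
      then have "card {L. deg1 p L \<and> y \<in> L} \<ge> 1" using L by (auto simp: Suc_le_eq card_gt_0_iff)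
      then have "ln (real p) * 1 \<le> ln (real p) * real (card {L. deg1 p L \<and> y \<in> L})"
        using lp by (intro mult_left_mono) auto
      finally show ?thesis using False by simp
    qed
  qed
  finally show ?thesis using n(3) by (simp add: n_def)
qed

end

end

context number_order
begin

lemma count_at_least_kappa:
  assumes kappa: "\<And>I u X q. zideal I \<Longrightarrow> finite (coset I ` Ord) \<Longrightarrow> u \<in> Ord \<Longrightarrow> X \<ge> 0 \<Longrightarrow> 0 < q \<Longrightarrow> q \<le> idx I \<Longrightarrow>
     real (card {x \<in> box X. x - u \<in> I}) \<le> K * (real (card (box X)) / real q + 1)"
    and I: "zideal I" "of_nat m \<in> I" "m > 0" "coprime Q (int m)" and q: "0 < q" "q \<le> idx I" and X: "X \<ge> 0"
  shows "real (card {x \<in> box X. 1 + of_int Q * x \<in> I}) \<le> K * (real (card (box X)) / real q + 1)"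
proof -
  obtain u where u: "u \<in> Ord" "\<forall>x\<in>Ord. 1 + of_int Q * x \<in> I \<longleftrightarrow> x - u \<in> I"
    using coset_of_residue_one[OF I(1), of "int m" Q] I by auto
  have "{x \<in> box X. 1 + of_int Q * x \<in> I} = {x \<in> box X. x - u \<in> I}"
    using u(2) by (auto simp: box_def bd_def)
  then show ?thesis using kappa[OF I(1) finite_cosets_above[OF I(1-3)] u(1) X q] by simp
qed

text \<open>The elements \<open>y = 1 + q * x\<close> have norm prime to \<open>q\<close>, so
  neither the primes up to \<open>z\<close> nor the divisors of \<open>D\<close> occur. The three
  terms belong to the degree one primes up to \<open>N\<close>, where cosets are counted almost
  exactly; to those between \<open>N\<close> and the largest possible norm \<open>T\<close>, counted
  only up to the factor \<open>K\<close>; and to the \<open>square_ideals\<close>, where summing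
  \<open>1 / p ^ 2\<close> over \<open>p > z\<close> gives the factor \<open>1 / z\<close>.\<close>

lemma norm_sum_upper:
  assumes gen: "\<And>p L. prime p \<Longrightarrow> \<not> p dvd D \<Longrightarrow> deg1 p L \<Longrightarrow>
     (\<exists>a\<in>Ord. a \<notin> L \<and> (\<forall>y\<in>L. \<exists>z\<in>Ord. a * y = of_nat p * z))"
    and K: "K \<ge> 1" and kappa: "\<And>I u X q. zideal I \<Longrightarrow> finite (coset I ` Ord) \<Longrightarrow> u \<in> Ord \<Longrightarrow> X \<ge> 0 \<Longrightarrow> 0 < q \<Longrightarrow> q \<le> idx I \<Longrightarrow>
     real (card {x \<in> box X. x - u \<in> I}) \<le> K * (real (card (box X)) / real q + 1)"
    and idxb: "\<And>I u B. zideal I \<Longrightarrow> finite (coset I ` Ord) \<Longrightarrow> u \<in> I \<Longrightarrow> u \<noteq> 0 \<Longrightarrow> bd B u \<Longrightarrow> int (idx I) \<le> (2 * (R * B) + 1) ^ d"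
    and C: "\<And>B x. bd B x \<Longrightarrow> \<bar>nrm x\<bar> \<le> C * B ^ d" "C \<ge> 1" and R: "R \<ge> 1"
    and X: "X \<ge> 1" and z: "z \<ge> 1" and Q: "2 \<le> q" "\<And>p. prime p \<Longrightarrow> p \<le> z \<or> p dvd D \<Longrightarrow> p dvd q" "D dvd q"
    and T: "int T = C * (2 * int q * X) ^ d" and S: "int S = (2 * (R * (2 * int q * X)) + 1) ^ d"
    and N: "N \<ge> 1"
    and up: "\<And>p L u. prime p \<Longrightarrow> p \<le> N \<Longrightarrow> deg1 p L \<Longrightarrow> u \<in> Ord \<Longrightarrow> 
      real (card {x \<in> box X. x - u \<in> L}) \<le> (11/10) * real (card (box X)) / real p"
  shows "(\<Sum>x\<in>box X. ln (real_of_int \<bar>nrm (1 + of_int (int q) * x)\<bar>)) \<le>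
     (11/10) * real (card (box X)) * prime_mass N
     + real d * K * (\<Sum>p | prime p \<and> N < p \<and> p \<le> T. ln (real p) * (real (card (box X)) / real p + 1))
     + ln (real T) * (3 * real d ^ 2 * K * (real (card (box X)) / real z + sqrt (real S)))"
proof -
  define B where "B = real (card (box X))"
  have Bpos: "B > 0" unfolding B_def using card_box_pos[of X] X by simp
  define y where "y x = 1 + of_int (int q) * x" for x :: complex
  have T1: "T \<ge> 1"
  proof -
    have "1 \<le> (2 * int q * X)" using Q(1) X by (metis mult_le_mono of_nat_1 of_nat_le_iff order_trans mult_mono' mult_1 int_one_le_iff_zero_less zero_less_mult_iff zero_less_numeral of_nat_0_less_iff numeral_2_eq_2 less_eq_Suc_le zero_less_Suc order_less_le_trans zero_less_one)
    then have "1 \<le> (2 * int q * X) ^ d" by (rule one_le_power)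
    then have "1 * 1 \<le> C * (2 * int q * X) ^ d" using C(2) by (intro mult_mono) auto
    then show ?thesis using T by linarith
  qed
  have lnT: "ln (real T) \<ge> 0" using T1 by simp
  define PT where "PT = {p. prime p \<and> p \<le> T \<and> \<not> p dvd q}"
  have finPT: "finite PT" unfolding PT_def by (rule finite_subset[of _ "{..T}"]) auto
  have facts: "y x \<in> Ord" "y x \<noteq> 0" "nrm (y x) \<noteq> 0" "coprime (nrm (y x)) (int q)" "\<bar>nrm (y x)\<bar> \<le> int T"
    "bd (2 * int q * X) (y x)" if x: "x \<in> box X" for x
  proof -
    have xO: "x \<in> Ord" and xb: "bd X x" using x by (auto simp: box_def bd_def)
    show yO: "y x \<in> Ord" unfolding y_def using xO by auto
    have "[nrm (y x) = 1] (mod int q)" unfolding y_def by (rule nrm_cong_one[OF xO])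
    then show cop: "coprime (nrm (y x)) (int q)" using cong_imp_coprime cong_sym by (metis coprime_1_left)
    show nz: "nrm (y x) \<noteq> 0"
    proof
      assume "nrm (y x) = 0"
      then have "is_unit (int q)" using cop by simp
      then show False using Q(1) by simp
    qed
    have "nrm 0 = 0" using nrm_of_int[of 0] d_pos by (simp add: zero_power)
    then show "y x \<noteq> 0" using nz by auto
    have "bd (1 + \<bar>int q\<bar> * X) (y x)" unfolding y_def by (intro bd_add bd_one bd_scale xb)
    moreover have "1 \<le> int q * X" using Q(1) X by (metis int_one_le_iff_zero_less mult_pos_pos of_nat_0_less_iff order_less_le_trans zero_less_numeral zero_less_one)
    ultimately show b: "bd (2 * int q * X) (y x)" by (elim bd_mono) (simp add: mult.commute)
    show "\<bar>nrm (y x)\<bar> \<le> int T" unfolding T by (rule C(1)[OF b])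
  qed
  have z_lt: "z < p" if "prime p" "\<not> p dvd q" for p using Q(2)[of p] that by force
  have copD: "coprime (nrm (y x)) (int D)" if "x \<in> box X" for x
    using facts(4)[OF that] Q(3) by (meson coprime_divisors dvd_refl int_dvd_int_iff)
  have "(\<Sum>x\<in>box X. ln (real_of_int \<bar>nrm (y x)\<bar>)) \<le>
    (\<Sum>x\<in>box X. \<Sum>p\<in>PT. ln (real p) * real (card {L. deg1 p L \<and> y x \<in> L}) +
        (if \<exists>I\<in>square_ideals p. y x \<in> I then ln (real T) else 0))"
  proof (rule sum_mono)
    fix x assume x: "x \<in> box X"
    note f = facts[OF x]
    have "ln (real_of_int \<bar>nrm (y x)\<bar>) \<le> (\<Sum>p\<in>prime_factors (nat \<bar>nrm (y x)\<bar>). ln (real p) * real (card {L. deg1 p L \<and> y x \<in> L}) +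
        (if \<exists>I\<in>square_ideals p. y x \<in> I then ln (real T) else 0))"
      by (rule ln_norm_le[OF gen f(1) copD[OF x] f(3) f(5)])
    also have "\<dots> \<le> (\<Sum>p\<in>PT. ln (real p) * real (card {L. deg1 p L \<and> y x \<in> L}) +
        (if \<exists>I\<in>square_ideals p. y x \<in> I then ln (real T) else 0))"
    proof (rule sum_mono2[OF finPT])
      show "prime_factors (nat \<bar>nrm (y x)\<bar>) \<subseteq> PT"
      proof
        fix p assume p: "p \<in> prime_factors (nat \<bar>nrm (y x)\<bar>)"
        then have pp: "prime p" "p dvd nat \<bar>nrm (y x)\<bar>" by auto
        have "p \<le> nat \<bar>nrm (y x)\<bar>" using pp(2) f(3) by (intro dvd_imp_le) auto
        then have "p \<le> T" using f(5) by linarith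
        moreover have "\<not> p dvd q"
        proof
          assume "p dvd q"
          moreover have "int p dvd nrm (y x)" using pp(2) by (simp flip: int_dvd_int_iff)
          ultimately have "is_unit (int p)" using f(4) by (meson coprime_common_divisor int_dvd_int_iff)
          then show False using pp(1) by (auto dest: prime_gt_1_nat)
        qed
        ultimately show "p \<in> PT" using pp(1) by (simp add: PT_def)
      qed
    next
      fix p assume "p \<in> PT - prime_factors (nat \<bar>nrm (y x)\<bar>)"
      then have "real p \<ge> 1" using prime_ge_1_nat by (auto simp: PT_def)
      then show "0 \<le> ln (real p) * real (card {L. deg1 p L \<and> y x \<in> L}) +
        (if \<exists>I\<in>square_ideals p. y x \<in> I then ln (real T) else 0)"
        using lnT by (intro add_nonneg_nonneg mult_nonneg_nonneg) auto
    qed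
    finally show "ln (real_of_int \<bar>nrm (y x)\<bar>) \<le> \<dots>" .
  qed
  also have "\<dots> = (\<Sum>p\<in>PT. \<Sum>x\<in>box X. ln (real p) * real (card {L. deg1 p L \<and> y x \<in> L}) +
        (if \<exists>I\<in>square_ideals p. y x \<in> I then ln (real T) else 0))" by (rule sum.swap)
  also have "\<dots> = (\<Sum>p\<in>PT. ln (real p) * (\<Sum>x\<in>box X. real (card {L. deg1 p L \<and> y x \<in> L}))) +
      (\<Sum>p\<in>PT. \<Sum>x\<in>box X. if \<exists>I\<in>square_ideals p. y x \<in> I then ln (real T) else 0)"
    by (simp add: sum.distrib sum_distrib_left)
  also have "(\<Sum>p\<in>PT. ln (real p) * (\<Sum>x\<in>box X. real (card {L. deg1 p L \<and> y x \<in> L}))) \<le>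
    (11/10) * B * prime_mass N + real d * K * (\<Sum>p | prime p \<and> N < p \<and> p \<le> T. ln (real p) * (B / real p + 1))"
  proof -
    have swap: "(\<Sum>x\<in>box X. real (card {L. deg1 p L \<and> y x \<in> L})) = (\<Sum>L\<in>{L. deg1 p L}. real (card {x \<in> box X. y x \<in> L}))"
      if "p \<in> PT" for p
    proof -
      have fin: "finite {L. deg1 p L}" using that finite_deg1 by (simp add: PT_def)
      have "(\<Sum>x\<in>box X. real (card {L. deg1 p L \<and> y x \<in> L})) = (\<Sum>x\<in>box X. \<Sum>L\<in>{L. deg1 p L}. of_bool (y x \<in> L))"
        using fin by (intro sum.cong refl) (simp add: Int_def)
      also have "\<dots> = (\<Sum>L\<in>{L. deg1 p L}. \<Sum>x\<in>box X. of_bool (y x \<in> L))" by (rule sum.swap)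
      also have "\<dots> = (\<Sum>L\<in>{L. deg1 p L}. real (card {x \<in> box X. y x \<in> L}))"
        by (intro sum.cong refl) (simp add: Int_def)
      finally show ?thesis .
    qed
    have cop: "coprime (int q) (int p)" if "p \<in> PT" for p
      using that prime_imp_coprime[of p q] by (simp add: PT_def coprime_commute)
    have small: "ln (real p) * (\<Sum>x\<in>box X. real (card {L. deg1 p L \<and> y x \<in> L})) \<le> (11/10) * B * (real (rho p) * ln (real p) / real p)"
      if p: "p \<in> PT" "p \<le> N" for p
    proof -
      have pr: "prime p" using p by (simp add: PT_def)
      have "(\<Sum>L\<in>{L. deg1 p L}. real (card {x \<in> box X. y x \<in> L})) \<le> (\<Sum>L\<in>{L. deg1 p L}. (11/10) * B / real p)"
      proof (rule sum_mono)
        fix L assume "L \<in> {L. deg1 p L}"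
        then have L: "deg1 p L" by simp
        then have zL: "zideal L" "of_int (int p) \<in> L" by (auto simp: deg1_def above_def)
        obtain u where u: "u \<in> Ord" "\<forall>x\<in>Ord. 1 + of_int (int q) * x \<in> L \<longleftrightarrow> x - u \<in> L"
          using coset_of_residue_one[OF zL cop[OF p(1)]] by blast
        have "{x \<in> box X. y x \<in> L} = {x \<in> box X. x - u \<in> L}"
          using u(2) unfolding y_def by (auto simp: box_def bd_def)
        then show "real (card {x \<in> box X. y x \<in> L}) \<le> (11/10) * B / real p"
          using up[OF pr p(2) L u(1)] by (simp add: B_def)
      qed
      also have "\<dots> = real (rho p) * ((11/10) * B / real p)" by (simp add: rho_def)
      finally have "ln (real p) * (\<Sum>x\<in>box X. real (card {L. deg1 p L \<and> y x \<in> L})) \<le> ln (real p) * (real (rho p) * ((11/10) * B / real p))"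
        unfolding swap[OF p(1)] using prime_ge_1_nat[OF pr] by (intro mult_left_mono) auto
      then show ?thesis by (simp add: mult_ac)
    qed
    have large: "ln (real p) * (\<Sum>x\<in>box X. real (card {L. deg1 p L \<and> y x \<in> L})) \<le> real d * K * (ln (real p) * (B / real p + 1))"
      if p: "p \<in> PT" for p
    proof -
      have pr: "prime p" using p by (simp add: PT_def)
      have "(\<Sum>L\<in>{L. deg1 p L}. real (card {x \<in> box X. y x \<in> L})) \<le> (\<Sum>L\<in>{L. deg1 p L}. K * (B / real p + 1))"
      proof (rule sum_mono)
        fix L assume "L \<in> {L. deg1 p L}"
        then have L: "deg1 p L" by simp
        then have zL: "zideal L" "of_nat p \<in> L" by (auto simp: deg1_def above_def)
        show "real (card {x \<in> box X. y x \<in> L}) \<le> K * (B / real p + 1)"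
          unfolding y_def B_def using deg1_idx[OF pr L] prime_gt_0_nat[OF pr] X
          by (intro count_at_least_kappa[OF kappa zL _ cop[OF p]]) auto
      qed
      also have "\<dots> = real (rho p) * (K * (B / real p + 1))" by (simp add: rho_def)
      also have "\<dots> \<le> real d * (K * (B / real p + 1))"
        using rho_le[OF pr] K Bpos by (intro mult_right_mono) auto
      finally have "ln (real p) * (\<Sum>x\<in>box X. real (card {L. deg1 p L \<and> y x \<in> L})) \<le> ln (real p) * (real d * (K * (B / real p + 1)))"
        unfolding swap[OF p] using prime_ge_1_nat[OF pr] by (intro mult_left_mono) auto
      then show ?thesis by (simp add: mult_ac)
    qed
    have "(\<Sum>p\<in>PT. ln (real p) * (\<Sum>x\<in>box X. real (card {L. deg1 p L \<and> y x \<in> L}))) =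
      (\<Sum>p\<in>{p\<in>PT. p \<le> N} \<union> {p\<in>PT. N < p}. ln (real p) * (\<Sum>x\<in>box X. real (card {L. deg1 p L \<and> y x \<in> L})))"
      by (rule sum.cong) auto
    also have "\<dots> = (\<Sum>p\<in>{p\<in>PT. p \<le> N}. ln (real p) * (\<Sum>x\<in>box X. real (card {L. deg1 p L \<and> y x \<in> L}))) +
      (\<Sum>p\<in>{p\<in>PT. N < p}. ln (real p) * (\<Sum>x\<in>box X. real (card {L. deg1 p L \<and> y x \<in> L})))"
      using finPT by (intro sum.union_disjoint) auto
    also have "\<dots> \<le> (\<Sum>p\<in>{p\<in>PT. p \<le> N}. (11/10) * B * (real (rho p) * ln (real p) / real p)) +
      (\<Sum>p\<in>{p\<in>PT. N < p}. real d * K * (ln (real p) * (B / real p + 1)))"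
      by (intro add_mono sum_mono) (use small large in blast)+
    also have "\<dots> \<le> (\<Sum>p | prime p \<and> p \<le> N. (11/10) * B * (real (rho p) * ln (real p) / real p)) +
      (\<Sum>p | prime p \<and> N < p \<and> p \<le> T. real d * K * (ln (real p) * (B / real p + 1)))"
    proof (intro add_mono sum_mono2)
      show "finite {p. prime p \<and> N < p \<and> p \<le> T}" by (rule finite_subset[of _ "{..T}"]) auto
      show "finite {p. prime p \<and> p \<le> N}" by (rule finite_primes_le)
      show "0 \<le> (11/10) * B * (real (rho p) * ln (real p) / real p)" if "p \<in> {p. prime p \<and> p \<le> N} - {p \<in> PT. p \<le> N}" for p
        using that Bpos prime_ge_1_nat[of p] by auto
      show "0 \<le> real d * K * (ln (real p) * (B / real p + 1))"
        if "p \<in> {p. prime p \<and> N < p \<and> p \<le> T} - {p \<in> PT. N < p}" for p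
        using that Bpos K prime_ge_1_nat[of p] by (intro mult_nonneg_nonneg) auto
    qed (auto simp: PT_def)
    also have "\<dots> = (11/10) * B * prime_mass N + real d * K * (\<Sum>p | prime p \<and> N < p \<and> p \<le> T. ln (real p) * (B / real p + 1))"
      by (simp only: prime_mass_def sum_distrib_left)
    finally show ?thesis .
  qed
  also have "(\<Sum>p\<in>PT. \<Sum>x\<in>box X. if \<exists>I\<in>square_ideals p. y x \<in> I then ln (real T) else 0) \<le>
     ln (real T) * (3 * real d ^ 2 * K * (B / real z + sqrt (real S)))"
  proof -
    define E where "E p = {x \<in> box X. \<exists>I\<in>square_ideals p. y x \<in> I}" for p
    have eq: "(\<Sum>x\<in>box X. if \<exists>I\<in>square_ideals p. y x \<in> I then ln (real T) else 0) = ln (real T) * real (card (E p))" for p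
    proof -
      have "(\<Sum>x\<in>box X. if \<exists>I\<in>square_ideals p. y x \<in> I then ln (real T) else 0) = (\<Sum>x\<in>E p. ln (real T))"
        unfolding E_def by (rule sum.inter_filter[symmetric]) auto
      then show ?thesis by simp
    qed
    have pD: "\<not> p dvd D" if "p \<in> PT" for p using that Q(3) dvd_trans by (auto simp: PT_def)
    have Ebound: "real (card (E p)) \<le> 3 * real d ^ 2 * K * (B / real p ^ 2 + 1)" if p: "p \<in> PT" for p
    proof -
      have pr: "prime p" "\<not> p dvd q" using p by (auto simp: PT_def)
      have "coprime q p" using pr prime_imp_coprime[of p q] by (simp add: coprime_commute)
      then have cop: "coprime (int q) (int (p * p))" by (simp add: coprime_mult_right_iff)
      have "card (E p) \<le> card (\<Union>I\<in>square_ideals p. {x \<in> box X. y x \<in> I})"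
        unfolding E_def by (rule card_mono) (use square_ideals_card(1)[OF pr(1)] in auto)
      also have "\<dots> \<le> (\<Sum>I\<in>square_ideals p. card {x \<in> box X. y x \<in> I})"
        by (rule card_UN_le[OF square_ideals_card(1)[OF pr(1)]])
      finally have "real (card (E p)) \<le> (\<Sum>I\<in>square_ideals p. real (card {x \<in> box X. y x \<in> I}))"
        by (metis of_nat_le_iff of_nat_sum)
      also have "\<dots> \<le> (\<Sum>I\<in>square_ideals p. K * (B / real p ^ 2 + 1))"
      proof (rule sum_mono)
        fix I assume I: "I \<in> square_ideals p"
        note sd = square_idealsD[OF gen pr(1) pD[OF p] I]
        have "real (card {x \<in> box X. 1 + of_int (int q) * x \<in> I}) \<le> K * (real (card (box X)) / real (p ^ 2) + 1)"
          using prime_gt_0_nat[OF pr(1)] X by (intro count_at_least_kappa[OF kappa sd(1,2) _ cop _ sd(3)]) auto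
        then show "real (card {x \<in> box X. y x \<in> I}) \<le> K * (B / real p ^ 2 + 1)" by (simp add: y_def B_def)
      qed
      also have "\<dots> = real (card (square_ideals p)) * (K * (B / real p ^ 2 + 1))" by simp
      also have "\<dots> \<le> (3 * real d ^ 2) * (K * (B / real p ^ 2 + 1))"
      proof (rule mult_right_mono)
        have "real (card (square_ideals p)) \<le> real (3 * d ^ 2)" using square_ideals_card(2)[OF pr(1)] by (rule of_nat_mono)
        then show "real (card (square_ideals p)) \<le> 3 * real d ^ 2" by simp
      qed (use K Bpos in auto)
      finally show ?thesis by (simp only: mult.assoc)
    qed
    \<comment> \<open>A square ideal for \<open>p\<close> has index at least \<open>p ^ 2\<close>,
      whereas an ideal containing the nonzero element \<open>y x\<close>, whose coordinates are at
      most \<open>2 q X\<close>, has index at most \<open>S\<close>. So the summand 1 is collected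
      only for \<open>p\<close> up to \<open>sqrt S\<close>.\<close>
    have Eempty: "card (E p) = 0" if p: "p \<in> PT" and "S < p ^ 2" for p
    proof -
      have pr: "prime p" using p by (auto simp: PT_def)
      have "E p = {}"
      proof (rule ccontr)
        assume "E p \<noteq> {}"
        then obtain x I where x: "x \<in> box X" "I \<in> square_ideals p" "y x \<in> I" unfolding E_def by blast
        note sd = square_idealsD[OF gen pr pD[OF p] x(2)]
        have pp: "p * p > 0" using prime_gt_0_nat[OF pr] by auto
        have "int (idx I) \<le> (2 * (R * (2 * int q * X)) + 1) ^ d"
          by (rule idxb[OF sd(1) finite_cosets_above[OF sd(1,2) pp] x(3) facts(2)[OF x(1)] facts(6)[OF x(1)]])
        then show False using sd(3) \<open>S < p ^ 2\<close> S by linarith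
      qed
      then show ?thesis by simp
    qed
    have "(\<Sum>p\<in>PT. real (card (E p))) = (\<Sum>p\<in>{p \<in> PT. p ^ 2 \<le> S}. real (card (E p)))"
      using finPT Eempty by (intro sum.mono_neutral_right) (auto simp: not_le)
    also have "\<dots> \<le> (\<Sum>p\<in>{p \<in> PT. p ^ 2 \<le> S}. 3 * real d ^ 2 * K * (B / real p ^ 2 + 1))"
      using Ebound by (intro sum_mono) auto
    also have "\<dots> = 3 * real d ^ 2 * K * (B * (\<Sum>p\<in>{p \<in> PT. p ^ 2 \<le> S}. 1 / real p ^ 2) + real (card {p \<in> PT. p ^ 2 \<le> S}))"
      by (simp add: sum_distrib_left[symmetric] sum.distrib) (simp add: sum_distrib_left)
    also have "\<dots> \<le> 3 * real d ^ 2 * K * (B * (1 / real z) + sqrt (real S))"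
    proof (intro mult_left_mono add_mono)
      have "(\<Sum>p\<in>{p \<in> PT. p ^ 2 \<le> S}. 1 / real p ^ 2) \<le> (\<Sum>p\<in>{z<..T}. 1 / real p ^ 2)"
        using z_lt by (intro sum_mono2) (auto simp: PT_def)
      also have "\<dots> \<le> 1 / real z" by (rule sum_inverse_square_tail[OF z])
      finally show "(\<Sum>p\<in>{p \<in> PT. p ^ 2 \<le> S}. 1 / real p ^ 2) \<le> 1 / real z" .
      have sq: "real p \<le> sqrt (real S)" if "p ^ 2 \<le> S" for p
        using that by (intro real_le_rsqrt) (simp flip: of_nat_power)
      have "{p \<in> PT. p ^ 2 \<le> S} \<subseteq> {1..nat \<lfloor>sqrt (real S)\<rfloor>}"
        using sq by (auto simp: PT_def le_nat_iff le_floor_iff prime_ge_1_nat[unfolded One_nat_def] intro: prime_ge_Suc_0_nat)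
      then have "card {p \<in> PT. p ^ 2 \<le> S} \<le> card {1..nat \<lfloor>sqrt (real S)\<rfloor>}" by (rule card_mono[rotated]) simp
      then have "card {p \<in> PT. p ^ 2 \<le> S} \<le> nat \<lfloor>sqrt (real S)\<rfloor>" by simp
      then have "real (card {p \<in> PT. p ^ 2 \<le> S}) \<le> real (nat \<lfloor>sqrt (real S)\<rfloor>)" by (rule of_nat_mono)
      also have "\<dots> \<le> sqrt (real S)" by simp
      finally show "real (card {p \<in> PT. p ^ 2 \<le> S}) \<le> sqrt (real S)" .
    qed (use K Bpos in auto)
    finally have "(\<Sum>p\<in>PT. real (card (E p))) \<le> 3 * real d ^ 2 * K * (B / real z + sqrt (real S))" by simp
    then have "ln (real T) * (\<Sum>p\<in>PT. real (card (E p))) \<le> ln (real T) * (3 * real d ^ 2 * K * (B / real z + sqrt (real S)))"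
      using lnT by (rule mult_left_mono)
    then show ?thesis unfolding eq by (simp only: sum_distrib_left)
  qed
  finally show ?thesis unfolding y_def B_def by simp
qed

end

context number_order
begin

text \<open>All but two percent of the elements have norm at least \<open>r ^ d\<close> in absolute
  value, and the logarithms of the other norms are nonnegative because the norms are nonzero
  integers.\<close>

lemma norm_sum_lower:
  assumes q: "q \<ge> (1::nat)" and X: "X \<ge> 50 * int d" and nz: "\<And>x. x \<in> box X \<Longrightarrow> nrm (1 + of_int (int q) * x) \<noteq> 0"
  shows "(\<Sum>x\<in>box X. ln (real_of_int \<bar>nrm (1 + of_int (int q) * x)\<bar>)) \<ge>
    (49/50) * real (card (box X)) * (real d * ln (real_of_int X) - real d * ln (100 * real d))"
proof -
  define B where "B = real (card (box X))"
  have X1: "X \<ge> 1" using X d_pos by linarith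
  \<comment> \<open>With this \<open>r\<close>, the bound \<open>d (2 r + 1)\<close> of
    \<open>small_norm_count\<close> is at most one fiftieth of \<open>2 X + 1\<close>.\<close>
  define r where "r = real_of_int X / (100 * real d)"
  have r: "r > 0" using X1 d_pos by (simp add: r_def)
  define bad where "bad = {x \<in> box X. real_of_int \<bar>nrm (1 + of_int (int q) * x)\<bar> < r ^ d}"
  have fb: "finite bad" unfolding bad_def by (rule finite_subset[OF _ finite_box[of X]]) auto
  have "real (card bad) * (2 * real_of_int X + 1) \<le> B * (real d * (2 * r + 1))"
    unfolding bad_def B_def using q r by (intro small_norm_count X1) auto
  also have "real d * (2 * r + 1) \<le> (1/50) * (2 * real_of_int X + 1)"
  proof -
    have "real d * (2 * r) = real_of_int X / 50" using d_pos by (simp add: r_def field_simps)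
    moreover have "real d \<le> real_of_int X / 50" using X by (simp add: field_simps)
    ultimately show ?thesis by (simp add: algebra_simps)
  qed
  finally have "real (card bad) * (2 * real_of_int X + 1) \<le> (B / 50) * (2 * real_of_int X + 1)"
    by (simp add: B_def mult_left_mono)
  then have cb: "real (card bad) \<le> B / 50" using X1 by (simp add: mult_le_cancel_right)
  have ln_nonneg: "ln (real_of_int \<bar>nrm (1 + of_int (int q) * x)\<bar>) \<ge> 0" if "x \<in> box X" for x
    using nz[OF that] by (intro ln_ge_zero) linarith
  have lr: "real d * ln (real_of_int X) - real d * ln (100 * real d) = ln (r ^ d)"
    using X1 d_pos r by (simp add: r_def ln_realpow ln_div algebra_simps)
  show ?thesis
  proof (cases "ln (r ^ d) \<ge> 0")
    case False
    then have "(49/50) * B * ln (r ^ d) \<le> 0" by (simp add: B_def mult_nonneg_nonpos)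
    also have "0 \<le> (\<Sum>x\<in>box X. ln (real_of_int \<bar>nrm (1 + of_int (int q) * x)\<bar>))" by (intro sum_nonneg ln_nonneg)
    finally show ?thesis unfolding lr B_def by simp
  next
    case True
    have "real (card (box X - bad)) = B - real (card bad)"
      unfolding B_def using fb by (subst card_Diff_subset) (auto simp: bad_def of_nat_diff card_mono)
    then have "(49/50) * B * ln (r ^ d) \<le> real (card (box X - bad)) * ln (r ^ d)"
      using cb True by (intro mult_right_mono) auto
    also have "\<dots> = (\<Sum>x\<in>box X - bad. ln (r ^ d))" by simp
    also have "\<dots> \<le> (\<Sum>x\<in>box X - bad. ln (real_of_int \<bar>nrm (1 + of_int (int q) * x)\<bar>))"
    proof (rule sum_mono)
      fix x assume "x \<in> box X - bad"
      then have "r ^ d \<le> real_of_int \<bar>nrm (1 + of_int (int q) * x)\<bar>" by (auto simp: bad_def)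
      then show "ln (r ^ d) \<le> ln (real_of_int \<bar>nrm (1 + of_int (int q) * x)\<bar>)" using r by (intro ln_mono) auto
    qed
    also have "\<dots> \<le> (\<Sum>x\<in>box X. ln (real_of_int \<bar>nrm (1 + of_int (int q) * x)\<bar>))"
      using ln_nonneg by (intro sum_mono2) auto
    finally show ?thesis unfolding lr B_def by simp
  qed
qed

lemma ex_powr_large:
  assumes e: "e > 0"
  shows "\<exists>N0 :: nat. \<forall>N\<ge>N0. t \<le> real N powr e"
proof -
  define s where "s = max t 1"
  have s: "s \<ge> 1" "t \<le> s" by (auto simp: s_def)
  have "t \<le> real N powr e" if N: "N \<ge> nat \<lceil>s powr (1 / e)\<rceil>" for N
  proof -
    have "s powr (1 / e) \<le> real N" using N by linarith
    then have "(s powr (1 / e)) powr e \<le> real N powr e" using e by (intro powr_mono2) auto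
    moreover have "(s powr (1 / e)) powr e = s" using s e by (simp add: powr_powr)
    ultimately show ?thesis using s by linarith
  qed
  then show ?thesis by blast
qed

text \<open>The average of \<open>ln |nrm (1 + q * x)|\<close> over the box is estimated twice. From
  below it is close to \<open>d ln X\<close>, which is at least \<open>ln N\<close>; from above it
  is at most \<open>(11/10) * prime_mass N\<close> plus two error terms, each arranged to be
  \<open>(ln N) / 100\<close> up to a constant. Since \<open>49/50 - 2/100\<close> exceeds
  \<open>(11/10) * (3/4)\<close>, the coefficient 3/4 results.\<close>

theorem prime_mass_lower: "\<exists>c. \<forall>N\<ge>1. prime_mass N \<ge> (3/4) * ln (real N) - c"
proof -
  obtain K where K: "K \<ge> 1" "\<And>I u X q. zideal I \<Longrightarrow> finite (coset I ` Ord) \<Longrightarrow> u \<in> Ord \<Longrightarrow> X \<ge> 0 \<Longrightarrow> 0 < q \<Longrightarrow> q \<le> idx I \<Longrightarrow>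
     real (card {x \<in> box X. x - u \<in> I}) \<le> K * (real (card (box X)) / real q + 1)"
    using ex_count_upper_const by blast
  obtain C where C: "C \<ge> 1" "\<And>B x. bd B x \<Longrightarrow> \<bar>nrm x\<bar> \<le> C * B ^ d" using ex_nrm_bound by blast
  obtain R where R: "R \<ge> 1" "\<And>I. zideal I \<Longrightarrow> finite (coset I ` Ord) \<Longrightarrow> count_bound R I"
    "\<And>I u B. zideal I \<Longrightarrow> finite (coset I ` Ord) \<Longrightarrow> u \<in> I \<Longrightarrow> u \<noteq> 0 \<Longrightarrow> bd B u \<Longrightarrow> int (idx I) \<le> (2 * (R * B) + 1) ^ d"
    using ex_count_const by blast
  obtain D where D: "D > 0" "\<And>p L. prime p \<Longrightarrow> \<not> p dvd D \<Longrightarrow> deg1 p L \<Longrightarrow>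
     (\<exists>a\<in>Ord. a \<notin> L \<and> (\<forall>y\<in>L. \<exists>z\<in>Ord. a * y = of_nat p * z))"
    using ex_local_generator by blast
  \<comment> \<open>Makes the square ideals contribute at most \<open>ln T / 200\<close> per element
    up to a constant, hence about \<open>ln N / 100\<close>, because \<open>ln T <= 2 ln N\<close>
    up to a constant.\<close>
  define z where "z = nat \<lceil>600 * real d ^ 2 * K\<rceil>"
  have dge: "real d \<ge> 1" using d_pos by simp
  have dK: "real d ^ 2 * K \<ge> 1"
  proof -
    have "1 * 1 \<le> real d ^ 2 * K" using dge K(1) by (intro mult_mono) auto
    then show ?thesis by simp
  qed
  have z: "z \<ge> 1" "600 * real d ^ 2 * K \<le> real z" unfolding z_def using dK by linarith+
  \<comment> \<open>Divisible by every prime up to \<open>z\<close> and by \<open>D\<close>; the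
    factor 2 ensures that \<open>q\<close> is not a unit.\<close>
  define q where "q = 2 * D * fact z"
  have q: "2 \<le> q" "\<And>p. prime p \<Longrightarrow> p \<le> z \<or> p dvd D \<Longrightarrow> p dvd q" "D dvd q"
  proof -
    have "1 \<le> D * fact z" using D(1) by (simp add: Suc_le_eq)
    then show "2 \<le> q" by (simp add: q_def)
    show "p dvd q" if "prime p" "p \<le> z \<or> p dvd D" for p
      using that by (auto simp: q_def prime_dvd_fact_iff)
    show "D dvd q" by (simp add: q_def)
  qed
  define c1 where "c1 = real_of_int C * (2 * real q) ^ d"
  define c2 where "c2 = (4 * real_of_int R * real q + 1) ^ d"
  have c1: "c1 \<ge> 1"
  proof -
    have "1 * 1 \<le> real_of_int C * (2 * real q) ^ d" using C(1) q(1) by (intro mult_mono one_le_power) auto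
    then show ?thesis by (simp add: c1_def)
  qed
  have c2: "c2 \<ge> 0" using R(1) by (simp add: c2_def)
  define M where "M = real d * K * (1 + c1)"
  have M: "M \<ge> 1"
  proof -
    have "1 * 1 * 1 \<le> real d * K * (1 + c1)" using dge K(1) c1 by (intro mult_mono) auto
    then show ?thesis by (simp add: M_def)
  qed
  \<comment> \<open>The primes between \<open>N\<close> and \<open>T\<close>, where \<open>T\<close>
    has size about \<open>N^(1+\<epsilon>)\<close>, contribute \<open>2 M \<epsilon> ln N\<close>
    per element up to a constant, and this is \<open>ln N / 100\<close>.\<close>
  define \<epsilon> where "\<epsilon> = 1 / (200 * M)"
  have eps: "0 < \<epsilon>" "\<epsilon> \<le> 1" using M by (auto simp: \<epsilon>_def field_simps)
  define \<eta> :: real where "\<eta> = (11/10) powr (1 / real d) - 1"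
  have eta: "0 < \<eta>" "(1 + \<eta>) ^ d = 11/10"
  proof -
    have "1 powr (1 / real d) < (11/10::real) powr (1 / real d)" using d_pos by (intro powr_less_mono2) auto
    then show "0 < \<eta>" by (simp add: \<eta>_def)
    show "(1 + \<eta>) ^ d = 11/10" using d_pos by (simp add: \<eta>_def powr_power)
  qed
  \<comment> \<open>A box of side \<open>N^\<beta>\<close> exceeds \<open>N^(1/d)\<close>, the order
    of the covering radius, by the factor \<open>N^(\<epsilon>/d)\<close>, which eventually outgrows
    \<open>R / \<eta>\<close>.\<close>
  define \<beta> where "\<beta> = (1 + \<epsilon>) / real d"
  have bpos: "\<beta> > 0" using eps dge by (simp add: \<beta>_def)
  obtain N1 where N1: "\<And>N. N \<ge> N1 \<Longrightarrow> real_of_int R / \<eta> \<le> real N powr (\<epsilon> / real d)"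
    using ex_powr_large[of "\<epsilon> / real d" "real_of_int R / \<eta>"] eps dge by auto
  obtain N2 where N2: "\<And>N. N \<ge> N2 \<Longrightarrow> 50 * real d \<le> real N powr \<beta>"
    using ex_powr_large[OF bpos, of "50 * real d"] by auto
  define e1 where "e1 = real d * ln (100 * real d)"
  define e2 where "e2 = ln c1 + real d * ln 2"
  define e3 where "e3 = 6 * real d ^ 2 * K * sqrt (c1 * c2)"
  define c where "c = e1 + M * (2 * e2 + ln 4) + e2 / 200 + e3"
  have main: "prime_mass N \<ge> (3/4) * ln (real N) - c" if N: "N \<ge> N1" "N \<ge> N2" "N \<ge> 1" for N
  proof -
    define X where "X = \<lceil>real N powr \<beta>\<rceil>"
    have g1: "real N powr \<beta> \<ge> 1" using N bpos by (intro ge_one_powr_ge_zero) auto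
    have X: "X \<ge> 1" "real N powr \<beta> \<le> real_of_int X" "real_of_int X \<le> 2 * real N powr \<beta>"
      unfolding X_def using g1 by linarith+
    have X50: "X \<ge> 50 * int d"
    proof -
      have "50 * real d \<le> real_of_int X" using N2[OF N(2)] X(2) by linarith
      then have "real_of_int (50 * int d) \<le> real_of_int X" by simp
      then show ?thesis by (simp only: of_int_le_iff)
    qed
    define B where "B = real (card (box X))"
    have B: "B = (2 * real_of_int X + 1) ^ d"
      unfolding B_def using arg_cong[OF card_box[of X], of real_of_int] X(1) by simp
    have Bpos: "B > 0" unfolding B using X(1) by simp
    have XB: "real_of_int X ^ d \<le> B" unfolding B using X(1) by (intro power_mono) auto
    have up: "real (card {x \<in> box X. x - u \<in> L}) \<le> (11/10) * real (card (box X)) / real p"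
      if p: "prime p" "p \<le> N" "deg1 p L" and u: "u \<in> Ord" for p L u
    proof -
      have zL: "zideal L" "of_nat p \<in> L" using p by (auto simp: deg1_def above_def)
      have pos: "p > 0" using p prime_gt_0_nat by blast
      have idxp: "idx L = p" by (rule deg1_idx[OF p(1,3)])
      obtain s :: nat where s: "s ^ d \<le> p" and cnt: "int p * int (card {x \<in> box X. x - u \<in> L}) \<le> (2 * (X + R * int s) + 1) ^ d"
        using X(1) idxp by (auto intro: count_boundE[OF R(2)[OF zL(1) finite_cosets_above[OF zL pos]] u, of X])
      have "real s ^ d \<le> real N" using s p(2) by (metis of_nat_le_iff of_nat_power order_trans)
      then have "(real s ^ d) powr (1 / real d) \<le> real N powr (1 / real d)" by (intro powr_mono2) auto
      moreover have "(real s ^ d) powr (1 / real d) = real s"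
        using d_pos by (cases "s = 0") (auto simp: powr_powr zero_power simp flip: powr_realpow)
      ultimately have sN: "real s \<le> real N powr (1 / real d)" by simp
      have "real_of_int R * real s \<le> (\<eta> * real N powr (\<epsilon> / real d)) * real N powr (1 / real d)"
        using N1[OF N(1)] eta R(1) sN by (intro mult_mono) (auto simp: field_simps)
      also have "\<dots> = \<eta> * real N powr (\<epsilon> / real d + 1 / real d)" by (simp only: powr_add mult.assoc)
      also have "\<epsilon> / real d + 1 / real d = \<beta>" by (simp add: \<beta>_def add_divide_distrib)
      also have "\<eta> * real N powr \<beta> \<le> \<eta> * real_of_int X" using X eta by (intro mult_left_mono) auto
      finally have Rs: "real_of_int R * real s \<le> \<eta> * real_of_int X" .
      have "real p * real (card {x \<in> box X. x - u \<in> L}) = real_of_int (int p * int (card {x \<in> box X. x - u \<in> L}))" by simp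
      also have "\<dots> \<le> real_of_int ((2 * (X + R * int s) + 1) ^ d)" using cnt by (simp only: of_int_le_iff)
      also have "\<dots> = (2 * (real_of_int X + real_of_int R * real s) + 1) ^ d" by simp
      also have "\<dots> \<le> ((1 + \<eta>) * (2 * real_of_int X + 1)) ^ d"
      proof (rule power_mono)
        show "2 * (real_of_int X + real_of_int R * real s) + 1 \<le> (1 + \<eta>) * (2 * real_of_int X + 1)"
          using Rs eta by (simp add: algebra_simps)
        show "0 \<le> 2 * (real_of_int X + real_of_int R * real s) + 1" using X(1) R(1) by auto
      qed
      also have "\<dots> = (11/10) * B" by (simp only: power_mult_distrib eta(2) B)
      finally show ?thesis using pos by (simp add: field_simps B_def)
    qed
    define T where "T = nat (C * (2 * int q * X) ^ d)"
    define S where "S = nat ((2 * (R * (2 * int q * X)) + 1) ^ d)"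
    have T: "int T = C * (2 * int q * X) ^ d" unfolding T_def using C(1) X(1) by simp
    have S: "int S = (2 * (R * (2 * int q * X)) + 1) ^ d" unfolding S_def using R(1) X(1) by simp
    have Tr: "real T = c1 * real_of_int X ^ d"
      using arg_cong[OF T, of real_of_int] by (simp add: c1_def power_mult_distrib)
    have Sr: "real S \<le> c2 * real_of_int X ^ d"
    proof -
      have "real S = (2 * (real_of_int R * (2 * real q * real_of_int X)) + 1) ^ d"
        using arg_cong[OF S, of real_of_int] by simp
      also have "\<dots> \<le> ((4 * real_of_int R * real q + 1) * real_of_int X) ^ d"
        using X(1) R(1) by (intro power_mono) (auto simp: algebra_simps)
      finally show ?thesis by (simp add: c2_def power_mult_distrib)
    qed
    define sm where "sm = (\<Sum>x\<in>box X. ln (real_of_int \<bar>nrm (1 + of_int (int q) * x)\<bar>))"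
    have upper: "sm \<le> (11/10) * B * prime_mass N
     + real d * K * (\<Sum>p | prime p \<and> N < p \<and> p \<le> T. ln (real p) * (B / real p + 1))
     + ln (real T) * (3 * real d ^ 2 * K * (B / real z + sqrt (real S)))"
      unfolding sm_def B_def
    proof (rule norm_sum_upper)
      show "\<And>p L. prime p \<Longrightarrow> \<not> p dvd D \<Longrightarrow> deg1 p L \<Longrightarrow>
         (\<exists>a\<in>Ord. a \<notin> L \<and> (\<forall>y\<in>L. \<exists>z\<in>Ord. a * y = of_nat p * z))" by (rule D(2))
      show "\<And>I u X q. zideal I \<Longrightarrow> finite (coset I ` Ord) \<Longrightarrow> u \<in> Ord \<Longrightarrow> X \<ge> 0 \<Longrightarrow> 0 < q \<Longrightarrow> q \<le> idx I \<Longrightarrow>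
        real (card {x \<in> box X. x - u \<in> I}) \<le> K * (real (card (box X)) / real q + 1)" by (rule K(2))
      show "\<And>I u B. zideal I \<Longrightarrow> finite (coset I ` Ord) \<Longrightarrow> u \<in> I \<Longrightarrow> u \<noteq> 0 \<Longrightarrow> bd B u \<Longrightarrow> int (idx I) \<le> (2 * (R * B) + 1) ^ d" 
        by (rule R(3))
      show "\<And>B x. bd B x \<Longrightarrow> \<bar>nrm x\<bar> \<le> C * B ^ d" by (rule C(2))
      show "\<And>p L u. prime p \<Longrightarrow> p \<le> N \<Longrightarrow> deg1 p L \<Longrightarrow> u \<in> Ord \<Longrightarrow> 
        real (card {x \<in> box X. x - u \<in> L}) \<le> (11/10) * real (card (box X)) / real p" by (rule up)
      show "\<And>p. prime p \<Longrightarrow> p \<le> z \<or> p dvd D \<Longrightarrow> p dvd q" by (rule q(2))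
    qed fact+
    have nz: "nrm (1 + of_int (int q) * x) \<noteq> 0" if "x \<in> box X" for x
    proof
      assume 0: "nrm (1 + of_int (int q) * x) = 0"
      have "[nrm (1 + of_int (int q) * x) = 1] (mod int q)" using that by (intro nrm_cong_one) (auto simp: box_def bd_def)
      then have "int q dvd 1" unfolding 0 by (metis cong_0_iff cong_sym)
      then show False using q(1) by simp
    qed
    have lower: "(49/50) * B * (real d * ln (real_of_int X) - e1) \<le> sm"
      unfolding sm_def B_def e1_def using q(1) by (intro norm_sum_lower[OF _ X50 nz]) auto
    have lnN: "ln (real N) \<ge> 0" using N by simp
    have "ln (real N powr \<beta>) \<le> ln (real_of_int X)" using X g1 N(3) by (intro ln_mono) auto
    then have "\<beta> * ln (real N) \<le> ln (real_of_int X)" using N by (simp add: ln_powr)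
    then have "real d * (\<beta> * ln (real N)) \<le> real d * ln (real_of_int X)" by (rule mult_left_mono) simp
    moreover have "real d * (\<beta> * ln (real N)) = (1 + \<epsilon>) * ln (real N)" using d_pos by (simp add: \<beta>_def)
    moreover have "1 * ln (real N) \<le> (1 + \<epsilon>) * ln (real N)" using eps lnN by (intro mult_right_mono) auto
    ultimately have lowX: "ln (real N) \<le> real d * ln (real_of_int X)" by linarith
    have "ln (real_of_int X) \<le> ln (2 * real N powr \<beta>)" using X g1 N(3) by (intro ln_mono) auto
    also have "\<dots> = ln 2 + \<beta> * ln (real N)" using N by (simp add: ln_mult ln_powr)
    finally have "real d * ln (real_of_int X) \<le> real d * (ln 2 + \<beta> * ln (real N))" by (intro mult_left_mono) auto
    also have "\<dots> = real d * ln 2 + (real d * \<beta>) * ln (real N)" by (simp only: distrib_left mult.assoc)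
    also have "real d * \<beta> = 1 + \<epsilon>" using d_pos by (simp add: \<beta>_def)
    finally have upX: "real d * ln (real_of_int X) \<le> real d * ln 2 + (1 + \<epsilon>) * ln (real N)" .
    have lnT: "ln (real T) = ln c1 + real d * ln (real_of_int X)"
      unfolding Tr using c1 X(1) by (simp add: ln_mult ln_realpow)
    then have lnT2: "ln (real T) \<le> e2 + (1 + \<epsilon>) * ln (real N)" using upX by (simp add: e2_def)
    have T1: "real T \<ge> 1"
    proof -
      have "1 * 1 \<le> c1 * real_of_int X ^ d" using c1 X(1) by (intro mult_mono one_le_power) auto
      then show ?thesis using Tr by simp
    qed
    have NT: "N \<le> T"
    proof -
      have "real N = real N powr 1" using N by simp
      also have "\<dots> \<le> real N powr (1 + \<epsilon>)" using N eps by (intro powr_mono) auto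
      also have "\<dots> = (real N powr \<beta>) ^ d" using d_pos N by (simp add: powr_power \<beta>_def)
      also have "\<dots> \<le> real_of_int X ^ d" using X by (intro power_mono) auto
      also have "\<dots> \<le> c1 * real_of_int X ^ d" using c1 X(1) by simp
      finally show ?thesis using Tr by simp
    qed
    \<comment> \<open>primes between \<open>N\<close> and the maximal norm\<close>
    have term2: "real d * K * (\<Sum>p | prime p \<and> N < p \<and> p \<le> T. ln (real p) * (B / real p + 1))
      \<le> B * (M * (2 * e2 + ln 4) + ln (real N) / 100)"
    proof -
      have "(\<Sum>p | prime p \<and> N < p \<and> p \<le> T. ln (real p) * (B / real p + 1)) \<le>
        (\<Sum>p | prime p \<and> N < p \<and> p \<le> T. (1 + c1) * B * (ln (real p) / real p))"
      proof (rule sum_mono)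
        fix p assume "p \<in> {p. prime p \<and> N < p \<and> p \<le> T}"
        then have p: "prime p" "p \<le> T" by auto
        have p1: "real p \<ge> 1" using prime_ge_1_nat[OF p(1)] by simp
        have "real p \<le> c1 * B"
          using p(2) Tr XB c1 mult_left_mono[OF XB, of c1] by linarith
        then have "1 \<le> c1 * B / real p" using p1 by (simp add: field_simps)
        then have "B / real p + 1 \<le> (1 + c1) * B / real p" by (simp add: add_divide_distrib distrib_right)
        then have "ln (real p) * (B / real p + 1) \<le> ln (real p) * ((1 + c1) * B / real p)"
          using p1 by (intro mult_left_mono) auto
        then show "ln (real p) * (B / real p + 1) \<le> (1 + c1) * B * (ln (real p) / real p)" by (simp add: mult_ac)
      qed
      also have "\<dots> = (1 + c1) * B * (\<Sum>p | prime p \<and> N < p \<and> p \<le> T. ln (real p) / real p)"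
        by (simp only: sum_distrib_left)
      also have "\<dots> \<le> (1 + c1) * B * (2 * ln (real T / real N) + ln 4)"
        using c1 Bpos by (intro mult_left_mono sum_ln_primes_between N(3) NT) auto
      also have "\<dots> \<le> (1 + c1) * B * (2 * (e2 + \<epsilon> * ln (real N)) + ln 4)"
      proof (intro mult_left_mono add_right_mono)
        have "ln (real T / real N) = ln (real T) - ln (real N)" using T1 N by (simp add: ln_div)
        then show "ln (real T / real N) \<le> e2 + \<epsilon> * ln (real N)" using lnT2 by (simp add: algebra_simps)
      qed (use c1 Bpos in auto)
      finally have "real d * K * (\<Sum>p | prime p \<and> N < p \<and> p \<le> T. ln (real p) * (B / real p + 1))
        \<le> real d * K * ((1 + c1) * B * (2 * (e2 + \<epsilon> * ln (real N)) + ln 4))"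
        using K(1) by (intro mult_left_mono) auto
      also have "\<dots> = B * (M * (2 * e2 + ln 4) + 2 * M * \<epsilon> * ln (real N))"
        by (simp add: M_def algebra_simps)
      also have "2 * M * \<epsilon> = 1 / 100" using M by (simp add: \<epsilon>_def)
      finally show ?thesis by simp
    qed
    have term3: "ln (real T) * (3 * real d ^ 2 * K * (B / real z + sqrt (real S))) \<le> B * (e2 / 200 + ln (real N) / 100 + e3)"
    proof -
      have l0: "ln (real T) \<ge> 0" using T1 by simp
      have "3 * real d ^ 2 * K / real z \<le> 1 / 200" using z by (simp add: field_simps)
      then have "ln (real T) * (3 * real d ^ 2 * K / real z) \<le> ln (real T) * (1 / 200)" using l0 by (rule mult_left_mono)
      also have "\<dots> \<le> (e2 + 2 * ln (real N)) * (1 / 200)"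
      proof (rule mult_right_mono)
        have "(1 + \<epsilon>) * ln (real N) \<le> 2 * ln (real N)" using eps lnN by (intro mult_right_mono) auto
        then show "ln (real T) \<le> e2 + 2 * ln (real N)" using lnT2 by linarith
      qed simp
      finally have a: "ln (real T) * (3 * real d ^ 2 * K / real z) \<le> e2 / 200 + ln (real N) / 100" by simp
      have "ln (real T) * sqrt (real S) \<le> (2 * sqrt (real T)) * sqrt (real S)"
        using ln_le_two_sqrt[OF T1] by (intro mult_right_mono) auto
      also have "\<dots> = 2 * sqrt (real T * real S)" by (simp add: real_sqrt_mult)
      also have "real T * real S \<le> (c1 * B) * (c2 * B)"
        using Tr Sr mult_left_mono[OF XB, of c1] mult_left_mono[OF XB c2] c1 c2 Bpos by (intro mult_mono) auto
      also have "(c1 * B) * (c2 * B) = (c1 * c2) * B ^ 2" by (simp add: power2_eq_square)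
      finally have b: "ln (real T) * sqrt (real S) \<le> 2 * (sqrt (c1 * c2) * B)"
        using Bpos by (simp add: real_sqrt_mult)
      have "ln (real T) * (3 * real d ^ 2 * K * (B / real z + sqrt (real S))) =
        B * (ln (real T) * (3 * real d ^ 2 * K / real z)) + 3 * real d ^ 2 * K * (ln (real T) * sqrt (real S))"
        by (simp add: algebra_simps)
      also have "\<dots> \<le> B * (e2 / 200 + ln (real N) / 100) + 3 * real d ^ 2 * K * (2 * (sqrt (c1 * c2) * B))"
        using a b Bpos K(1) by (intro add_mono mult_left_mono) auto
      also have "\<dots> = B * (e2 / 200 + ln (real N) / 100 + e3)" by (simp add: e3_def algebra_simps)
      finally show ?thesis .
    qed
    have "B * ((49/50) * (ln (real N) - e1)) \<le> (49/50) * B * (real d * ln (real_of_int X) - e1)"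
      using lowX Bpos by simp
    also have "\<dots> \<le> B * ((11/10) * prime_mass N + (M * (2 * e2 + ln 4) + ln (real N) / 100) + (e2 / 200 + ln (real N) / 100 + e3))"
      using lower upper term2 term3 by (simp add: distrib_left)
    finally have fin: "(49/50) * (ln (real N) - e1) \<le> (11/10) * prime_mass N + (M * (2 * e2 + ln 4) + ln (real N) / 100) + (e2 / 200 + ln (real N) / 100 + e3)"
      using Bpos by (simp only: mult_le_cancel_left_pos)
    have pos: "e1 \<ge> 0" "M * (2 * e2 + ln 4) \<ge> 0" "e2 / 200 \<ge> 0" "e3 \<ge> 0"
    proof -
      show "e1 \<ge> 0" unfolding e1_def using dge by (intro mult_nonneg_nonneg ln_ge_zero) auto
      have e2: "e2 \<ge> 0" unfolding e2_def using c1 by (intro add_nonneg_nonneg mult_nonneg_nonneg ln_ge_zero) auto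
      then show "e2 / 200 \<ge> 0" "M * (2 * e2 + ln 4) \<ge> 0" using M by auto
      show "e3 \<ge> 0" unfolding e3_def using K(1) c1 c2 by simp
    qed
    have arith: "m \<ge> (3/4) * l - (a + b + c + e)"
      if "(49/50) * (l - a) \<le> (11/10) * m + (b + l / 100) + (c + l / 100 + e)" "a \<ge> 0" "b \<ge> 0" "c \<ge> 0" "e \<ge> 0" "l \<ge> 0"
      for l a m b c e :: real
      using that by (simp add: field_simps)
    show ?thesis unfolding c_def using arith[OF fin pos lnN] .
  qed
  define N0 where "N0 = max 1 (max N1 N2)"
  have "prime_mass N \<ge> (3/4) * ln (real N) - max c (ln (real N0))" if N: "N \<ge> 1" for N
  proof (cases "N \<ge> N0")
    case True
    then have "prime_mass N \<ge> (3/4) * ln (real N) - c" by (intro main) (auto simp: N0_def)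
    moreover have "c \<le> max c (ln (real N0))" by simp
    ultimately show ?thesis by linarith
  next
    case False
    then have "ln (real N) \<le> ln (real N0)" using N by (intro ln_mono) auto
    moreover have "ln (real N) \<ge> 0" using N by simp
    moreover have "ln (real N0) \<le> max c (ln (real N0))" by simp
    ultimately show ?thesis using prime_mass_nonneg[of N] by linarith
  qed
  then show ?thesis by blast
qed

end

section \<open>Number fields and their extensions\<close>

text \<open>Independence makes multiplication by a nonzero element injective on integer vectors, so
  its matrix has nonzero determinant; the first column of the adjugate then gives the required
  cofactor, with \<open>n\<close> the determinant.\<close>

lemma number_orderI:
  assumes d: "0 < d" and w0: "w 0 = 1"
    and indep: "\<And>a :: nat \<Rightarrow> int. (\<Sum>i<d. of_int (a i) * w i) = 0 \<Longrightarrow> \<forall>i<d. a i = 0"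
    and mult: "\<And>i j. i < d \<Longrightarrow> j < d \<Longrightarrow> \<exists>c :: nat \<Rightarrow> int. w i * w j = (\<Sum>k<d. of_int (c k) * w k)"
  shows "number_order d w"
proof (unfold_locales, fact d, fact w0, fact indep, fact mult)
  fix a :: "nat \<Rightarrow> int"
  define x where "x = (\<Sum>i<d. of_int (a i) * w i)"
  assume "(\<Sum>i<d. of_int (a i) * w i) \<noteq> 0"
  then have x0: "x \<noteq> 0" by (simp add: x_def)
  have "\<exists>c :: nat \<Rightarrow> nat \<Rightarrow> nat \<Rightarrow> int. \<forall>i<d. \<forall>j<d. w i * w j = (\<Sum>k<d. of_int (c i j k) * w k)"
    using mult by metis
  then obtain c :: "nat \<Rightarrow> nat \<Rightarrow> nat \<Rightarrow> int" where c: "\<And>i j. i < d \<Longrightarrow> j < d \<Longrightarrow> w i * w j = (\<Sum>k<d. of_int (c i j k) * w k)"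
    by blast
  define g where "g k j = (\<Sum>i<d. a i * c i j k)" for k j
  have xw: "x * w j = (\<Sum>k<d. of_int (g k j) * w k)" if j: "j < d" for j
  proof -
    have "x * w j = (\<Sum>i<d. of_int (a i) * (w i * w j))" by (simp add: x_def sum_distrib_right mult.assoc)
    also have "\<dots> = (\<Sum>i<d. \<Sum>k<d. of_int (a i * c i j k) * w k)"
      by (intro sum.cong refl) (use c j in \<open>simp add: sum_distrib_left mult_ac\<close>)
    also have "\<dots> = (\<Sum>k<d. \<Sum>i<d. of_int (a i * c i j k) * w k)" by (rule sum.swap)
    finally show ?thesis by (simp add: g_def sum_distrib_right)
  qed
  define M where "M = mat d d (\<lambda>(k, j). g k j)"
  have M: "M \<in> carrier_mat d d" by (simp add: M_def)
  have xv: "x * (\<Sum>j<d. of_int (v j) * w j) = (\<Sum>k<d. of_int (\<Sum>j<d. g k j * v j) * w k)" for v :: "nat \<Rightarrow> int"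
  proof -
    have "x * (\<Sum>j<d. of_int (v j) * w j) = (\<Sum>j<d. of_int (v j) * (x * w j))" by (simp add: sum_distrib_left mult_ac)
    also have "\<dots> = (\<Sum>j<d. \<Sum>k<d. of_int (g k j * v j) * w k)"
      by (intro sum.cong refl) (simp add: xw sum_distrib_left mult_ac)
    also have "\<dots> = (\<Sum>k<d. \<Sum>j<d. of_int (g k j * v j) * w k)" by (rule sum.swap)
    finally show ?thesis by (simp add: sum_distrib_right)
  qed
  have "det M \<noteq> 0"
  proof
    assume "det M = 0"
    then obtain v where v: "v \<in> carrier_vec d" "v \<noteq> 0\<^sub>v d" "M *\<^sub>v v = 0\<^sub>v d"
      using det_0_iff_vec_prod_zero[OF M] by blast
    have "(\<Sum>j<d. g k j * v $ j) = 0" if k: "k < d" for k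
    proof -
      have "(M *\<^sub>v v) $ k = (\<Sum>j<d. g k j * v $ j)"
        using k v(1) by (simp add: M_def scalar_prod_def atLeast0LessThan)
      then show ?thesis using v(3) k by simp
    qed
    then have "x * (\<Sum>j<d. of_int (v $ j) * w j) = 0" by (subst xv) simp
    then have "\<forall>j<d. v $ j = 0" using x0 indep[of "\<lambda>j. v $ j"] by simp
    then have "v = 0\<^sub>v d" using v(1) by (intro eq_vecI) auto
    then show False using v(2) by simp
  qed
  moreover have "x * (\<Sum>j<d. of_int (adj_mat M $$ (j, 0)) * w j) = of_int (det M)"
  proof -
    have "(\<Sum>j<d. g k j * adj_mat M $$ (j, 0)) = (if k = 0 then det M else 0)" if k: "k < d" for k
    proof -
      have "(M * adj_mat M) $$ (k, 0) = (\<Sum>j<d. g k j * adj_mat M $$ (j, 0))"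
        using k d M adj_mat(1)[OF M] by (simp add: scalar_prod_def atLeast0LessThan M_def)
      then show ?thesis unfolding adj_mat(2)[OF M] using k d by (cases "k = 0") auto
    qed
    then have "x * (\<Sum>j<d. of_int (adj_mat M $$ (j, 0)) * w j) = (\<Sum>k<d. of_int (if k = 0 then det M else 0) * w k)"
      unfolding xv by (intro sum.cong refl) simp
    also have "\<dots> = (\<Sum>k<d. if k = 0 then of_int (det M) else 0)" by (intro sum.cong refl) (simp add: w0)
    also have "\<dots> = of_int (det M)" using d by (subst sum.delta) auto
    finally show ?thesis .
  qed
  ultimately show "\<exists>b n. n \<noteq> 0 \<and> (\<Sum>i<d. of_int (a i) * w i) * (\<Sum>i<d. of_int (b i) * w i) = of_int n"
    unfolding x_def by (intro exI conjI)
qed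

context number_order
begin

text \<open>Integer denominators give the whole fraction field, because each nonzero element divides
  its norm.\<close>

definition Frac :: "complex set" where
  "Frac = {x. \<exists>n :: int. n \<noteq> 0 \<and> of_int n * x \<in> Ord}"

lemma Ord_subset_Frac: "Ord \<subseteq> Frac"
  unfolding Frac_def by (auto intro: exI[of _ 1])

lemma Frac_add: "x \<in> Frac \<Longrightarrow> y \<in> Frac \<Longrightarrow> x + y \<in> Frac"
proof -
  assume "x \<in> Frac" "y \<in> Frac"
  then obtain m n :: int where mn: "m \<noteq> 0" "n \<noteq> 0" "of_int m * x \<in> Ord" "of_int n * y \<in> Ord" by (auto simp: Frac_def)
  have "of_int (m * n) * (x + y) = of_int n * (of_int m * x) + of_int m * (of_int n * y)" by (simp add: algebra_simps)
  also have "\<dots> \<in> Ord" using mn by auto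
  finally show ?thesis unfolding Frac_def using mn(1,2) by (intro CollectI exI[of _ "m * n"]) auto
qed

lemma Frac_mult: "x \<in> Frac \<Longrightarrow> y \<in> Frac \<Longrightarrow> x * y \<in> Frac"
proof -
  assume "x \<in> Frac" "y \<in> Frac"
  then obtain m n :: int where mn: "m \<noteq> 0" "n \<noteq> 0" "of_int m * x \<in> Ord" "of_int n * y \<in> Ord" by (auto simp: Frac_def)
  have "of_int (m * n) * (x * y) = (of_int m * x) * (of_int n * y)" by (simp add: algebra_simps)
  also have "\<dots> \<in> Ord" using mn by auto
  finally show ?thesis unfolding Frac_def using mn(1,2) by (intro CollectI exI[of _ "m * n"]) auto
qed

lemma Frac_of_int: "of_int n \<in> Frac" using Ord_subset_Frac by auto

lemma Frac_inverse: "x \<in> Frac \<Longrightarrow> inverse x \<in> Frac"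
proof (cases "x = 0")
  case False
  assume "x \<in> Frac"
  then obtain n :: int where n: "n \<noteq> 0" "of_int n * x \<in> Ord" by (auto simp: Frac_def)
  have nz: "of_int n * x \<noteq> 0" using n False by simp
  obtain y where y: "y \<in> Ord" "of_int n * x * y = of_int (nrm (of_int n * x))" using nrm_multiple[OF n(2)] by blast
  have "(of_int n * x * y) * inverse x = of_int n * y" using False by simp
  then have "of_int (nrm (of_int n * x)) * inverse x = of_int n * y" by (simp only: y(2))
  then show ?thesis unfolding Frac_def using nrm_nonzero[OF n(2) nz] y(1)
    by (intro CollectI exI[of _ "nrm (of_int n * x)"]) auto
qed (auto simp: Frac_def intro: exI[of _ 1])

lemma common_denominator:
  assumes "finite S" "S \<subseteq> Frac"
  shows "\<exists>n :: int. n > 0 \<and> (\<forall>x\<in>S. of_int n * x \<in> Ord)"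
  using assms
proof (induction S rule: finite_induct)
  case (insert x S)
  then obtain n :: int where n: "n > 0" "\<forall>x\<in>S. of_int n * x \<in> Ord" by blast
  from insert obtain m :: int where m: "m \<noteq> 0" "of_int m * x \<in> Ord" by (auto simp: Frac_def)
  have "of_int (\<bar>m\<bar> * n) * y \<in> Ord" if y: "y \<in> insert x S" for y
  proof (cases "y = x")
    case True
    have "of_int (\<bar>m\<bar> * n) * x = of_int (sgn m * n) * (of_int m * x)" by (simp add: abs_sgn mult_ac)
    moreover have "of_int (sgn m * n) * (of_int m * x) \<in> Ord" by (rule Ord_scale[OF m(2)])
    ultimately show ?thesis using True by (simp only:)
  next
    case False
    then have "of_int n * y \<in> Ord" using n y by blast
    then have "of_int \<bar>m\<bar> * (of_int n * y) \<in> Ord" by (rule Ord_scale)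
    then show ?thesis by (simp only: of_int_mult mult.assoc)
  qed
  moreover have "\<bar>m\<bar> * n > 0" using m n by simp
  ultimately show ?case by blast
qed (auto intro: exI[of _ 1])

text \<open>Growth: the combinations of \<open>e\<close> independent elements with coefficients in
  \<open>{0..T}\<close> are \<open>(T + 1) ^ e\<close> distinct elements of a box with
  \<open>O(T ^ d)\<close> elements.\<close>

lemma rank_le:
  assumes b: "\<And>j. j < e \<Longrightarrow> b j \<in> Ord"
    and ind: "\<And>a :: nat \<Rightarrow> int. (\<Sum>j<e. of_int (a j) * b j) = 0 \<Longrightarrow> \<forall>j<e. a j = 0"
  shows "e \<le> d"
proof (rule ccontr)
  assume "\<not> e \<le> d"
  then have ed: "d < e" by simp
  have "\<forall>j. \<exists>B. j < e \<longrightarrow> bd B (b j)" using ex_bd b by blast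
  then obtain B where B: "\<And>j. j < e \<Longrightarrow> bd (B j) (b j)" by metis
  define C where "C = (\<Sum>j<e. B j)"
  have C0: "C \<ge> 0" unfolding C_def using bd_nonneg[OF B] by (intro sum_nonneg) auto
  have key: "(T + 1) ^ e \<le> (2 * nat C * T + 1) ^ d" for T :: nat
  proof -
    let ?F = "{..<e} \<rightarrow>\<^sub>E {0..int T}"
    let ?f = "\<lambda>t. \<Sum>j<e. of_int (t j) * b j"
    have "inj_on ?f ?F"
    proof (rule inj_onI)
      fix s t assume st: "s \<in> ?F" "t \<in> ?F" "?f s = ?f t"
      then have "(\<Sum>j<e. of_int (s j - t j) * b j) = 0" by (simp add: algebra_simps sum_subtractf)
      then have "\<forall>j<e. s j = t j" using ind[of "\<lambda>j. s j - t j"] by simp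
      then show "s = t" using st by (intro PiE_ext[of s "{..<e}" _ t]) auto
    qed
    moreover have "?f ` ?F \<subseteq> box (C * int T)"
    proof
      fix x assume "x \<in> ?f ` ?F"
      then obtain t where t: "t \<in> ?F" "x = ?f t" by blast
      have "bd (\<Sum>j<e. B j * int T) x" unfolding t(2)
      proof (intro bd_sum finite_lessThan)
        fix j assume j: "j \<in> {..<e}"
        have "t j \<in> {0..int T}" using t j by blast
        then have "\<bar>t j\<bar> * B j \<le> B j * int T" using bd_nonneg[OF B[of j]] j by (simp add: mult.commute mult_left_mono)
        then show "bd (B j * int T) (of_int (t j) * b j)" using bd_mono[OF bd_scale[OF B]] j by blast
      qed
      then show "x \<in> box (C * int T)" by (simp add: box_def C_def sum_distrib_right)
    qed
    ultimately have "card ?F \<le> card (box (C * int T))" by (intro card_inj_on_le) auto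
    then have "int (card ?F) \<le> (2 * (C * int T) + 1) ^ d" using card_box[of "C * int T"] C0 by simp
    moreover have "card ?F = (T + 1) ^ e" by (simp add: card_funcsetE nat_add_distrib)
    moreover have "(2 * (C * int T) + 1) ^ d = int ((2 * nat C * T + 1) ^ d)" using C0 by (simp add: mult.assoc add.commute)
    ultimately have "int ((T + 1) ^ e) \<le> int ((2 * nat C * T + 1) ^ d)" by (simp only:)
    then show ?thesis by (simp only: of_nat_le_iff)
  qed
  \<comment> \<open>Chosen so that \<open>((2 C + 1) (T + 1)) ^ d = T (T + 1) ^ d\<close>, just
    below \<open>(T + 1) ^ (d + 1)\<close>.\<close>
  define T where "T = (2 * nat C + 1) ^ d"
  have "(T + 1) ^ d * (T + 1) ^ 1 \<le> (T + 1) ^ d * (T + 1) ^ (e - d)"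
    using ed by (intro mult_le_mono power_increasing) auto
  also have "\<dots> = (T + 1) ^ e" using ed by (simp flip: power_add)
  also have "\<dots> \<le> (2 * nat C * T + 1) ^ d" by (rule key)
  also have "\<dots> \<le> ((2 * nat C + 1) * (T + 1)) ^ d" by (intro power_mono) (auto simp: algebra_simps)
  also have "\<dots> = T * (T + 1) ^ d" by (simp only: T_def power_mult_distrib)
  finally show False by simp
qed

end

text \<open>Number fields are subfields of the complex numbers, so that roots, square roots and
  roots of unity can be adjoined as concrete numbers. The order is existentially quantified because
  each extension step produces a new one.\<close>

definition number_field :: "complex set \<Rightarrow> bool" where
  "number_field K \<longleftrightarrow> (\<exists>d w. number_order d w \<and> K = number_order.Frac d w)"

lemma number_fieldD:
  assumes "number_field K"
  shows "\<And>x y. x \<in> K \<Longrightarrow> y \<in> K \<Longrightarrow> x + y \<in> K" "\<And>x y. x \<in> K \<Longrightarrow> y \<in> K \<Longrightarrow> x * y \<in> K"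
    "\<And>n. of_int n \<in> K" "\<And>x. x \<in> K \<Longrightarrow> inverse x \<in> K" "\<And>x. x \<in> K \<Longrightarrow> - x \<in> K"
    "\<And>x y. x \<in> K \<Longrightarrow> y \<in> K \<Longrightarrow> x - y \<in> K" "\<And>x y. x \<in> K \<Longrightarrow> y \<in> K \<Longrightarrow> x / y \<in> K"
    "0 \<in> K" "1 \<in> K" "\<And>x n. x \<in> K \<Longrightarrow> x ^ n \<in> K" "\<And>q. of_rat q \<in> K"
proof -
  from assms obtain d w where dw: "number_order d w" "K = number_order.Frac d w" by (auto simp: number_field_def)
  interpret number_order d w by (fact dw(1))
  show add: "\<And>x y. x \<in> K \<Longrightarrow> y \<in> K \<Longrightarrow> x + y \<in> K" and mul: "\<And>x y. x \<in> K \<Longrightarrow> y \<in> K \<Longrightarrow> x * y \<in> K"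
    and int: "\<And>n. of_int n \<in> K" and inv: "\<And>x. x \<in> K \<Longrightarrow> inverse x \<in> K"
    unfolding dw(2) by (fact Frac_add Frac_mult Frac_of_int Frac_inverse)+
  show neg: "- x \<in> K" if "x \<in> K" for x using mul[OF int[of "-1"] that] by simp
  show "x - y \<in> K" if "x \<in> K" "y \<in> K" for x y using add[OF that(1) neg[OF that(2)]] by simp
  show div: "x / y \<in> K" if "x \<in> K" "y \<in> K" for x y using mul[OF that(1) inv[OF that(2)]] by (simp add: field_simps)
  show "0 \<in> K" "1 \<in> K" using int[of 0] int[of 1] by auto
  then show "x ^ n \<in> K" if "x \<in> K" for x n using that mul by (induction n) auto
  show "of_rat q \<in> K" for q
    by (cases q) (auto simp: of_rat_rat intro!: div int)
qed

lemma number_field_rat: "number_field (range (of_rat :: rat \<Rightarrow> complex))"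
proof -
  interpret number_order 1 "\<lambda>_. 1"
    by (rule number_orderI) (auto intro: exI[of _ "\<lambda>_. 1"])
  have "Frac = range (of_rat :: rat \<Rightarrow> complex)"
  proof (rule equalityI; rule subsetI)
    fix x assume "x \<in> Frac"
    then obtain n m :: int where "n \<noteq> 0" "of_int n * x = of_int m"
      unfolding Frac_def Ord_def comb_def by auto
    then have "x = of_rat (Rat.Fract m n)" by (simp add: of_rat_rat field_simps)
    then show "x \<in> range (of_rat :: rat \<Rightarrow> complex)" by simp
  next
    fix x assume "x \<in> range (of_rat :: rat \<Rightarrow> complex)"
    then obtain q where q: "x = (of_rat q :: complex)" by blast
    obtain m n where mn: "q = Rat.Fract m n" "n > 0" by (cases q) auto
    then have "of_int n * x = of_int m" by (simp add: q of_rat_rat)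
    then have "of_int n * x \<in> Ord" by (metis of_int_in_Ord)
    moreover have "n \<noteq> 0" using mn(2) by simp
    ultimately show "x \<in> Frac" unfolding Frac_def by blast
  qed
  then show ?thesis
    unfolding number_field_def by - (rule exI, rule exI, rule conjI, rule number_order_axioms, rule sym)
qed

context number_order
begin

definition pow_span :: "complex \<Rightarrow> nat \<Rightarrow> complex set" where
  "pow_span \<alpha> m = {\<Sum>j<m. b j * \<alpha> ^ j | b. \<forall>j<m. b j \<in> Ord}"

lemma pow_spanI: "(\<And>j. j < m \<Longrightarrow> b j \<in> Ord) \<Longrightarrow> x = (\<Sum>j<m. b j * \<alpha> ^ j) \<Longrightarrow> x \<in> pow_span \<alpha> m"
  unfolding pow_span_def by blast

lemma pow_span_mult_Ord: "r \<in> Ord \<Longrightarrow> x \<in> pow_span \<alpha> m \<Longrightarrow> r * x \<in> pow_span \<alpha> m"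
proof -
  assume r: "r \<in> Ord" and "x \<in> pow_span \<alpha> m"
  then obtain b where "x = (\<Sum>j<m. b j * \<alpha> ^ j)" "\<forall>j<m. b j \<in> Ord" unfolding pow_span_def by blast
  then show ?thesis using r by (intro pow_spanI[of m "\<lambda>j. r * b j"]) (auto simp: sum_distrib_left mult.assoc)
qed

lemma pow_span_power:
  assumes m: "m > 0" and k: "\<And>j. j < m \<Longrightarrow> k j \<in> Ord" and \<alpha>: "\<alpha> ^ m = (\<Sum>j<m. k j * \<alpha> ^ j)"
  shows "\<alpha> ^ n \<in> pow_span \<alpha> m"
proof (induction n)
  case 0
  have "(\<Sum>j<m. (if j = 0 then 1 else 0) * \<alpha> ^ j) = 1"
    using m by (cases m) (auto simp: sum.lessThan_Suc_shift simp del: sum.lessThan_Suc)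
  then show ?case by (intro pow_spanI[of m "\<lambda>j. if j = 0 then 1 else 0"]) auto
next
  case (Suc n)
  then obtain b where b: "\<alpha> ^ n = (\<Sum>j<m. b j * \<alpha> ^ j)" "\<forall>j<m. b j \<in> Ord" unfolding pow_span_def by blast
  obtain m' where m': "m = Suc m'" using m by (cases m) auto
  have "\<alpha> ^ Suc n = (\<Sum>j<Suc m'. b j * \<alpha> ^ Suc j)"
    by (simp add: b(1) m' sum_distrib_left distrib_left mult_ac)
  also have "\<dots> = (\<Sum>j<m'. b j * \<alpha> ^ Suc j) + b m' * (\<Sum>j<m. k j * \<alpha> ^ j)"
    using \<alpha> by (simp add: m')
  also have "(\<Sum>j<m'. b j * \<alpha> ^ Suc j) = (\<Sum>j<m. (if j = 0 then 0 else b (j - 1)) * \<alpha> ^ j)"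
    unfolding m' by (subst sum.lessThan_Suc_shift) simp
  finally have "\<alpha> ^ Suc n = (\<Sum>j<m. ((if j = 0 then 0 else b (j - 1)) + b m' * k j) * \<alpha> ^ j)"
    by (simp add: sum_distrib_left sum.distrib distrib_right mult.assoc)
  moreover have "(if j = 0 then 0 else b (j - 1)) + b m' * k j \<in> Ord" if "j < m" for j
    using that b(2) k m' by (intro Ord_add Ord_mult) auto
  ultimately show ?case by (intro pow_spanI[of m "\<lambda>j. (if j = 0 then 0 else b (j - 1)) + b m' * k j"]) auto
qed

text \<open>The basis of the extension consists of the products \<open>w i * \<alpha> ^ j\<close>,
  numbered \<open>i + j * d\<close>. The monic relation reduces all powers of
  \<open>\<alpha>\<close> to the first \<open>m\<close>, and independence over \<open>Ord\<close>
  gives independence over the integers.\<close>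

lemma order_adjoin:
  assumes m: "m > 0" and k: "\<And>j. j < m \<Longrightarrow> k j \<in> Ord" and \<alpha>: "\<alpha> ^ m = (\<Sum>j<m. k j * \<alpha> ^ j)"
    and ind: "\<And>b. (\<And>j. j < m \<Longrightarrow> b j \<in> Ord) \<Longrightarrow> (\<Sum>j<m. b j * \<alpha> ^ j) = 0 \<Longrightarrow> \<forall>j<m. b j = 0"
  shows "\<exists>W. number_order (m * d) W \<and> number_order.Ord (m * d) W = pow_span \<alpha> m"
proof -
  define W where "W i = w (i mod d) * \<alpha> ^ (i div d)" for i
  have expand: "(\<Sum>i<m * d. of_int (a i) * W i) = (\<Sum>j<m. comb (\<lambda>i. a (i + j * d)) * \<alpha> ^ j)" for a :: "nat \<Rightarrow> int"
  proof -
    have "(\<Sum>i<m * d. of_int (a i) * W i) = (\<Sum>j<m. \<Sum>i\<in>{j * d..<j * d + d}. of_int (a i) * W i)"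
      by (rule sum.nat_group[symmetric])
    also have "\<dots> = (\<Sum>j<m. comb (\<lambda>i. a (i + j * d)) * \<alpha> ^ j)"
    proof (rule sum.cong[OF refl])
      fix j
      have "(\<Sum>i\<in>{j * d..<j * d + d}. of_int (a i) * W i) = (\<Sum>i\<in>{0 + j * d..<d + j * d}. of_int (a i) * W i)"
        by (simp add: add.commute)
      also have "\<dots> = (\<Sum>i\<in>{0..<d}. of_int (a (i + j * d)) * W (i + j * d))" by (rule sum.shift_bounds_nat_ivl)
      also have "\<dots> = (\<Sum>i\<in>{0..<d}. (of_int (a (i + j * d)) * w i) * \<alpha> ^ j)"
        using d_pos by (intro sum.cong refl) (simp add: W_def mult.assoc)
      finally show "(\<Sum>i\<in>{j * d..<j * d + d}. of_int (a i) * W i) = comb (\<lambda>i. a (i + j * d)) * \<alpha> ^ j"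
        by (simp add: comb_def sum_distrib_right atLeast0LessThan)
    qed
    finally show ?thesis .
  qed
  have idx: "i + j * d < m * d" if "i < d" "j < m" for i j
  proof -
    have "i + j * d < Suc j * d" using that by simp
    also have "\<dots> \<le> m * d" using that by (intro mult_le_mono1) simp
    finally show ?thesis .
  qed
  have rep: "\<exists>a :: nat \<Rightarrow> int. x = (\<Sum>i<m * d. of_int (a i) * W i)" if "x \<in> pow_span \<alpha> m" for x
  proof -
    obtain b where b: "x = (\<Sum>j<m. b j * \<alpha> ^ j)" "\<forall>j<m. b j \<in> Ord" using \<open>x \<in> _\<close> unfolding pow_span_def by blast
    have "comb (\<lambda>i. cf (b ((i + j * d) div d)) ((i + j * d) mod d)) = b j" if j: "j < m" for j
    proof -
      have "comb (\<lambda>i. cf (b ((i + j * d) div d)) ((i + j * d) mod d)) = comb (cf (b j))"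
        unfolding comb_def using d_pos by (intro sum.cong refl) simp
      then show ?thesis using b(2) j comb_cf by simp
    qed
    then have "(\<Sum>i<m * d. of_int (cf (b (i div d)) (i mod d)) * W i) = x"
      unfolding expand b(1) by (intro sum.cong) auto
    then show ?thesis by metis
  qed
  have W: "number_order (m * d) W"
  proof (rule number_orderI)
    show "0 < m * d" using m d_pos by simp
    show "W 0 = 1" using w0 by (simp add: W_def)
    show "\<forall>i<m * d. a i = 0" if 0: "(\<Sum>i<m * d. of_int (a i) * W i) = 0" for a :: "nat \<Rightarrow> int"
    proof (intro allI impI)
      fix i assume i: "i < m * d"
      have "\<forall>j<m. comb (\<lambda>i. a (i + j * d)) = 0"
        using 0 unfolding expand by (intro ind) auto
      moreover have "i div d < m" using i by (simp add: less_mult_imp_div_less)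
      ultimately have "comb (\<lambda>l. a (l + (i div d) * d)) = 0" by blast
      then have "\<forall>l<d. a (l + (i div d) * d) = 0" unfolding comb_def by (rule indep)
      moreover have "i mod d < d" using d_pos by simp
      ultimately have "a (i mod d + (i div d) * d) = 0" by blast
      then show "a i = 0" by (simp add: mod_div_mult_eq)
    qed
    show "\<exists>c :: nat \<Rightarrow> int. W i * W j = (\<Sum>l<m * d. of_int (c l) * W l)" if "i < m * d" "j < m * d" for i j
    proof (rule rep)
      have "W i * W j = (w (i mod d) * w (j mod d)) * \<alpha> ^ (i div d + j div d)"
        by (simp add: W_def power_add mult_ac)
      moreover have "w (i mod d) * w (j mod d) \<in> Ord" using d_pos by (intro w_mult_in_Ord) auto
      ultimately show "W i * W j \<in> pow_span \<alpha> m"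
        using pow_span_mult_Ord pow_span_power[OF m k \<alpha>] by metis
    qed
  qed
  interpret W: number_order "m * d" W by (fact W)
  have "W.Ord = pow_span \<alpha> m"
  proof (rule equalityI; rule subsetI)
    fix x assume "x \<in> W.Ord"
    then obtain a where "x = (\<Sum>i<m * d. of_int (a i) * W i)" by (auto simp: W.Ord_def W.comb_def)
    then show "x \<in> pow_span \<alpha> m" unfolding expand by (intro pow_spanI[of m "\<lambda>j. comb (\<lambda>i. a (i + j * d))"]) auto
  next
    fix x assume "x \<in> pow_span \<alpha> m"
    then show "x \<in> W.Ord" using rep[of x] by (auto simp: W.Ord_def W.comb_def)
  qed
  then show ?thesis using W by blast
qed

lemma order_sqrt:
  assumes s: "s ^ 2 \<in> Ord" "s \<notin> Frac"
  shows "\<exists>W. number_order (2 * d) W \<and> number_order.Ord (2 * d) W = {a + b * s | a b. a \<in> Ord \<and> b \<in> Ord}"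
proof -
  have "\<exists>W. number_order (2 * d) W \<and> number_order.Ord (2 * d) W = pow_span s 2"
  proof (rule order_adjoin[where k = "\<lambda>j. if j = 0 then s ^ 2 else 0"])
    fix b assume b: "\<And>j. j < 2 \<Longrightarrow> b j \<in> Ord" and 0: "(\<Sum>j<2. b j * s ^ j) = 0"
    have e: "b 0 + b 1 * s = 0" using 0 by (simp add: numeral_2_eq_2)
    have "b 1 = 0"
    proof (rule ccontr)
      assume b1: "b 1 \<noteq> 0"
      have "s = (- b 0) * inverse (b 1)" using e b1 by (simp add: field_simps add_eq_0_iff)
      moreover have "b 1 \<in> Ord" "- b 0 \<in> Ord" using b by auto
      ultimately have "s \<in> Frac" using Ord_subset_Frac Frac_mult Frac_inverse by blast
      then show False using s(2) by blast
    qed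
    moreover from this e have "b 0 = 0" by simp
    ultimately show "\<forall>j<2. b j = 0" by (auto simp: less_2_cases_iff)
  qed (use s in \<open>auto simp: numeral_2_eq_2\<close>)
  moreover have "pow_span s 2 = {a + b * s | a b. a \<in> Ord \<and> b \<in> Ord}"
  proof (rule equalityI; rule subsetI)
    fix x assume "x \<in> pow_span s 2"
    then obtain b where b: "x = (\<Sum>j<2. b j * s ^ j)" "\<forall>j<2. b j \<in> Ord" unfolding pow_span_def by blast
    then have "x = b 0 + b 1 * s" "b 0 \<in> Ord" "b 1 \<in> Ord" by (auto simp: numeral_2_eq_2)
    then show "x \<in> {a + b * s | a b. a \<in> Ord \<and> b \<in> Ord}" by blast
  next
    fix x assume "x \<in> {a + b * s | a b. a \<in> Ord \<and> b \<in> Ord}"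
    then obtain a b where "x = a + b * s" "a \<in> Ord" "b \<in> Ord" by blast
    then show "x \<in> pow_span s 2" by (intro pow_spanI[of 2 "\<lambda>j. if j = 0 then a else b"]) (auto simp: numeral_2_eq_2)
  qed
  ultimately show ?thesis by simp
qed

lemma Frac_eq_if_Ord_eq:
  assumes "number_order e W" and O: "number_order.Ord e W = {a + b * s | a b. a \<in> Ord \<and> b \<in> Ord}"
  shows "number_order.Frac e W = {a + b * s | a b. a \<in> Frac \<and> b \<in> Frac}"
proof -
  interpret W: number_order e W by fact
  show ?thesis
  proof (rule equalityI; rule subsetI)
    fix x assume "x \<in> W.Frac"
    then obtain n :: int where n: "n \<noteq> 0" "of_int n * x \<in> W.Ord" by (auto simp: W.Frac_def)
    then obtain a b where ab: "of_int n * x = a + b * s" "a \<in> Ord" "b \<in> Ord" unfolding O by blast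
    have "x = inverse (of_int n) * a + (inverse (of_int n) * b) * s"
      using ab(1) n(1) by (simp add: field_simps)
    moreover have "inverse (of_int n) * a \<in> Frac" "inverse (of_int n) * b \<in> Frac"
      using ab Ord_subset_Frac by (auto intro!: Frac_mult Frac_inverse Frac_of_int)
    ultimately show "x \<in> {a + b * s | a b. a \<in> Frac \<and> b \<in> Frac}" by blast
  next
    fix x assume "x \<in> {a + b * s | a b. a \<in> Frac \<and> b \<in> Frac}"
    then obtain a b where ab: "x = a + b * s" "a \<in> Frac" "b \<in> Frac" by blast
    obtain n :: int where n: "n > 0" "\<forall>x\<in>{a, b}. of_int n * x \<in> Ord"
      using common_denominator[of "{a, b}"] ab by auto
    have "of_int n * x = of_int n * a + (of_int n * b) * s" by (simp add: ab algebra_simps)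
    then have "of_int n * x \<in> W.Ord" unfolding O using n(2) by blast
    then show "x \<in> W.Frac" unfolding W.Frac_def using n(1) by (intro CollectI exI[of _ n]) auto
  qed
qed

lemma Frac_sqrt:
  assumes s: "s ^ 2 \<in> Frac" "s \<notin> Frac"
  shows "\<exists>W. number_order (2 * d) W \<and> number_order.Frac (2 * d) W = {a + b * s | a b. a \<in> Frac \<and> b \<in> Frac}"
proof -
  obtain n :: int where n: "n > 0" "of_int n * s ^ 2 \<in> Ord"
    using common_denominator[of "{s ^ 2}"] s(1) by auto
  have "of_int n * (of_int n * s ^ 2) \<in> Ord" using n(2) by (rule Ord_scale)
  then have s1: "(of_int n * s) ^ 2 \<in> Ord" by (simp add: power2_eq_square mult_ac)
  have n0: "of_int n \<noteq> (0 :: complex)" using n(1) by simp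
  have s2: "of_int n * s \<notin> Frac"
  proof
    assume "of_int n * s \<in> Frac"
    from Frac_mult[OF Frac_inverse[OF Frac_of_int] this] have "inverse (of_int n) * (of_int n * s) \<in> Frac" .
    then show False using s(2) n0 by (simp flip: mult.assoc)
  qed
  obtain W where W: "number_order (2 * d) W" "number_order.Ord (2 * d) W = {a + b * (of_int n * s) | a b. a \<in> Ord \<and> b \<in> Ord}"
    using order_sqrt[OF s1 s2] by blast
  have "number_order.Frac (2 * d) W = {a + b * (of_int n * s) | a b. a \<in> Frac \<and> b \<in> Frac}"
    by (rule Frac_eq_if_Ord_eq[OF W])
  also have "\<dots> = {a + b * s | a b. a \<in> Frac \<and> b \<in> Frac}"
  proof (rule equalityI; rule subsetI)
    fix x assume "x \<in> {a + b * (of_int n * s) | a b. a \<in> Frac \<and> b \<in> Frac}"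
    then obtain a b where "x = a + (b * of_int n) * s" "a \<in> Frac" "b \<in> Frac" by (auto simp: mult.assoc)
    moreover from this have "b * of_int n \<in> Frac" using Frac_mult[OF _ Frac_of_int] by blast
    ultimately show "x \<in> {a + b * s | a b. a \<in> Frac \<and> b \<in> Frac}" by blast
  next
    fix x assume "x \<in> {a + b * s | a b. a \<in> Frac \<and> b \<in> Frac}"
    then obtain a b where ab: "x = a + b * s" "a \<in> Frac" "b \<in> Frac" by blast
    then have "x = a + (b * inverse (of_int n)) * (of_int n * s)" using n0 by simp
    moreover have "b * inverse (of_int n) \<in> Frac" by (rule Frac_mult[OF ab(3) Frac_inverse[OF Frac_of_int]])
    ultimately show "x \<in> {a + b * (of_int n * s) | a b. a \<in> Frac \<and> b \<in> Frac}"
      using ab(2) by blast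
  qed
  finally have "number_order.Frac (2 * d) W = {a + b * s | a b. a \<in> Frac \<and> b \<in> Frac}" .
  with W(1) show ?thesis by (intro exI conjI)
qed

end

lemma number_field_sqrt:
  assumes K: "number_field K" and s: "s ^ 2 \<in> K" "s \<notin> K"
  shows "number_field {a + b * s | a b. a \<in> K \<and> b \<in> K}"
proof -
  from K obtain d w where dw: "number_order d w" "K = number_order.Frac d w" by (auto simp: number_field_def)
  obtain W where W: "number_order (2 * d) W" "number_order.Frac (2 * d) W = {a + b * s | a b. a \<in> K \<and> b \<in> K}"
    using number_order.Frac_sqrt[OF dw(1), of s] s unfolding dw(2) by blast
  show ?thesis
    unfolding number_field_def by (rule exI, rule exI, rule conjI, rule W(1), rule W(2)[symmetric])
qed

text \<open>A monic relation of least degree \<open>m\<close> is used. Multiplying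
  \<open>\<alpha>\<close> by a common denominator \<open>n\<close> makes it integral, the factor
  \<open>n ^ (m - j)\<close> being absorbed into coefficient \<open>j\<close>; minimality makes the
  powers below \<open>m\<close> independent, as \<open>order_adjoin\<close> requires.\<close>

lemma number_field_adjoin:
  assumes K: "number_field K" and M: "M > 0" "\<And>j. j < M \<Longrightarrow> k j \<in> K" "\<alpha> ^ M = (\<Sum>j<M. k j * \<alpha> ^ j)"
  shows "\<exists>K'. number_field K' \<and> K \<subseteq> K' \<and> \<alpha> \<in> K'"
proof -
  from K obtain d w where dw: "number_order d w" "K = number_order.Frac d w" by (auto simp: number_field_def)
  interpret number_order d w by (fact dw(1))
  note Kf = number_fieldD[OF K]
  define P where "P m \<longleftrightarrow> m > 0 \<and> (\<exists>k. (\<forall>j<m. k j \<in> K) \<and> \<alpha> ^ m = (\<Sum>j<m. k j * \<alpha> ^ j))" for m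
  have "P M" unfolding P_def using M by blast
  define m where "m = (LEAST m. P m)"
  have Pm: "P m" and min: "\<And>n. n < m \<Longrightarrow> \<not> P n" unfolding m_def using LeastI[of P, OF \<open>P M\<close>] not_less_Least by blast+
  from Pm obtain k where m: "m > 0" and k: "\<And>j. j < m \<Longrightarrow> k j \<in> K" "\<alpha> ^ m = (\<Sum>j<m. k j * \<alpha> ^ j)"
    unfolding P_def by blast
  obtain n :: int where n: "n > 0" "\<forall>x\<in>k ` {..<m}. of_int n * x \<in> Ord"
    using common_denominator[of "k ` {..<m}"] k(1) dw(2) by auto
  have n0: "of_int n \<noteq> (0 :: complex)" using n(1) by simp
  define \<beta> where "\<beta> = of_int n * \<alpha>"
  define l where "l j = of_int (n ^ (m - j - 1)) * (of_int n * k j)" for j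
  have lO: "l j \<in> Ord" if "j < m" for j
  proof -
    have "of_int n * k j \<in> Ord" using n(2) that by blast
    then show ?thesis unfolding l_def by (rule Ord_scale)
  qed
  have "\<beta> ^ m = (\<Sum>j<m. of_int n ^ m * (k j * \<alpha> ^ j))"
    by (simp add: \<beta>_def power_mult_distrib k(2) sum_distrib_left)
  also have "\<dots> = (\<Sum>j<m. l j * \<beta> ^ j)"
  proof (rule sum.cong[OF refl])
    fix j assume "j \<in> {..<m}"
    then have "(of_int n :: complex) ^ m = of_int n ^ ((m - j - 1) + 1 + j)" by simp
    also have "\<dots> = of_int n ^ (m - j - 1) * of_int n * of_int n ^ j" by (simp only: power_add power_one_right)
    finally have "of_int n ^ m = (of_int n ^ (m - j - 1) * of_int n * of_int n ^ j :: complex)" .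
    then show "of_int n ^ m * (k j * \<alpha> ^ j) = l j * \<beta> ^ j" by (simp add: l_def \<beta>_def power_mult_distrib mult_ac)
  qed
  finally have rel: "\<beta> ^ m = (\<Sum>j<m. l j * \<beta> ^ j)" .
  have ind: "\<forall>j<m. b j = 0" if b: "\<And>j. j < m \<Longrightarrow> b j \<in> Ord" and 0: "(\<Sum>j<m. b j * \<beta> ^ j) = 0" for b
  proof (rule ccontr)
    assume "\<not> ?thesis"
    then have ne: "{j. j < m \<and> b j \<noteq> 0} \<noteq> {}" by blast
    \<comment> \<open>The largest index with a nonzero coefficient; dividing by that coefficient
      gives a monic relation of degree \<open>i < m\<close>.\<close>
    define i where "i = Max {j. j < m \<and> b j \<noteq> 0}"
    have fin: "finite {j. j < m \<and> b j \<noteq> 0}" by simp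
    have i: "i < m" "b i \<noteq> 0" using Max_in[OF fin ne] by (auto simp: i_def)
    have top: "b j = 0" if j: "j < m" "i < j" for j
    proof (rule ccontr)
      assume "b j \<noteq> 0"
      then have "j \<le> i" unfolding i_def using j by (intro Max_ge[OF fin]) simp
      then show False using j by simp
    qed
    have "(\<Sum>j<m. b j * \<beta> ^ j) = (\<Sum>j<Suc i. b j * \<beta> ^ j)"
      using i(1) top by (intro sum.mono_neutral_right) auto
    then have e: "b i * \<beta> ^ i = - (\<Sum>j<i. b j * \<beta> ^ j)" using 0 by (simp add: add_eq_0_iff2)
    have bi: "of_int n ^ i * b i \<noteq> 0" using n0 i(2) by simp
    have "(of_int n ^ i * b i) * \<alpha> ^ i = (\<Sum>j<i. (- b j * of_int n ^ j) * \<alpha> ^ j)"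
      using e by (simp add: \<beta>_def power_mult_distrib sum_negf mult_ac)
    then have "\<alpha> ^ i = inverse (of_int n ^ i * b i) * (\<Sum>j<i. (- b j * of_int n ^ j) * \<alpha> ^ j)"
      using bi by (simp add: field_simps)
    then have eq: "\<alpha> ^ i = (\<Sum>j<i. (inverse (of_int n ^ i * b i) * (- b j * of_int n ^ j)) * \<alpha> ^ j)"
      by (simp add: sum_distrib_left mult.assoc)
    have mem: "inverse (of_int n ^ i * b i) * (- b j * of_int n ^ j) \<in> K" if "j < i" for j
      using b[of j] b[of i] that i(1) Ord_subset_Frac unfolding dw(2)[symmetric]
      by (intro Kf(2,4,5,10) Kf(3)) auto
    have pos: "i > 0"
    proof (rule ccontr)
      assume "\<not> i > 0"
      then show False using e i(2) by simp
    qed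
    have "P i" unfolding P_def
      by (intro conjI pos exI[of _ "\<lambda>j. inverse (of_int n ^ i * b i) * (- b j * of_int n ^ j)"] allI impI mem eq)
    then show False using min i(1) by blast
  qed
  obtain W where W: "number_order (m * d) W" "number_order.Ord (m * d) W = pow_span \<beta> m"
    using order_adjoin[OF m lO rel ind] by blast
  interpret W: number_order "m * d" W by (fact W(1))
  have OW: "Ord \<subseteq> W.Ord"
  proof
    fix x assume "x \<in> Ord"
    moreover have "(\<Sum>j<m. (if j = 0 then x else 0) * \<beta> ^ j) = x"
      using m by (cases m) (auto simp: sum.lessThan_Suc_shift simp del: sum.lessThan_Suc)
    ultimately show "x \<in> W.Ord" unfolding W(2)
      by (intro pow_spanI[of m "\<lambda>j. if j = 0 then x else 0"]) auto
  qed
  have "Frac \<subseteq> W.Frac" unfolding Frac_def W.Frac_def using OW by blast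
  moreover have "\<beta> ^ 1 \<in> W.Ord" unfolding W(2) by (rule pow_span_power[OF m lO rel])
  then have "\<alpha> \<in> W.Frac" unfolding W.Frac_def \<beta>_def using n(1) by (intro CollectI exI[of _ n]) auto
  moreover have "number_field W.Frac" unfolding number_field_def by (rule exI, rule exI, rule conjI, rule W(1), rule refl)
  ultimately show ?thesis unfolding dw(2) by blast
qed

lemma number_field_roots:
  fixes P :: "rat poly"
  assumes K: "number_field K" and P: "P \<noteq> 0"
  shows "\<exists>K'. number_field K' \<and> K \<subseteq> K' \<and> {x. poly (map_poly of_rat P) x = (0::complex)} \<subseteq> K'"
proof -
  define Q where "Q = map_poly (of_rat :: rat \<Rightarrow> complex) P"
  have cQ: "coeff Q i = of_rat (coeff P i)" for i by (simp add: Q_def coeff_map_poly)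
  have Q0: "Q \<noteq> 0" using P by (metis cQ coeff_0 of_rat_eq_0_iff poly_eqI)
  have dQ: "degree Q = degree P" using P by (simp add: Q_def degree_map_poly)
  have one: "\<exists>K'. number_field K' \<and> K \<subseteq> K' \<and> x \<in> K'" if K: "number_field K" and x: "poly Q x = 0" for K x
  proof -
    let ?n = "degree Q"
    have lc: "lead_coeff Q \<noteq> 0" using Q0 by simp
    have n: "?n > 0"
    proof (rule ccontr)
      assume "\<not> ?n > 0"
      then obtain c where "Q = [:c:]" by (metis degree_eq_zeroE neq0_conv)
      then show False using x Q0 by simp
    qed
    have "(\<Sum>j\<le>?n. coeff Q j * x ^ j) = 0" using x by (simp add: poly_altdef)
    then have "(\<Sum>j<?n. coeff Q j * x ^ j) + lead_coeff Q * x ^ ?n = 0" by (simp add: lessThan_Suc_atMost[symmetric])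
    then have "x ^ ?n = (- inverse (lead_coeff Q)) * (\<Sum>j<?n. coeff Q j * x ^ j)"
      using lc by (simp add: field_simps add_eq_0_iff)
    then have "x ^ ?n = (\<Sum>j<?n. (- inverse (lead_coeff Q) * coeff Q j) * x ^ j)"
      by (simp add: sum_distrib_left mult.assoc sum_negf)
    moreover have "- inverse (lead_coeff Q) * coeff Q j \<in> K" for j
      unfolding cQ using number_fieldD[OF K] by auto
    ultimately show ?thesis using number_field_adjoin[OF K n, of "\<lambda>j. - inverse (lead_coeff Q) * coeff Q j"] by blast
  qed
  have fin: "finite {x. poly Q x = 0}" by (rule poly_roots_finite[OF Q0])
  have all: "\<exists>K'. number_field K' \<and> K \<subseteq> K' \<and> S \<subseteq> K'" if "finite S" "S \<subseteq> {x. poly Q x = 0}" for S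
    using that
  proof (induction S rule: finite_induct)
    case empty
    show ?case by (rule exI[of _ K]) (use K in simp)
  next
    case (insert x S)
    then obtain K' where K': "number_field K'" "K \<subseteq> K'" "S \<subseteq> K'" by auto
    have "poly Q x = 0" using insert by auto
    from one[OF K'(1) this] obtain K'' where "number_field K''" "K' \<subseteq> K''" "x \<in> K''" by (elim exE conjE)
    then show ?case using K' by (intro exI[of _ K''] conjI) auto
  qed
  from all[OF fin order_refl] show ?thesis unfolding Q_def .
qed

section \<open>Residue homomorphisms and primes with a prescribed non-residue\<close>

text \<open>A ring homomorphism from \<open>R\<close> to the prime field, its values represented by
  integers, so that the laws hold modulo \<open>p\<close>. \<open>R\<close> contains the inverses of
  integers prime to \<open>p\<close>, hence all \<open>p\<close>-integral rationals. The later parts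
  see primes of degree one only in this form.\<close>

definition residue_hom :: "nat \<Rightarrow> complex set \<Rightarrow> (complex \<Rightarrow> int) \<Rightarrow> bool" where
  "residue_hom p R \<psi> \<longleftrightarrow> prime p \<and> (\<forall>n. of_int n \<in> R \<and> [\<psi> (of_int n) = n] (mod int p)) \<and>
     (\<forall>x\<in>R. \<forall>y\<in>R. x + y \<in> R \<and> x * y \<in> R \<and> [\<psi> (x + y) = \<psi> x + \<psi> y] (mod int p) \<and>
        [\<psi> (x * y) = \<psi> x * \<psi> y] (mod int p)) \<and>
     (\<forall>n. \<not> int p dvd n \<longrightarrow> inverse (of_int n) \<in> R)"

context number_order
begin

text \<open>Inverting the integers prime to \<open>p\<close> in \<open>Ord\<close> does not change
  the residue field of \<open>L\<close>.\<close>

lemma ex_residue_hom: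
  assumes p: "prime p" and L: "deg1 p L"
  shows "\<exists>\<psi>. residue_hom p {x. \<exists>n. \<not> int p dvd n \<and> of_int n * x \<in> Ord} \<psi> \<and> (\<forall>x\<in>Ord. x - of_int (\<psi> x) \<in> L)"
proof -
  have aL: "above p L" and z: "zideal L" using L by (auto simp: deg1_def above_def)
  note iL = int_in_above[OF p aL]
  have pp: "prime (int p)" using p by simp
  define R where "R = {x. \<exists>n. \<not> int p dvd n \<and> of_int n * x \<in> Ord}"
  \<comment> \<open>\<open>t\<close> is a residue of \<open>x\<close> with respect to some
    denominator \<open>n\<close>; \<open>uniq\<close> shows that the choice of \<open>n\<close> does
    not matter modulo \<open>p\<close>, and sums and products are treated for this relation before
    \<open>\<psi>\<close> enters.\<close>
  define is_res where "is_res x t \<longleftrightarrow> (\<exists>n. \<not> int p dvd n \<and> of_int n * x \<in> Ord \<and> of_int n * x - of_int (n * t) \<in> L)" for x t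
  have ex: "\<exists>t. is_res x t" if "x \<in> R" for x
  proof -
    from that obtain n where n: "\<not> int p dvd n" "of_int n * x \<in> Ord" by (auto simp: R_def)
    then obtain m where m: "of_int n * x - of_int m \<in> L" using L by (auto simp: deg1_def)
    have "coprime n (int p)" using n(1) pp prime_imp_coprime by (metis coprime_commute)
    then obtain b where b: "[n * b = 1] (mod int p)" using cong_solve_coprime_int by blast
    then have "[n * b * m = 1 * m] (mod int p)" by (rule cong_scalar_right)
    then have "int p dvd m - n * (b * m)" by (metis cong_iff_dvd_diff cong_sym mult.assoc mult_1)
    then have "of_int (m - n * (b * m)) \<in> L" using iL by blast
    moreover have "of_int n * x - of_int (n * (b * m)) = (of_int n * x - of_int m) + of_int (m - n * (b * m))" by simp
    ultimately have "of_int n * x - of_int (n * (b * m)) \<in> L" using zidealD(3)[OF z m] by (simp only:)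
    then show ?thesis unfolding is_res_def using n by blast
  qed
  have uniq: "[t = u] (mod int p)" if "is_res x t" "is_res x u" for x t u
  proof -
    from that obtain n m where nm: "\<not> int p dvd n" "of_int n * x - of_int (n * t) \<in> L"
      "\<not> int p dvd m" "of_int m * x - of_int (m * u) \<in> L" unfolding is_res_def by blast
    have "of_int (n * m * (u - t)) = of_int m * (of_int n * x - of_int (n * t)) - of_int n * (of_int m * x - of_int (m * u))"
      by (simp add: algebra_simps)
    also have "\<dots> \<in> L" by (rule zideal_diff[OF z zidealD(4)[OF z of_int_in_Ord nm(2)] zidealD(4)[OF z of_int_in_Ord nm(4)]])
    finally have "int p dvd n * m * (u - t)" using iL by blast
    then have "int p dvd u - t" using nm pp by (simp add: prime_dvd_mult_iff)
    then show ?thesis by (metis cong_iff_dvd_diff cong_sym)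
  qed
  define \<psi> where "\<psi> x = (SOME t. is_res x t)" for x
  have psi: "is_res x (\<psi> x)" if "x \<in> R" for x unfolding \<psi>_def by (rule someI_ex[OF ex[OF that]])
  have res_in_R: "x \<in> R" if "is_res x t" for x t using that by (auto simp: is_res_def R_def)
  have psiI: "[\<psi> x = t] (mod int p)" if "is_res x t" for x t using uniq[OF psi[OF res_in_R[OF that]] that] .
  have OR: "is_res x t" if "x \<in> Ord" "x - of_int t \<in> L" for x t
    unfolding is_res_def using that pp by (intro exI[of _ 1]) auto
  have int: "is_res (of_int n) n" for n using zidealD(2)[OF z] by (intro OR) auto
  have add: "is_res (x + y) (t + u)" and mul: "is_res (x * y) (t * u)" if "is_res x t" "is_res y u" for x y t u
  proof -
    from that obtain n m where nm: "\<not> int p dvd n" "of_int n * x \<in> Ord" "of_int n * x - of_int (n * t) \<in> L"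
      "\<not> int p dvd m" "of_int m * y \<in> Ord" "of_int m * y - of_int (m * u) \<in> L" unfolding is_res_def by blast
    have nd: "\<not> int p dvd n * m" using nm pp by (simp add: prime_dvd_mult_iff)
    have "of_int (n * m) * (x + y) - of_int (n * m * (t + u)) =
        of_int m * (of_int n * x - of_int (n * t)) + of_int n * (of_int m * y - of_int (m * u))"
      by (simp add: algebra_simps)
    also have "\<dots> \<in> L" using nm by (intro zidealD(3)[OF z] zidealD(4)[OF z of_int_in_Ord])
    finally have 1: "of_int (n * m) * (x + y) - of_int (n * m * (t + u)) \<in> L" .
    have "of_int (n * m) * (x + y) = of_int m * (of_int n * x) + of_int n * (of_int m * y)" by (simp add: algebra_simps)
    then have "of_int (n * m) * (x + y) \<in> Ord" using nm by (metis Ord_add Ord_scale)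
    with 1 nd show "is_res (x + y) (t + u)" unfolding is_res_def by blast
    have "of_int (n * m) * (x * y) - of_int (n * m * (t * u)) =
        (of_int n * x - of_int (n * t)) * (of_int m * y) + of_int (n * t) * (of_int m * y - of_int (m * u))"
      by (simp add: algebra_simps)
    also have "\<dots> \<in> L" using nm
      by (intro zidealD(3)[OF z] zidealD(4)[OF z of_int_in_Ord] zidealD(5)[OF z])
    finally have 2: "of_int (n * m) * (x * y) - of_int (n * m * (t * u)) \<in> L" .
    have "of_int (n * m) * (x * y) = (of_int n * x) * (of_int m * y)" by (simp add: algebra_simps)
    then have "of_int (n * m) * (x * y) \<in> Ord" using nm by (metis Ord_mult)
    with 2 nd show "is_res (x * y) (t * u)" unfolding is_res_def by blast
  qed
  have "residue_hom p R \<psi>"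
    unfolding residue_hom_def
  proof (intro conjI allI ballI impI p)
    show "of_int n \<in> R" "[\<psi> (of_int n) = n] (mod int p)" for n using res_in_R[OF int] psiI[OF int] by blast+
    fix x y assume xy: "x \<in> R" "y \<in> R"
    show "x + y \<in> R" "[\<psi> (x + y) = \<psi> x + \<psi> y] (mod int p)" using res_in_R psiI add[OF psi[OF xy(1)] psi[OF xy(2)]] by blast+
    show "x * y \<in> R" "[\<psi> (x * y) = \<psi> x * \<psi> y] (mod int p)" using res_in_R psiI mul[OF psi[OF xy(1)] psi[OF xy(2)]] by blast+
  next
    fix n :: int assume n: "\<not> int p dvd n"
    then have "n \<noteq> 0" by auto
    then have "of_int n * inverse (of_int n) = (1 :: complex)" by simp
    then have "of_int n * inverse (of_int n) \<in> Ord" using one_in_Ord by (simp only:)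
    then show "inverse (of_int n) \<in> R" unfolding R_def using n by blast
  qed
  moreover have "x - of_int (\<psi> x) \<in> L" if x: "x \<in> Ord" for x
  proof -
    obtain t where t: "x - of_int t \<in> L" using L x by (auto simp: deg1_def)
    have "[\<psi> x = t] (mod int p)" by (rule psiI[OF OR[OF x t]])
    then have "of_int (t - \<psi> x) \<in> L" using iL by (metis cong_iff_dvd_diff cong_sym)
    from zidealD(3)[OF z t this] show ?thesis by simp
  qed
  ultimately show ?thesis unfolding R_def by blast
qed

lemma sqrt_rep_unique:
  assumes s: "s \<notin> Frac" and "a \<in> Ord" "b \<in> Ord" "c \<in> Ord" "e \<in> Ord" "a + b * s = c + e * s"
  shows "a = c \<and> b = e"
proof -
  have "(b - e) * s = c - a" using assms(6) by (simp add: algebra_simps)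
  moreover have "b - e = 0"
  proof (rule ccontr)
    assume "b - e \<noteq> 0"
    then have "s = (c - a) * inverse (b - e)" using \<open>(b - e) * s = c - a\<close> by (simp add: field_simps)
    moreover have "(c - a) * inverse (b - e) \<in> Frac"
      using assms Ord_subset_Frac by (intro Frac_mult Frac_inverse) auto
    ultimately show False using s by simp
  qed
  ultimately show ?thesis by simp
qed

text \<open>A prime of degree one at which \<open>s\<^sup>2\<close> becomes a nonzero square splits in the quadratic extension.\<close>

lemma split_prime:
  assumes p: "prime p" "p > 2" and L: "deg1 p L" and s: "s ^ 2 \<in> Ord" "s \<notin> Frac"
    and W: "number_order e W" "number_order.Ord e W = {a + b * s | a b. a \<in> Ord \<and> b \<in> Ord}"
    and t: "s ^ 2 - of_int (t ^ 2) \<in> L"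
  shows "number_order.deg1 e W p {a + b * s | a b. a \<in> Ord \<and> b \<in> Ord \<and> a + b * of_int t \<in> L}"
proof -
  interpret W: number_order e W by (fact W(1))
  let ?J = "{a + b * s | a b. a \<in> Ord \<and> b \<in> Ord \<and> a + b * of_int t \<in> L}"
  have aL: "above p L" and z: "zideal L" "of_nat p \<in> L" "1 \<notin> L" using L by (auto simp: deg1_def above_def)
  have "W.zideal ?J"
    unfolding W.zideal_def W(2)
  proof (intro conjI ballI)
    show "?J \<subseteq> {a + b * s | a b. a \<in> Ord \<and> b \<in> Ord}" by blast
    show "0 \<in> ?J" using zidealD(2)[OF z(1)] by (intro CollectI exI[of _ 0]) auto
  next
    fix x y assume "x \<in> ?J" "y \<in> ?J"
    then obtain a b c f where *: "x = a + b * s" "a \<in> Ord" "b \<in> Ord" "a + b * of_int t \<in> L"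
      "y = c + f * s" "c \<in> Ord" "f \<in> Ord" "c + f * of_int t \<in> L" by blast
    have "x + y = (a + c) + (b + f) * s" using * by (simp add: algebra_simps)
    moreover have "(a + c) + (b + f) * of_int t \<in> L"
      using zidealD(3)[OF z(1) *(4) *(8)] by (simp add: algebra_simps)
    ultimately show "x + y \<in> ?J" using * by blast
  next
    fix r x assume "r \<in> {a + b * s | a b. a \<in> Ord \<and> b \<in> Ord}" "x \<in> ?J"
    then obtain a b c f where *: "r = a + b * s" "a \<in> Ord" "b \<in> Ord"
      "x = c + f * s" "c \<in> Ord" "f \<in> Ord" "c + f * of_int t \<in> L" by blast
    have "r * x = (a * c + b * f * s ^ 2) + (a * f + b * c) * s" using * by (simp add: algebra_simps power2_eq_square)
    moreover have "a * c + b * f * s ^ 2 \<in> Ord" "a * f + b * c \<in> Ord" using * s by auto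
    moreover have "(a * c + b * f * s ^ 2) + (a * f + b * c) * of_int t \<in> L"
    proof -
      have "(a * c + b * f * s ^ 2) + (a * f + b * c) * of_int t =
          (a + b * of_int t) * (c + f * of_int t) + (b * f) * (s ^ 2 - of_int (t ^ 2))"
        by (simp add: algebra_simps power2_eq_square)
      also have "\<dots> \<in> L"
        by (rule zidealD(3)[OF z(1) zidealD(4)[OF z(1) _ *(7)] zidealD(4)[OF z(1) _ t]]) (use * in auto)
      finally show ?thesis .
    qed
    ultimately show "r * x \<in> ?J" by blast
  qed
  moreover have "of_nat p \<in> ?J" using z(2) by (intro CollectI exI[of _ "of_nat p"] exI[of _ 0]) auto
  moreover have "1 \<notin> ?J"
  proof
    assume "1 \<in> ?J"
    then obtain a b where ab: "1 = a + b * s" "a \<in> Ord" "b \<in> Ord" "a + b * of_int t \<in> L" by blast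
    have "a = 1 \<and> b = 0" by (rule sqrt_rep_unique[OF s(2) ab(2,3) one_in_Ord zero_in_Ord]) (use ab(1) in simp)
    then show False using ab(4) z(3) by simp
  qed
  moreover have "\<exists>m. y - of_int m \<in> ?J" if "y \<in> W.Ord" for y
  proof -
    from that obtain a b where ab: "y = a + b * s" "a \<in> Ord" "b \<in> Ord" unfolding W(2) by blast
    then have "a + b * of_int t \<in> Ord" by auto
    then obtain m where m: "(a + b * of_int t) - of_int m \<in> L" using L unfolding deg1_def by blast
    have "y - of_int m = (a - of_int m) + b * s" using ab by simp
    moreover have "(a - of_int m) + b * of_int t \<in> L" using m by (simp add: algebra_simps)
    moreover have "a - of_int m \<in> Ord" using ab by auto
    ultimately show ?thesis using ab(3) by blast
  qed
  ultimately show ?thesis unfolding W.deg1_def W.above_def by blast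
qed

end

text \<open>If \<open>\<delta>\<close> were a square modulo every large prime of degree one, each
  such prime would split into two in the quadratic extension. The \<open>prime_mass\<close> there
  would then be at least \<open>2 * (3/4) * ln N\<close> up to a constant, more than
  \<open>(5/4) * ln N\<close>. Prescribing \<open>S\<close> lets later arguments demand integrality
  of finitely many numbers.\<close>

theorem ex_nonsquare_residue:
  assumes K: "number_field K" and \<delta>: "\<delta> \<in> K" "\<And>s. s \<in> K \<Longrightarrow> s ^ 2 \<noteq> \<delta>" and S: "finite S" "S \<subseteq> K"
  shows "\<exists>p R \<psi>. p > P0 \<and> residue_hom p R \<psi> \<and> S \<subseteq> R \<and> \<delta> \<in> R \<and> (\<forall>t. \<not> [t ^ 2 = \<psi> \<delta>] (mod int p))"
proof (rule ccontr)
  assume contra: "\<not> ?thesis"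
  from K obtain d w where dw: "number_order d w" "K = number_order.Frac d w" by (auto simp: number_field_def)
  interpret number_order d w by (fact dw(1))
  obtain n :: int where n: "n > 0" "\<forall>x\<in>insert \<delta> S. of_int n * x \<in> Ord"
    using common_denominator[of "insert \<delta> S"] S \<delta>(1) dw(2) by auto
  \<comment> \<open>The factor \<open>n ^ 2\<close> instead of \<open>n\<close> keeps the square
    class while making the element integral.\<close>
  define \<delta>' where "\<delta>' = of_int n * (of_int n * \<delta>)"
  have dO: "\<delta>' \<in> Ord" unfolding \<delta>'_def by (rule Ord_scale) (use n(2) in blast)
  define s where "s = csqrt \<delta>'"
  have s2: "s ^ 2 = \<delta>'" by (simp add: s_def)
  have sO: "s ^ 2 \<in> Ord" using s2 dO by simp
  have n0: "of_int n \<noteq> (0::complex)" using n(1) by simp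
  have sF: "s \<notin> Frac"
  proof
    assume "s \<in> Frac"
    then have "s * inverse (of_int n) \<in> K" unfolding dw(2) by (intro Frac_mult Frac_inverse Frac_of_int)
    moreover have "(s * inverse (of_int n)) ^ 2 = \<delta>"
      using n0 s2 by (simp add: power_mult_distrib \<delta>'_def power2_eq_square field_simps)
    ultimately show False using \<delta>(2) by blast
  qed
  have d0: "\<delta>' \<noteq> 0" using sF Frac_of_int[of 0] by (auto simp: s_def)
  obtain W where W: "number_order (2 * d) W" "number_order.Ord (2 * d) W = {a + b * s | a b. a \<in> Ord \<and> b \<in> Ord}"
    using order_sqrt[OF sO sF] by blast
  interpret W: number_order "2 * d" W by (fact W(1))
  \<comment> \<open>Excludes the prime 2, the primes dividing the denominator \<open>n\<close>, and
    those at which \<open>\<delta>'\<close> vanishes.\<close>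
  define P1 where "P1 = P0 + nat n + nat \<bar>nrm \<delta>'\<bar> + 2"
  have P1: "P0 \<le> P1" "nat n \<le> P1" "nat \<bar>nrm \<delta>'\<bar> \<le> P1" "2 \<le> P1" unfolding P1_def by auto
  have ext: "\<exists>t. s ^ 2 - of_int (t ^ 2) \<in> L \<and> \<not> int p dvd t" if p: "prime p" "p > P1" and L: "deg1 p L" for p L
  proof -
    have aL: "above p L" and z: "zideal L" "of_nat p \<in> L" "1 \<notin> L" using L by (auto simp: deg1_def above_def)
    let ?R = "{x. \<exists>n. \<not> int p dvd n \<and> of_int n * x \<in> Ord}"
    obtain \<psi> where psi: "residue_hom p ?R \<psi>" "\<And>x. x \<in> Ord \<Longrightarrow> x - of_int (\<psi> x) \<in> L"
      using ex_residue_hom[OF p(1) L] by blast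
    have pn: "\<not> int p dvd n"
    proof
      assume "int p dvd n"
      then have "int p \<le> n" using n(1) by (rule zdvd_imp_le)
      then show False using p(2) P1(2) by linarith
    qed
    have SR: "insert \<delta> S \<subseteq> ?R" using n(2) pn by blast
    have "\<not> (\<forall>t. \<not> [t ^ 2 = \<psi> \<delta>] (mod int p))"
    proof
      assume *: "\<forall>t. \<not> [t ^ 2 = \<psi> \<delta>] (mod int p)"
      have "p > P0" using p(2) P1(1) by linarith
      with * psi(1) SR have "\<exists>p R \<psi>. p > P0 \<and> residue_hom p R \<psi> \<and> S \<subseteq> R \<and> \<delta> \<in> R \<and> (\<forall>t. \<not> [t ^ 2 = \<psi> \<delta>] (mod int p))"
        by (intro exI[of _ p] exI[of _ ?R] exI[of _ \<psi>]) simp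
      then show False using contra by simp
    qed
    then obtain t where t: "[t ^ 2 = \<psi> \<delta>] (mod int p)" by blast
    have dR: "\<delta> \<in> ?R" and nR: "of_int n \<in> ?R" using SR psi(1) by (auto simp: residue_hom_def)
    have h: "\<And>x y. x \<in> ?R \<Longrightarrow> y \<in> ?R \<Longrightarrow> x * y \<in> ?R" "\<And>x y. x \<in> ?R \<Longrightarrow> y \<in> ?R \<Longrightarrow> [\<psi> (x * y) = \<psi> x * \<psi> y] (mod int p)"
      "\<And>n. [\<psi> (of_int n) = n] (mod int p)"
      using psi(1) unfolding residue_hom_def by blast+
    have "[\<psi> \<delta>' = \<psi> (of_int n) * \<psi> (of_int n * \<delta>)] (mod int p)" unfolding \<delta>'_def by (rule h(2)[OF nR h(1)[OF nR dR]])
    also have "[\<psi> (of_int n) * \<psi> (of_int n * \<delta>) = n * (\<psi> (of_int n) * \<psi> \<delta>)] (mod int p)"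
      by (intro cong_mult h(3) h(2)[OF nR dR])
    also have "[n * (\<psi> (of_int n) * \<psi> \<delta>) = n * (n * t ^ 2)] (mod int p)"
      by (intro cong_mult h(3) cong_refl cong_sym[OF t])
    also have "n * (n * t ^ 2) = (n * t) ^ 2" by (simp add: power2_eq_square)
    finally have c: "[\<psi> \<delta>' = (n * t) ^ 2] (mod int p)" .
    have "of_int (\<psi> \<delta>' - (n * t) ^ 2) \<in> L" using int_in_above[OF p(1) aL] c by (simp only: cong_iff_dvd_diff)
    from zidealD(3)[OF z(1) psi(2)[OF dO] this] have 1: "s ^ 2 - of_int ((n * t) ^ 2) \<in> L" by (simp add: s2)
    moreover have "\<not> int p dvd n * t"
    proof
      assume "int p dvd n * t"
      then have "int p dvd (n * t) ^ 2" by (simp add: power2_eq_square)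
      then have "of_int ((n * t) ^ 2) \<in> L" using int_in_above[OF p(1) aL] by blast
      from zidealD(3)[OF z(1) 1 this] have "\<delta>' \<in> L" by (simp add: s2)
      then have "int p dvd nrm \<delta>'" by (rule dvd_nrm_of_mem[OF z(1) p(1) z(2,3)])
      then have "int p \<le> \<bar>nrm \<delta>'\<bar>" using nrm_nonzero[OF dO d0] dvd_imp_le_int[of "nrm \<delta>'" "int p"] by simp
      then show False using p(2) P1(3) by linarith
    qed
    ultimately show ?thesis by blast
  qed
  have rho2: "2 * rho p \<le> W.rho p" if p: "prime p" "p > P1" for p
  proof -
    define \<tau> where "\<tau> L = (SOME t. s ^ 2 - of_int (t ^ 2) \<in> L \<and> \<not> int p dvd t)" for L
    have \<tau>: "s ^ 2 - of_int (\<tau> L ^ 2) \<in> L" "\<not> int p dvd \<tau> L" if "deg1 p L" for L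
      using someI_ex[OF ext[OF p that]] unfolding \<tau>_def by blast+
    define J where "J L t = {a + b * s | a b. a \<in> Ord \<and> b \<in> Ord \<and> a + b * of_int t \<in> L}" for L and t :: int
    have p2: "p > 2" using p P1(4) by linarith
    have sub: "(\<lambda>(L, e). J L (e * \<tau> L)) ` ({L. deg1 p L} \<times> {1, -1}) \<subseteq> {L. W.deg1 p L}"
    proof clarify
      fix L e assume L: "deg1 p L" and e: "(e :: int) \<in> {1, -1}"
      have "s ^ 2 - of_int ((e * \<tau> L) ^ 2) \<in> L" using \<tau>(1)[OF L] e by auto
      then show "W.deg1 p (J L (e * \<tau> L))" unfolding J_def by (rule split_prime[OF p(1) p2 L sO sF W])
    qed
    \<comment> \<open>\<open>L\<close> is recovered from an ideal above it as the intersection with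
      \<open>Ord\<close>, so ideals above different \<open>L\<close> are different.\<close>
    have mem: "a \<in> J L t \<longleftrightarrow> a \<in> L" if a: "a \<in> Ord" for a L t
    proof
      assume "a \<in> J L t"
      then obtain c b where cb: "a = c + b * s" "c \<in> Ord" "b \<in> Ord" "c + b * of_int t \<in> L" unfolding J_def by blast
      have "c = a \<and> b = 0" by (rule sqrt_rep_unique[OF sF cb(2,3) a zero_in_Ord]) (use cb(1) in simp)
      then show "a \<in> L" using cb(4) by simp
    next
      assume "a \<in> L"
      then show "a \<in> J L t" unfolding J_def using a by (intro CollectI exI[of _ a] exI[of _ 0]) auto
    qed
    have inj: "inj_on (\<lambda>(L, e). J L (e * \<tau> L)) ({L. deg1 p L} \<times> {1, -1})"
    proof (rule inj_onI, clarify)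
      fix L e M f assume L: "deg1 p L" "deg1 p M" and ef: "e \<in> {1, -1 :: int}" "f \<in> {1, -1}" and eq: "J L (e * \<tau> L) = J M (f * \<tau> M)"
      have LO: "L \<subseteq> Ord" "M \<subseteq> Ord" using L zidealD(1) by (auto simp: deg1_def above_def)
      have "x \<in> L \<longleftrightarrow> x \<in> M" for x
        using mem[of x L "e * \<tau> L"] mem[of x M "f * \<tau> M"] LO eq by blast
      then have LM: "L = M" by blast
      have zL: "zideal L" "above p L" using L(1) by (auto simp: deg1_def above_def)
      have "e = f"
      proof (rule ccontr)
        assume "e \<noteq> f"
        then have fe: "f = - e" using ef by auto
        \<comment> \<open>\<open>s - e * \<tau> L\<close> belongs to the first of the two ideals;
          membership in the conjugate one would force \<open>2 * \<tau> L\<close> into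
          \<open>L\<close>.\<close>
        have "of_int (- (e * \<tau> L)) + 1 * s \<in> J L (e * \<tau> L)"
          unfolding J_def using zidealD(2)[OF zL(1)] by (intro CollectI exI[of _ "of_int (- (e * \<tau> L))"] exI[of _ 1]) auto
        then have "of_int (- (e * \<tau> L)) + 1 * s \<in> J L (- e * \<tau> L)" using eq LM fe by simp
        then obtain a b where ab: "of_int (- (e * \<tau> L)) + 1 * s = a + b * s" "a \<in> Ord" "b \<in> Ord" "a + b * of_int (- e * \<tau> L) \<in> L"
          unfolding J_def by blast
        have "a = of_int (- (e * \<tau> L)) \<and> b = 1"
          by (rule sqrt_rep_unique[OF sF ab(2,3) of_int_in_Ord one_in_Ord ab(1)[symmetric]])
        then have "of_int (- 2 * e * \<tau> L) = a + b * of_int (- e * \<tau> L)" by (simp add: algebra_simps)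
        with ab(4) have "of_int (- 2 * e * \<tau> L) \<in> L" by (simp only:)
        then have "int p dvd - 2 * e * \<tau> L" using int_in_above[OF p(1) zL(2)] by blast
        then have "int p dvd 2 * \<tau> L" using ef(1) by auto
        then have "int p dvd 2" using \<tau>(2)[OF L(1)] p(1) by (simp add: prime_dvd_mult_iff)
        then show False using p2 zdvd_imp_le[of "int p" 2] by simp
      qed
      then show "L = M \<and> e = f" using LM by simp
    qed
    have "card ({L. deg1 p L} \<times> {1, -1 :: int}) \<le> card {L. W.deg1 p L}"
      by (rule card_inj_on_le[OF inj sub W.finite_deg1[OF p(1)]])
    then show ?thesis by (simp add: rho_def W.rho_def card_cartesian_product)
  qed
  obtain c1 where c1: "\<And>N. N \<ge> 1 \<Longrightarrow> W.prime_mass N \<le> (5/4) * ln (real N) + c1" using W.prime_mass_upper by blast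
  obtain c2 where c2: "\<And>N. N \<ge> 1 \<Longrightarrow> prime_mass N \<ge> (3/4) * ln (real N) - c2" using prime_mass_lower by blast
  define C where "C = 2 * c2 + 2 * prime_mass P1 + c1"
  \<comment> \<open>\<open>2 * (3/4) - 5/4 = 1/4\<close>; the primes up to \<open>P1\<close>, for
    which splitting is not known, are absorbed into \<open>C\<close>.\<close>
  have small: "(1/4) * ln (real N) \<le> C" if N: "N \<ge> 1" for N
  proof -
    let ?f = "\<lambda>p. real (rho p) * ln (real p) / real p"
    have nn: "?f p \<ge> 0" if "prime p" for p using prime_ge_1_nat[OF that] by simp
    have "prime_mass N \<le> (\<Sum>p\<in>{p. prime p \<and> p \<le> P1} \<union> {p. prime p \<and> P1 < p \<and> p \<le> N}. ?f p)"
      unfolding prime_mass_def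
      by (rule sum_mono2) (use nn in \<open>auto intro: finite_subset[of _ "{..P1} \<union> {..N}"]\<close>)
    also have "\<dots> \<le> prime_mass P1 + (\<Sum>p | prime p \<and> P1 < p \<and> p \<le> N. ?f p)"
      unfolding prime_mass_def
      by (subst sum.union_disjoint) (auto intro: finite_subset[of _ "{..P1} \<union> {..N}"])
    finally have 1: "prime_mass N \<le> prime_mass P1 + (\<Sum>p | prime p \<and> P1 < p \<and> p \<le> N. ?f p)" .
    have "2 * (\<Sum>p | prime p \<and> P1 < p \<and> p \<le> N. ?f p) = (\<Sum>p | prime p \<and> P1 < p \<and> p \<le> N. real (2 * rho p) * ln (real p) / real p)"
      by (simp add: sum_distrib_left mult.assoc)
    also have "\<dots> \<le> (\<Sum>p | prime p \<and> P1 < p \<and> p \<le> N. real (W.rho p) * ln (real p) / real p)"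
      using rho2 prime_ge_1_nat by (intro sum_mono divide_right_mono mult_right_mono of_nat_mono) auto
    also have "\<dots> \<le> W.prime_mass N" unfolding W.prime_mass_def
      by (rule sum_mono2[OF finite_primes_le]) (use prime_ge_1_nat in auto)
    finally show ?thesis using 1 c1[OF N] c2[OF N] unfolding C_def by linarith
  qed
  define N where "N = nat \<lceil>exp (4 * C + 4)\<rceil>"
  have eN: "exp (4 * C + 4) \<le> real N" unfolding N_def by linarith
  have "0 < real N" by (rule less_le_trans[OF _ eN]) simp
  then have N: "N \<ge> 1" by simp
  have "ln (exp (4 * C + 4)) \<le> ln (real N)" by (rule ln_mono[OF eN]) simp
  then show False using small[OF N] by simp
qed

section \<open>Linear recurrences at primes of degree one\<close>

lemma pcompose_diff_taylor:
  fixes g x h :: "'a :: idom poly"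
  shows "\<exists>w. g \<circ>\<^sub>p (x - h) = g \<circ>\<^sub>p x - h * (pderiv g \<circ>\<^sub>p x) + h ^ 2 * w"
proof (induction g)
  case 0
  show ?case by (intro exI[of _ 0]) (simp add: pderiv_0)
next
  case (pCons a g)
  then obtain w where w: "g \<circ>\<^sub>p (x - h) = g \<circ>\<^sub>p x - h * (pderiv g \<circ>\<^sub>p x) + h ^ 2 * w" by blast
  have "pCons a g \<circ>\<^sub>p (x - h) = pCons a g \<circ>\<^sub>p x - h * (pderiv (pCons a g) \<circ>\<^sub>p x)
      + h ^ 2 * ((pderiv g \<circ>\<^sub>p x) + x * w - h * w)"
    by (simp add: pcompose_pCons pderiv_pCons pcompose_add w algebra_simps power2_eq_square)
  then show ?case by blast
qed

text \<open>Newton iteration started at \<open>X\<close>.\<close>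

lemma newton_root:
  fixes g :: "'a :: idom poly"
  assumes uv: "u * g + v * pderiv g = 1"
  shows "\<exists>s. g ^ (2 ^ k) dvd g \<circ>\<^sub>p s \<and> g dvd [:0, 1:] - s"
proof (induction k)
  case 0
  show ?case by (intro exI[of _ "[:0, 1:]"]) (simp add: pcompose_idR)
next
  case (Suc k)
  then obtain s where s: "g ^ (2 ^ k) dvd g \<circ>\<^sub>p s" "g dvd [:0, 1:] - s" by blast
  define h where "h = (g \<circ>\<^sub>p s) * (v \<circ>\<^sub>p s)"
  obtain w where w: "g \<circ>\<^sub>p (s - h) = g \<circ>\<^sub>p s - h * (pderiv g \<circ>\<^sub>p s) + h ^ 2 * w"
    using pcompose_diff_taylor by blast
  have "(u * g + v * pderiv g) \<circ>\<^sub>p s = 1 \<circ>\<^sub>p s" by (simp only: uv)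
  then have 1: "1 - (v \<circ>\<^sub>p s) * (pderiv g \<circ>\<^sub>p s) = (u \<circ>\<^sub>p s) * (g \<circ>\<^sub>p s)"
    by (simp add: pcompose_add pcompose_mult pcompose_1 algebra_simps)
  have "g \<circ>\<^sub>p (s - h) = (g \<circ>\<^sub>p s) * (1 - (v \<circ>\<^sub>p s) * (pderiv g \<circ>\<^sub>p s)) + h ^ 2 * w"
    unfolding w by (simp add: h_def algebra_simps)
  also have "\<dots> = (g \<circ>\<^sub>p s) ^ 2 * ((u \<circ>\<^sub>p s) + (v \<circ>\<^sub>p s) ^ 2 * w)"
    unfolding 1 by (simp add: h_def algebra_simps power2_eq_square)
  finally have "(g \<circ>\<^sub>p s) ^ 2 dvd g \<circ>\<^sub>p (s - h)" by simp
  moreover have "(g ^ (2 ^ k)) ^ 2 dvd (g \<circ>\<^sub>p s) ^ 2" using s(1) by (rule dvd_power_same)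
  moreover have "(g ^ (2 ^ k)) ^ 2 = g ^ (2 ^ Suc k)" by (simp flip: power_mult add: mult.commute)
  ultimately have "g ^ (2 ^ Suc k) dvd g \<circ>\<^sub>p (s - h)" using dvd_trans by metis
  moreover have "g dvd g ^ (2 ^ k)" by simp
  then have "g dvd h" unfolding h_def using s(1) by (meson dvd_mult2 dvd_trans)
  then have "g dvd [:0, 1:] - (s - h)" using s(2) dvd_add[of g "[:0, 1:] - s" h] by (simp add: algebra_simps)
  ultimately show ?case by blast
qed

lemma poly_bezout:
  fixes f g :: "'a :: field poly"
  shows "\<exists>d r s. d = r * f + s * g \<and> d dvd f \<and> d dvd g"
proof (induction "if g = 0 then 0 else Suc (degree g)" arbitrary: f g rule: less_induct)
  case less
  show ?case
  proof (cases "g = 0")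
    case True
    then show ?thesis by (intro exI[of _ f] exI[of _ 1] exI[of _ 0]) simp
  next
    case False
    then have "(if f mod g = 0 then 0 else Suc (degree (f mod g))) < (if g = 0 then 0 else Suc (degree g))"
      using degree_mod_less[of g f] by auto
    from less[OF this] obtain d r s where d: "d = r * g + s * (f mod g)" "d dvd g" "d dvd f mod g" by blast
    have m: "f mod g = f - f div g * g" by (simp add: minus_div_mult_eq_mod)
    have "d = s * f + (r - s * (f div g)) * g" unfolding d(1) m by (simp add: algebra_simps)
    moreover have "d dvd f" using d(2,3) by (metis dvd_add dvd_mult div_mult_mod_eq)
    ultimately show ?thesis using d(2) by blast
  qed
qed

abbreviation cpoly :: "rat poly \<Rightarrow> complex poly" where
  "cpoly \<equiv> map_poly of_rat"

text \<open>The Jordan decomposition of multiplication by X modulo \<open>f\<close>, with rational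
  coefficients: \<open>g\<close> is the squarefree part of \<open>f\<close>, and Newton's iteration
  moves X to a polynomial \<open>s\<close> with \<open>g(s) = 0\<close> modulo \<open>f\<close>. So
  \<open>s\<close> is the semisimple part, and \<open>X - s\<close>, a multiple of \<open>g\<close>,
  is the nilpotent part.\<close>

lemma semisimple_part:
  fixes f :: "rat poly"
  assumes f: "degree f > 0"
  shows "\<exists>s. cpoly f dvd (\<Prod>z | poly (cpoly f) z = 0. [:-z, 1:]) \<circ>\<^sub>p cpoly s \<and>
    cpoly f dvd ([:0, 1:] - cpoly s) ^ degree f"
proof -
  interpret of_rat_poly_hom: map_poly_comm_ring_hom "of_rat :: rat \<Rightarrow> complex" ..
  note hom = of_rat_poly_hom.hom_add of_rat_poly_hom.hom_mult of_rat_poly_hom.hom_minus of_rat_poly_hom.hom_power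
    of_rat_poly_hom.hom_one of_rat_hom.map_poly_pcompose of_rat_hom.map_poly_pderiv
  have f0: "f \<noteq> 0" using f by auto
  have deg: "degree (cpoly q) = degree q" for q by (simp add: degree_map_poly)
  obtain d r s where rs: "d = r * f + s * pderiv f" and dvd: "d dvd f" "d dvd pderiv f"
    using poly_bezout by blast
  obtain g where fg: "f = g * d" using dvd(1) by (metis dvdE mult.commute)
  obtain e where e: "pderiv f = e * d" using dvd(2) by (metis dvdE mult.commute)
  have "pderiv (cpoly f) \<noteq> 0" using f by (simp add: pderiv_eq_0_iff deg)
  moreover have "cpoly f = cpoly g * cpoly d" using arg_cong[OF fg, of cpoly] by (simp only: hom)
  moreover have "pderiv (cpoly f) = cpoly e * cpoly d" using arg_cong[OF e, of cpoly] by (simp only: hom)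
  moreover have "cpoly d = cpoly r * cpoly f + cpoly s * pderiv (cpoly f)"
    using arg_cong[OF rs, of cpoly] by (simp only: hom)
  ultimately have sq: "rsquarefree (cpoly g)" and roots: "\<And>a. poly (cpoly g) a = 0 \<longleftrightarrow> poly (cpoly f) a = 0"
    using poly_squarefree_decomp[of "cpoly f" "cpoly g" "cpoly d" "cpoly e" "cpoly r" "cpoly s"] by blast+
  obtain c u v where c: "c = u * g + v * pderiv g" "c dvd g" "c dvd pderiv g"
    using poly_bezout by blast
  have g0: "g \<noteq> 0" using fg f0 by auto
  have c0: "c \<noteq> 0" using g0 c(2) by auto
  \<comment> \<open>A nonconstant common divisor of \<open>g\<close> and its derivative would have a
    complex root, a multiple root of the squarefree \<open>g\<close>.\<close>
  have "degree c = 0"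
  proof (rule ccontr)
    assume "degree c \<noteq> 0"
    then have "\<not> constant (poly (cpoly c))" by (simp add: constant_degree deg)
    then obtain z where z: "poly (cpoly c) z = 0" using fundamental_theorem_of_algebra by blast
    obtain a b where ab: "g = c * a" "pderiv g = c * b" using c(2,3) by (meson dvdE)
    have "cpoly g = cpoly c * cpoly a" using arg_cong[OF ab(1), of cpoly] by (simp only: hom)
    moreover have "pderiv (cpoly g) = cpoly c * cpoly b" using arg_cong[OF ab(2), of cpoly] by (simp only: hom)
    ultimately show False using sq z unfolding rsquarefree_roots by (metis mult_zero_left poly_mult)
  qed
  then have "is_unit c" using c0 by (simp add: is_unit_iff_degree)
  then obtain e where e: "1 = c * e" by (rule dvdE)
  have "(e * u) * g + (e * v) * pderiv g = c * e" unfolding c(1) by (simp add: algebra_simps)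
  then have uv: "(e * u) * g + (e * v) * pderiv g = 1" using e by simp
  \<comment> \<open>\<open>degree f\<close> iterations are enough: \<open>f\<close> divides
    \<open>g ^ degree f\<close> because the two polynomials have the same roots, and
    \<open>2 ^ degree f\<close> exceeds \<open>degree f\<close>.\<close>
  obtain s where s: "g ^ (2 ^ degree f) dvd g \<circ>\<^sub>p s" "g dvd [:0, 1:] - s"
    using newton_root[OF uv] by blast
  have cg: "cpoly f dvd cpoly g ^ degree f"
    using nullstellensatz_univariate[of "cpoly f" "cpoly g"] roots f0 by (simp add: deg)
  obtain q where q: "g \<circ>\<^sub>p s = g ^ (2 ^ degree f) * q" using s(1) by blast
  obtain t where t: "[:0, 1:] - s = g * t" using s(2) by blast
  have "cpoly g \<circ>\<^sub>p cpoly s = cpoly g ^ (2 ^ degree f) * cpoly q"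
    using arg_cong[OF q, of cpoly] by (simp only: hom)
  moreover have "cpoly g ^ degree f dvd cpoly g ^ (2 ^ degree f)"
    by (intro le_imp_power_dvd less_imp_le less_exp)
  ultimately have 1: "cpoly f dvd cpoly g \<circ>\<^sub>p cpoly s" using cg by (metis dvd_mult2 dvd_trans)
  have "cpoly [:0, 1:] - cpoly s = cpoly g * cpoly t" using arg_cong[OF t, of cpoly] by (simp only: hom)
  then have X: "[:0, 1:] - cpoly s = cpoly g * cpoly t" by (simp add: of_rat_hom.map_poly_pCons_hom)
  have 2: "cpoly f dvd ([:0, 1:] - cpoly s) ^ degree f"
    unfolding X power_mult_distrib using cg by (rule dvd_mult2)
  have "cpoly g = smult (lead_coeff (cpoly g)) (\<Prod>z | poly (cpoly f) z = 0. [:-z, 1:])"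
    using complex_poly_decompose_rsquarefree[OF sq] roots by simp
  then have "cpoly g \<circ>\<^sub>p cpoly s = smult (lead_coeff (cpoly g)) ((\<Prod>z | poly (cpoly f) z = 0. [:-z, 1:]) \<circ>\<^sub>p cpoly s)"
    by (metis pcompose_smult)
  moreover have "lead_coeff (cpoly g) \<noteq> 0" using sq by (auto simp: rsquarefree_def)
  ultimately have "cpoly f dvd (\<Prod>z | poly (cpoly f) z = 0. [:-z, 1:]) \<circ>\<^sub>p cpoly s"
    using 1 by (simp add: dvd_smult_iff)
  with 2 show ?thesis by blast
qed

definition lagrange :: "complex set \<Rightarrow> complex \<Rightarrow> complex poly" where
  "lagrange A a = (\<Prod>b\<in>A - {a}. smult (inverse (a - b)) [:-b, 1:])"

lemma poly_lagrange: "finite A \<Longrightarrow> x \<in> A \<Longrightarrow> poly (lagrange A a) x = (if x = a then 1 else 0)"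
proof (cases "x = a")
  case True
  have "(\<Prod>b\<in>A - {a}. inverse (a - b) * (a - b)) = 1" by (intro prod.neutral ballI left_inverse) auto
  then show ?thesis using True by (simp add: lagrange_def poly_prod algebra_simps)
qed (auto simp: lagrange_def poly_prod)

lemma prod_roots_dvd:
  fixes p :: "complex poly"
  assumes "finite A" "\<And>a. a \<in> A \<Longrightarrow> poly p a = 0"
  shows "(\<Prod>a\<in>A. [:-a, 1:]) dvd p"
  using assms
proof (induction A arbitrary: p rule: finite_induct)
  case (insert a A)
  then obtain q where q: "p = [:-a, 1:] * q" by (meson insertI1 poly_eq_0_iff_dvd dvdE)
  have "poly q b = 0" if "b \<in> A" for b
  proof -
    have "poly p b = 0" "b \<noteq> a" using insert that by auto
    then show ?thesis by (simp add: q)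
  qed
  then have "(\<Prod>a\<in>A. [:-a, 1:]) dvd q" by (rule insert.IH)
  then show ?case using insert by (simp add: q mult_dvd_mono del: mult_pCons_left)
qed auto

lemma lagrange_interpolation:
  assumes "finite A"
  shows "(\<Prod>a\<in>A. [:-a, 1:]) dvd p - (\<Sum>a\<in>A. smult (poly p a) (lagrange A a))"
proof (rule prod_roots_dvd[OF assms])
  fix x assume "x \<in> A"
  then show "poly (p - (\<Sum>a\<in>A. smult (poly p a) (lagrange A a))) x = 0"
    using assms by (simp add: poly_sum poly_lagrange if_distrib cong: if_cong)
qed

text \<open>The functional sending the n-th power of X to \<open>r n\<close>. A linear recurrence
  makes it vanish on the multiples of the characteristic polynomial, so it may be evaluated modulo
  that polynomial (\<open>linear_form_eq_0\<close>).\<close>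

definition linear_form :: "(nat \<Rightarrow> complex) \<Rightarrow> complex poly \<Rightarrow> complex" where
  "linear_form r f = (\<Sum>i\<le>degree f. coeff f i * r i)"

lemma linear_form_eq: "degree f \<le> n \<Longrightarrow> linear_form r f = (\<Sum>i\<le>n. coeff f i * r i)"
  unfolding linear_form_def by (intro sum.mono_neutral_left) (auto simp: coeff_eq_0)

lemma linear_form_add: "linear_form r (f + g) = linear_form r f + linear_form r g"
proof -
  let ?n = "max (degree f) (degree g)"
  have "degree (f + g) \<le> ?n" by (rule degree_add_le) auto
  then show ?thesis
    using linear_form_eq[of "f + g" ?n r] linear_form_eq[of f ?n r] linear_form_eq[of g ?n r]
    by (simp add: sum.distrib algebra_simps)
qed

lemma linear_form_smult: "linear_form r (smult c f) = c * linear_form r f"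
  by (cases "c = 0") (simp_all add: linear_form_def sum_distrib_left mult.assoc)

lemma linear_form_sum: "linear_form r (sum f A) = (\<Sum>a\<in>A. linear_form r (f a))"
proof (induction A rule: infinite_finite_induct)
  case (insert x F)
  then show ?case by (simp add: linear_form_add)
qed (simp_all add: linear_form_def)

lemma linear_form_diff: "linear_form r (f - g) = linear_form r f - linear_form r g"
  using linear_form_add[of r f "smult (-1) g"] linear_form_smult[of r "-1" g] by simp

lemma linear_form_monom: "linear_form r (monom 1 n) = r n"
proof -
  have "linear_form r (monom 1 n) = (\<Sum>i\<le>n. if i = n then r n else 0)"
    unfolding linear_form_eq[OF degree_monom_le] by (intro sum.cong) (auto simp: coeff_monom)
  then show ?thesis by simp
qed

lemma linear_form_eq_0:
  assumes "\<And>n. linear_form r (monom 1 n * f) = 0" "f dvd h"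
  shows "linear_form r h = 0"
proof -
  from assms(2) obtain q where q: "h = q * f" by (metis dvdE mult.commute)
  have "h = (\<Sum>i\<le>degree q. smult (coeff q i) (monom 1 i * f))"
    by (subst q, subst poly_as_sum_of_monoms[symmetric]) (simp add: sum_distrib_right smult_monom flip: mult_smult_left)
  then show ?thesis using assms(1) by (simp add: linear_form_sum linear_form_smult)
qed

definition coeffs_in :: "'a :: comm_ring_1 set \<Rightarrow> 'a poly \<Rightarrow> bool" where
  "coeffs_in R f \<longleftrightarrow> (\<forall>i. coeff f i \<in> R)"

lemma sum_in_closed:
  assumes "0 \<in> R" "\<And>x y. x \<in> R \<Longrightarrow> y \<in> R \<Longrightarrow> x + y \<in> R" "\<And>i. i \<in> A \<Longrightarrow> g i \<in> R"
  shows "sum g A \<in> R"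
  using assms(3) by (induction A rule: infinite_finite_induct) (auto intro: assms(1,2))

context
  fixes R :: "'a :: comm_ring_1 set"
  assumes R0: "0 \<in> R" and R1: "1 \<in> R" and R_add: "\<And>x y. x \<in> R \<Longrightarrow> y \<in> R \<Longrightarrow> x + y \<in> R"
    and R_mult: "\<And>x y. x \<in> R \<Longrightarrow> y \<in> R \<Longrightarrow> x * y \<in> R"
begin

lemma coeffs_in_pCons: "a \<in> R \<Longrightarrow> coeffs_in R f \<Longrightarrow> coeffs_in R (pCons a f)"
  by (auto simp: coeffs_in_def coeff_pCons split: nat.split)

lemma coeffs_in_0: "coeffs_in R 0"
  by (simp add: coeffs_in_def R0)

lemma coeffs_in_1: "coeffs_in R 1"
  by (simp add: one_pCons coeffs_in_pCons coeffs_in_0 R1)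

lemma coeffs_in_mult: "coeffs_in R f \<Longrightarrow> coeffs_in R g \<Longrightarrow> coeffs_in R (f * g)"
  unfolding coeffs_in_def coeff_mult by (auto intro!: sum_in_closed R0 R_add R_mult)

lemma coeffs_in_power: "coeffs_in R f \<Longrightarrow> coeffs_in R (f ^ n)"
  by (induction n) (auto simp: coeffs_in_1 coeffs_in_mult)

lemma coeffs_in_prod: "(\<And>a. a \<in> A \<Longrightarrow> coeffs_in R (f a)) \<Longrightarrow> coeffs_in R (prod f A)"
  by (induction A rule: infinite_finite_induct) (auto simp: coeffs_in_1 coeffs_in_mult)

lemma coeffs_in_pcompose: "coeffs_in R f \<Longrightarrow> coeffs_in R g \<Longrightarrow> coeffs_in R (f \<circ>\<^sub>p g)"
proof (induction f)
  case (pCons a f)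
  have a: "a \<in> R" using pCons.prems(1) unfolding coeffs_in_def by (metis coeff_pCons_0)
  have "coeffs_in R f" using pCons.prems(1) unfolding coeffs_in_def by (metis coeff_pCons_Suc)
  then have "coeffs_in R (g * (f \<circ>\<^sub>p g))" using pCons by (simp add: coeffs_in_mult)
  moreover have "coeffs_in R [:a:]" using a by (simp add: coeffs_in_pCons coeffs_in_0)
  ultimately show ?case unfolding coeffs_in_def pcompose_pCons by (auto intro: R_add)
qed (simp add: coeffs_in_0)

end

lemma linear_form_in_closed:
  assumes "0 \<in> R" "\<And>x y. x \<in> R \<Longrightarrow> y \<in> R \<Longrightarrow> x + y \<in> R" "\<And>x y. x \<in> R \<Longrightarrow> y \<in> R \<Longrightarrow> x * y \<in> R"
    and "coeffs_in R f" "\<And>n. r n \<in> R"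
  shows "linear_form r f \<in> R"
  unfolding linear_form_def using assms by (intro sum_in_closed) (auto simp: coeffs_in_def)

lemma residue_homD:
  assumes "residue_hom p R \<psi>"
  shows "prime p" "\<And>n. of_int n \<in> R" "\<And>n. [\<psi> (of_int n) = n] (mod int p)" "0 \<in> R" "1 \<in> R"
    "\<And>x y. x \<in> R \<Longrightarrow> y \<in> R \<Longrightarrow> x + y \<in> R" "\<And>x y. x \<in> R \<Longrightarrow> y \<in> R \<Longrightarrow> x * y \<in> R"
    "\<And>x y. x \<in> R \<Longrightarrow> y \<in> R \<Longrightarrow> [\<psi> (x + y) = \<psi> x + \<psi> y] (mod int p)"
    "\<And>x y. x \<in> R \<Longrightarrow> y \<in> R \<Longrightarrow> [\<psi> (x * y) = \<psi> x * \<psi> y] (mod int p)"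
    "\<And>n. \<not> int p dvd n \<Longrightarrow> inverse (of_int n) \<in> R"
    "\<And>x n. x \<in> R \<Longrightarrow> x ^ n \<in> R" "\<And>x n. x \<in> R \<Longrightarrow> [\<psi> (x ^ n) = \<psi> x ^ n] (mod int p)"
proof -
  show *: "prime p" "\<And>n. of_int n \<in> R" "\<And>n. [\<psi> (of_int n) = n] (mod int p)"
    "\<And>x y. x \<in> R \<Longrightarrow> y \<in> R \<Longrightarrow> x + y \<in> R" "\<And>x y. x \<in> R \<Longrightarrow> y \<in> R \<Longrightarrow> x * y \<in> R"
    "\<And>x y. x \<in> R \<Longrightarrow> y \<in> R \<Longrightarrow> [\<psi> (x + y) = \<psi> x + \<psi> y] (mod int p)"
    "\<And>x y. x \<in> R \<Longrightarrow> y \<in> R \<Longrightarrow> [\<psi> (x * y) = \<psi> x * \<psi> y] (mod int p)"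
    "\<And>n. \<not> int p dvd n \<Longrightarrow> inverse (of_int n) \<in> R"
    using assms unfolding residue_hom_def by blast+
  show "0 \<in> R" "1 \<in> R" using *(2)[of 0] *(2)[of 1] by auto
  then show pow: "x ^ n \<in> R" if "x \<in> R" for x n using that *(5) by (induction n) auto
  show "[\<psi> (x ^ n) = \<psi> x ^ n] (mod int p)" if "x \<in> R" for x n
  proof (induction n)
    case 0
    show ?case using *(3)[of 1] by simp
  next
    case (Suc n)
    have "[\<psi> (x * x ^ n) = \<psi> x * \<psi> (x ^ n)] (mod int p)" by (rule *(7)[OF that pow[OF that]])
    also have "[\<psi> x * \<psi> (x ^ n) = \<psi> x * \<psi> x ^ n] (mod int p)" by (rule cong_scalar_left[OF Suc])
    finally show ?case by simp
  qed
qed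

lemma residue_hom_of_rat:
  assumes h: "residue_hom p R \<psi>" and q: "of_rat q \<in> R"
  shows "p_integral p q" "[\<psi> (of_rat q) = rat_mod p q] (mod int p)"
proof -
  note h = residue_homD[OF h]
  obtain n d where nd: "quotient_of q = (n, d)" by force
  have d: "d > 0" "coprime n d" "q = of_int n / of_int d"
    using quotient_of_denom_pos[OF nd] quotient_of_coprime[OF nd] quotient_of_div[OF nd] by auto
  have e: "of_int d * of_rat q = (of_int n :: complex)" using d by (simp add: of_rat_divide)
  have "[n = \<psi> (of_int d * of_rat q)] (mod int p)" unfolding e by (rule cong_sym[OF h(3)])
  also have "[\<psi> (of_int d * of_rat q) = \<psi> (of_int d) * \<psi> (of_rat q)] (mod int p)" by (rule h(9)[OF h(2) q])
  also have "[\<psi> (of_int d) * \<psi> (of_rat q) = d * \<psi> (of_rat q)] (mod int p)" by (rule cong_scalar_right[OF h(3)])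
  finally have c: "[n = d * \<psi> (of_rat q)] (mod int p)" .
  have pd: "\<not> int p dvd d"
  proof
    assume "int p dvd d"
    then have "int p dvd n" using c by (metis cong_dvd_iff dvd_mult2)
    then have "int p dvd 1" using d(2) \<open>int p dvd d\<close> by (metis coprime_common_divisor_int coprime_def)
    then show False using h(1) by (metis int_dvd_int_iff not_prime_unit of_nat_1)
  qed
  then show "p_integral p q" by (simp add: p_integral_def nd)
  have "coprime d (int p)" using prime_imp_coprime[of "int p" d] h(1) pd by (simp add: coprime_commute)
  then have inv: "[d * modular_inverse (int p) d = 1] (mod int p)" by (rule cong_modular_inverse1)
  have "[rat_mod p q = n * modular_inverse (int p) d] (mod int p)" by (simp add: rat_mod_def nd cong_def)
  also have "[n * modular_inverse (int p) d = d * \<psi> (of_rat q) * modular_inverse (int p) d] (mod int p)"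
    by (rule cong_scalar_right[OF c])
  also have "d * \<psi> (of_rat q) * modular_inverse (int p) d = d * modular_inverse (int p) d * \<psi> (of_rat q)" by simp
  also have "[d * modular_inverse (int p) d * \<psi> (of_rat q) = 1 * \<psi> (of_rat q)] (mod int p)"
    by (rule cong_scalar_right[OF inv])
  finally show "[\<psi> (of_rat q) = rat_mod p q] (mod int p)" by (simp add: cong_sym_eq)
qed

lemma fermat_int:
  assumes p: "prime p"
  shows "[x ^ p = x] (mod int p)"
proof -
  define y where "y = nat (x mod int p)"
  have y: "[x = int y] (mod int p)" using p by (simp add: y_def cong_def prime_gt_0_nat)
  have "[y ^ p = y] (mod p)"
  proof (cases "p dvd y")
    case True
    then have "p dvd y ^ p" using prime_gt_0_nat[OF p] by (simp add: dvd_power_le dvd_trans)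
    then show ?thesis using True by (simp add: cong_def)
  next
    case False
    from cong_scalar_left[OF fermat_theorem[OF p False], of y] have "[y * y ^ (p - 1) = y] (mod p)" by simp
    then show ?thesis using prime_gt_0_nat[OF p] by (simp flip: power_Suc)
  qed
  then have "[int y ^ p = int y] (mod int p)" by (metis cong_int_iff of_nat_power)
  then show ?thesis using y by (meson cong_pow cong_sym cong_trans)
qed

text \<open>\<open>r p\<close> is the value of the functional at \<open>X ^ p\<close>. Modulo
  \<open>f\<close>, \<open>X = T + (X - T)\<close> with \<open>X - T\<close> nilpotent, so beyond
  the degree only \<open>T ^ p\<close> survives modulo \<open>p\<close> in the binomial expansion.
  The value at \<open>T ^ n\<close> is a combination of the \<open>a ^ n\<close> over the roots
  \<open>a\<close>, with coefficients \<open>q a\<close> that do not depend on \<open>n\<close>;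
  under a residue homomorphism \<open>a ^ p\<close> and \<open>a\<close> agree, which replaces
  \<open>T ^ p\<close> by \<open>T\<close>. The value at \<open>T\<close> is the rational number
  \<open>c\<close>.\<close>

theorem recurrence_residue:
  assumes "linear_recurrent r"
  shows "\<exists>c K S N. number_field K \<and> finite S \<and> S \<subseteq> K \<and>
    (\<forall>p R \<psi>. p > N \<longrightarrow> residue_hom p R \<psi> \<longrightarrow> S \<subseteq> R \<longrightarrow>
       p_integral p c \<and> [rat_mod p (r p) = rat_mod p c] (mod int p))"
proof -
  from assms obtain k c0 where k: "k \<ge> 1" and rec: "\<And>n. r (n + k) = (\<Sum>i=1..k. c0 i * r (n + k - i))"
    unfolding linear_recurrent_def by blast
  define f :: "rat poly" where "f = monom 1 k - (\<Sum>i=1..k. monom (c0 i) (k - i))"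
  have "coeff f k = 1 - (\<Sum>i=1..k. 0)" unfolding f_def coeff_diff coeff_sum coeff_monom
    by (intro arg_cong2[of _ _ _ _ minus] sum.cong) auto
  then have "degree f \<ge> k" by (intro le_degree) simp
  then have f: "degree f > 0" using k by simp
  then have f0: "f \<noteq> 0" by auto
  interpret of_rat_poly_hom: map_poly_comm_ring_hom "of_rat :: rat \<Rightarrow> complex" ..
  define rc where "rc n = (of_rat (r n) :: complex)" for n
  define \<Lambda> where "\<Lambda> = linear_form rc"
  note L = linear_form_add[of rc, folded \<Lambda>_def] linear_form_diff[of rc, folded \<Lambda>_def]
    linear_form_smult[of rc, folded \<Lambda>_def] linear_form_sum[of rc, folded \<Lambda>_def] linear_form_monom[of rc, folded \<Lambda>_def]
  have "\<Lambda> (monom 1 n * cpoly f) = 0" for n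
  proof -
    have "cpoly f = monom 1 k - (\<Sum>i=1..k. monom (of_rat (c0 i)) (k - i))"
      unfolding f_def of_rat_poly_hom.hom_minus of_rat_poly_hom.hom_sum by (simp add: map_poly_monom)
    then have "monom 1 n * cpoly f = monom 1 (n + k) - (\<Sum>i=1..k. monom (of_rat (c0 i)) (n + (k - i)))"
      by (simp only: right_diff_distrib sum_distrib_left mult_monom mult_1_left)
    also have "(\<Sum>i=1..k. monom (of_rat (c0 i)) (n + (k - i))) = (\<Sum>i=1..k. smult (of_rat (c0 i)) (monom 1 (n + k - i)))"
      by (intro sum.cong) (auto simp: smult_monom)
    finally have "monom 1 n * cpoly f = monom 1 (n + k) - (\<Sum>i=1..k. smult (of_rat (c0 i)) (monom 1 (n + k - i)))" .
    then have "\<Lambda> (monom 1 n * cpoly f) = rc (n + k) - (\<Sum>i=1..k. of_rat (c0 i) * rc (n + k - i))"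
      by (simp add: L)
    also have "\<dots> = 0" unfolding rc_def rec by (simp add: of_rat_sum of_rat_mult)
    finally show ?thesis .
  qed
  then have L0: "\<Lambda> h = 0" if "cpoly f dvd h" for h
    unfolding \<Lambda>_def using that by (rule linear_form_eq_0)
  define A where "A = {z. poly (cpoly f) z = 0}"
  have A: "finite A" unfolding A_def using f0 by (intro poly_roots_finite) simp
  obtain s where s: "cpoly f dvd (\<Prod>z\<in>A. [:-z, 1:]) \<circ>\<^sub>p cpoly s" "cpoly f dvd ([:0, 1:] - cpoly s) ^ degree f"
    using semisimple_part[OF f] unfolding A_def by blast
  define X :: "complex poly" where "X = [:0, 1:]"
  define T where "T = cpoly s"
  define q where "q a = \<Lambda> (lagrange A a \<circ>\<^sub>p T)" for a
  have LX: "\<Lambda> (X ^ n) = rc n" for n using L(5)[of n] by (simp add: X_def monom_altdef)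
  \<comment> \<open>Modulo \<open>f\<close>, \<open>T\<close> satisfies the polynomial with simple
    roots \<open>A\<close>, so powers of \<open>T\<close> may be replaced by their Lagrange
    interpolation at \<open>A\<close>.\<close>
  have tT: "\<Lambda> (T ^ n) = (\<Sum>a\<in>A. a ^ n * q a)" for n
  proof -
    let ?h = "X ^ n - (\<Sum>a\<in>A. smult (poly (X ^ n) a) (lagrange A a))"
    obtain h where h: "?h = (\<Prod>a\<in>A. [:-a, 1:]) * h" using lagrange_interpolation[OF A] by blast
    have "?h \<circ>\<^sub>p T = ((\<Prod>z\<in>A. [:-z, 1:]) \<circ>\<^sub>p T) * (h \<circ>\<^sub>p T)" unfolding h by (rule pcompose_mult)
    then have "cpoly f dvd ?h \<circ>\<^sub>p T" using s(1) unfolding T_def by simp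
    moreover have "?h \<circ>\<^sub>p T = T ^ n - (\<Sum>a\<in>A. smult (a ^ n) (lagrange A a \<circ>\<^sub>p T))"
      by (simp add: pcompose_diff pcompose_hom.hom_power pcompose_sum pcompose_smult X_def pcompose_pCons)
    ultimately have "\<Lambda> (T ^ n - (\<Sum>a\<in>A. smult (a ^ n) (lagrange A a \<circ>\<^sub>p T))) = 0" using L0 by metis
    then show ?thesis by (simp add: L q_def)
  qed
  \<comment> \<open>The rationality of \<open>s\<close> makes this number rational; it involves only
    \<open>s\<close> and \<open>r\<close>, so it is the same for all \<open>p\<close>.\<close>
  define c where "c = (\<Sum>i\<le>degree s. coeff s i * r i)"
  have tc: "\<Lambda> T = of_rat c"
    by (simp add: \<Lambda>_def linear_form_def T_def c_def rc_def of_rat_sum of_rat_mult degree_map_poly)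
  obtain K where K: "number_field K" "A \<subseteq> K"
    using number_field_roots[OF number_field_rat f0] unfolding A_def by blast
  note Kf = number_fieldD[OF K(1)]
  note Kc = Kf(8,9,1,2)
  have TK: "coeffs_in K T" by (simp add: T_def coeffs_in_def Kf(11))
  have "coeffs_in K (smult (inverse (a - b)) [:-b, 1:])" if "a \<in> A" "b \<in> A" for a b
  proof -
    have ab: "a \<in> K" "b \<in> K" using that K(2) by auto
    have "inverse (a - b) \<in> K" "- (inverse (a - b) * b) \<in> K"
      by (intro Kf(5) Kf(2) Kf(4) Kf(6) ab)+
    then show ?thesis by (simp add: coeffs_in_pCons[OF Kc] coeffs_in_0[OF Kc])
  qed
  note factor = this
  have "coeffs_in K (lagrange A a)" if a: "a \<in> A" for a
    unfolding lagrange_def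
    by (rule coeffs_in_prod; (rule Kf(8) | rule Kf(9) | erule (1) Kf(1) | erule (1) Kf(2) | (rule factor[OF a], simp)))
  then have qK: "q ` A \<subseteq> K"
    unfolding q_def \<Lambda>_def using TK by (auto intro!: linear_form_in_closed Kc coeffs_in_pcompose[OF Kc] simp: rc_def Kf(11))
  \<comment> \<open>Everything that has to be integral at \<open>p\<close>: once these elements lie
    in \<open>R\<close>, so do all terms of the sequence and all values of the functional used
    below.\<close>
  define S where "S = A \<union> q ` A \<union> coeff T ` {..degree T} \<union> rc ` {..<k} \<union> (\<lambda>i. of_rat (c0 i)) ` {1..k}"
  have SK: "S \<subseteq> K" unfolding S_def using K(2) qK TK Kf(11) by (auto simp: rc_def coeffs_in_def)
  have finS: "finite S" using A by (simp add: S_def)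
  have "p_integral p c \<and> [rat_mod p (r p) = rat_mod p c] (mod int p)"
    if p: "p > degree f" and h: "residue_hom p R \<psi>" and SR: "S \<subseteq> R" for p R \<psi>
  proof -
    note h' = residue_homD[OF h]
    note Rc = h'(4,5,6,7)
    have p0: "p > 0" using p by simp
    have AR: "A \<subseteq> R" "q ` A \<subseteq> R" and c0R: "\<And>i. i \<in> {1..k} \<Longrightarrow> of_rat (c0 i) \<in> R"
      and rk: "\<And>n. n < k \<Longrightarrow> rc n \<in> R"
      using SR unfolding S_def by blast+
    have rR: "rc n \<in> R" for n
    proof (induction n rule: less_induct)
      case (less n)
      show ?case
      proof (cases "n < k")
        case False
        then have "rc n = (\<Sum>i=1..k. of_rat (c0 i) * rc (n - i))"
          using rec[of "n - k"] by (simp add: rc_def of_rat_sum of_rat_mult)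
        moreover have "of_rat (c0 i) * rc (n - i) \<in> R" if i: "i \<in> {1..k}" for i
          using less[of "n - i"] c0R[OF i] i False by (intro h'(7)) auto
        then have "(\<Sum>i=1..k. of_rat (c0 i) * rc (n - i)) \<in> R"
          by - (rule sum_in_closed; (rule h'(4) | erule (1) h'(6) | blast))
        ultimately show ?thesis by (simp only:)
      qed (rule rk)
    qed
    have TR: "coeffs_in R T"
      unfolding coeffs_in_def
    proof
      fix i show "coeff T i \<in> R"
        using SR h'(4) unfolding S_def by (cases "i \<le> degree T") (auto simp: coeff_eq_0)
    qed
    have XR: "coeffs_in R (X - T)"
    proof -
      have "coeff (X - T) i = coeff X i + of_int (-1) * coeff T i" for i by simp
      moreover have "coeffs_in R X" unfolding X_def by (intro coeffs_in_pCons[OF Rc] coeffs_in_0[OF Rc] h')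
      ultimately show ?thesis using TR h'(2)[of "-1"] unfolding coeffs_in_def by (metis h'(6,7))
    qed
    have LR: "\<Lambda> ((X - T) ^ j * T ^ i) \<in> R" for i j
      unfolding \<Lambda>_def by (intro linear_form_in_closed Rc coeffs_in_mult[OF Rc] coeffs_in_power[OF Rc] XR TR rR)
    have "X ^ p = ((X - T) + T) ^ p" by simp
    also have "\<dots> = (\<Sum>j\<le>p. of_nat (p choose j) * (X - T) ^ j * T ^ (p - j))" by (rule binomial_ring)
    finally have "X ^ p = (\<Sum>j\<le>p. smult (of_nat (p choose j)) ((X - T) ^ j * T ^ (p - j)))"
      by (simp add: of_nat_poly)
    then have "rc p = (\<Sum>j\<le>p. of_nat (p choose j) * \<Lambda> ((X - T) ^ j * T ^ (p - j)))"
      unfolding LX[symmetric] by (simp add: L)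
    also have "{..p} = insert 0 (insert p {0<..<p})" using p0 by auto
    also have "(\<Sum>j\<in>\<dots>. of_nat (p choose j) * \<Lambda> ((X - T) ^ j * T ^ (p - j))) =
        \<Lambda> (T ^ p) + (\<Lambda> ((X - T) ^ p) + (\<Sum>j\<in>{0<..<p}. of_nat (p choose j) * \<Lambda> ((X - T) ^ j * T ^ (p - j))))"
      using p0 by simp
    also have "\<Lambda> ((X - T) ^ p) = 0"
      using s(2) p unfolding X_def T_def by (intro L0) (meson dvd_trans le_imp_power_dvd less_imp_le)
    also have "(\<Sum>j\<in>{0<..<p}. of_nat (p choose j) * \<Lambda> ((X - T) ^ j * T ^ (p - j))) =
        of_int (int p) * (\<Sum>j\<in>{0<..<p}. of_int (int ((p choose j) div p)) * \<Lambda> ((X - T) ^ j * T ^ (p - j)))"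
      unfolding sum_distrib_left
    proof (rule sum.cong[OF refl])
      fix j assume j: "j \<in> {0<..<p}"
      then have "p dvd (p choose j)" using h'(1) by (intro dvd_choose_prime) auto
      then have "of_nat (p choose j) = (of_nat (p * ((p choose j) div p)) :: complex)" by simp
      also have "\<dots> = of_int (int p) * of_int (int ((p choose j) div p))" by (simp only: of_nat_mult of_int_of_nat_eq)
      finally show "of_nat (p choose j) * \<Lambda> ((X - T) ^ j * T ^ (p - j)) =
        of_int (int p) * (of_int (int ((p choose j) div p)) * \<Lambda> ((X - T) ^ j * T ^ (p - j)))" by (simp only: mult.assoc)
    qed
    finally obtain y where y: "rc p = \<Lambda> (T ^ p) + of_int (int p) * y"
      "y = (\<Sum>j\<in>{0<..<p}. of_int (int ((p choose j) div p)) * \<Lambda> ((X - T) ^ j * T ^ (p - j)))" by auto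
    have yR: "y \<in> R" unfolding y(2) by (intro sum_in_closed h'(4,6) h'(7)[OF h'(2) LR])
    have pyR: "of_int (int p) * y \<in> R" by (rule h'(7)[OF h'(2) yR])
    have "[\<psi> (of_int (int p) * y) = \<psi> (of_int (int p)) * \<psi> y] (mod int p)" by (rule h'(9)[OF h'(2) yR])
    also have "[\<psi> (of_int (int p)) * \<psi> y = int p * \<psi> y] (mod int p)" by (rule cong_scalar_right[OF h'(3)])
    finally have py: "[\<psi> (of_int (int p) * y) = 0] (mod int p)" by (simp add: cong_def)
    have TpR: "\<Lambda> (T ^ n) \<in> R" for n using LR[of 0 n] by simp
    have "[\<psi> (rc p) = \<psi> (\<Lambda> (T ^ p)) + \<psi> (of_int (int p) * y)] (mod int p)"
      unfolding y(1) by (rule h'(8)[OF TpR pyR])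
    also have "[\<psi> (\<Lambda> (T ^ p)) + \<psi> (of_int (int p) * y) = \<psi> (\<Lambda> (T ^ p)) + 0] (mod int p)"
      by (intro cong_add cong_refl py)
    finally have 1: "[\<psi> (rc p) = \<psi> (\<Lambda> (T ^ p))] (mod int p)" by simp
    have summand: "x ^ n * q x \<in> R" if "x \<in> A" for x n using that AR h'(7,11) by blast
    \<comment> \<open>Here degree one is used: residues are represented by integers, so Fermat's
      theorem replaces \<open>a ^ p\<close> by \<open>a\<close>.\<close>
    have sums: "[\<psi> (\<Sum>a\<in>B. a ^ p * q a) = \<psi> (\<Sum>a\<in>B. a ^ 1 * q a)] (mod int p)" if "B \<subseteq> A" for B
      using finite_subset[OF that A] that
    proof (induction B rule: finite_induct)
      case (insert a B)
      then have a: "a \<in> R" "q a \<in> R" "a \<in> A" and B: "B \<subseteq> A" using AR by auto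
      have SB: "(\<Sum>a\<in>B. a ^ n * q a) \<in> R" for n using summand B by (intro sum_in_closed h'(4,6)) auto
      have one: "[\<psi> (a ^ n * q a) = \<psi> a ^ n * \<psi> (q a)] (mod int p)" for n
        using h'(9)[OF h'(11)[OF a(1)] a(2)] cong_scalar_right[OF h'(12)[OF a(1)]] by (rule cong_trans)
      have "[\<psi> (a ^ p * q a + (\<Sum>a\<in>B. a ^ p * q a)) = \<psi> (a ^ p * q a) + \<psi> (\<Sum>a\<in>B. a ^ p * q a)] (mod int p)"
        by (rule h'(8)[OF summand[OF a(3)] SB])
      also have "[\<psi> (a ^ p * q a) + \<psi> (\<Sum>a\<in>B. a ^ p * q a) = \<psi> (a ^ 1 * q a) + \<psi> (\<Sum>a\<in>B. a ^ 1 * q a)] (mod int p)"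
      proof (intro cong_add insert.IH B)
        have "[\<psi> a ^ p * \<psi> (q a) = \<psi> a ^ 1 * \<psi> (q a)] (mod int p)"
          unfolding power_one_right by (rule cong_scalar_right[OF fermat_int[OF h'(1)]])
        then show "[\<psi> (a ^ p * q a) = \<psi> (a ^ 1 * q a)] (mod int p)"
          using one[of p] one[of 1] by (meson cong_sym cong_trans)
      qed
      also have "[\<psi> (a ^ 1 * q a) + \<psi> (\<Sum>a\<in>B. a ^ 1 * q a) = \<psi> (a ^ 1 * q a + (\<Sum>a\<in>B. a ^ 1 * q a))] (mod int p)"
        by (rule cong_sym[OF h'(8)[OF summand[OF a(3)] SB]])
      finally show ?case using insert.hyps by simp
    qed simp
    have cR: "of_rat c \<in> R" using TpR[of 1] tc by simp
    have 2: "[\<psi> (\<Lambda> (T ^ p)) = \<psi> (of_rat c)] (mod int p)"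
      using sums[OF order_refl] tT[of p] tT[of 1] tc by simp
    have "[rat_mod p (r p) = \<psi> (rc p)] (mod int p)"
      using residue_hom_of_rat(2)[OF h] rR[of p] unfolding rc_def by (simp add: cong_sym_eq)
    also note 1
    also note 2
    also have "[\<psi> (of_rat c) = rat_mod p c] (mod int p)" by (rule residue_hom_of_rat(2)[OF h cR])
    finally show ?thesis using residue_hom_of_rat(1)[OF h cR] by blast
  qed
  with K(1) finS SK show ?thesis
    by (intro exI[of _ c] exI[of _ K] exI[of _ S] exI[of _ "degree f"]) blast
qed

section \<open>Roots of unity of 2-power order\<close>

text \<open>A compatible choice of primitive roots, each the square of the next, so that a field is
  measured by the largest index it contains.\<close>

definition zeta :: "nat \<Rightarrow> complex" where
  "zeta m = cis (2 * pi / 2 ^ m)"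

lemma zeta_Suc: "zeta (Suc m) ^ 2 = zeta m"
  by (simp add: zeta_def power2_eq_square cis_mult field_simps)

lemma zeta_add: "zeta (m + n) ^ (2 ^ n) = zeta m"
  by (induction n) (simp_all add: zeta_Suc power_mult)

lemma zeta_0: "zeta 0 = 1" and zeta_1: "zeta 1 = -1" and zeta_2: "zeta 2 = \<i>"
proof -
  show "zeta 0 = 1" by (simp add: zeta_def complex_eq_iff)
  show "zeta 1 = -1" by (simp add: zeta_def)
  have "2 * pi / 2 ^ 2 = pi / 2" by simp
  then show "zeta 2 = \<i>" by (simp only: zeta_def cis_pi_half)
qed

lemma zeta_mono:
  assumes "number_field K" "zeta n \<in> K" "m \<le> n"
  shows "zeta m \<in> K"
  using number_fieldD(10)[OF assms(1,2), of "2 ^ (n - m)"] zeta_add[of m "n - m"] assms(3) by simp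

text \<open>Adjoining a square root to \<open>G\<close> creates no new element with \<open>x\<^sup>4 \<in> F\<close> and \<open>x\<^sup>2 \<notin> F\<close>: this keeps
  roots of unity of \<open>2\<close>-power order under control in multiquadratic extensions.\<close>

lemma fourth_power_quadratic:
  assumes F: "number_field F" and G: "number_field G" "F \<subseteq> G" and i: "\<i> \<in> F"
    and s: "s ^ 2 \<in> F" "s \<notin> G" and old: "\<And>x. x \<in> G \<Longrightarrow> x ^ 4 \<in> F \<Longrightarrow> x ^ 2 \<in> F"
    and x: "x = a + b * s" "a \<in> G" "b \<in> G" "x ^ 4 \<in> F"
  shows "x ^ 2 \<in> F"
proof -
  note Gf = number_fieldD[OF G(1)] and Ff = number_fieldD[OF F]
  have sG: "s ^ 2 \<in> G" using s G by blast
  define A where "A = a ^ 2 + b ^ 2 * s ^ 2"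
  define B where "B = 2 * a * b"
  have two: "(2::complex) \<in> G" using Gf(3)[of 2] by simp
  have AB: "A \<in> G" "B \<in> G" unfolding A_def B_def
    by (rule Gf(1)[OF Gf(10)[OF x(2)] Gf(2)[OF Gf(10)[OF x(3)] sG]], rule Gf(2)[OF Gf(2)[OF two x(2)] x(3)])
  have x2: "x ^ 2 = A + B * s" unfolding x A_def B_def by (simp add: algebra_simps power2_eq_square)
  have x4: "x ^ 4 = (A ^ 2 + B ^ 2 * s ^ 2) + (2 * A * B) * s"
  proof -
    have "x ^ 4 = (x ^ 2) ^ 2" by simp
    then show ?thesis unfolding x2 by (simp add: algebra_simps power2_eq_square)
  qed
  have "2 * A * B = 0"
  proof (rule ccontr)
    assume n: "2 * A * B \<noteq> 0"
    have "x ^ 4 - (A ^ 2 + B ^ 2 * s ^ 2) \<in> G"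
      by (rule Gf(6)[OF subsetD[OF G(2) x(4)] Gf(1)[OF Gf(10)[OF AB(1)] Gf(2)[OF Gf(10)[OF AB(2)] sG]]])
    moreover have "2 * A * B \<in> G" by (intro Gf(2) two AB)
    ultimately have "(x ^ 4 - (A ^ 2 + B ^ 2 * s ^ 2)) / (2 * A * B) \<in> G" by (rule Gf(7))
    moreover have "(x ^ 4 - (A ^ 2 + B ^ 2 * s ^ 2)) / (2 * A * B) = s" unfolding x4 using n by simp
    ultimately show False using s(2) by simp
  qed
  then consider "b = 0" | "a = 0" "b \<noteq> 0" | "A = 0" "b \<noteq> 0" by (auto simp: B_def)
  then show ?thesis
  proof cases
    case 1
    then show ?thesis using old x by simp
  next
    case 2
    have s0: "s ^ 2 \<noteq> 0" using s(2) Gf(8) by auto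
    have "x ^ 4 = b ^ 4 * (s ^ 2) ^ 2" using x(1) 2 by (simp add: power_mult_distrib)
    then have "b ^ 4 = x ^ 4 / (s ^ 2) ^ 2" using s0 by simp
    then have "b ^ 4 \<in> F" using Ff(7)[OF x(4) Ff(10)[OF s(1), of 2]] by simp
    then have "b ^ 2 \<in> F" using old x(3) by blast
    then have "b ^ 2 * s ^ 2 \<in> F" using s(1) by (rule Ff(2))
    then show ?thesis using x(1) 2 by (simp add: power_mult_distrib)
  next
    case 3
    then have "s ^ 2 = (\<i> * a / b) ^ 2" unfolding A_def by (simp add: field_simps eq_neg_iff_add_eq_0)
    then have "s = \<i> * a / b \<or> s = - (\<i> * a / b)" by (simp only: power2_eq_iff)
    moreover have "\<i> * a / b \<in> G" using i G(2) x by (intro Gf(7) Gf(2)) auto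
    ultimately show ?thesis using s(2) Gf(5) by blast
  qed
qed

text \<open>Square roots are adjoined one at a time. The invariant refers to the fixed base
  \<open>F\<close> and not to the intermediate field; in this form
  \<open>fourth_power_quadratic\<close> carries it through any number of steps, so for roots of
  unity a whole layer costs no more than a single square root.\<close>

lemma multiquadratic_extension:
  assumes F: "number_field F" and i: "\<i> \<in> F" and S: "finite S" "S \<subseteq> F"
  shows "\<exists>G. number_field G \<and> F \<subseteq> G \<and> csqrt ` S \<subseteq> G \<and> (\<forall>x\<in>G. x ^ 4 \<in> F \<longrightarrow> x ^ 2 \<in> F)"
  using S
proof (induction S rule: finite_induct)
  case empty
  show ?case by (rule exI[of _ F]) (use F number_fieldD(10)[OF F] in auto)
next
  case (insert \<delta> S)
  then obtain G where G: "number_field G" "F \<subseteq> G" "csqrt ` S \<subseteq> G" "\<And>x. x \<in> G \<Longrightarrow> x ^ 4 \<in> F \<Longrightarrow> x ^ 2 \<in> F" by auto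
  show ?case
  proof (cases "csqrt \<delta> \<in> G")
    case True
    then show ?thesis using G by (intro exI[of _ G]) auto
  next
    case False
    have s: "csqrt \<delta> ^ 2 \<in> F" "csqrt \<delta> ^ 2 \<in> G" using insert G(2) by auto
    let ?G = "{a + b * csqrt \<delta> | a b. a \<in> G \<and> b \<in> G}"
    have 1: "number_field ?G" by (rule number_field_sqrt[OF G(1) s(2) False])
    have 2: "G \<subseteq> ?G"
    proof
      fix x assume "x \<in> G"
      moreover have "x = x + 0 * csqrt \<delta>" by simp
      ultimately show "x \<in> ?G" using number_fieldD(8)[OF G(1)] by blast
    qed
    have "csqrt \<delta> = 0 + 1 * csqrt \<delta>" by simp
    then have 3: "csqrt \<delta> \<in> ?G" using number_fieldD(8,9)[OF G(1)] by blast
    have 4: "x ^ 2 \<in> F" if x: "x \<in> ?G" "x ^ 4 \<in> F" for x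
    proof -
      from x(1) obtain a b where "x = a + b * csqrt \<delta>" "a \<in> G" "b \<in> G" by blast
      from fourth_power_quadratic[OF F G(1,2) i s(1) False G(4) this x(2)] show ?thesis .
    qed
    show ?thesis
      by (rule exI[of _ ?G], intro conjI 1 ballI impI 4) (use 2 3 G in auto)
  qed
qed

lemma two_times_square_rat: "2 * (q :: rat) ^ 2 \<noteq> 1" "2 * q ^ 2 \<noteq> - 1"
proof -
  show "2 * q ^ 2 \<noteq> 1"
  proof
    assume q: "2 * q ^ 2 = 1"
    obtain m n where mn: "quotient_of q = (m, n)" by force
    have n: "n > 0" "coprime m n" "q = of_int m / of_int n"
      using quotient_of_denom_pos[OF mn] quotient_of_coprime[OF mn] quotient_of_div[OF mn] by auto
    have "of_int (2 * m ^ 2) = (of_int (n ^ 2) :: rat)" using q n by (simp add: power_divide field_simps)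
    then have e: "2 * m ^ 2 = n ^ 2" by (simp only: of_int_eq_iff)
    then have "even (n ^ 2)" by (metis dvd_triv_left)
    then have "even n" by simp
    then obtain k where "n = 2 * k" by blast
    then have "m ^ 2 = 2 * k ^ 2" using e by (simp add: power_mult_distrib)
    then have "even (m ^ 2)" by simp
    then have "even m" by simp
    then show False using n(2) \<open>even n\<close> by auto
  qed
  show "2 * q ^ 2 \<noteq> - 1"
  proof
    assume "2 * q ^ 2 = - 1"
    moreover have "0 \<le> 2 * q ^ 2" by simp
    ultimately show False by linarith
  qed
qed

text \<open>The fields \<open>\<rat>(\<zeta>\<^sub>4)\<close>, \<open>\<rat>(\<zeta>\<^sub>8)\<close>, \<open>\<dots>\<close> have degrees \<open>2, 4, \<dots>\<close>.\<close>

lemma cyclotomic_order: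
  "\<exists>w. number_order (2 ^ Suc k) w \<and> zeta (k + 2) \<in> number_order.Frac (2 ^ Suc k) w \<and>
     zeta (k + 3) \<notin> number_order.Frac (2 ^ Suc k) w \<and>
     (\<forall>K. number_field K \<longrightarrow> zeta (k + 2) \<in> K \<longrightarrow> number_order.Frac (2 ^ Suc k) w \<subseteq> K)"
proof (induction k)
  case 0
  let ?Q = "range (of_rat :: rat \<Rightarrow> complex)"
  interpret number_order 1 "\<lambda>_. 1"
    by (rule number_orderI) (auto intro: exI[of _ "\<lambda>_. 1"])
  have Q: "Frac = ?Q"
  proof (rule equalityI; rule subsetI)
    fix x assume "x \<in> Frac"
    then obtain n m :: int where "n \<noteq> 0" "of_int n * x = of_int m"
      unfolding Frac_def Ord_def comb_def by auto
    then have "x = of_rat (Rat.Fract m n)" by (simp add: of_rat_rat field_simps)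
    then show "x \<in> ?Q" by simp
  next
    fix x assume x: "x \<in> ?Q"
    have "number_field Frac"
      unfolding number_field_def by (rule exI, rule exI, rule conjI, rule number_order_axioms, rule refl)
    from number_fieldD(11)[OF this] show "x \<in> Frac" using x by blast
  qed
  have iQ: "\<i> \<notin> ?Q"
  proof
    assume "\<i> \<in> ?Q"
    then obtain q where "\<i> = of_rat q" by blast
    then have "of_rat (q ^ 2) = (of_rat (- 1) :: complex)" by (simp add: of_rat_power flip: power2_eq_square)
    then have "q ^ 2 = - 1" by (simp only: of_rat_eq_iff)
    moreover have "0 \<le> q ^ 2" by simp
    ultimately show False by linarith
  qed
  have "\<i> ^ 2 \<in> Frac" using Frac_of_int[of "-1"] by simp
  moreover have "\<i> \<notin> Frac" unfolding Q by (rule iQ)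
  ultimately obtain w where w: "number_order (2 * 1) w" "number_order.Frac (2 * 1) w = {a + b * \<i> | a b. a \<in> Frac \<and> b \<in> Frac}"
    using Frac_sqrt[of \<i>] by blast
  have two: "2 * 1 = (2 ^ Suc 0 :: nat)" by simp
  have "zeta (0 + 2) \<in> {a + b * \<i> | a b. a \<in> Frac \<and> b \<in> Frac}"
  proof -
    have "zeta (0 + 2) = of_int 0 + of_int 1 * \<i>" using zeta_2 by (simp add: numeral_2_eq_2)
    then show ?thesis using Frac_of_int by blast
  qed
  moreover have "zeta (0 + 3) \<notin> {a + b * \<i> | a b. a \<in> Frac \<and> b \<in> Frac}"
  proof
    assume "zeta (0 + 3) \<in> {a + b * \<i> | a b. a \<in> Frac \<and> b \<in> Frac}"
    then obtain a b where ab: "zeta 3 = of_rat a + of_rat b * \<i>" unfolding Q by auto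
    \<comment> \<open>Squaring \<open>a + b * \<i>\<close> gives \<open>a ^ 2 = b ^ 2\<close> and
      \<open>2 * a * b = 1\<close>, so \<open>2 * a ^ 2\<close> would be 1 or -1 for a rational
      \<open>a\<close>.\<close>
    have "zeta 3 ^ 2 = \<i>" using zeta_Suc[of 2] zeta_2 by (simp add: numeral_3_eq_3 numeral_2_eq_2)
    then have "of_rat (a ^ 2 - b ^ 2) + of_rat (2 * a * b) * \<i> = \<i>"
      unfolding ab by (simp add: algebra_simps power2_eq_square of_rat_diff of_rat_mult)
    then have "of_rat (2 * a * b - 1) * \<i> = of_rat (b ^ 2 - a ^ 2)"
      by (simp add: algebra_simps of_rat_diff)
    then have e: "2 * a * b - 1 = 0"
    proof (rule contrapos_pp)
      assume n: "2 * a * b - 1 \<noteq> 0"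
      show "of_rat (2 * a * b - 1) * \<i> \<noteq> of_rat (b ^ 2 - a ^ 2)"
      proof
        assume "of_rat (2 * a * b - 1) * \<i> = of_rat (b ^ 2 - a ^ 2)"
        then have "\<i> = of_rat (b ^ 2 - a ^ 2) / of_rat (2 * a * b - 1)" using n by (simp add: field_simps)
        then have "\<i> = of_rat ((b ^ 2 - a ^ 2) / (2 * a * b - 1))" by (simp only: of_rat_divide)
        then show False using iQ by blast
      qed
    qed
    then have "of_rat (b ^ 2 - a ^ 2) = (0 :: complex)" using \<open>of_rat (2 * a * b - 1) * \<i> = of_rat (b ^ 2 - a ^ 2)\<close> by simp
    then have "b ^ 2 = a ^ 2" by simp
    then have "b = a \<or> b = - a" by (simp only: power2_eq_iff)
    then show False using e two_times_square_rat[of a] by (auto simp: power2_eq_square)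
  qed
  moreover have "{a + b * \<i> | a b. a \<in> Frac \<and> b \<in> Frac} \<subseteq> K" if K: "number_field K" "zeta (0 + 2) \<in> K" for K
  proof -
    have "\<i> \<in> K" using K(2) zeta_2 by (simp add: numeral_2_eq_2)
    then show ?thesis unfolding Q using number_fieldD(1,2,11)[OF K(1)] by auto
  qed
  ultimately show ?case using w unfolding two by (intro exI[of _ w]) simp
next
  case (Suc k)
  then obtain w where w: "number_order (2 ^ Suc k) w" "zeta (k + 2) \<in> number_order.Frac (2 ^ Suc k) w"
    "zeta (k + 3) \<notin> number_order.Frac (2 ^ Suc k) w"
    "\<And>K. number_field K \<Longrightarrow> zeta (k + 2) \<in> K \<Longrightarrow> number_order.Frac (2 ^ Suc k) w \<subseteq> K" by blast
  define F where "F = number_order.Frac (2 ^ Suc k) w"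
  have F: "number_field F"
    unfolding number_field_def F_def by (rule exI, rule exI, rule conjI, rule w(1), rule refl)
  have sq: "zeta (k + 3) ^ 2 = zeta (k + 2)" "zeta (k + 4) ^ 2 = zeta (k + 3)"
    using zeta_Suc[of "k + 2"] zeta_Suc[of "k + 3"] by (simp_all add: eval_nat_numeral)
  have s: "zeta (k + 3) ^ 2 \<in> F" "zeta (k + 3) \<notin> F" unfolding sq F_def by (rule w)+
  obtain W where W: "number_order (2 * 2 ^ Suc k) W"
    "number_order.Frac (2 * 2 ^ Suc k) W = {a + b * zeta (k + 3) | a b. a \<in> F \<and> b \<in> F}"
    using number_order.Frac_sqrt[OF w(1), of "zeta (k + 3)"] s unfolding F_def by blast
  have i: "\<i> \<in> F" using zeta_mono[OF F, of "k + 2" 2] w(2) zeta_2 unfolding F_def by simp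
  have "zeta (k + 3) = 0 + 1 * zeta (k + 3)" by simp
  then have 1: "zeta (k + 3) \<in> {a + b * zeta (k + 3) | a b. a \<in> F \<and> b \<in> F}"
    using number_fieldD(8,9)[OF F] by blast
  \<comment> \<open>An element of the extension with fourth power in \<open>F\<close> has its square
    in \<open>F\<close>, but the square of \<open>zeta (k + 4)\<close> is
    \<open>zeta (k + 3)\<close>.\<close>
  have 2: "zeta (k + 4) \<notin> {a + b * zeta (k + 3) | a b. a \<in> F \<and> b \<in> F}"
  proof
    assume "zeta (k + 4) \<in> {a + b * zeta (k + 3) | a b. a \<in> F \<and> b \<in> F}"
    then obtain a b where ab: "zeta (k + 4) = a + b * zeta (k + 3)" "a \<in> F" "b \<in> F" by blast
    have "zeta (k + 4) ^ 4 = (zeta (k + 4) ^ 2) ^ 2" by simp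
    then have "zeta (k + 4) ^ 4 \<in> F" using s(1) by (simp only: sq)
    from fourth_power_quadratic[OF F F order_refl i s number_fieldD(10)[OF F] ab this]
    show False using s(2) unfolding sq by blast
  qed
  have 3: "{a + b * zeta (k + 3) | a b. a \<in> F \<and> b \<in> F} \<subseteq> K" if K: "number_field K" "zeta (k + 3) \<in> K" for K
  proof -
    have "F \<subseteq> K" unfolding F_def by (rule w(4)[OF K(1) zeta_mono[OF K]]) simp
    then show ?thesis using number_fieldD(1,2)[OF K(1)] K(2) by blast
  qed
  have nat: "2 * 2 ^ Suc k = (2 ^ Suc (Suc k) :: nat)" "Suc k + 2 = k + 3" "Suc k + 3 = k + 4" by simp_all
  show ?case unfolding nat(2,3)
    by (rule exI[of _ W]) (use W 1 2 3 in \<open>simp add: nat(1)[symmetric] del: power_Suc\<close>)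
qed

text \<open>Otherwise the field, the fraction field of an order of some rank \<open>d\<close>, would
  contain the cyclotomic field of degree \<open>2 ^ (d + 1)\<close>, whose basis after clearing
  denominators contradicts \<open>rank_le\<close>.\<close>

lemma zeta_bounded:
  assumes "number_field K"
  shows "\<exists>N. \<forall>n. zeta n \<in> K \<longrightarrow> n < N"
proof (rule ccontr)
  assume "\<not> ?thesis"
  then have "\<And>N. \<exists>n. zeta n \<in> K \<and> N \<le> n" by (meson not_less)
  then have all: "zeta m \<in> K" for m using zeta_mono[OF assms] by blast
  from assms obtain d v where dv: "number_order d v" "K = number_order.Frac d v" by (auto simp: number_field_def)
  interpret number_order d v by (fact dv(1))
  let ?e = "2 ^ Suc d :: nat"
  obtain w where w: "number_order ?e w" "number_order.Frac ?e w \<subseteq> K"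
    using cyclotomic_order[of d] all assms by blast
  interpret W: number_order ?e w by (fact w(1))
  have "w j \<in> W.Ord" if j: "j < ?e" for j
  proof -
    have "w j = (\<Sum>i<?e. of_int (if i = j then 1 else 0) * w i)"
      using j by (subst sum.cong[OF refl, of _ _ "\<lambda>i. if i = j then w j else 0"]) auto
    then show ?thesis unfolding W.Ord_def W.comb_def by (rule range_eqI[of _ _ "\<lambda>i. if i = j then 1 else 0"])
  qed
  then have wF: "w ` {..<?e} \<subseteq> Frac" using W.Ord_subset_Frac w(2) unfolding dv(2) by blast
  obtain n :: int where n: "n > 0" "\<forall>x\<in>w ` {..<?e}. of_int n * x \<in> Ord"
    using common_denominator[OF _ wF] by auto
  have "?e \<le> d"
  proof (rule rank_le[of ?e "\<lambda>j. of_int n * w j"])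
    fix a :: "nat \<Rightarrow> int" assume "(\<Sum>j<?e. of_int (a j) * (of_int n * w j)) = 0"
    then have "of_int n * (\<Sum>j<?e. of_int (a j) * w j) = 0" by (simp add: sum_distrib_left mult_ac)
    then have "(\<Sum>j<?e. of_int (a j) * w j) = 0" using n(1) by simp
    then show "\<forall>j<?e. a j = 0" by (rule W.indep)
  qed (use n in auto)
  moreover have "d < 2 ^ d" by (rule less_exp)
  ultimately show False by simp
qed

section \<open>Two-isogenies and division by two\<close>

definition curve :: "'a :: field \<Rightarrow> 'a \<Rightarrow> ('a \<times> 'a) option set" where
  "curve a b = insert None (Some ` {(x, y). y ^ 2 = x * (x ^ 2 + a * x + b)})"

text \<open>Slope of the chord, or of the tangent at a point with nonzero ordinate. Vertical lines
  are left out; their third point is at infinity.\<close>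

definition is_slope :: "'a :: field \<Rightarrow> 'a \<Rightarrow> 'a \<Rightarrow> 'a \<Rightarrow> 'a \<Rightarrow> 'a \<Rightarrow> 'a \<Rightarrow> bool" where
  "is_slope a b x1 y1 x2 y2 m \<longleftrightarrow> x1 \<noteq> x2 \<and> y2 - y1 = m * (x2 - x1) \<or>
     x1 = x2 \<and> y1 = y2 \<and> y1 \<noteq> 0 \<and> 2 * y1 * m = 3 * x1 ^ 2 + 2 * a * x1 + b"

text \<open>The third intersection point of a line is the negative of the sum of the other two, so these
  are the subgroups; the group law itself is not needed.\<close>

definition closed_points :: "'a :: field \<Rightarrow> 'a \<Rightarrow> ('a \<times> 'a) option set \<Rightarrow> bool" where
  "closed_points a b H \<longleftrightarrow> H \<subseteq> curve a b \<and> None \<in> H \<and> (\<forall>x y. Some (x, y) \<in> H \<longrightarrow> Some (x, - y) \<in> H) \<and>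
     (\<forall>x1 y1 x2 y2 m. Some (x1, y1) \<in> H \<longrightarrow> Some (x2, y2) \<in> H \<longrightarrow> is_slope a b x1 y1 x2 y2 m \<longrightarrow>
        Some (m ^ 2 - a - x1 - x2, y1 + m * (m ^ 2 - a - x1 - x2 - x1)) \<in> H)"

lemma closed_pointsD:
  assumes "closed_points a b H"
  shows "None \<in> H" "\<And>x y. Some (x, y) \<in> H \<Longrightarrow> y ^ 2 = x * (x ^ 2 + a * x + b)"
    "\<And>x y. Some (x, y) \<in> H \<Longrightarrow> Some (x, - y) \<in> H"
    "\<And>x1 y1 x2 y2 m x3. Some (x1, y1) \<in> H \<Longrightarrow> Some (x2, y2) \<in> H \<Longrightarrow> is_slope a b x1 y1 x2 y2 m \<Longrightarrow>
        x3 = m ^ 2 - a - x1 - x2 \<Longrightarrow> Some (x3, y1 + m * (x3 - x1)) \<in> H"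
  using assms unfolding closed_points_def curve_def by blast+

text \<open>Vieta's relations for the cubic \<open>x (x^2 + a x + b) - (m x + c)^2\<close>, whose
  third root \<open>x3\<close> is read off from the sum of the roots. For a tangent the relation for
  the products of pairs is the tangency condition; for a chord it appears after cancelling
  \<open>x1 - x2\<close>.\<close>

lemma slope_symmetric_functions:
  fixes a b :: "'a :: field"
  assumes on: "y1 ^ 2 = x1 * (x1 ^ 2 + a * x1 + b)" "y2 ^ 2 = x2 * (x2 ^ 2 + a * x2 + b)"
    and m: "is_slope a b x1 y1 x2 y2 m" and c: "c = y1 - m * x1" and x3: "x3 = m ^ 2 - a - x1 - x2"
  shows "y1 = m * x1 + c" "y2 = m * x2 + c" "x1 * x2 + x1 * x3 + x2 * x3 = b - 2 * m * c" "x1 * x2 * x3 = c ^ 2"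
proof -
  show y1: "y1 = m * x1 + c" by (simp add: c)
  show y2: "y2 = m * x2 + c" using m c by (auto simp: is_slope_def algebra_simps)
  have a: "a = m ^ 2 - x1 - x2 - x3" by (simp add: x3)
  show pair: "x1 * x2 + x1 * x3 + x2 * x3 = b - 2 * m * c"
  proof (cases "x1 = x2")
    case True
    then have "2 * y1 * m = 3 * x1 ^ 2 + 2 * a * x1 + b" using m by (auto simp: is_slope_def)
    then show ?thesis unfolding y1 a True by (simp add: algebra_simps power2_eq_square)
  next
    case False
    have "(x1 - x2) * (x1 * x2 + x1 * x3 + x2 * x3 - (b - 2 * m * c)) =
      ((m * x1 + c) ^ 2 - x1 * (x1 ^ 2 + a * x1 + b)) - ((m * x2 + c) ^ 2 - x2 * (x2 ^ 2 + a * x2 + b))"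
      unfolding a by (simp add: algebra_simps power2_eq_square)
    also have "\<dots> = 0" using on unfolding y1 y2 by simp
    finally show ?thesis using False by simp
  qed
  have "c ^ 2 - x1 * x2 * x3 = ((m * x1 + c) ^ 2 - x1 * (x1 ^ 2 + a * x1 + b))
     + x1 * (b - 2 * m * c - (x1 * x2 + x1 * x3 + x2 * x3))"
    unfolding a by (simp add: algebra_simps power2_eq_square)
  also have "\<dots> = 0" using on(1) pair unfolding y1 by simp
  finally show "x1 * x2 * x3 = c ^ 2" by simp
qed

lemma closed_points_curve: "closed_points a b (curve a b)"
proof -
  have "y3 ^ 2 = x3 * (x3 ^ 2 + a * x3 + b)"
    if on: "y1 ^ 2 = x1 * (x1 ^ 2 + a * x1 + b)" "y2 ^ 2 = x2 * (x2 ^ 2 + a * x2 + b)"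
      and m: "is_slope a b x1 y1 x2 y2 m" and x3: "x3 = m ^ 2 - a - x1 - x2" and y3: "y3 = y1 + m * (x3 - x1)"
    for x1 y1 x2 y2 m x3 y3
  proof -
    define c where "c = y1 - m * x1"
    note sym = slope_symmetric_functions[OF on m c_def x3]
    have a: "a = m ^ 2 - x1 - x2 - x3" by (simp add: x3)
    have "y3 = m * x3 + c" by (simp add: y3 c_def algebra_simps)
    then have "y3 ^ 2 - x3 * (x3 ^ 2 + a * x3 + b) =
      (c ^ 2 - x1 * x2 * x3) - x3 * (b - 2 * m * c - (x1 * x2 + x1 * x3 + x2 * x3))"
      unfolding a by (simp add: algebra_simps power2_eq_square)
    also have "\<dots> = 0" using sym(3,4) by simp
    finally show ?thesis by simp
  qed
  then show ?thesis unfolding closed_points_def curve_def by auto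
qed

text \<open>The 2-isogeny with kernel \<open>None\<close>, \<open>(0, 0)\<close> onto the curve with
  parameters \<open>- 2 * a\<close> and \<open>a ^ 2 - 4 * b\<close>. It is written in terms of the
  slope \<open>y / x\<close> of the line to the origin, which suits its compatibility with
  lines.\<close>

fun isogeny :: "'a :: field \<Rightarrow> 'a \<Rightarrow> ('a \<times> 'a) option \<Rightarrow> ('a \<times> 'a) option" where
  "isogeny a b None = None" |
  "isogeny a b (Some (x, y)) = (if x = 0 then None else Some ((y / x) ^ 2, y / x * (b / x - x)))"

lemma isogeny_on_curve:
  fixes a b :: "'a :: field"
  assumes "y ^ 2 = x * (x ^ 2 + a * x + b)" "x \<noteq> 0"
  shows "(y / x) ^ 2 = x + a + b / x"
    "(y / x * (b / x - x)) ^ 2 = (y / x) ^ 2 * (((y / x) ^ 2) ^ 2 + (- 2 * a) * (y / x) ^ 2 + (a ^ 2 - 4 * b))"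
proof -
  show X: "(y / x) ^ 2 = x + a + b / x"
    using assms by (simp add: power_divide field_simps power2_eq_square)
  have "(b / x - x) ^ 2 = (x + a + b / x) ^ 2 + (- 2 * a) * (x + a + b / x) + (a ^ 2 - 4 * b)"
    using assms(2) by (simp add: field_simps power2_eq_square)
  then show "(y / x * (b / x - x)) ^ 2 = (y / x) ^ 2 * (((y / x) ^ 2) ^ 2 + (- 2 * a) * (y / x) ^ 2 + (a ^ 2 - 4 * b))"
    unfolding power_mult_distrib X by simp
qed

text \<open>With \<open>w\<^sub>i = c / x\<^sub>i\<close> for the points \<open>(x\<^sub>i, m x\<^sub>i + c)\<close> of a line, \<open>x\<^sub>1 = w\<^sub>2 w\<^sub>3\<close> and so on,
  and collinearity of the images becomes a polynomial identity.\<close>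

lemma isogeny_line:
  fixes w1 w2 w3 m :: "'a :: field"
  assumes a: "a = m ^ 2 - (w1 * w2 + w1 * w3 + w2 * w3)" and q: "q = w1 + w2 + w3 + 2 * m"
    and M: "M = q - m" and C: "C = a * m - w1 * w2 * w3 - m ^ 2 * q"
  shows "(m + w1) * (w1 * q - w2 * w3) = M * (m + w1) ^ 2 + C"
    "(m + w2) * (w2 * q - w1 * w3) = M * (m + w2) ^ 2 + C"
    "(m + w3) * (w3 * q - w1 * w2) = M * (m + w3) ^ 2 + C"
    "(m + w1) ^ 2 + (m + w2) ^ 2 + (m + w3) ^ 2 = M ^ 2 + 2 * a"
    "(m + w1) ^ 2 * (m + w2) ^ 2 + (m + w1) ^ 2 * (m + w3) ^ 2 + (m + w2) ^ 2 * (m + w3) ^ 2 =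
       a ^ 2 - 4 * (w1 * w2 * w3 * q) - 2 * M * C"
  unfolding a q M C by (simp_all add: algebra_simps power2_eq_square)

context
  fixes a b :: "'a :: field" and H
  assumes two: "(2 :: 'a) \<noteq> 0" and b: "b \<noteq> 0" and ab: "a ^ 2 - 4 * b \<noteq> 0"
    and H: "closed_points a b H" and T: "Some (0, 0) \<in> H"
begin

text \<open>Two points of the image are lifted to \<open>H\<close>, the line through the lifts gives
  a third point there, and its image lies on the line through the given points. The lifts have to be
  chosen so that chords and tangents correspond, and the line has to stay away from the kernel point
  \<open>(0, 0)\<close>.\<close>

lemma closed_points_isogeny: "closed_points (- 2 * a) (a ^ 2 - 4 * b) (isogeny a b ` H)"
proof -
  note Hd = closed_pointsD[OF H]
  have pre: "\<exists>x y. Some (x, y) \<in> H \<and> x \<noteq> 0 \<and> X = (y / x) ^ 2 \<and> Y = y / x * (b / x - x)"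
    if "Some (X, Y) \<in> isogeny a b ` H" for X Y
  proof -
    from that obtain P where P: "P \<in> H" "Some (X, Y) = isogeny a b P" by blast
    then obtain x y where "P = Some (x, y)" "x \<noteq> 0" by (cases P) (auto split: if_splits)
    then show ?thesis using P by auto
  qed
  have image: "Some ((y / x) ^ 2, y / x * (b / x - x)) \<in> isogeny a b ` H" if "Some (x, y) \<in> H" "x \<noteq> 0" for x y
    using that by (intro image_eqI[of _ _ "Some (x, y)"]) auto
  have "isogeny a b ` H \<subseteq> curve (- 2 * a) (a ^ 2 - 4 * b)"
  proof
    fix P assume P: "P \<in> isogeny a b ` H"
    show "P \<in> curve (- 2 * a) (a ^ 2 - 4 * b)"
    proof (cases P)
      case (Some Q)
      then obtain X Y where XY: "P = Some (X, Y)" by (cases Q) auto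
      then obtain x y where xy: "Some (x, y) \<in> H" "x \<noteq> 0" "X = (y / x) ^ 2" "Y = y / x * (b / x - x)"
        using pre P by blast
      have "Y ^ 2 = X * (X ^ 2 + (- 2 * a) * X + (a ^ 2 - 4 * b))"
        unfolding xy(3,4) by (rule isogeny_on_curve(2)[OF Hd(2)[OF xy(1)] xy(2)])
      then show ?thesis unfolding XY curve_def by blast
    qed (simp add: curve_def)
  qed
  moreover have "None \<in> isogeny a b ` H" using Hd(1) by (intro image_eqI[of _ _ None]) auto
  moreover have "Some (X, - Y) \<in> isogeny a b ` H" if P: "Some (X, Y) \<in> isogeny a b ` H" for X Y
  proof -
    obtain x y where xy: "Some (x, y) \<in> H" "x \<noteq> 0" "X = (y / x) ^ 2" "Y = y / x * (b / x - x)"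
      using pre[OF P] by blast
    show ?thesis using image[OF Hd(3)[OF xy(1)] xy(2)] xy(3,4) by simp
  qed
  moreover have "Some (M ^ 2 - (- 2 * a) - X1 - X2, Y1 + M * (M ^ 2 - (- 2 * a) - X1 - X2 - X1)) \<in> isogeny a b ` H"
    if P: "Some (X1, Y1) \<in> isogeny a b ` H" "Some (X2, Y2) \<in> isogeny a b ` H"
      and M: "is_slope (- 2 * a) (a ^ 2 - 4 * b) X1 Y1 X2 Y2 M" for X1 Y1 X2 Y2 M
  proof -
    obtain x1 y1 where 1: "Some (x1, y1) \<in> H" "x1 \<noteq> 0" "X1 = (y1 / x1) ^ 2" "Y1 = y1 / x1 * (b / x1 - x1)"
      using pre[OF P(1)] by blast
    \<comment> \<open>When the images coincide the same lift is taken twice, so that the tangent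
      corresponds to a tangent; otherwise distinct abscissas of the images force distinct abscissas
      of the lifts.\<close>
    have "\<exists>x2 y2 m. Some (x2, y2) \<in> H \<and> x2 \<noteq> 0 \<and> X2 = (y2 / x2) ^ 2 \<and> Y2 = y2 / x2 * (b / x2 - x2) \<and>
        is_slope a b x1 y1 x2 y2 m \<and> (X1 = X2 \<longrightarrow> x1 = x2)"
    proof (cases "X1 = X2")
      case True
      then have Y: "Y1 = Y2" "Y1 \<noteq> 0" using M by (auto simp: is_slope_def)
      then have y1: "y1 \<noteq> 0" using 1 by auto
      have "is_slope a b x1 y1 x1 y1 ((3 * x1 ^ 2 + 2 * a * x1 + b) / (2 * y1))"
        using y1 two by (simp add: is_slope_def)
      then show ?thesis using 1 True Y by blast
    next
      case False
      obtain x2 y2 where 2: "Some (x2, y2) \<in> H" "x2 \<noteq> 0" "X2 = (y2 / x2) ^ 2" "Y2 = y2 / x2 * (b / x2 - x2)"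
        using pre[OF P(2)] by blast
      have "x1 \<noteq> x2"
      proof
        assume "x1 = x2"
        then have "X1 = X2" using Hd(2)[OF 1(1)] Hd(2)[OF 2(1)] 1(3) 2(3) by (simp add: power_divide)
        then show False using False by blast
      qed
      then have "is_slope a b x1 y1 x2 y2 ((y2 - y1) / (x2 - x1))" by (simp add: is_slope_def)
      then show ?thesis using 2 False by blast
    qed
    then obtain x2 y2 m where 2: "Some (x2, y2) \<in> H" "x2 \<noteq> 0" "X2 = (y2 / x2) ^ 2" "Y2 = y2 / x2 * (b / x2 - x2)"
      and m: "is_slope a b x1 y1 x2 y2 m" and same: "X1 = X2 \<Longrightarrow> x1 = x2" by blast
    define c where "c = y1 - m * x1"
    define x3 where "x3 = m ^ 2 - a - x1 - x2"
    note sym = slope_symmetric_functions[OF Hd(2)[OF 1(1)] Hd(2)[OF 2(1)] m c_def x3_def]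
    have 3: "Some (x3, m * x3 + c) \<in> H" using Hd(4)[OF 1(1) 2(1) m x3_def] by (simp add: c_def algebra_simps)
    \<comment> \<open>A line through the origin has third point \<open>(0, 0)\<close>. Then both
      images have abscissa \<open>m ^ 2\<close>, the lifts coincide, and their image has ordinate 0,
      where no tangent slope is defined.\<close>
    have c: "c \<noteq> 0"
    proof
      assume c: "c = 0"
      then have "x3 = 0" using sym(4) 1(2) 2(2) by simp
      have "X1 = X2" using sym(1,2) 1 2 c by simp
      then have "x1 * x1 = b" using sym(3) same c \<open>x3 = 0\<close> by simp
      then have "Y1 = 0" using 1(2,4) by (simp add: field_simps)
      moreover have "Y1 \<noteq> 0" using M \<open>X1 = X2\<close> by (auto simp: is_slope_def)
      ultimately show False by blast
    qed
    then have x3: "x3 \<noteq> 0" using sym(4) by auto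
    define w1 w2 w3 where w: "w1 = c / x1" "w2 = c / x2" "w3 = c / x3"
    have xw: "x1 = w2 * w3" "x2 = w1 * w3" "x3 = w1 * w2"
      using sym(4) 1(2) 2(2) x3 c by (simp_all add: w field_simps power2_eq_square)
    have cw: "c = w1 * w2 * w3" using xw(3) w(3) x3 by (simp add: field_simps)
    have w0: "w1 \<noteq> 0" "w2 \<noteq> 0" "w3 \<noteq> 0" using cw c by auto
    define q where "q = w1 + w2 + w3 + 2 * m"
    have bq: "b = w1 * w2 * w3 * q" using sym(3) unfolding q_def xw cw by (simp add: algebra_simps)
    have aw: "a = m ^ 2 - (w1 * w2 + w1 * w3 + w2 * w3)" using x3_def xw by (simp add: algebra_simps)
    have s: "y1 / x1 = m + w1" "y2 / x2 = m + w2" "(m * x3 + c) / x3 = m + w3"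
      using sym(1,2) 1(2) 2(2) x3 by (simp_all add: w field_simps)
    have bx: "b / x1 = w1 * q" "b / x2 = w2 * q" "b / x3 = w3 * q" unfolding bq xw using w0 by simp_all
    define M' where "M' = q - m"
    define C where "C = a * m - w1 * w2 * w3 - m ^ 2 * q"
    note line = isogeny_line[OF aw q_def M'_def C_def]
    have "Y1 = (m + w1) * (w1 * q - w2 * w3)" unfolding 1(4) s(1) bx(1) by (simp only: xw(1))
    then have XY1: "X1 = (m + w1) ^ 2" "Y1 = M' * X1 + C" by (simp_all only: 1(3) s(1) line(1))
    have "Y2 = (m + w2) * (w2 * q - w1 * w3)" unfolding 2(4) s(2) bx(2) by (simp only: xw(2))
    then have XY2: "X2 = (m + w2) ^ 2" "Y2 = M' * X2 + C" by (simp_all only: 2(3) s(2) line(2))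
    define X3 where "X3 = (m + w3) ^ 2"
    have P3: "Some (X3, M' * X3 + C) \<in> isogeny a b ` H"
    proof -
      have "(m * x3 + c) / x3 * (b / x3 - x3) = (m + w3) * (w3 * q - w1 * w2)"
        unfolding s(3) bx(3) by (simp only: xw(3))
      also have "\<dots> = M' * X3 + C" by (simp only: line(3) X3_def)
      finally show ?thesis using image[OF 3 x3] by (simp only: s(3) X3_def)
    qed
    have sum: "X1 + X2 + X3 = M' ^ 2 + 2 * a" using line(4) XY1(1) XY2(1) by (simp only: X3_def)
    have pair: "X1 * X2 + X1 * X3 + X2 * X3 = a ^ 2 - 4 * b - 2 * M' * C"
      using line(5) unfolding XY1(1) XY2(1) X3_def bq by simp
    \<comment> \<open>In the tangent case the slope is given by the derivative; eliminating the
      coefficients through \<open>sum\<close> and \<open>pair\<close> shows that \<open>M'\<close>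
      satisfies the same equation.\<close>
    have "M = M'"
    proof (cases "X1 = X2")
      case False
      then have "M * (X2 - X1) = Y2 - Y1" using M by (simp add: is_slope_def)
      also have "\<dots> = M' * (X2 - X1)" using XY1 XY2 by (simp add: algebra_simps)
      finally show ?thesis using False by simp
    next
      case True
      then have *: "Y1 \<noteq> 0" "2 * Y1 * M = 3 * X1 ^ 2 + 2 * (- 2 * a) * X1 + (a ^ 2 - 4 * b)"
        using M by (auto simp: is_slope_def)
      have A: "2 * a = 2 * X1 + X3 - M' ^ 2" using sum True by (simp add: algebra_simps)
      have B: "a ^ 2 - 4 * b = X1 ^ 2 + 2 * X1 * X3 + 2 * M' * C"
        using pair True by (simp add: algebra_simps power2_eq_square)
      have "3 * X1 ^ 2 + 2 * (- 2 * a) * X1 + (a ^ 2 - 4 * b) = 3 * X1 ^ 2 - 2 * (2 * a) * X1 + (a ^ 2 - 4 * b)" by simp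
      also have "\<dots> = 2 * Y1 * M'" unfolding A B XY1(2) by (simp add: algebra_simps power2_eq_square)
      finally show ?thesis using * two by simp
    qed
    moreover have "M' * X3 + C = Y1 + M' * (X3 - X1)" unfolding XY1(2) by (simp add: algebra_simps)
    moreover have "M' ^ 2 - (- 2 * a) - X1 - X2 = X3" using sum by (simp add: algebra_simps)
    ultimately show ?thesis using P3 by (simp only:)
  qed
  ultimately show ?thesis unfolding closed_points_def by blast
qed

text \<open>Addition of the kernel point \<open>(0, 0)\<close>, written out in coordinates; its
  orbits are the fibres of the isogeny by \<open>isogeny_eq_iff\<close>.\<close>

fun translate :: "('a \<times> 'a) option \<Rightarrow> ('a \<times> 'a) option" where
  "translate None = Some (0, 0)" |
  "translate (Some (x, y)) = (if x = 0 then None else Some (b / x, - (b * y / x ^ 2)))"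

lemma translate_closed:
  assumes P: "P \<in> H"
  shows "translate P \<in> H"
proof (cases P rule: translate.cases)
  case (2 x y)
  show ?thesis
  proof (cases "x = 0")
    case False
    have xy: "Some (x, y) \<in> H" using P 2 by simp
    have m: "is_slope a b 0 0 x y (y / x)" using False by (simp add: is_slope_def)
    have "b / x = (y / x) ^ 2 - a - 0 - x"
      using isogeny_on_curve(1)[OF closed_pointsD(2)[OF H xy] False] by simp
    from closed_pointsD(3)[OF H closed_pointsD(4)[OF H T xy m this]]
    show ?thesis using False 2 by (simp add: power2_eq_square mult.commute)
  qed (use 2 closed_pointsD(1)[OF H] in simp)
qed (use T in simp)

text \<open>A fixed affine point would have \<open>b = x ^ 2\<close> and \<open>y = 0\<close>,
  making \<open>x\<close> a double root of the quadratic factor, against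
  \<open>a ^ 2 - 4 * b\<close> being nonzero.\<close>

lemma translate_neq:
  assumes P: "P \<in> H"
  shows "translate P \<noteq> P"
proof (cases P rule: translate.cases)
  case (2 x y)
  show ?thesis
  proof
    assume e: "translate P = P"
    then have x: "x \<noteq> 0" using 2 by auto
    then have bx: "b / x = x" and y: "- (b * y / x ^ 2) = y" using e 2 by auto
    have b: "b = x * x" using bx x by (simp add: field_simps)
    then have "2 * y = 0" using y x by (simp add: power2_eq_square)
    then have "y = 0" using two by simp
    then have "x * (x * (2 * x + a)) = 0"
      using closed_pointsD(2)[OF H P[unfolded 2]] b by (simp add: algebra_simps power2_eq_square)
    then have "a = - 2 * x" using x by (simp add: eq_neg_iff_add_eq_0 add.commute)
    then show False using ab b by (simp add: power2_eq_square)
  qed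
qed simp

text \<open>Equal values of \<open>x + a + b / x\<close> leave \<open>x' = x\<close> or
  \<open>x' = b / x\<close>, and equal squares leave a sign for the slope. The wrong sign is
  compatible with the second coordinate only if \<open>y = 0\<close> or \<open>x * x = b\<close>,
  and then the candidate coincides with \<open>P\<close> or its translate.\<close>

lemma isogeny_eq_iff:
  assumes P: "P \<in> H" and Q: "Q \<in> H"
  shows "isogeny a b Q = isogeny a b P \<longleftrightarrow> Q \<in> {P, translate P}"
proof -
  have zero: "y = 0" if "Some (0, y) \<in> H" for y using closed_pointsD(2)[OF H that] by simp
  consider "P = None \<or> P = Some (0, 0)" | x y where "P = Some (x, y)" "x \<noteq> 0"
    using zero P by (cases P rule: translate.cases) metis+
  then show ?thesis
  proof cases
    case 1
    then show ?thesis using zero Q by (cases Q) (auto split: if_splits)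
  next
    case (2 x y)
    note e = isogeny_on_curve(1)[OF closed_pointsD(2)[OF H P[unfolded 2(1)]] 2(2)]
    have y0: "x * x = b" if "y / x * (b / x - x) = - (y / x * (b / x - x))" "y \<noteq> 0"
    proof -
      have "2 * (y / x * (b / x - x)) = 0" using that(1) by (metis add.right_inverse mult_2)
      then show ?thesis using that(2) 2(2) two by (simp add: field_simps)
    qed
    show ?thesis
    proof
      assume eq: "isogeny a b Q = isogeny a b P"
      then obtain x' y' where Q': "Q = Some (x', y')" "x' \<noteq> 0" using 2 by (cases Q) (auto split: if_splits)
      note e' = isogeny_on_curve(1)[OF closed_pointsD(2)[OF H Q[unfolded Q'(1)]] Q'(2)]
      from eq have X: "(y' / x') ^ 2 = (y / x) ^ 2" and Y: "y' / x' * (b / x' - x') = y / x * (b / x - x)"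
        using 2 Q' by auto
      have "(x' - x) * (x' * x - b) = 0"
        using X unfolding e e' using 2(2) Q'(2) by (simp add: field_simps)
      then have "x' = x \<or> x' * x = b" unfolding mult_eq_0_iff by simp
      then consider "x' = x" | "x' = b / x" using 2(2) by (auto simp: nonzero_eq_divide_eq)
      moreover have "y' / x' = y / x \<or> y' / x' = - (y / x)" using X by (simp add: power2_eq_iff)
      then have "y' = y / x * x' \<or> y' = - (y / x) * x'" unfolding nonzero_divide_eq_eq[OF Q'(2)] .
      ultimately consider "x' = x" "y' = y / x * x'" | "x' = x" "y' = - (y / x) * x'"
        | "x' = b / x" "y' = y / x * x'" | "x' = b / x" "y' = - (y / x) * x'" by blast
      then show "Q \<in> {P, translate P}"
      proof cases
        case 1
        then show ?thesis using 2 Q' by simp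
      next
        case *: 2
        then have y': "y' = - y" using 2(2) by simp
        show ?thesis
        proof (cases "y = 0")
          case False
          have "- y / x * (b / x - x) = y / x * (b / x - x)" using Y by (simp only: *(1) y')
          then have "y / x * (b / x - x) = - (y / x * (b / x - x))" by (metis minus_divide_left minus_mult_left)
          then have "x * x = b" using y0 False by blast
          then have "b / x = x" "b * y / x ^ 2 = y" using 2(2) by (auto simp: power2_eq_square)
          then show ?thesis using 2 Q' *(1) y' by simp
        qed (use 2 Q' * in simp)
      next
        case 3
        then have y': "y' = b * y / x ^ 2" by (simp add: power2_eq_square)
        show ?thesis
        proof (cases "y = 0")
          case False
          have "y' / x' = y / x" "b / x' = x" using 3 2(2) b by simp_all
          then have "y / x * (x - b / x) = y / x * (b / x - x)" using Y 3(1) by (simp only:)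
          then have "y / x * (b / x - x) = - (y / x * (b / x - x))" by (metis minus_diff_eq mult_minus_right)
          then have "x * x = b" using y0 False by blast
          then have "b / x = x" "b * y / x ^ 2 = y" using 2(2) by (auto simp: power2_eq_square)
          then show ?thesis using 2 Q' 3(1) y' by simp
        qed (use 2 Q' 3 y' in simp)
      next
        case 4
        then show ?thesis using 2 Q' by (simp add: power2_eq_square)
      qed
    next
      assume "Q \<in> {P, translate P}"
      then consider "Q = P" | "Q = Some (b / x, - (b * y / x ^ 2))" using 2 by auto
      then show "isogeny a b Q = isogeny a b P"
      proof cases
        case *: 2
        have t: "- (b * y / x ^ 2) / (b / x) = - (y / x)" "b / (b / x) = x"
          using 2(2) b by (simp_all add: power2_eq_square)
        have "isogeny a b Q = Some ((- (b * y / x ^ 2) / (b / x)) ^ 2, - (b * y / x ^ 2) / (b / x) * (b / (b / x) - b / x))"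
          unfolding * isogeny.simps using 2(2) b by (simp only: divide_eq_0_iff simp_thms if_False)
        also have "\<dots> = Some ((y / x) ^ 2, y / x * (b / x - x))" unfolding t by (simp add: right_diff_distrib)
        finally show ?thesis using 2 by simp
      qed simp
    qed
  qed
qed

lemma card_isogeny:
  assumes "finite H"
  shows "card H = 2 * card (isogeny a b ` H)"
proof -
  have "card {Q \<in> H. isogeny a b Q = R} = 2" if R: "R \<in> isogeny a b ` H" for R
  proof -
    from R obtain P where P: "P \<in> H" "R = isogeny a b P" by blast
    have "{Q \<in> H. isogeny a b Q = R} = {P, translate P}"
      using isogeny_eq_iff[OF P(1)] translate_closed[OF P(1)] P by blast
    then show ?thesis using translate_neq[OF P(1)] by simp
  qed
  moreover have "card H = (\<Sum>R\<in>isogeny a b ` H. card {Q \<in> H. isogeny a b Q = R})"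
    using sum.image_gen[OF assms, of "\<lambda>_. 1 :: nat" "isogeny a b"] by simp
  ultimately show ?thesis by simp
qed

end

fun rescale :: "('a :: field \<times> 'a) option \<Rightarrow> ('a \<times> 'a) option" where
  "rescale None = None" |
  "rescale (Some (x, y)) = Some (x / 4, y / 8)"

text \<open>Multiplication by 2, factored as the isogeny followed by its dual. The composition of
  the two formulas lands on the curve with parameters \<open>4 * a\<close> and
  \<open>16 * b\<close>, and \<open>rescale\<close> brings it back. Counting fibres thus reduces to
  two maps with fibres of size 2.\<close>

definition double :: "'a :: field \<Rightarrow> 'a \<Rightarrow> ('a \<times> 'a) option \<Rightarrow> ('a \<times> 'a) option" where
  "double a b P = rescale (isogeny (- 2 * a) (a ^ 2 - 4 * b) (isogeny a b P))"

lemma powers_of_two_nonzero: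
  assumes "(2 :: 'a :: field) \<noteq> 0"
  shows "(4 :: 'a) \<noteq> 0" "(8 :: 'a) \<noteq> 0" "(16 :: 'a) \<noteq> 0"
proof -
  have "(4 :: 'a) = 2 * 2" "(8 :: 'a) = 2 * 2 * 2" "(16 :: 'a) = 2 * 2 * 2 * 2" by simp_all
  then show "(4 :: 'a) \<noteq> 0" "(8 :: 'a) \<noteq> 0" "(16 :: 'a) \<noteq> 0" using assms by (simp_all only: mult_eq_0_iff simp_thms)
qed

lemma inj_rescale: "(2 :: 'a :: field) \<noteq> 0 \<Longrightarrow> inj (rescale :: ('a \<times> 'a) option \<Rightarrow> _)"
  using powers_of_two_nonzero[where 'a = 'a] by (auto simp: inj_def elim!: rescale.elims)

lemma closed_points_rescale:
  fixes a b :: "'a :: field"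
  assumes two: "(2 :: 'a) \<noteq> 0" and H: "closed_points (4 * a) (16 * b) H"
  shows "closed_points a b (rescale ` H)"
proof -
  note nz = two powers_of_two_nonzero[OF two]
  note Hd = closed_pointsD[OF H]
  have mem: "Some (x, y) \<in> rescale ` H \<longleftrightarrow> Some (4 * x, 8 * y) \<in> H" for x y
  proof
    assume "Some (x, y) \<in> rescale ` H"
    then obtain P where P: "P \<in> H" "Some (x, y) = rescale P" by blast
    then obtain x' y' where P': "P = Some (x', y')" by (cases P) auto
    then have "4 * x = x'" "8 * y = y'" using P(2) nz by (auto simp: mult.commute)
    then show "Some (4 * x, 8 * y) \<in> H" using P(1) P' by simp
  qed (use nz in \<open>auto intro!: image_eqI[of _ _ "Some (4 * x, 8 * y)"]\<close>)
  have "y ^ 2 = x * (x ^ 2 + a * x + b)" if "Some (x, y) \<in> rescale ` H" for x y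
  proof -
    have "(8 * y) ^ 2 = 4 * x * ((4 * x) ^ 2 + 4 * a * (4 * x) + 16 * b)" using Hd(2) that mem by blast
    then have "(16 * 4) * y ^ 2 = (16 * 4) * (x * (x ^ 2 + a * x + b))" by (simp add: algebra_simps power2_eq_square)
    then show ?thesis using nz by (metis mult_eq_0_iff mult_left_cancel)
  qed
  then have "rescale ` H \<subseteq> curve a b"
    unfolding curve_def by (intro subsetI) (metis (mono_tags, lifting) case_prodI image_eqI insertCI mem_Collect_eq option.exhaust surj_pair)
  moreover have "None \<in> rescale ` H" using Hd(1) by (intro image_eqI[of _ _ None]) auto
  moreover have "Some (x, - y) \<in> rescale ` H" if "Some (x, y) \<in> rescale ` H" for x y
    using Hd(3) that unfolding mem by simp
  moreover have "Some (m ^ 2 - a - x1 - x2, y1 + m * (m ^ 2 - a - x1 - x2 - x1)) \<in> rescale ` H"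
    if P: "Some (x1, y1) \<in> rescale ` H" "Some (x2, y2) \<in> rescale ` H" and m: "is_slope a b x1 y1 x2 y2 m" for x1 y1 x2 y2 m
  proof -
    have "is_slope (4 * a) (16 * b) (4 * x1) (8 * y1) (4 * x2) (8 * y2) (2 * m)"
    proof (cases "x1 = x2")
      case True
      then have *: "y1 = y2" "y1 \<noteq> 0" "2 * y1 * m = 3 * x1 ^ 2 + 2 * a * x1 + b" using m by (auto simp: is_slope_def)
      have "2 * (8 * y1) * (2 * m) = 16 * (2 * y1 * m)" by simp
      also have "\<dots> = 3 * (4 * x1) ^ 2 + 2 * (4 * a) * (4 * x1) + 16 * b" unfolding *(3) by (simp add: algebra_simps power2_eq_square)
      finally show ?thesis using * True nz by (simp add: is_slope_def)
    next
      case False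
      then have "y2 - y1 = m * (x2 - x1)" using m by (simp add: is_slope_def)
      then have "8 * (y2 - y1) = 8 * (m * (x2 - x1))" by (simp only:)
      then have "8 * y2 - 8 * y1 = 2 * m * (4 * x2 - 4 * x1)" by (simp add: algebra_simps)
      then show ?thesis using False nz by (simp add: is_slope_def)
    qed
    from Hd(4)[OF P[unfolded mem] this refl] show ?thesis
      unfolding mem by (simp add: algebra_simps power2_eq_square)
  qed
  ultimately show ?thesis unfolding closed_points_def by blast
qed

text \<open>The count for the second isogeny requires its own kernel point to lie in the image of
  \<open>H\<close>; the 2-torsion point \<open>(e, 0)\<close> is mapped to it. So two independent
  2-torsion points must lie in \<open>H\<close>.\<close>

lemma double_closed_points:
  fixes a b :: "'a :: field"
  assumes two: "(2 :: 'a) \<noteq> 0" and b: "b \<noteq> 0" and ab: "a ^ 2 - 4 * b \<noteq> 0" and H: "closed_points a b H"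
    and T: "Some (0, 0) \<in> H" and S: "Some (e, 0) \<in> H" "e \<noteq> 0"
  shows "closed_points a b (double a b ` H)" "finite H \<Longrightarrow> card H = 4 * card (double a b ` H)"
proof -
  let ?a = "- 2 * a" and ?b = "a ^ 2 - 4 * b"
  let ?I = "isogeny a b ` H"
  note I = closed_points_isogeny[OF two b ab H T]
  have b': "?a ^ 2 - 4 * ?b = 16 * b" by (simp add: power2_eq_square)
  have b'0: "?a ^ 2 - 4 * ?b \<noteq> 0" unfolding b' using powers_of_two_nonzero[OF two] b by simp
  have T': "Some (0, 0) \<in> ?I" using S by (intro image_eqI[of _ _ "Some (e, 0)"]) auto
  note J = closed_points_isogeny[OF two ab b'0 I T']
  have a': "- 2 * ?a = 4 * a" by simp
  have D: "double a b ` H = rescale ` isogeny ?a ?b ` ?I" by (auto simp: double_def image_image)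
  show "closed_points a b (double a b ` H)"
    unfolding D using J unfolding b' a' by (rule closed_points_rescale[OF two])
  assume fin: "finite H"
  have "card (double a b ` H) = card (isogeny ?a ?b ` ?I)"
    unfolding D by (rule card_image[OF inj_on_subset[OF inj_rescale[OF two] subset_UNIV]])
  moreover have "card H = 2 * card ?I" by (rule card_isogeny[OF two b ab H T fin])
  moreover have "card ?I = 2 * card (isogeny ?a ?b ` ?I)"
    by (rule card_isogeny[OF two ab b'0 I T']) (use fin in simp)
  ultimately show "card H = 4 * card (double a b ` H)" by simp
qed

fun neg :: "('a :: field \<times> 'a) option \<Rightarrow> ('a \<times> 'a) option" where
  "neg None = None" |
  "neg (Some (x, y)) = Some (x, - y)"

lemma double_neg: "double a b (neg P) = neg (double a b P)"
  by (cases P) (auto simp: double_def)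

text \<open>The classical criterion for divisibility by 2 when all 2-torsion is rational:
  \<open>X\<close>, \<open>X - e\<close> and \<open>X - f\<close> are squares, and their roots give
  the abscissa of a half. The product of the roots is not compared with \<open>Y\<close>, so the
  double is known only up to sign.\<close>

lemma halve_point:
  fixes X :: "'a :: field"
  assumes two: "(2 :: 'a) \<noteq> 0" and e: "e \<noteq> 0" "f \<noteq> 0" "e \<noteq> f"
    and r: "r1 ^ 2 = X" "r2 ^ 2 = X - e" "r3 ^ 2 = X - f"
    and Y: "Y ^ 2 = X * (X - e) * (X - f)" and x: "x = (r1 + r2) * (r1 + r3)"
  shows "\<exists>y. y ^ 2 = x * (x - e) * (x - f) \<and> double (- (e + f)) (e * f) (Some (x, y)) \<in> {Some (X, Y), neg (Some (X, Y))}"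
proof -
  define y where "y = x * (r2 + r3)"
  have ef: "e = r1 ^ 2 - r2 ^ 2" "f = r1 ^ 2 - r3 ^ 2" using r by simp_all
  have on: "y ^ 2 = x * (x - e) * (x - f)" unfolding y_def x ef by (simp add: algebra_simps power2_eq_square)
  have "e = (r1 + r2) * (r1 - r2)" "f = (r1 + r3) * (r1 - r3)" "f - e = (r2 + r3) * (r2 - r3)"
    unfolding ef by (simp_all add: algebra_simps power2_eq_square)
  then have nz: "r1 + r2 \<noteq> 0" "r1 + r3 \<noteq> 0" "r2 + r3 \<noteq> 0" using e by auto
  then have x0: "x \<noteq> 0" and y0: "y \<noteq> 0" by (auto simp: x y_def)
  let ?a = "- (e + f)" and ?b = "e * f"
  have on': "y ^ 2 = x * (x ^ 2 + ?a * x + ?b)" unfolding on by (simp add: algebra_simps power2_eq_square)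
  define u v where uv: "u = (y / x) ^ 2" "v = y / x * (?b / x - x)"
  have uv_on: "v ^ 2 = u * (u ^ 2 + (- 2 * ?a) * u + (?a ^ 2 - 4 * ?b))"
    unfolding uv by (rule isogeny_on_curve(2)[OF on' x0])
  have u0: "u \<noteq> 0" using x0 y0 by (simp add: uv)
  have "?b - x ^ 2 = (- 2 * r1) * y" unfolding y_def x ef by (simp add: algebra_simps power2_eq_square)
  moreover have "v / u = (?b - x ^ 2) / y" using x0 y0 by (simp add: uv field_simps power2_eq_square)
  ultimately have s: "v / u = - 2 * r1" using y0 by simp
  define w where "w = v / u * ((?a ^ 2 - 4 * ?b) / u - u) / 8"
  have D: "double ?a ?b (Some (x, y)) = Some (X, w)"
  proof -
    have "isogeny ?a ?b (Some (x, y)) = Some (u, v)" using x0 by (simp add: uv)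
    then have "double ?a ?b (Some (x, y)) = Some ((v / u) ^ 2 / 4, w)" using u0 by (simp add: double_def w_def)
    moreover have "(v / u) ^ 2 / 4 = X"
      unfolding s r(1)[symmetric] using powers_of_two_nonzero(1)[OF two] by (simp add: power2_eq_square)
    ultimately show ?thesis by simp
  qed
  have "(8 * w) ^ 2 = (v / u) ^ 2 * (((v / u) ^ 2) ^ 2 + (- 2 * (- 2 * ?a)) * (v / u) ^ 2 + ((- 2 * ?a) ^ 2 - 4 * (?a ^ 2 - 4 * ?b)))"
    using isogeny_on_curve(2)[OF uv_on u0] powers_of_two_nonzero[OF two] by (simp add: w_def)
  also have "\<dots> = 64 * (X * (X - e) * (X - f))"
    unfolding s r(1)[symmetric] by (simp add: algebra_simps power2_eq_square)
  finally have "8 * 8 * w ^ 2 = 8 * 8 * Y ^ 2" unfolding Y by (simp add: power_mult_distrib)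
  then have "w ^ 2 = Y ^ 2"
    unfolding mult.assoc mult_left_cancel[OF powers_of_two_nonzero(2)[OF two]] .
  then have "w = Y \<or> w = - Y" by (simp add: power2_eq_iff)
  then show ?thesis using on D by (intro exI[of _ y]) auto
qed

text \<open>Only abscissas are recorded, since each halving fixes its point only up to sign.\<close>

definition half_chain :: "'a :: field \<Rightarrow> 'a \<Rightarrow> (nat \<Rightarrow> 'a) \<Rightarrow> nat \<Rightarrow> bool" where
  "half_chain e f X n \<longleftrightarrow> (\<exists>r1 r2 r3. \<forall>k<n. r1 k ^ 2 = X k \<and> r2 k ^ 2 = X k - e \<and> r3 k ^ 2 = X k - f \<and>
     X (Suc k) = (r1 k + r2 k) * (r1 k + r3 k))"

text \<open>The signs lost by \<open>halve_point\<close> are harmless: \<open>double\<close>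
  commutes with \<open>neg\<close>, and the starting point has ordinate 0, so it equals its own
  negative.\<close>

lemma half_chain_point:
  fixes X :: "nat \<Rightarrow> 'a :: field"
  assumes two: "(2 :: 'a) \<noteq> 0" and e: "e \<noteq> 0" "f \<noteq> 0" "e \<noteq> f"
    and X0: "X 0 * (X 0 - e) * (X 0 - f) = 0" and chain: "half_chain e f X n"
  shows "k \<le> n \<Longrightarrow> Some (X 0, 0) \<in> (double (- (e + f)) (e * f) ^^ k) ` curve (- (e + f)) (e * f)"
proof -
  let ?D = "double (- (e + f)) (e * f)"
  from chain obtain r1 r2 r3 where r: "\<And>k. k < n \<Longrightarrow> r1 k ^ 2 = X k" "\<And>k. k < n \<Longrightarrow> r2 k ^ 2 = X k - e"
    "\<And>k. k < n \<Longrightarrow> r3 k ^ 2 = X k - f" "\<And>k. k < n \<Longrightarrow> X (Suc k) = (r1 k + r2 k) * (r1 k + r3 k)"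
    unfolding half_chain_def by blast
  have pow_neg: "(?D ^^ k) (neg P) = neg ((?D ^^ k) P)" for k P by (induction k) (simp_all add: double_neg)
  have "\<exists>y. y ^ 2 = X k * (X k - e) * (X k - f) \<and> (?D ^^ k) (Some (X k, y)) = Some (X 0, 0)" if "k \<le> n" for k
    using that
  proof (induction k)
    case 0
    show ?case using X0 by (intro exI[of _ 0]) simp
  next
    case (Suc k)
    then obtain Y where Y: "Y ^ 2 = X k * (X k - e) * (X k - f)" "(?D ^^ k) (Some (X k, Y)) = Some (X 0, 0)" by auto
    have k: "k < n" using Suc by simp
    obtain y where y: "y ^ 2 = X (Suc k) * (X (Suc k) - e) * (X (Suc k) - f)"
      "?D (Some (X (Suc k), y)) \<in> {Some (X k, Y), neg (Some (X k, Y))}"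
      using halve_point[OF two e r(1-3)[OF k] Y(1) r(4)[OF k]] by blast
    have "(?D ^^ k) (?D (Some (X (Suc k), y))) = Some (X 0, 0)"
      using y(2) Y(2) pow_neg[of k "Some (X k, Y)"] by auto
    then have "(?D ^^ Suc k) (Some (X (Suc k), y)) = Some (X 0, 0)" by (simp add: funpow_swap1)
    with y(1) show ?case by (intro exI[of _ y] conjI)
  qed
  moreover assume "k \<le> n"
  ultimately obtain y where y: "y ^ 2 = X k * (X k - e) * (X k - f)" "(?D ^^ k) (Some (X k, y)) = Some (X 0, 0)" by blast
  have "Some (X k, y) \<in> curve (- (e + f)) (e * f)"
    unfolding curve_def using y(1) by (auto simp: algebra_simps power2_eq_square)
  then show ?thesis using y(2) by (metis image_eqI)
qed

text \<open>At each of the \<open>n\<close> stages the image of the curve under iterated doubling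
  still contains \<open>(0, 0)\<close> and \<open>(e, 0)\<close>, because these points can be halved
  \<open>n\<close> times; so \<open>double_closed_points\<close> applies again and removes another
  factor 4.\<close>

theorem four_power_dvd_card_curve:
  fixes e f :: "'a :: field"
  assumes two: "(2 :: 'a) \<noteq> 0" and e: "e \<noteq> 0" "f \<noteq> 0" "e \<noteq> f" and fin: "finite (UNIV :: 'a set)"
    and chains: "X 0 = 0" "half_chain e f X n" "X' 0 = e" "half_chain e f X' n"
  shows "4 ^ n dvd card (curve (- (e + f)) (e * f))"
proof -
  let ?a = "- (e + f)" and ?b = "e * f"
  let ?G = "curve ?a ?b" and ?D = "double ?a ?b"
  have finG: "finite ?G" by (rule finite_subset[OF subset_UNIV]) (use fin in \<open>simp add: finite_option_UNIV finite_Prod_UNIV\<close>)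
  have ab: "?a ^ 2 - 4 * ?b = (e - f) ^ 2" by (simp add: algebra_simps power2_eq_square)
  have ab0: "?a ^ 2 - 4 * ?b \<noteq> 0" unfolding ab using e by simp
  have b0: "?b \<noteq> 0" using e by simp
  have T: "Some (0, 0) \<in> (?D ^^ k) ` ?G" "Some (e, 0) \<in> (?D ^^ k) ` ?G" if "k \<le> n" for k
    using half_chain_point[OF two e _ chains(2) that] half_chain_point[OF two e _ chains(4) that] chains(1,3) by auto
  have "closed_points ?a ?b ((?D ^^ k) ` ?G) \<and> card ?G = 4 ^ k * card ((?D ^^ k) ` ?G)" if "k \<le> n" for k
    using that
  proof (induction k)
    case (Suc k)
    then have IH: "closed_points ?a ?b ((?D ^^ k) ` ?G)" "card ?G = 4 ^ k * card ((?D ^^ k) ` ?G)" and k: "k \<le> n" by auto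
    note D = double_closed_points[OF two b0 ab0 IH(1) T[OF k] e(1)]
    have "(?D ^^ Suc k) ` ?G = ?D ` (?D ^^ k) ` ?G" by (auto simp: image_image)
    then show ?case using D IH(2) finG by simp
  qed (simp add: closed_points_curve)
  from this[OF order_refl] show ?thesis by simp
qed

section \<open>Counting points over prime fields\<close>

text \<open>At most two ordinates belong to each abscissa. As there is always the point at infinity,
  this amounts to \<open>|a_p| <= p\<close>.\<close>

lemma card_curve_le:
  fixes a b :: "'a :: field"
  assumes fin: "finite (UNIV :: 'a set)"
  shows "card (curve a b) \<le> 2 * card (UNIV :: 'a set) + 1"
proof -
  let ?S = "{(x, y). y ^ 2 = x * (x ^ 2 + a * x + b)}"
  have two: "card {y :: 'a. y ^ 2 = c} \<le> 2" for c
  proof (cases "\<exists>z :: 'a. z ^ 2 = c")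
    case True
    then obtain z where z: "z ^ 2 = c" by blast
    have "{y. y ^ 2 = c} \<subseteq> {z, - z}" unfolding z[symmetric] by (auto simp: power2_eq_iff)
    then have "card {y. y ^ 2 = c} \<le> card {z, - z}" by (intro card_mono) auto
    also have "\<dots> \<le> 2" by (simp add: card_insert_if)
    finally show ?thesis .
  qed simp
  have "?S = (SIGMA x : UNIV. {y. y ^ 2 = x * (x ^ 2 + a * x + b)})" by auto
  then have "card ?S = (\<Sum>x\<in>UNIV. card {y. y ^ 2 = x * (x ^ 2 + a * x + b)})"
    using fin by (simp add: card_SigmaI finite_subset[OF subset_UNIV])
  also have "\<dots> \<le> (\<Sum>x\<in>(UNIV :: 'a set). 2)" by (intro sum_mono two)
  finally have "card ?S \<le> 2 * card (UNIV :: 'a set)" by (simp add: mult.commute)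
  moreover have "card (curve a b) \<le> Suc (card (Some ` ?S))" unfolding curve_def
    by (cases "finite (Some ` ?S)") (auto simp: card_insert_if)
  moreover have "card (Some ` ?S) = card ?S" by (rule card_image) simp
  ultimately show ?thesis by linarith
qed

text \<open>\<open>four_torsion_data p E U d\<^sub>1 d\<^sub>2 d\<^sub>3 n\<close>: over \<open>\<F>\<^sub>p\<close> the substitution
  \<open>X = U\<^sup>2 x + d\<^sub>1\<close>, \<open>Y = U\<^sup>3 (2 y + a\<^sub>1 x + a\<^sub>3) / 2\<close> turns \<open>E\<close> into
  \<open>Y\<^sup>2 = X (X - d\<^sub>1 + d\<^sub>2) (X - d\<^sub>1 + d\<^sub>3)\<close>, and two of its \<open>2\<close>-torsion points can be halved
  \<open>n\<close> times.\<close>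

definition int_half_chain :: "nat \<Rightarrow> int \<Rightarrow> int \<Rightarrow> (nat \<Rightarrow> int) \<Rightarrow> nat \<Rightarrow> bool" where
  "int_half_chain p e f X n \<longleftrightarrow> (\<exists>r1 r2 r3. \<forall>k<n. [r1 k ^ 2 = X k] (mod int p) \<and> [r2 k ^ 2 = X k - e] (mod int p) \<and>
     [r3 k ^ 2 = X k - f] (mod int p) \<and> [X (Suc k) = (r1 k + r2 k) * (r1 k + r3 k)] (mod int p))"

fun four_torsion_data :: "nat \<Rightarrow> int weierstrass \<Rightarrow> int \<Rightarrow> int \<Rightarrow> int \<Rightarrow> int \<Rightarrow> nat \<Rightarrow> bool" where
  "four_torsion_data p (Weierstrass a1 a2 a3 a4 a6) U d1 d2 d3 n \<longleftrightarrow>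
     \<not> int p dvd U \<and> \<not> int p dvd d1 - d2 \<and> \<not> int p dvd d1 - d3 \<and> \<not> int p dvd d2 - d3 \<and>
     [U ^ 2 * (a1 ^ 2 + 4 * a2) = 4 * (d1 + d2 + d3)] (mod int p) \<and>
     [U ^ 4 * (2 * (2 * a4 + a1 * a3)) = 4 * (d1 * d2 + d1 * d3 + d2 * d3)] (mod int p) \<and>
     [U ^ 6 * (a3 ^ 2 + 4 * a6) = 4 * (d1 * d2 * d3)] (mod int p) \<and>
     (\<exists>X. X 0 = 0 \<and> int_half_chain p (d1 - d2) (d1 - d3) X n) \<and>
     (\<exists>X. X 0 = d1 - d2 \<and> int_half_chain p (d1 - d2) (d1 - d3) X n)"

definition four_power_property :: "nat \<Rightarrow> bool" where
  "four_power_property p \<longleftrightarrow> (\<forall>E U d1 d2 d3 n. four_torsion_data p E U d1 d2 d3 n \<longrightarrow>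
     4 ^ n dvd card (points_mod p E) \<and> card (points_mod p E) \<le> 2 * p + 1)"

text \<open>To compute in a field rather than with congruences, a type with \<open>p\<close> elements is needed. The
  type below has that many for a least counterexample \<open>p\<close>, which suffices.\<close>

definition critical_prime :: nat where
  "critical_prime = (if \<exists>p. prime p \<and> p > 2 \<and> \<not> four_power_property p
     then LEAST p. prime p \<and> p > 2 \<and> \<not> four_power_property p else SOME p. prime p \<and> p > 2)"

lemma critical_prime: "prime critical_prime" "critical_prime > 2"
proof -
  have "prime critical_prime \<and> critical_prime > 2"
  proof (cases "\<exists>p. prime p \<and> p > 2 \<and> \<not> four_power_property p")
    case True
    then have "critical_prime = (LEAST p. prime p \<and> p > 2 \<and> \<not> four_power_property p)" by (simp add: critical_prime_def)
    then show ?thesis using LeastI_ex[OF True] by simp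
  next
    case False
    then have "critical_prime = (SOME p. prime p \<and> p > 2)" by (simp only: critical_prime_def if_False)
    then show ?thesis using someI_ex[OF bigger_prime[of 2]] by simp
  qed
  then show "prime critical_prime" "critical_prime > 2" by blast+
qed

typedef critical_index = "{..<critical_prime}"
  using critical_prime(2) by (intro exI[of _ 0]) simp

lemma card_critical_index: "CARD(critical_index) = critical_prime"
  using type_definition.card[OF type_definition_critical_index] by simp

instance critical_index :: prime_card
  by standard (simp add: card_critical_index critical_prime)

type_synonym residue_field = "critical_index mod_ring"

abbreviation red :: "int \<Rightarrow> residue_field" where
  "red \<equiv> of_int"

lemma red_eq_iff: "red a = red b \<longleftrightarrow> [a = b] (mod int critical_prime)"
  unfolding of_int_of_int_mod_ring cong_def card_critical_index[symmetric] by transfer simp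

lemma red_eq_0_iff: "red a = 0 \<longleftrightarrow> int critical_prime dvd a"
  using red_eq_iff[of a 0] by (simp add: cong_0_iff)

lemma red_bij: "bij_betw red {0..<int critical_prime} UNIV"
proof (rule bij_betwI[where g = to_int_mod_ring])
  show "to_int_mod_ring \<in> (UNIV :: residue_field set) \<rightarrow> {0..<int critical_prime}"
    using range_to_int_mod_ring[where 'a = critical_index] unfolding card_critical_index by auto
qed (auto simp: of_int_of_int_mod_ring card_critical_index)

lemma half_chain_red:
  assumes "int_half_chain critical_prime e f X n"
  shows "half_chain (red e) (red f) (\<lambda>k. red (X k)) n"
proof -
  from assms obtain r1 r2 r3 where r: "\<forall>k<n. [r1 k ^ 2 = X k] (mod int critical_prime) \<and> [r2 k ^ 2 = X k - e] (mod int critical_prime) \<and>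
     [r3 k ^ 2 = X k - f] (mod int critical_prime) \<and> [X (Suc k) = (r1 k + r2 k) * (r1 k + r3 k)] (mod int critical_prime)"
    unfolding int_half_chain_def by blast
  show ?thesis unfolding half_chain_def
    by (rule exI[of _ "\<lambda>k. red (r1 k)"], rule exI[of _ "\<lambda>k. red (r2 k)"], rule exI[of _ "\<lambda>k. red (r3 k)"])
      (use r in \<open>simp flip: red_eq_iff\<close>)
qed

text \<open>Completing the square turns the equation into
  \<open>(2 y + a1 x + a3)^2 = 4 x^3 + b2 x^2 + 2 b4 x + b6\<close>, and the hypotheses
  \<open>b\<close> say that \<open>U ^ 6\<close> times the right side is
  \<open>4 (U^2 x + d1) (U^2 x + d2) (U^2 x + d3)\<close>. The shift by \<open>d1\<close> moves one
  root to 0.\<close>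

lemma card_weierstrass:
  fixes a1 a2 a3 a4 a6 U d1 d2 d3 :: "'a :: field"
  assumes two: "(2 :: 'a) \<noteq> 0" and U: "U \<noteq> 0"
    and b: "U ^ 2 * (a1 ^ 2 + 4 * a2) = 4 * (d1 + d2 + d3)"
      "U ^ 4 * (2 * (2 * a4 + a1 * a3)) = 4 * (d1 * d2 + d1 * d3 + d2 * d3)"
      "U ^ 6 * (a3 ^ 2 + 4 * a6) = 4 * (d1 * d2 * d3)"
  shows "bij_betw (\<lambda>(x, y). (U ^ 2 * x + d1, U ^ 3 * (2 * y + a1 * x + a3) / 2))
    {(x, y). weierstrass_poly (Weierstrass a1 a2 a3 a4 a6) x y = 0}
    {(x, y). y ^ 2 = x * (x ^ 2 + (- ((d1 - d2) + (d1 - d3))) * x + (d1 - d2) * (d1 - d3))}"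
    (is "bij_betw ?h ?A ?B")
proof -
  have four: "(4 :: 'a) \<noteq> 0" by (rule powers_of_two_nonzero(1)[OF two])
  have key: "(U ^ 3 * (2 * y + a1 * x + a3)) ^ 2 - 4 * ((U ^ 2 * x + d1) * ((U ^ 2 * x + d1) ^ 2 + (- ((d1 - d2) + (d1 - d3))) * (U ^ 2 * x + d1) + (d1 - d2) * (d1 - d3)))
     = 4 * U ^ 6 * weierstrass_poly (Weierstrass a1 a2 a3 a4 a6) x y" for x y
  proof -
    have "4 * ((U ^ 2 * x + d1) * ((U ^ 2 * x + d1) ^ 2 + (- ((d1 - d2) + (d1 - d3))) * (U ^ 2 * x + d1) + (d1 - d2) * (d1 - d3)))
      = 4 * U ^ 6 * x ^ 3 + U ^ 4 * x ^ 2 * (4 * (d1 + d2 + d3)) + U ^ 2 * x * (4 * (d1 * d2 + d1 * d3 + d2 * d3)) + 4 * (d1 * d2 * d3)"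
      by (simp add: algebra_simps eval_nat_numeral)
    also have "\<dots> = 4 * U ^ 6 * x ^ 3 + U ^ 6 * ((a1 ^ 2 + 4 * a2) * x ^ 2 + 2 * (2 * a4 + a1 * a3) * x + (a3 ^ 2 + 4 * a6))"
      unfolding b[symmetric] by (simp add: algebra_simps eval_nat_numeral)
    finally have e: "4 * ((U ^ 2 * x + d1) * ((U ^ 2 * x + d1) ^ 2 + (- ((d1 - d2) + (d1 - d3))) * (U ^ 2 * x + d1) + (d1 - d2) * (d1 - d3)))
      = 4 * U ^ 6 * x ^ 3 + U ^ 6 * ((a1 ^ 2 + 4 * a2) * x ^ 2 + 2 * (2 * a4 + a1 * a3) * x + (a3 ^ 2 + 4 * a6))" .
    show ?thesis unfolding e by (simp add: algebra_simps eval_nat_numeral)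
  qed
  have iff: "?h (x, y) \<in> ?B \<longleftrightarrow> (x, y) \<in> ?A" for x y
  proof -
    have "?h (x, y) \<in> ?B \<longleftrightarrow> 4 * (U ^ 3 * (2 * y + a1 * x + a3) / 2) ^ 2 - 4 * ((U ^ 2 * x + d1) * ((U ^ 2 * x + d1) ^ 2 + (- ((d1 - d2) + (d1 - d3))) * (U ^ 2 * x + d1) + (d1 - d2) * (d1 - d3))) = 0"
      using four by (simp only: mem_Collect_eq case_prod_conv right_diff_distrib[symmetric] mult_eq_0_iff simp_thms right_minus_eq)
    also have "4 * (U ^ 3 * (2 * y + a1 * x + a3) / 2) ^ 2 = (U ^ 3 * (2 * y + a1 * x + a3)) ^ 2"
      using four by (simp add: power_divide)
    finally show ?thesis unfolding key using four U by simp
  qed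
  define g where "g = (\<lambda>(X, Y). ((X - d1) / U ^ 2, (2 * Y / U ^ 3 - a1 * ((X - d1) / U ^ 2) - a3) / 2))"
  have gh: "g (?h P) = P" for P
    using two U by (simp add: g_def split_beta)
  have hg: "?h (g P) = P" for P
  proof -
    obtain X Y where P: "P = (X, Y)" by (cases P)
    define A where "A = a1 * ((X - d1) / U ^ 2)"
    have e: "2 * ((2 * Y / U ^ 3 - A - a3) / 2) = 2 * Y / U ^ 3 - A - a3" by (subst times_divide_eq_right) (rule nonzero_mult_div_cancel_left[OF two])
    have y: "U ^ 3 * (2 * ((2 * Y / U ^ 3 - A - a3) / 2) + A + a3) / 2 = Y" unfolding e using two U by simp
    have x: "U ^ 2 * ((X - d1) / U ^ 2) + d1 = X" using U by simp
    have "g P = ((X - d1) / U ^ 2, (2 * Y / U ^ 3 - A - a3) / 2)" by (simp only: P g_def case_prod_conv A_def)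
    then show ?thesis by (simp only: case_prod_conv A_def[symmetric] x y P)
  qed
  show ?thesis
  proof (rule bij_betwI[where g = g])
    have iff': "?h P \<in> ?B \<longleftrightarrow> P \<in> ?A" for P
    proof -
      obtain x y where P: "P = (x, y)" by (cases P)
      show ?thesis unfolding P by (rule iff)
    qed
    show "?h \<in> ?A \<rightarrow> ?B" by (rule Pi_I) (rule iffD2[OF iff'])
    have "g P \<in> ?A" if "P \<in> ?B" for P by (rule iffD1[OF iff']) (use that in \<open>simp only: hg\<close>)
    then show "g \<in> ?B \<rightarrow> ?A" by (rule Pi_I)
  qed (rule gh hg)+
qed

text \<open>Transfers the count from integer pairs in \<open>{0..<p}\<close> to the type
  \<open>residue_field\<close>, and from there to the model with a 2-torsion point at the
  origin.\<close>

lemma four_power_property_critical_prime: "four_power_property critical_prime"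
  unfolding four_power_property_def
proof (intro allI impI)
  fix E U d1 d2 d3 n
  let ?p = critical_prime
  assume d: "four_torsion_data ?p E U d1 d2 d3 n"
  obtain a1 a2 a3 a4 a6 where E: "E = Weierstrass a1 a2 a3 a4 a6" by (cases E)
  have two: "(2 :: residue_field) \<noteq> 0"
    using red_eq_0_iff[of 2] critical_prime(2) zdvd_imp_le[of "int ?p" 2] by auto
  have nz: "red U \<noteq> 0" "red (d1 - d2) \<noteq> 0" "red (d1 - d3) \<noteq> 0" "red (d1 - d2) \<noteq> red (d1 - d3)"
    using d by (auto simp: E red_eq_0_iff red_eq_iff cong_iff_dvd_diff dvd_diff_commute simp del: of_int_diff)
  have b: "red U ^ 2 * (red a1 ^ 2 + 4 * red a2) = 4 * (red d1 + red d2 + red d3)"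
    "red U ^ 4 * (2 * (2 * red a4 + red a1 * red a3)) = 4 * (red d1 * red d2 + red d1 * red d3 + red d2 * red d3)"
    "red U ^ 6 * (red a3 ^ 2 + 4 * red a6) = 4 * (red d1 * red d2 * red d3)"
    using d by (simp_all add: E flip: red_eq_iff)
  let ?WF = "{(x, y). weierstrass_poly (Weierstrass (red a1) (red a2) (red a3) (red a4) (red a6)) x y = 0}"
  let ?W = "{(x, y). x \<in> {0..<int ?p} \<and> y \<in> {0..<int ?p} \<and> [weierstrass_poly E x y = 0] (mod int ?p)}"
  let ?e = "red (d1 - d2)" and ?f = "red (d1 - d3)"
  let ?C = "{(x, y). y ^ 2 = x * (x ^ 2 + (- (?e + ?f)) * x + ?e * ?f)}"
  have "bij_betw (map_prod red red) ?W ?WF"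
  proof -
    have "bij_betw (map_prod red red) ({0..<int ?p} \<times> {0..<int ?p}) (UNIV \<times> UNIV)"
      by (rule bij_betw_map_prod[OF red_bij red_bij])
    moreover have "map_prod red red P \<in> ?WF \<longleftrightarrow> P \<in> {(x, y). [weierstrass_poly E x y = 0] (mod int ?p)}" for P
      by (cases P) (simp add: E flip: red_eq_iff)
    ultimately have bij: "bij_betw (map_prod red red) ({0..<int ?p} \<times> {0..<int ?p}) UNIV"
      and mem: "\<And>P. map_prod red red P \<in> ?WF \<longleftrightarrow> P \<in> {(x, y). [weierstrass_poly E x y = 0] (mod int ?p)}"
      by simp_all
    have "map_prod red red ` {P \<in> {0..<int ?p} \<times> {0..<int ?p}. map_prod red red P \<in> ?WF} = ?WF"
    proof (rule equalityI; rule subsetI)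
      fix Q assume Q: "Q \<in> ?WF"
      have "Q \<in> map_prod red red ` ({0..<int ?p} \<times> {0..<int ?p})"
        unfolding bij_betw_imp_surj_on[OF bij] by simp
      then obtain P where P: "Q = map_prod red red P" "P \<in> {0..<int ?p} \<times> {0..<int ?p}" by (rule imageE)
      from Q have PW: "map_prod red red P \<in> ?WF" unfolding P(1) .
      have "P \<in> {P \<in> {0..<int ?p} \<times> {0..<int ?p}. map_prod red red P \<in> ?WF}" by (rule CollectI, rule conjI, rule P(2), rule PW)
      then show "Q \<in> map_prod red red ` {P \<in> {0..<int ?p} \<times> {0..<int ?p}. map_prod red red P \<in> ?WF}"
        unfolding P(1) by (rule imageI)
    qed (erule imageE, erule CollectE, erule conjE, hypsubst, assumption)
    then have "bij_betw (map_prod red red) {P \<in> {0..<int ?p} \<times> {0..<int ?p}. map_prod red red P \<in> ?WF} ?WF"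
      by (intro bij_betw_subset[OF bij]) auto
    moreover have "{P \<in> {0..<int ?p} \<times> {0..<int ?p}. map_prod red red P \<in> ?WF} = ?W"
      by (auto simp: E simp flip: red_eq_iff)
    ultimately show ?thesis by simp
  qed
  then have "card ?W = card ?WF" by (rule bij_betw_same_card)
  also have "\<dots> = card ?C"
    using bij_betw_same_card[OF card_weierstrass[OF two nz(1) b]] by simp
  finally have c: "card ?W = card ?C" .
  have "finite ?W" by (rule finite_subset[of _ "{0..<int ?p} \<times> {0..<int ?p}"]) auto
  moreover have "finite ?C" by (rule finite_subset[OF subset_UNIV]) simp
  ultimately have N: "card (points_mod ?p E) = card (curve (- (?e + ?f)) (?e * ?f))"
    unfolding points_mod_def curve_def using c by (subst (1 2) card_insert_disjoint) (auto simp: card_image)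
  from d obtain X X' where X: "X 0 = 0" "int_half_chain ?p (d1 - d2) (d1 - d3) X n"
    "X' 0 = d1 - d2" "int_half_chain ?p (d1 - d2) (d1 - d3) X' n" by (auto simp: E)
  have "4 ^ n dvd card (curve (- (?e + ?f)) (?e * ?f))"
    using four_power_dvd_card_curve[OF two nz(2-4) finite_class.finite_UNIV _ half_chain_red[OF X(2)] _ half_chain_red[OF X(4)]] X by simp
  moreover have "card (curve (- (?e + ?f)) (?e * ?f)) \<le> 2 * ?p + 1"
    using card_curve_le[OF finite_class.finite_UNIV, of "- (?e + ?f)" "?e * ?f"] by (simp add: card_critical_index)
  ultimately show "4 ^ n dvd card (points_mod ?p E) \<and> card (points_mod ?p E) \<le> 2 * ?p + 1" unfolding N by blast
qed

text \<open>A counterexample would make \<open>critical_prime\<close> the least one, but for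
  \<open>critical_prime\<close> the property has been proved.\<close>

theorem four_power_dvd_card_points:
  assumes p: "prime p" "p > 2" and d: "four_torsion_data p E U d1 d2 d3 n"
  shows "4 ^ n dvd card (points_mod p E)" "card (points_mod p E) \<le> 2 * p + 1"
proof -
  have "four_power_property p"
  proof (rule ccontr)
    assume "\<not> four_power_property p"
    then have ex: "\<exists>p. prime p \<and> p > 2 \<and> \<not> four_power_property p" using p by blast
    then have "critical_prime = (LEAST p. prime p \<and> p > 2 \<and> \<not> four_power_property p)" by (simp add: critical_prime_def)
    then have "\<not> four_power_property critical_prime" using LeastI_ex[OF ex] by simp
    then show False using four_power_property_critical_prime by blast
  qed
  then show "4 ^ n dvd card (points_mod p E)" "card (points_mod p E) \<le> 2 * p + 1"
    using d unfolding four_power_property_def by blast+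
qed

section \<open>Good models and the residues of the 2-division data\<close>

text \<open>A relation rather than a function: residues of compound expressions are built up by
  introduction rules and compared at the end with \<open>residue_of_unique\<close>.\<close>

definition residue_of :: "nat \<Rightarrow> complex set \<Rightarrow> (complex \<Rightarrow> int) \<Rightarrow> complex \<Rightarrow> int \<Rightarrow> bool" where
  "residue_of p R \<psi> x m \<longleftrightarrow> x \<in> R \<and> [\<psi> x = m] (mod int p)"

lemma residue_of_unique: "residue_of p R \<psi> x m \<Longrightarrow> residue_of p R \<psi> x n \<Longrightarrow> [m = n] (mod int p)"
  unfolding residue_of_def by (meson cong_sym cong_trans)

lemma residue_of_self: "x \<in> R \<Longrightarrow> residue_of p R \<psi> x (\<psi> x)"
  by (simp add: residue_of_def)

context
  fixes p R \<psi>
  assumes h: "residue_hom p R \<psi>"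
begin

lemma residue_of_add: "residue_of p R \<psi> x m \<Longrightarrow> residue_of p R \<psi> y n \<Longrightarrow> residue_of p R \<psi> (x + y) (m + n)"
  unfolding residue_of_def by (meson cong_add cong_trans residue_homD(6,8)[OF h])

lemma residue_of_mult: "residue_of p R \<psi> x m \<Longrightarrow> residue_of p R \<psi> y n \<Longrightarrow> residue_of p R \<psi> (x * y) (m * n)"
  unfolding residue_of_def by (meson cong_mult cong_trans residue_homD(7,9)[OF h])

lemma residue_of_of_int: "residue_of p R \<psi> (of_int n) n"
  unfolding residue_of_def using residue_homD(2,3)[OF h] by blast

lemma residue_of_numeral: "residue_of p R \<psi> (numeral k) (numeral k)"
  using residue_of_of_int[of "numeral k"] by simp

lemma residue_of_uminus: "residue_of p R \<psi> x m \<Longrightarrow> residue_of p R \<psi> (- x) (- m)"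
  using residue_of_mult[OF residue_of_of_int[of "-1"]] by fastforce

lemma residue_of_diff: "residue_of p R \<psi> x m \<Longrightarrow> residue_of p R \<psi> y n \<Longrightarrow> residue_of p R \<psi> (x - y) (m - n)"
  using residue_of_add[OF _ residue_of_uminus] by fastforce

lemma residue_of_power: "residue_of p R \<psi> x m \<Longrightarrow> residue_of p R \<psi> (x ^ n) (m ^ n)"
  using residue_of_of_int[of 1] by (induction n) (auto intro: residue_of_mult)

lemmas residue_of_intros = residue_of_add residue_of_mult residue_of_numeral residue_of_uminus
  residue_of_diff residue_of_power

lemma residue_of_rat: "of_rat q \<in> R \<Longrightarrow> residue_of p R \<psi> (of_rat q) (rat_mod p q)"
  unfolding residue_of_def using residue_hom_of_rat(2)[OF h] by blast

lemma of_rat_in_iff: "of_rat q \<in> R \<longleftrightarrow> p_integral p q"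
proof
  assume q: "p_integral p q"
  obtain n d where nd: "quotient_of q = (n, d)" by force
  then have "of_rat q = (of_int n * inverse (of_int d) :: complex)"
    using quotient_of_div[OF nd] by (simp add: of_rat_divide field_simps)
  moreover have "inverse (of_int d) \<in> R" using q nd by (intro residue_homD(10)[OF h]) (simp add: p_integral_def)
  ultimately show "of_rat q \<in> R" using residue_homD(2,7)[OF h] by simp
qed (rule residue_hom_of_rat(1)[OF h])

lemma residue_of_discriminant:
  assumes "residue_of p R \<psi> x1 m1" "residue_of p R \<psi> x2 m2" "residue_of p R \<psi> x3 m3" "residue_of p R \<psi> x4 m4"
    "residue_of p R \<psi> x6 m6"
  shows "residue_of p R \<psi> (discriminant (Weierstrass x1 x2 x3 x4 x6)) (discriminant (Weierstrass m1 m2 m3 m4 m6))"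
  unfolding discriminant.simps Let_def by (intro residue_of_intros assms)

lemma residue_of_unit:
  assumes "residue_of p R \<psi> x m" "inverse x \<in> R" "x \<noteq> 0"
  shows "\<not> int p dvd m"
proof
  assume "int p dvd m"
  have "residue_of p R \<psi> (x * inverse x) (m * \<psi> (inverse x))" by (intro residue_of_mult assms residue_of_self)
  then have "residue_of p R \<psi> (of_int 1) (m * \<psi> (inverse x))" using assms(3) by simp
  from residue_of_unique[OF this residue_of_of_int] have "int p dvd 1"
    using \<open>int p dvd m\<close> by (metis cong_dvd_iff dvd_mult2)
  then show False using residue_homD(1)[OF h] by (metis int_dvd_int_iff not_prime_unit of_nat_1)
qed

lemma int_half_chain_residues:
  assumes "\<And>k. k < n \<Longrightarrow> r1 k ^ 2 = X k \<and> r2 k ^ 2 = X k - e \<and> r3 k ^ 2 = X k - f \<and>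
      X (Suc k) = (r1 k + r2 k) * (r1 k + r3 k)"
    and "\<And>k. k < n \<Longrightarrow> r1 k \<in> R \<and> r2 k \<in> R \<and> r3 k \<in> R"
    and "\<And>k. residue_of p R \<psi> (X k) (Y k)" "residue_of p R \<psi> e m" "residue_of p R \<psi> f l"
  shows "int_half_chain p m l Y n"
  unfolding int_half_chain_def
proof (rule exI[of _ "\<lambda>k. \<psi> (r1 k)"], rule exI[of _ "\<lambda>k. \<psi> (r2 k)"], rule exI[of _ "\<lambda>k. \<psi> (r3 k)"],
    intro allI impI)
  fix k assume k: "k < n"
  have r: "residue_of p R \<psi> (r1 k) (\<psi> (r1 k))" "residue_of p R \<psi> (r2 k) (\<psi> (r2 k))" "residue_of p R \<psi> (r3 k) (\<psi> (r3 k))"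
    using assms(2)[OF k] by (simp_all add: residue_of_self)
  have 1: "residue_of p R \<psi> (r1 k ^ 2) (Y k)" "residue_of p R \<psi> (r2 k ^ 2) (Y k - m)" "residue_of p R \<psi> (r3 k ^ 2) (Y k - l)"
    "residue_of p R \<psi> ((r1 k + r2 k) * (r1 k + r3 k)) (Y (Suc k))"
    using assms(1)[OF k] assms(3)[of k] assms(3)[of "Suc k"] residue_of_diff assms(4,5) by auto
  show "[\<psi> (r1 k) ^ 2 = Y k] (mod int p) \<and> [\<psi> (r2 k) ^ 2 = Y k - m] (mod int p) \<and>
     [\<psi> (r3 k) ^ 2 = Y k - l] (mod int p) \<and> [Y (Suc k) = (\<psi> (r1 k) + \<psi> (r2 k)) * (\<psi> (r1 k) + \<psi> (r3 k))] (mod int p)"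
    by (intro conjI residue_of_unique[OF _ 1(1)] residue_of_unique[OF _ 1(2)] residue_of_unique[OF _ 1(3)]
        residue_of_unique[OF 1(4)] residue_of_intros r)
qed

end

text \<open>Uses \<open>4 * b8 = b2 * b6 - b4 ^ 2\<close>. The factor 4 eliminates
  \<open>b8\<close>, so that only the three invariants treated in
  \<open>change_vars_invariants\<close> remain.\<close>

lemma four_discriminant:
  fixes a1 :: "'a :: comm_ring_1"
  assumes "b2 = a1 ^ 2 + 4 * a2" "b4 = 2 * a4 + a1 * a3" "b6 = a3 ^ 2 + 4 * a6"
  shows "4 * discriminant (Weierstrass a1 a2 a3 a4 a6) =
    - (b2 ^ 2 * (b2 * b6 - b4 ^ 2)) - 32 * b4 ^ 3 - 108 * b6 ^ 2 + 36 * b2 * b4 * b6"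
  unfolding discriminant.simps Let_def assms by (simp add: algebra_simps eval_nat_numeral)

lemma change_vars_invariants:
  fixes u :: "'a :: field"
  assumes u: "u \<noteq> 0" and c: "change_vars u r s t (Weierstrass a1 a2 a3 a4 a6) = Weierstrass A1 A2 A3 A4 A6"
  shows "u ^ 2 * (A1 ^ 2 + 4 * A2) = a1 ^ 2 + 4 * a2 + 12 * r"
    "u ^ 4 * (2 * A4 + A1 * A3) = (2 * a4 + a1 * a3) + r * (a1 ^ 2 + 4 * a2) + 6 * r ^ 2"
    "u ^ 6 * (A3 ^ 2 + 4 * A6) = (a3 ^ 2 + 4 * a6) + 2 * r * (2 * a4 + a1 * a3) + r ^ 2 * (a1 ^ 2 + 4 * a2) + 4 * r ^ 3"
proof -
  have A: "u * A1 = a1 + 2 * s" "u ^ 2 * A2 = a2 - s * a1 + 3 * r - s^2" "u ^ 3 * A3 = a3 + r * a1 + 2 * t"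
    "u ^ 4 * A4 = a4 - s * a3 + 2 * r * a2 - (t + r * s) * a1 + 3 * r^2 - 2 * s * t"
    "u ^ 6 * A6 = a6 + r * a4 + r^2 * a2 + r^3 - t * a3 - t^2 - r * t * a1"
    using c u by auto
  have "u ^ 2 * (A1 ^ 2 + 4 * A2) = (u * A1) ^ 2 + 4 * (u ^ 2 * A2)"
    "u ^ 4 * (2 * A4 + A1 * A3) = 2 * (u ^ 4 * A4) + (u * A1) * (u ^ 3 * A3)"
    "u ^ 6 * (A3 ^ 2 + 4 * A6) = (u ^ 3 * A3) ^ 2 + 4 * (u ^ 6 * A6)"
    by (simp_all add: algebra_simps eval_nat_numeral)
  then show "u ^ 2 * (A1 ^ 2 + 4 * A2) = a1 ^ 2 + 4 * a2 + 12 * r"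
    "u ^ 4 * (2 * A4 + A1 * A3) = (2 * a4 + a1 * a3) + r * (a1 ^ 2 + 4 * a2) + 6 * r ^ 2"
    "u ^ 6 * (A3 ^ 2 + 4 * A6) = (a3 ^ 2 + 4 * a6) + 2 * r * (2 * a4 + a1 * a3) + r ^ 2 * (a1 ^ 2 + 4 * a2) + 4 * r ^ 3"
    unfolding A by (simp_all add: algebra_simps eval_nat_numeral)
qed

lemma discriminant_change_vars:
  fixes u :: rat
  assumes u: "u \<noteq> 0" and c: "change_vars u r s t (Weierstrass a1 a2 a3 a4 a6) = Weierstrass A1 A2 A3 A4 A6"
  shows "u ^ 12 * discriminant (Weierstrass A1 A2 A3 A4 A6) = discriminant (Weierstrass a1 a2 a3 a4 a6)"
proof -
  note B = change_vars_invariants[OF u c]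
  define b2 b4 b6 where b: "b2 = a1 ^ 2 + 4 * a2" "b4 = 2 * a4 + a1 * a3" "b6 = a3 ^ 2 + 4 * a6"
  define B2 B4 B6 where B': "B2 = A1 ^ 2 + 4 * A2" "B4 = 2 * A4 + A1 * A3" "B6 = A3 ^ 2 + 4 * A6"
  note B2 = B[folded b B']
  have "4 * (u ^ 12 * discriminant (Weierstrass A1 A2 A3 A4 A6)) = u ^ 12 * (4 * discriminant (Weierstrass A1 A2 A3 A4 A6))" by simp
  also have "\<dots> = - ((u ^ 2 * B2) ^ 2 * ((u ^ 2 * B2) * (u ^ 6 * B6) - (u ^ 4 * B4) ^ 2)) - 32 * (u ^ 4 * B4) ^ 3
      - 108 * (u ^ 6 * B6) ^ 2 + 36 * (u ^ 2 * B2) * (u ^ 4 * B4) * (u ^ 6 * B6)"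
    unfolding four_discriminant[OF B'] by (simp add: algebra_simps eval_nat_numeral)
  also have "\<dots> = 4 * discriminant (Weierstrass a1 a2 a3 a4 a6)"
    unfolding B2 four_discriminant[OF b] by (simp add: algebra_simps eval_nat_numeral)
  finally show ?thesis by simp
qed

lemma of_rat_discriminant:
  "(of_rat (discriminant (Weierstrass a1 a2 a3 a4 a6)) :: complex) =
     discriminant (Weierstrass (of_rat a1) (of_rat a2) (of_rat a3) (of_rat a4) (of_rat a6))"
  by (simp add: Let_def of_rat_add of_rat_mult of_rat_diff of_rat_minus of_rat_power)

text \<open>A model \<open>u, r, s, t\<close> that is good at \<open>p\<close> has \<open>u\<close> a unit and \<open>r\<close> integral at \<open>p\<close>, so over
  the residue field it can be brought to the form given by the roots \<open>\<epsilon>\<^sub>i\<close> of the \<open>2\<close>-division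
  polynomial of \<open>E\<close>.\<close>

lemma four_torsion_data_good_model:
  fixes \<epsilon>1 \<epsilon>2 \<epsilon>3 :: complex
  assumes h: "residue_hom p R \<psi>" and p3: "p > 3"
    and E: "E = Weierstrass a1 a2 a3 a4 a6" "discriminant E \<noteq> 0"
    and aR: "of_rat ` {a1, a2, a3, a4, a6, inverse (discriminant E)} \<subseteq> R"
    and \<epsilon>: "of_rat (a1 ^ 2 + 4 * a2) = - 4 * (\<epsilon>1 + \<epsilon>2 + \<epsilon>3)"
      "of_rat (2 * (2 * a4 + a1 * a3)) = 4 * (\<epsilon>1 * \<epsilon>2 + \<epsilon>1 * \<epsilon>3 + \<epsilon>2 * \<epsilon>3)"
      "of_rat (a3 ^ 2 + 4 * a6) = - 4 * (\<epsilon>1 * \<epsilon>2 * \<epsilon>3)"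
    and \<epsilon>R: "{\<epsilon>1, \<epsilon>2, \<epsilon>3, inverse (\<epsilon>2 - \<epsilon>1), inverse (\<epsilon>3 - \<epsilon>1), inverse (\<epsilon>3 - \<epsilon>2)} \<subseteq> R"
    and dist: "\<epsilon>1 \<noteq> \<epsilon>2" "\<epsilon>1 \<noteq> \<epsilon>3" "\<epsilon>2 \<noteq> \<epsilon>3"
    and good: "good_model p E E'"
    and chains: "\<And>m l. residue_of p R \<psi> (\<epsilon>2 - \<epsilon>1) m \<Longrightarrow> residue_of p R \<psi> (\<epsilon>3 - \<epsilon>1) l \<Longrightarrow>
       (\<exists>X. X 0 = 0 \<and> int_half_chain p m l X n) \<and> (\<exists>X. X 0 = m \<and> int_half_chain p m l X n)"
  shows "\<exists>U d1 d2 d3. four_torsion_data p (reduce_curve p E') U d1 d2 d3 n"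
proof -
  note res = residue_of_intros[OF h]
  note hD = residue_homD[OF h]
  have pp: "prime (int p)" using hD(1) by simp
  \<comment> \<open>\<open>frobenius_trace\<close> evaluates an unspecified good model, so all that
    is known about this change of variables is that its result is good.\<close>
  obtain u r s t where u: "u \<noteq> 0" "E' = change_vars u r s t E"
    using good unfolding good_model_def isomorphic_curves_def by blast
  obtain A1 A2 A3 A4 A6 where E': "E' = Weierstrass A1 A2 A3 A4 A6" by (cases E')
  note c = u(2)[symmetric, unfolded E(1) E']
  note inv = change_vars_invariants[OF u(1) c]
  have AR: "of_rat A1 \<in> R" "of_rat A2 \<in> R" "of_rat A3 \<in> R" "of_rat A4 \<in> R" "of_rat A6 \<in> R"
    using good unfolding good_model_def E' of_rat_in_iff[OF h] by auto
  note Ares = AR[THEN residue_of_rat[OF h]]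
  let ?D = "discriminant E" and ?D' = "discriminant E'"
  have redE: "reduce_curve p E' = Weierstrass (rat_mod p A1) (rat_mod p A2) (rat_mod p A3) (rat_mod p A4) (rat_mod p A6)"
    by (simp add: reduce_curve_def E')
  have D': "residue_of p R \<psi> (of_rat ?D') (discriminant (reduce_curve p E'))"
    unfolding redE unfolding E' of_rat_discriminant by (rule residue_of_discriminant[OF h Ares])
  have D'p: "\<not> int p dvd discriminant (reduce_curve p E')" using good by (simp add: good_model_def)
  have a: "of_rat a1 \<in> R" "of_rat a2 \<in> R" "of_rat a3 \<in> R" "of_rat a4 \<in> R" "of_rat a6 \<in> R"
    "inverse (of_rat ?D) \<in> R" using aR by (auto simp: of_rat_inverse)
  note ares = a(1-5)[THEN residue_of_rat[OF h]]
  obtain \<delta> where D: "residue_of p R \<psi> (of_rat ?D) \<delta>"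
    unfolding E(1) of_rat_discriminant using residue_of_discriminant[OF h ares] by blast
  have Dp: "\<not> int p dvd \<delta>" by (rule residue_of_unit[OF h D a(6)]) (use E(2) in simp)
  have disc: "u ^ 12 * ?D' = ?D" using discriminant_change_vars[OF u(1) c] by (simp only: E(1) E')
  \<comment> \<open>In \<open>u ^ 12 * ?D' = ?D\<close> the factor \<open>?D'\<close> is prime to
    \<open>p\<close> and \<open>?D\<close> is integral there: a prime \<open>p\<close> in the
    denominator of \<open>u\<close> would also divide its numerator.\<close>
  have uR: "of_rat u \<in> R"
    unfolding of_rat_in_iff[OF h]
  proof -
    obtain m d where md: "quotient_of u = (m, d)" by force
    have q: "d > 0" "coprime m d" "u = of_int m / of_int d"
      using quotient_of_denom_pos[OF md] quotient_of_coprime[OF md] quotient_of_div[OF md] by auto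
    have "of_int m ^ 12 * ?D' = of_int d ^ 12 * ?D"
      unfolding disc[symmetric] q(3) using q(1) by (simp add: power_divide)
    from arg_cong[OF this, of "of_rat :: rat \<Rightarrow> complex"]
    have eq: "of_int m ^ 12 * (of_rat ?D') = of_int d ^ 12 * (of_rat ?D :: complex)"
      by (simp add: of_rat_mult of_rat_power)
    have "residue_of p R \<psi> (of_int m ^ 12 * of_rat ?D') (m ^ 12 * discriminant (reduce_curve p E'))"
      by (intro res D' residue_of_of_int[OF h])
    moreover have "residue_of p R \<psi> (of_int d ^ 12 * of_rat ?D) (d ^ 12 * \<delta>)"
      by (intro res D residue_of_of_int[OF h])
    ultimately have cg: "[m ^ 12 * discriminant (reduce_curve p E') = d ^ 12 * \<delta>] (mod int p)"
      unfolding eq by (rule residue_of_unique)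
    have "\<not> int p dvd d"
    proof
      assume d: "int p dvd d"
      then have "int p dvd d ^ 12 * \<delta>" by (simp add: dvd_power_le dvd_mult2 prime_dvd_power_iff[OF pp])
      then have "int p dvd m ^ 12 * discriminant (reduce_curve p E')" using cg by (simp add: cong_dvd_iff)
      then have "int p dvd m" using D'p pp by (simp add: prime_dvd_mult_iff prime_dvd_power_iff)
      then have "int p dvd 1" using d q(2) by (metis coprime_common_divisor)
      then show False using pp by (simp add: not_prime_unit)
    qed
    then show "p_integral p u" by (simp add: p_integral_def md)
  qed
  note ures = residue_of_rat[OF h uR]
  \<comment> \<open>The discriminant of \<open>E\<close> is a unit at \<open>p\<close> as well, so
    the same equation makes \<open>u\<close> a unit.\<close>
  have up: "\<not> int p dvd rat_mod p u"
  proof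
    assume d: "int p dvd rat_mod p u"
    have "residue_of p R \<psi> (of_rat u ^ 12 * of_rat ?D') (rat_mod p u ^ 12 * discriminant (reduce_curve p E'))"
      by (intro res ures D')
    moreover have "of_rat u ^ 12 * of_rat ?D' = (of_rat ?D :: complex)"
      unfolding disc[symmetric] by (simp add: of_rat_mult of_rat_power)
    ultimately have "[rat_mod p u ^ 12 * discriminant (reduce_curve p E') = \<delta>] (mod int p)"
      using residue_of_unique[OF _ D] by metis
    moreover have "int p dvd rat_mod p u ^ 12 * discriminant (reduce_curve p E')"
      using d pp by (simp add: prime_dvd_power_iff)
    ultimately show False using Dp by (simp add: cong_dvd_iff)
  qed
  define b2 :: complex where "b2 = of_rat (a1 ^ 2 + 4 * a2)"
  define b4 :: complex where "b4 = of_rat (2 * a4 + a1 * a3)"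
  define b6 :: complex where "b6 = of_rat (a3 ^ 2 + 4 * a6)"
  define U :: complex where "U = of_rat u"
  define \<rho> :: complex where "\<rho> = of_rat r"
  have inv': "U ^ 2 * (of_rat A1 ^ 2 + 4 * of_rat A2) = b2 + 12 * \<rho>"
    "U ^ 4 * (2 * of_rat A4 + of_rat A1 * of_rat A3) = b4 + \<rho> * b2 + 6 * \<rho> ^ 2"
    "U ^ 6 * (of_rat A3 ^ 2 + 4 * of_rat A6) = b6 + 2 * \<rho> * b4 + \<rho> ^ 2 * b2 + 4 * \<rho> ^ 3"
    using inv[THEN arg_cong[of _ _ "of_rat :: rat \<Rightarrow> complex"]]
    by (simp_all add: U_def \<rho>_def b2_def b4_def b6_def of_rat_add of_rat_mult of_rat_power)
  \<comment> \<open>\<open>r\<close> is recovered from the first invariant by a division by 12; this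
    is where \<open>p > 3\<close> enters.\<close>
  have "\<not> int p dvd 12"
  proof
    assume "int p dvd 12"
    then have "int p dvd 2 * (2 * 3)" by simp
    then have "int p dvd 2 \<or> int p dvd 3" using pp by (simp only: prime_dvd_mult_iff) blast
    then show False using p3 zdvd_imp_le[of "int p" 2] zdvd_imp_le[of "int p" 3] by auto
  qed
  then have "inverse 12 \<in> R" using hD(10)[of 12] by simp
  moreover have "U ^ 2 * (of_rat A1 ^ 2 + 4 * of_rat A2) - b2 \<in> R"
  proof -
    have "residue_of p R \<psi> (U ^ 2 * (of_rat A1 ^ 2 + 4 * of_rat A2) - (of_rat a1 ^ 2 + 4 * of_rat a2))
      (rat_mod p u ^ 2 * (rat_mod p A1 ^ 2 + 4 * rat_mod p A2) - (rat_mod p a1 ^ 2 + 4 * rat_mod p a2))"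
      unfolding U_def by (intro res ures Ares ares)
    then show ?thesis by (simp add: residue_of_def b2_def of_rat_add of_rat_mult of_rat_power)
  qed
  moreover have "\<rho> = (U ^ 2 * (of_rat A1 ^ 2 + 4 * of_rat A2) - b2) * inverse 12" unfolding inv' by simp
  ultimately have \<rho>R: "\<rho> \<in> R" using hD(7) by metis
  have dres: "residue_of p R \<psi> (\<rho> - x) (\<psi> \<rho> - \<psi> x)" if "x \<in> R" for x
    by (intro residue_of_diff[OF h] residue_of_self \<rho>R that)
  have eR: "\<epsilon>1 \<in> R" "\<epsilon>2 \<in> R" "\<epsilon>3 \<in> R" "inverse (\<epsilon>2 - \<epsilon>1) \<in> R" "inverse (\<epsilon>3 - \<epsilon>1) \<in> R" "inverse (\<epsilon>3 - \<epsilon>2) \<in> R"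
    using \<epsilon>R by auto
  define d1 d2 d3 where d: "d1 = \<psi> \<rho> - \<psi> \<epsilon>1" "d2 = \<psi> \<rho> - \<psi> \<epsilon>2" "d3 = \<psi> \<rho> - \<psi> \<epsilon>3"
  note dr = dres[OF eR(1), folded d(1)] dres[OF eR(2), folded d(2)] dres[OF eR(3), folded d(3)]
  have diffs: "residue_of p R \<psi> (\<epsilon>2 - \<epsilon>1) (d1 - d2)" "residue_of p R \<psi> (\<epsilon>3 - \<epsilon>1) (d1 - d3)" "residue_of p R \<psi> (\<epsilon>3 - \<epsilon>2) (d2 - d3)"
    using residue_of_diff[OF h dr(1,2)] residue_of_diff[OF h dr(1,3)] residue_of_diff[OF h dr(2,3)] by simp_all
  have nz: "\<not> int p dvd d1 - d2" "\<not> int p dvd d1 - d3" "\<not> int p dvd d2 - d3"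
    using residue_of_unit[OF h diffs(1) eR(4)] residue_of_unit[OF h diffs(2) eR(5)] residue_of_unit[OF h diffs(3) eR(6)] dist by auto
  note UR = ures[folded U_def]
  have b: "b2 = - 4 * (\<epsilon>1 + \<epsilon>2 + \<epsilon>3)" "2 * b4 = 4 * (\<epsilon>1 * \<epsilon>2 + \<epsilon>1 * \<epsilon>3 + \<epsilon>2 * \<epsilon>3)" "b6 = - 4 * (\<epsilon>1 * \<epsilon>2 * \<epsilon>3)"
  proof -
    have "2 * b4 = of_rat (2 * (2 * a4 + a1 * a3))" by (simp only: b4_def of_rat_mult of_rat_numeral_eq)
    then show "2 * b4 = 4 * (\<epsilon>1 * \<epsilon>2 + \<epsilon>1 * \<epsilon>3 + \<epsilon>2 * \<epsilon>3)" by (simp only: \<epsilon>(2))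
  qed (simp_all only: b2_def b6_def \<epsilon>(1,3))
  have e1: "U ^ 2 * (of_rat A1 ^ 2 + 4 * of_rat A2) = 4 * ((\<rho> - \<epsilon>1) + (\<rho> - \<epsilon>2) + (\<rho> - \<epsilon>3))"
    unfolding inv' b by (simp add: algebra_simps)
  have "U ^ 4 * (2 * (2 * of_rat A4 + of_rat A1 * of_rat A3)) = 2 * (U ^ 4 * (2 * of_rat A4 + of_rat A1 * of_rat A3))" by simp
  also have "\<dots> = 2 * b4 + 2 * \<rho> * b2 + 12 * \<rho> ^ 2" unfolding inv' by (simp add: algebra_simps)
  also have "\<dots> = 4 * ((\<rho> - \<epsilon>1) * (\<rho> - \<epsilon>2) + (\<rho> - \<epsilon>1) * (\<rho> - \<epsilon>3) + (\<rho> - \<epsilon>2) * (\<rho> - \<epsilon>3))"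
    unfolding b by (simp add: algebra_simps power2_eq_square)
  finally have e2: "U ^ 4 * (2 * (2 * of_rat A4 + of_rat A1 * of_rat A3)) = 4 * ((\<rho> - \<epsilon>1) * (\<rho> - \<epsilon>2) + (\<rho> - \<epsilon>1) * (\<rho> - \<epsilon>3) + (\<rho> - \<epsilon>2) * (\<rho> - \<epsilon>3))" .
  have "U ^ 6 * (of_rat A3 ^ 2 + 4 * of_rat A6) = b6 + \<rho> * (2 * b4) + \<rho> ^ 2 * b2 + 4 * \<rho> ^ 3" unfolding inv' by simp
  also have "\<dots> = 4 * ((\<rho> - \<epsilon>1) * (\<rho> - \<epsilon>2) * (\<rho> - \<epsilon>3))" unfolding b by (simp add: algebra_simps eval_nat_numeral)
  finally have e3: "U ^ 6 * (of_rat A3 ^ 2 + 4 * of_rat A6) = 4 * ((\<rho> - \<epsilon>1) * (\<rho> - \<epsilon>2) * (\<rho> - \<epsilon>3))" .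
  let ?u = "rat_mod p u" and ?A = "rat_mod p"
  have "residue_of p R \<psi> (U ^ 2 * (of_rat A1 ^ 2 + 4 * of_rat A2)) (?u ^ 2 * (?A A1 ^ 2 + 4 * ?A A2))" by (intro res UR Ares)
  then have c1: "[?u ^ 2 * (?A A1 ^ 2 + 4 * ?A A2) = 4 * (d1 + d2 + d3)] (mod int p)"
    unfolding e1 by (rule residue_of_unique) (intro res dr)
  have "residue_of p R \<psi> (U ^ 4 * (2 * (2 * of_rat A4 + of_rat A1 * of_rat A3))) (?u ^ 4 * (2 * (2 * ?A A4 + ?A A1 * ?A A3)))"
    by (intro res UR Ares)
  then have c2: "[?u ^ 4 * (2 * (2 * ?A A4 + ?A A1 * ?A A3)) = 4 * (d1 * d2 + d1 * d3 + d2 * d3)] (mod int p)"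
    unfolding e2 by (rule residue_of_unique) (intro res dr)
  have "residue_of p R \<psi> (U ^ 6 * (of_rat A3 ^ 2 + 4 * of_rat A6)) (?u ^ 6 * (?A A3 ^ 2 + 4 * ?A A6))" by (intro res UR Ares)
  then have c3: "[?u ^ 6 * (?A A3 ^ 2 + 4 * ?A A6) = 4 * (d1 * d2 * d3)] (mod int p)"
    unfolding e3 by (rule residue_of_unique) (intro res dr)
  have "four_torsion_data p (reduce_curve p E') ?u d1 d2 d3 n"
    unfolding redE four_torsion_data.simps using up nz c1 c2 c3 chains[OF diffs(1,2)] by (intro conjI) blast+
  then show ?thesis by blast
qed

lemma good_reductionI:
  assumes h: "residue_hom p R \<psi>" and E: "E = Weierstrass a1 a2 a3 a4 a6" "discriminant E \<noteq> 0"
    and aR: "of_rat ` {a1, a2, a3, a4, a6, inverse (discriminant E)} \<subseteq> R"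
  shows "good_reduction p E"
proof -
  have a: "of_rat a1 \<in> R" "of_rat a2 \<in> R" "of_rat a3 \<in> R" "of_rat a4 \<in> R" "of_rat a6 \<in> R"
    "inverse (of_rat (discriminant E)) \<in> R" using aR by (auto simp: of_rat_inverse)
  have redE: "reduce_curve p E = Weierstrass (rat_mod p a1) (rat_mod p a2) (rat_mod p a3) (rat_mod p a4) (rat_mod p a6)"
    by (simp add: reduce_curve_def E(1))
  have "residue_of p R \<psi> (of_rat (discriminant E)) (discriminant (reduce_curve p E))"
    unfolding redE unfolding E(1) of_rat_discriminant
    by (rule residue_of_discriminant[OF h a(1-5)[THEN residue_of_rat[OF h]]])
  then have "\<not> int p dvd discriminant (reduce_curve p E)"
    by (rule residue_of_unit[OF h _ a(6)]) (use E(2) in simp)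
  moreover have "isomorphic_curves E E"
    unfolding isomorphic_curves_def E(1) by (rule exI[of _ 1], rule exI[of _ 0], rule exI[of _ 0], rule exI[of _ 0]) simp
  moreover have "\<forall>c\<in>set_weierstrass E. p_integral p c"
    unfolding E(1) using a(1-5) unfolding of_rat_in_iff[OF h] by simp
  ultimately show ?thesis unfolding good_reduction_def good_model_def by blast
qed

section \<open>The tower of halvings\<close>

text \<open>Repeated halving of a 2-torsion point in characteristic 0, with principal square roots
  as fixed choices. A residue homomorphism turns it into a chain as in
  \<open>int_half_chain\<close>.\<close>

fun halving :: "complex \<Rightarrow> complex \<Rightarrow> complex \<Rightarrow> nat \<Rightarrow> complex" where
  "halving e f x 0 = x" |
  "halving e f x (Suc k) = (csqrt (halving e f x k) + csqrt (halving e f x k - e)) *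
     (csqrt (halving e f x k) + csqrt (halving e f x k - f))"

text \<open>The numbers whose square roots lead from level \<open>k\<close> to level
  \<open>k + 1\<close>, for both starting points.\<close>

definition radicands :: "complex \<Rightarrow> complex \<Rightarrow> nat \<Rightarrow> complex set" where
  "radicands e f k = (\<Union>x\<in>{0, e}. {halving e f x k, halving e f x k - e, halving e f x k - f})"

lemma halving_in:
  assumes "\<And>x y. x \<in> R \<Longrightarrow> y \<in> R \<Longrightarrow> x + y \<in> R" "\<And>x y. x \<in> R \<Longrightarrow> y \<in> R \<Longrightarrow> x * y \<in> R"
    and "x \<in> {0, e}" "csqrt ` radicands e f k \<subseteq> R"
  shows "halving e f x (Suc k) \<in> R"
proof -
  have "halving e f x k \<in> radicands e f k" "halving e f x k - e \<in> radicands e f k" "halving e f x k - f \<in> radicands e f k"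
    using assms(3) unfolding radicands_def by blast+
  then show ?thesis using assms(4) by (auto intro!: assms(1,2))
qed

text \<open>One layer can raise the exponent of the 2-power roots of unity by at most one: with
  \<open>N\<close> the largest index in \<open>L\<close>, \<open>zeta (N + 2)\<close> in the
  extension would have its fourth power \<open>zeta N\<close> in \<open>L\<close>, hence also its
  square \<open>zeta (N + 1)\<close>, against the choice of \<open>N\<close>.\<close>

lemma tower:
  assumes K: "number_field K" "\<i> \<in> K" "e \<in> K" "f \<in> K" and M: "\<And>n. zeta n \<in> K \<Longrightarrow> n \<le> M"
  shows "\<exists>L. number_field L \<and> K \<subseteq> L \<and> (\<forall>k<j. csqrt ` radicands e f k \<subseteq> L) \<and> radicands e f j \<subseteq> L \<and>
    (\<forall>n. zeta n \<in> L \<longrightarrow> n \<le> M + j)"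
proof (induction j)
  case 0
  have "radicands e f 0 \<subseteq> K" unfolding radicands_def using K number_fieldD(5,6,8)[OF K(1)] by auto
  then show ?case using K M by (intro exI[of _ K]) auto
next
  case (Suc j)
  then obtain L where L: "number_field L" "K \<subseteq> L" "\<And>k. k < j \<Longrightarrow> csqrt ` radicands e f k \<subseteq> L" "radicands e f j \<subseteq> L"
    "\<And>n. zeta n \<in> L \<Longrightarrow> n \<le> M + j" by blast
  have fin: "finite (radicands e f j)" by (simp add: radicands_def)
  have iL: "\<i> \<in> L" using K L by blast
  obtain G where G: "number_field G" "L \<subseteq> G" "csqrt ` radicands e f j \<subseteq> G" "\<And>x. x \<in> G \<Longrightarrow> x ^ 4 \<in> L \<Longrightarrow> x ^ 2 \<in> L"
    using multiquadratic_extension[OF L(1) iL fin L(4)] by blast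
  have z: "n \<le> M + Suc j" if n: "zeta n \<in> G" for n
  proof (rule ccontr)
    assume "\<not> n \<le> M + Suc j"
    then have n2: "n \<ge> M + j + 2" by simp
    define N where "N = (GREATEST m. zeta m \<in> L)"
    have "zeta 0 \<in> L" using number_fieldD(9)[OF L(1)] zeta_0 by simp
    then have N: "zeta N \<in> L" unfolding N_def by (rule GreatestI_nat) (use L(5) in blast)
    have Nmax: "m \<le> N" if "zeta m \<in> L" for m unfolding N_def using that by (rule Greatest_le_nat) (use L(5) in blast)
    have "N \<le> M + j" by (rule L(5)[OF N])
    then have "zeta (N + 2) \<in> G" using zeta_mono[OF G(1) n] n2 by simp
    moreover have "zeta (N + 2) ^ 4 = zeta N" using zeta_add[of N 2] by simp
    moreover have "zeta (N + 2) ^ 2 = zeta (N + 1)" using zeta_Suc[of "N + 1"] by simp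
    ultimately have "zeta (N + 1) \<in> L" using G(4) N by metis
    then show False using Nmax by fastforce
  qed
  have cs: "csqrt ` radicands e f k \<subseteq> G" if "k < Suc j" for k
    using that L(3)[of k] G(2,3) by (cases "k = j") auto
  have "halving e f x (Suc j) \<in> G" if "x \<in> {0, e}" for x
    by (rule halving_in[OF number_fieldD(1,2)[OF G(1)] that G(3)])
  moreover have "e \<in> G" "f \<in> G" using K L(2) G(2) by blast+
  ultimately have "radicands e f (Suc j) \<subseteq> G" unfolding radicands_def using number_fieldD(6)[OF G(1)] by blast
  then show ?case using G L(2) z cs by (intro exI[of _ G]) auto
qed

lemma halving_chains:
  assumes h: "residue_hom p R \<psi>" and R: "\<And>k. k < n \<Longrightarrow> csqrt ` radicands e f k \<subseteq> R"
    and m: "residue_of p R \<psi> e m" and l: "residue_of p R \<psi> f l"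
  shows "\<exists>X. X 0 = 0 \<and> int_half_chain p m l X n" "\<exists>X. X 0 = m \<and> int_half_chain p m l X n"
proof -
  have *: "\<exists>X. X 0 = c \<and> int_half_chain p m l X n" if x: "x \<in> {0, e}" and c: "residue_of p R \<psi> x c" for x c
  proof -
    \<comment> \<open>\<open>?X\<close> is cut off after \<open>n\<close> because square roots are
      available in \<open>R\<close> only up to that level; the filler \<open>x\<close> keeps all
      values in \<open>R\<close>. \<open>?Y\<close> starts with the prescribed integer
      \<open>c\<close> itself, not merely with an integer congruent to it.\<close>
    let ?X = "\<lambda>k. if k \<le> n then halving e f x k else x"
    let ?Y = "\<lambda>k. if k = 0 then c else \<psi> (?X k)"
    have XR: "?X k \<in> R" for k
    proof (cases k)
      case 0
      then show ?thesis using c by (simp add: residue_of_def)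
    next
      case (Suc j)
      show ?thesis
      proof (cases "k \<le> n")
        case True
        then have "halving e f x (Suc j) \<in> R"
          by (intro halving_in[OF residue_homD(6,7)[OF h] x R]) (use Suc in auto)
        then show ?thesis using Suc True by simp
      qed (use c in \<open>simp add: residue_of_def\<close>)
    qed
    have mem: "halving e f x k \<in> radicands e f k" "halving e f x k - e \<in> radicands e f k" "halving e f x k - f \<in> radicands e f k" for k
      using x unfolding radicands_def by blast+
    have "int_half_chain p m l ?Y n"
    proof (rule int_half_chain_residues[OF h])
      fix k assume k: "k < n"
      show "csqrt (?X k) ^ 2 = ?X k \<and> csqrt (?X k - e) ^ 2 = ?X k - e \<and> csqrt (?X k - f) ^ 2 = ?X k - f \<and>
        ?X (Suc k) = (csqrt (?X k) + csqrt (?X k - e)) * (csqrt (?X k) + csqrt (?X k - f))"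
        using k by simp
      show "csqrt (?X k) \<in> R \<and> csqrt (?X k - e) \<in> R \<and> csqrt (?X k - f) \<in> R"
        using k R[OF k] mem[of k] by auto
    next
      fix k
      show "residue_of p R \<psi> (?X k) (?Y k)"
      proof (cases "k = 0")
        case False
        then show ?thesis using residue_of_self[OF XR[of k]] by simp
      qed (use c in simp)
    qed (rule m, rule l)
    then show ?thesis by (intro exI[of _ ?Y]) simp
  qed
  have "residue_of p R \<psi> 0 0" using residue_of_of_int[OF h, of 0] by simp
  then show "\<exists>X. X 0 = 0 \<and> int_half_chain p m l X n" by (intro *) auto
  show "\<exists>X. X 0 = m \<and> int_half_chain p m l X n" by (rule *[OF _ m]) simp
qed

text \<open>Applied to the 2-division polynomial \<open>4 X^3 + b2 X^2 + 2 b4 X + b6\<close>: one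
  root comes from the fundamental theorem of algebra, the other two from the quadratic
  formula.\<close>

lemma cubic_roots:
  fixes c2 c1 c0 :: complex
  shows "\<exists>x y z. c2 = - 4 * (x + y + z) \<and> c1 = 4 * (x * y + x * z + y * z) \<and> c0 = - 4 * (x * y * z)"
proof -
  have "\<not> constant (poly [:c0, c1, c2, 4:])" by (simp add: constant_degree)
  then obtain x where x: "poly [:c0, c1, c2, 4:] x = 0" using fundamental_theorem_of_algebra by blast
  define B where "B = c2 + 4 * x"
  define C where "C = c1 + x * B"
  define s where "s = csqrt (B ^ 2 - 16 * C)"
  have s2: "s * s = B * B - 16 * C" using power2_csqrt[of "B ^ 2 - 16 * C"] by (simp add: s_def power2_eq_square)
  define y where "y = (- B + s) / 8"
  define z where "z = (- B - s) / 8"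
  have yz: "y + z = - B / 4" "y * z = C / 4"
  proof -
    show "y + z = - B / 4" by (simp add: y_def z_def field_simps)
    have "y * z = (B * B - s * s) / 64" by (simp add: y_def z_def algebra_simps)
    then show "y * z = C / 4" unfolding s2 by simp
  qed
  have "c2 = - 4 * (x + (y + z))" unfolding yz by (simp add: B_def algebra_simps)
  moreover have "c1 = 4 * (x * (y + z) + y * z)" unfolding yz by (simp add: C_def algebra_simps)
  moreover have "c0 = - (x * C)" using x by (simp add: C_def B_def algebra_simps eq_neg_iff_add_eq_0)
  then have "c0 = - 4 * (x * (y * z))" unfolding yz by simp
  ultimately show ?thesis by (intro exI[of _ x] exI[of _ y] exI[of _ z]) (simp add: algebra_simps)
qed

section \<open>The 2-adic contradiction\<close>

text \<open>A nonzero integer below \<open>2 ^ s\<close> contains fewer than \<open>s\<close>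
  factors 2, so cancelling \<open>D\<close> costs no more than \<open>s\<close> of them; the
  induction halves an even \<open>D\<close>.\<close>

lemma two_power_dvd_factor:
  fixes D q :: int
  assumes "2 ^ n dvd D * q" "D \<noteq> 0" "\<bar>D\<bar> < 2 ^ s"
  shows "2 ^ (n - s) dvd q"
  using assms
proof (induction s arbitrary: D n)
  case (Suc s)
  show ?case
  proof (cases "even D")
    case True
    then obtain D' where D': "D = 2 * D'" by blast
    show ?thesis
    proof (cases n)
      case (Suc k)
      have "2 ^ k dvd D' * q" using Suc.prems(1) unfolding D' \<open>n = Suc k\<close> by simp
      moreover have "D' \<noteq> 0" "\<bar>D'\<bar> < 2 ^ s" using Suc.prems(2,3) D' by auto
      ultimately show ?thesis using Suc.IH \<open>n = Suc k\<close> by simp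
    qed simp
  next
    case False
    then have "coprime (2 ^ n) D" by simp
    then have "2 ^ n dvd q" using Suc.prems(1) by (simp add: coprime_dvd_mult_right_iff)
    then show ?thesis by (meson diff_le_self dvd_trans le_imp_power_dvd)
  qed
qed simp

text \<open>\<open>A\<close> is \<open>a\<^sub>p(E)\<close>: being at most \<open>p\<close> in absolute value and congruent to the fixed rational
  number \<open>u / v\<close> modulo \<open>p\<close>, it is determined by its residue modulo a fixed power of \<open>2\<close>.\<close>

lemma two_power_dvd_pred:
  fixes u v A :: int
  assumes p: "p > 0" and v: "v > 0" and A: "\<bar>A\<bar> \<le> int p" "A \<noteq> int p + 1" and c: "[v * A = u] (mod int p)"
    and N: "4 ^ j dvd int p + 1 - A" and m: "2 ^ m dvd int p - 1" "m \<le> 2 * j" "3 * v + 2 * \<bar>u\<bar> < 2 ^ m"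
    and s: "\<bar>u - v\<bar> < 2 ^ s"
  shows "2 ^ (2 * j - s) dvd int p - 1"
proof -
  from c obtain k where k: "v * A = u + int p * k" by (metis cong_iff_lin cong_sym)
  have "int p * \<bar>k\<bar> = \<bar>v * A - u\<bar>" using k by (simp add: abs_mult)
  also have "\<dots> \<le> v * \<bar>A\<bar> + \<bar>u\<bar>" using v by (metis abs_mult abs_of_pos abs_triangle_ineq4)
  also have "\<dots> \<le> v * int p + \<bar>u\<bar> * int p"
  proof (rule add_mono)
    show "v * \<bar>A\<bar> \<le> v * int p" using v A(1) by (intro mult_left_mono) auto
    have "\<bar>u\<bar> * 1 \<le> \<bar>u\<bar> * int p" using p by (intro mult_left_mono) auto
    then show "\<bar>u\<bar> \<le> \<bar>u\<bar> * int p" by simp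
  qed
  finally have "int p * \<bar>k\<bar> \<le> int p * (v + \<bar>u\<bar>)" by (simp add: algebra_simps)
  then have kb: "\<bar>k\<bar> \<le> v + \<bar>u\<bar>" using p by (simp add: mult_le_cancel_left)
  have four: "(4::int) ^ j = 2 ^ (2 * j)" by (simp add: power_mult)
  \<comment> \<open>Modulo \<open>2 ^ m\<close> both \<open>p - 1\<close> and
    \<open>p + 1 - A\<close> vanish, so \<open>2 ^ m\<close> divides \<open>2 * v - k - u\<close>,
    which is too small to be anything but 0. This forces the value of \<open>k\<close>, and the
    congruence modulo \<open>p\<close> becomes the equation \<open>e\<close>.\<close>
  have vN: "v * (int p + 1 - A) = (v - k) * (int p - 1) + (2 * v - k - u)" using k by (simp add: algebra_simps)
  have "2 ^ m dvd (4::int) ^ j" unfolding four using m(2) by (rule le_imp_power_dvd)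
  then have "2 ^ m dvd v * (int p + 1 - A)" using N by (meson dvd_mult dvd_trans)
  moreover have "2 ^ m dvd (v - k) * (int p - 1)" using m(1) by simp
  ultimately have "2 ^ m dvd 2 * v - k - u" unfolding vN by (simp add: dvd_add_right_iff)
  moreover have "\<bar>2 * v - k - u\<bar> < 2 ^ m" using kb m(3) v by linarith
  ultimately have k': "2 * v - k - u = 0" by (metis dvd_imp_le_int abs_of_nonneg not_less zero_le_numeral zero_le_power)
  then have k2: "k = 2 * v - u" by simp
  have e: "v * (int p + 1 - A) = (u - v) * (int p - 1)" using vN unfolding k2 by (simp add: algebra_simps)
  \<comment> \<open>\<open>u = v\<close> would give \<open>A = p + 1\<close>, a curve without
    points.\<close>
  have "u - v \<noteq> 0"
  proof
    assume "u - v = 0"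
    then have "v * (int p + 1 - A) = 0" using e by simp
    then show False using v A(2) by simp
  qed
  moreover have "2 ^ (2 * j) dvd (u - v) * (int p - 1)" unfolding e[symmetric] four[symmetric] using N by (rule dvd_mult)
  ultimately show ?thesis using s by (intro two_power_dvd_factor)
qed

text \<open>The residue \<open>g\<close> of \<open>zeta M\<close> satisfies
  \<open>g ^ (2 ^ (M - 1)) = - 1\<close>, so it has exact order \<open>2 ^ M\<close>, which
  therefore divides \<open>p - 1\<close>. If one more factor 2 did, \<open>(p - 1) / 2\<close> would
  be a multiple of \<open>2 ^ M\<close>, and Euler's criterion would make \<open>g\<close> a
  square.\<close>

lemma zeta_residue:
  assumes h: "residue_hom p R \<psi>" and p: "p > 2" and M: "zeta M \<in> R" "M > 0"
    and nonsquare: "\<And>t. \<not> [t ^ 2 = \<psi> (zeta M)] (mod int p)"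
  shows "2 ^ M dvd int p - 1" "\<not> 2 ^ Suc M dvd int p - 1"
proof -
  let ?g = "\<psi> (zeta M)"
  have pr: "prime p" by (rule residue_homD(1)[OF h])
  note zr = residue_of_power[OF h residue_of_self[OF M(1)]]
  have "zeta M ^ (2 ^ M) = of_int 1" using zeta_add[of 0 M] zeta_0 by simp
  then have "residue_of p R \<psi> (of_int 1) (?g ^ (2 ^ M))" using zr by metis
  from residue_of_unique[OF this residue_of_of_int[OF h]] have g1: "[?g ^ (2 ^ M) = 1] (mod int p)" .
  have "zeta M ^ (2 ^ (M - 1)) = of_int (- 1)" using zeta_add[of 1 "M - 1"] zeta_1 M(2) by simp
  then have "residue_of p R \<psi> (of_int (- 1)) (?g ^ (2 ^ (M - 1)))" using zr by metis
  from residue_of_unique[OF this residue_of_of_int[OF h]] have g2: "[?g ^ (2 ^ (M - 1)) = - 1] (mod int p)" .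
  have gp: "\<not> [?g = 0] (mod int p)"
    using nonsquare[of 0] by (simp add: cong_sym_eq)
  have fermat: "[?g ^ (p - 1) = 1] (mod int p)"
  proof -
    have c1: "[?g * ?g ^ (p - 1) = ?g * 1] (mod int p)"
      using fermat_int[OF pr, of ?g] p by (simp flip: power_Suc)
    have "coprime ?g (int p)"
      using gp pr prime_imp_coprime[of "int p" ?g] by (simp add: cong_0_iff coprime_commute)
    then show ?thesis using c1 by (rule cong_mult_lcancel[THEN iffD1])
  qed
  have "p - 1 \<noteq> 0" using p by simp
  then obtain b where b: "p - 1 = 2 ^ multiplicity 2 (p - 1) * b" "\<not> 2 dvd b"
    by (rule multiplicity_decompose'[of "p - 1" 2]) auto
  define a where "a = multiplicity 2 (p - 1)"
  have ab: "odd b" "p - 1 = 2 ^ a * b" using b by (simp_all only: a_def not_False_eq_True)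
  have "M \<le> a"
  proof (rule ccontr)
    assume "\<not> M \<le> a"
    then have e: "2 ^ (M - 1) * b = (p - 1) * 2 ^ (M - 1 - a)" using ab(2) by (simp flip: power_add)
    have e1: "(?g ^ (2 ^ (M - 1))) ^ b = (?g ^ (p - 1)) ^ (2 ^ (M - 1 - a))"
      by (simp only: power_mult[symmetric] e)
    have m1: "(- 1 :: int) ^ b = - 1" using ab(1) by simp
    have c1: "[(?g ^ (2 ^ (M - 1))) ^ b = - 1] (mod int p)" using cong_pow[OF g2, of b] unfolding m1 .
    have c2: "[(?g ^ (p - 1)) ^ (2 ^ (M - 1 - a)) = 1] (mod int p)"
      using cong_pow[OF fermat, of "2 ^ (M - 1 - a)"] unfolding power_one .
    have "[1 = - 1] (mod int p)" by (rule cong_sym[OF cong_trans[OF cong_sym[OF c1] c2[folded e1]]])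
    then have "int p dvd 2" by (simp add: cong_iff_dvd_diff)
    then show False using p zdvd_imp_le[of "int p" 2] by simp
  qed
  have p1: "int p - 1 = int (p - 1)" using p by (simp add: of_nat_diff)
  have ip: "int p - 1 = 2 ^ a * int b" unfolding p1 ab(2) by simp
  show "2 ^ M dvd int p - 1" unfolding ip using \<open>M \<le> a\<close> by (intro dvd_mult2 le_imp_power_dvd)
  show "\<not> 2 ^ Suc M dvd int p - 1"
  proof
    assume "2 ^ Suc M dvd int p - 1"
    then obtain q where q: "int p - 1 = 2 ^ Suc M * q" by blast
    have "q \<ge> 0"
    proof (rule ccontr)
      assume "\<not> q \<ge> 0"
      then have "2 ^ Suc M * q < 0" by (intro mult_pos_neg) simp_all
      then show False using q p by linarith
    qed
    then obtain q' where q': "q = int q'" by (rule nonneg_int_cases)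
    have "int (p - 1) = 2 ^ Suc M * q" by (rule trans[OF p1[symmetric] q])
    also have "\<dots> = int (2 * (2 ^ M * q'))" unfolding q' by simp
    finally have "int (p - 1) = int (2 * (2 ^ M * q'))" .
    then have "p - 1 = 2 * (2 ^ M * q')" unfolding of_nat_eq_iff .
    then have half: "(p - 1) div 2 = 2 ^ M * q'" by simp
    have "[Legendre ?g (int p) = ?g ^ ((p - 1) div 2)] (mod int p)"
      using euler_criterion[OF pr p] .
    also have "?g ^ ((p - 1) div 2) = (?g ^ (2 ^ M)) ^ q'" by (simp only: half power_mult)
    also have "[(?g ^ (2 ^ M)) ^ q' = 1 ^ q'] (mod int p)" by (rule cong_pow[OF g1])
    finally have L: "[Legendre ?g (int p) = 1] (mod int p)" by simp
    have "\<not> QuadRes (int p) ?g" using nonsquare by (simp add: QuadRes_def)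
    then have "Legendre ?g (int p) = - 1" using gp by (simp add: Legendre_def)
    then have "int p dvd 2" using cong_sym[OF L] by (simp add: cong_iff_dvd_diff)
    then show False using p zdvd_imp_le[of "int p" 2] by simp
  qed
qed

theorem theorem1:
  fixes E :: "rat weierstrass" and a :: "nat \<Rightarrow> int"
  assumes "elliptic_curve E"
    and "\<And>p. prime p \<Longrightarrow> good_reduction p E \<Longrightarrow> a p = frobenius_trace p E"
  shows "finite_transcendental (residues_class a)"
proof (rule ccontr)
  assume "\<not> ?thesis"
  then obtain r where r: "linear_recurrent r" "finite {p. prime p \<and> \<not> [a p = rat_mod p (r p)] (mod int p)}"
    unfolding finite_transcendental_def finite_algebraic_numbers_def by (auto simp: residues_class_eq_iff)
  from recurrence_residue[OF r(1)] obtain c Kr Sr Nr where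
    rec: "number_field Kr \<and> finite Sr \<and> Sr \<subseteq> Kr \<and> (\<forall>p R \<psi>. p > Nr \<longrightarrow> residue_hom p R \<psi> \<longrightarrow> Sr \<subseteq> R \<longrightarrow>
       p_integral p c \<and> [rat_mod p (r p) = rat_mod p c] (mod int p))" by (elim exE)
  then have Kr: "number_field Kr" "finite Sr" "Sr \<subseteq> Kr" by blast+
  have cr: "p_integral p c \<and> [rat_mod p (r p) = rat_mod p c] (mod int p)"
    if "p > Nr" "residue_hom p R \<psi>" "Sr \<subseteq> R" for p R \<psi> using rec that by blast
  obtain u v where uv: "quotient_of c = (u, v)" by force
  have v: "v > 0" by (rule quotient_of_denom_pos[OF uv])
  obtain a1 a2 a3 a4 a6 where E: "E = Weierstrass a1 a2 a3 a4 a6" by (cases E)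
  have D0: "discriminant E \<noteq> 0" using assms(1) by (simp add: elliptic_curve_def)
  let ?c = "of_rat :: rat \<Rightarrow> complex"
  define b2 b4 b6 where b: "b2 = a1 ^ 2 + 4 * a2" "b4 = 2 * a4 + a1 * a3" "b6 = a3 ^ 2 + 4 * a6"
  obtain x y z where xyz: "?c b2 = - 4 * (x + y + z)" "?c (2 * b4) = 4 * (x * y + x * z + y * z)" "?c b6 = - 4 * (x * y * z)"
    using cubic_roots[of "?c b2" "?c (2 * b4)" "?c b6"] by blast
  have xyz': "?c (a1 ^ 2 + 4 * a2) = - 4 * (x + y + z)" "?c (2 * (2 * a4 + a1 * a3)) = 4 * (x * y + x * z + y * z)"
    "?c (a3 ^ 2 + 4 * a6) = - 4 * (x * y * z)" using xyz unfolding b by simp_all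
  have dist: "x \<noteq> y \<and> x \<noteq> z \<and> y \<noteq> z"
  proof (rule ccontr)
    assume "\<not> ?thesis"
    then have zero: "(x - y) * (x - z) * (y - z) = 0" by auto
    have "?c b4 = ?c (2 * b4) / 2" by (simp add: of_rat_mult)
    also have "\<dots> = 2 * (x * y + x * z + y * z)" unfolding xyz(2) by simp
    finally have B4: "?c b4 = 2 * (x * y + x * z + y * z)" .
    have "?c (4 * discriminant E) = - (?c b2 ^ 2 * (?c b2 * ?c b6 - ?c b4 ^ 2)) - 32 * ?c b4 ^ 3 - 108 * ?c b6 ^ 2 + 36 * ?c b2 * ?c b4 * ?c b6"
      unfolding E four_discriminant[OF b] by (simp add: of_rat_diff of_rat_add of_rat_minus of_rat_mult of_rat_power)
    also have "\<dots> = 64 * ((x - y) * (x - z) * (y - z)) ^ 2"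
      unfolding xyz(1,3) B4 by (simp add: algebra_simps eval_nat_numeral)
    finally show False using zero D0 by simp
  qed
  \<comment> \<open>The 2-division polynomial, through which its roots \<open>x\<close>,
    \<open>y\<close>, \<open>z\<close> are put into a number field.\<close>
  define P where "P = [:b6, 2 * b4, b2, 4:]"
  have P0: "P \<noteq> 0" by (simp add: P_def)
  have roots: "w \<in> {w. poly (map_poly of_rat P) w = 0}" if w: "w \<in> {x, y, z}" for w :: complex
  proof -
    have "poly (map_poly of_rat P) w = ?c b6 + w * (?c (2 * b4) + w * (?c b2 + w * 4))"
      by (simp add: P_def of_rat_hom.map_poly_pCons_hom)
    also have "\<dots> = 4 * ((w - x) * (w - y) * (w - z))" unfolding xyz by (simp add: algebra_simps)
    finally show ?thesis using w by auto
  qed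
  \<comment> \<open>The modulus \<open>2 ^ m\<close> with which \<open>two_power_dvd_pred\<close>
    singles out \<open>a_p\<close> among the integers congruent to \<open>u / v\<close>.\<close>
  obtain m where m: "3 * v + 2 * \<bar>u\<bar> < 2 ^ m" "m > 0"
  proof -
    define m where "m = Suc (nat (3 * v + 2 * \<bar>u\<bar>))"
    have "int m < int (2 ^ m)" by (simp only: of_nat_less_iff less_exp)
    then have "3 * v + 2 * \<bar>u\<bar> < 2 ^ m" unfolding m_def using v by simp
    then show ?thesis using that[of m] by (simp add: m_def)
  qed
  obtain s where s: "\<bar>u - v\<bar> < 2 ^ s"
  proof -
    have "int (nat \<bar>u - v\<bar>) < int (2 ^ nat \<bar>u - v\<bar>)" by (simp only: of_nat_less_iff less_exp)
    then show ?thesis using that[of "nat \<bar>u - v\<bar>"] by simp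
  qed
  from number_field_roots[OF Kr(1) P0] obtain K1 where K1': "number_field K1" "Kr \<subseteq> K1"
    "{w. poly (map_poly of_rat P) w = (0 :: complex)} \<subseteq> K1" by (elim exE conjE)
  have "{x, y, z} \<subseteq> K1" by (rule subsetI) (rule subsetD[OF K1'(3) roots])
  with K1' have K1: "number_field K1" "Kr \<subseteq> K1" "{x, y, z} \<subseteq> K1" by simp_all
  have zroot: "\<exists>K'. number_field K' \<and> K \<subseteq> K' \<and> zeta n \<in> K'" if K: "number_field K" for K n
  proof -
    have "(\<Sum>j<(2 :: nat) ^ n. (if j = 0 then 1 else 0) * zeta n ^ j) = (\<Sum>j<(2 :: nat) ^ n. if j = 0 then 1 else 0)"
      by (intro sum.cong) auto
    also have "\<dots> = 1" by (subst sum.delta) auto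
    finally have "zeta n ^ (2 ^ n) = (\<Sum>j<(2 :: nat) ^ n. (if j = 0 then 1 else 0) * zeta n ^ j)"
      using zeta_add[of 0 n] zeta_0 by simp
    from number_field_adjoin[OF K _ _ this] show ?thesis using number_fieldD(8,9)[OF K] by simp
  qed
  \<comment> \<open>\<open>zeta (m + 2)\<close> forces \<open>2 ^ m\<close> to divide
    \<open>p - 1\<close> for the prime chosen below, and as \<open>m + 2 >= 2\<close> it puts the
    imaginary unit into \<open>K0\<close>, as the tower requires.\<close>
  obtain K0 where K0: "number_field K0" "K1 \<subseteq> K0" "zeta (m + 2) \<in> K0" using zroot[OF K1(1)] by blast
  have iK: "\<i> \<in> K0" using zeta_mono[OF K0(1,3), of 2] zeta_2 by simp
  have xK: "x \<in> K0" "y \<in> K0" "z \<in> K0" using K1 K0 by blast+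
  note Kf = number_fieldD[OF K0(1)]
  obtain M0 where M0': "\<forall>n. zeta n \<in> K0 \<longrightarrow> n < M0" using zeta_bounded[OF K0(1)] by blast
  have M0: "n \<le> M0" if "zeta n \<in> K0" for n using M0' that by (simp add: less_imp_le)
  \<comment> \<open>With this \<open>j\<close>, the bound \<open>M <= M0 + j\<close> gives
    \<open>M + 1 <= 2 * j - s\<close>, where \<open>s\<close> accounts for the power of 2 in
    \<open>u - v\<close>.\<close>
  define j where "j = M0 + s + m + 1"
  have eK: "y - x \<in> K0" "z - x \<in> K0" by (rule Kf(6)[OF xK(2,1)], rule Kf(6)[OF xK(3,1)])
  obtain L where L: "number_field L" "K0 \<subseteq> L" "\<And>k. k < j \<Longrightarrow> csqrt ` radicands (y - x) (z - x) k \<subseteq> L"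
    "\<And>n. zeta n \<in> L \<Longrightarrow> n \<le> M0 + j"
    using tower[OF K0(1) iK eK M0, of j] by blast
  note Lf = number_fieldD[OF L(1)]
  \<comment> \<open>By maximality \<open>zeta M\<close> is not a square in \<open>L\<close>; a prime
    at which its residue is not a square either has exactly \<open>M\<close> factors 2 in
    \<open>p - 1\<close>.\<close>
  define M where "M = (GREATEST n. zeta n \<in> L)"
  have mL: "zeta (m + 2) \<in> L" using K0 L by blast
  then have M: "zeta M \<in> L" unfolding M_def by (rule GreatestI_nat) (use L(4) in blast)
  have Mmax: "n \<le> M" if "zeta n \<in> L" for n unfolding M_def using that by (rule Greatest_le_nat) (use L(4) in blast)
  have Mm: "m + 2 \<le> M" by (rule Mmax[OF mL])
  have Mj: "M \<le> M0 + j" by (rule L(4)[OF M])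
  have nonsq: "w ^ 2 \<noteq> zeta M" if w: "w \<in> L" for w
  proof
    assume "w ^ 2 = zeta M"
    then have "w ^ 2 = zeta (Suc M) ^ 2" by (simp add: zeta_Suc)
    then have "zeta (Suc M) = w \<or> zeta (Suc M) = - w" by (auto simp: power2_eq_iff)
    then have "zeta (Suc M) \<in> L" using w Lf(5) by auto
    then show False using Mmax by fastforce
  qed
  \<comment> \<open>All numbers that must be integral at \<open>p\<close>. The inverses of the root
    differences and of the discriminant exclude degenerate reductions, and the square roots make the
    halvings reduce.\<close>
  define S where "S = Sr \<union> ?c ` {a1, a2, a3, a4, a6, inverse (discriminant E)} \<union>
    {x, y, z, inverse (y - x), inverse (z - x), inverse (z - y)} \<union> (\<Union>k<j. csqrt ` radicands (y - x) (z - x) k)"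
  have finS: "finite S" unfolding S_def radicands_def using Kr(2) by simp
  have SL: "S \<subseteq> L"
  proof -
    have "x \<in> L" "y \<in> L" "z \<in> L" using xK L(2) by blast+
    moreover have "Sr \<subseteq> L" using Kr K1 K0 L by blast
    moreover have "(\<Union>k<j. csqrt ` radicands (y - x) (z - x) k) \<subseteq> L" using L(3) by blast
    ultimately show ?thesis unfolding S_def using Lf(4,6,11) by blast
  qed
  obtain B where B: "\<forall>p\<in>{p. prime p \<and> \<not> [a p = rat_mod p (r p)] (mod int p)}. p \<le> B"
    using r(2) unfolding finite_nat_set_iff_bounded_le by blast
  \<comment> \<open>The prime that leads to the contradiction: beyond all finite exceptions, with
    every element of \<open>S\<close> integral and \<open>zeta M\<close> reducing to a
    non-square.\<close>
  obtain p R \<psi> where p: "p > Nr + B + 3" and h: "residue_hom p R \<psi>" and SR: "S \<subseteq> R"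
    and zM: "zeta M \<in> R" "\<And>t. \<not> [t ^ 2 = \<psi> (zeta M)] (mod int p)"
    using ex_nonsquare_residue[OF L(1) M nonsq finS SL, of "Nr + B + 3"] by blast
  have pr: "prime p" by (rule residue_homD(1)[OF h])
  have p3: "p > 3" "p > 2" "p > Nr" "p > B" using p by simp_all
  have aR: "?c ` {a1, a2, a3, a4, a6, inverse (discriminant E)} \<subseteq> R"
    and xR: "{x, y, z, inverse (y - x), inverse (z - x), inverse (z - y)} \<subseteq> R"
    and cR: "\<And>k. k < j \<Longrightarrow> csqrt ` radicands (y - x) (z - x) k \<subseteq> R" and SrR: "Sr \<subseteq> R"
    using SR unfolding S_def by blast+
  have good: "good_reduction p E" by (rule good_reductionI[OF h E D0 aR])
  define E' where "E' = (SOME E'. good_model p E E')"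
  have E': "good_model p E E'" using good unfolding good_reduction_def E'_def by (rule someI_ex)
  define N where "N = card (points_mod p (reduce_curve p E'))"
  have ap: "a p = int p + 1 - int N"
    using assms(2)[OF pr good] by (simp add: frobenius_trace_def N_def E'_def)
  have ch: "(\<exists>X. X 0 = 0 \<and> int_half_chain p k l X j) \<and> (\<exists>X. X 0 = k \<and> int_half_chain p k l X j)"
    if "residue_of p R \<psi> (y - x) k" "residue_of p R \<psi> (z - x) l" for k l
    using halving_chains[OF h cR that] by (intro conjI)
  have neq: "x \<noteq> y" "x \<noteq> z" "y \<noteq> z" using dist by blast+
  have "\<exists>U d1 d2 d3. four_torsion_data p (reduce_curve p E') U d1 d2 d3 j"
    by (rule four_torsion_data_good_model[OF h p3(1) E D0 aR xyz' xR neq E'], rule ch)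
  then obtain U d1 d2 d3 where data: "four_torsion_data p (reduce_curve p E') U d1 d2 d3 j" by (elim exE)
  have N4: "4 ^ j dvd N" and N2: "N \<le> 2 * p + 1"
    unfolding N_def by (fact four_power_dvd_card_points[OF pr p3(2) data])+
  have N1: "N \<ge> 1"
  proof -
    let ?A = "{(x, y). x \<in> {0..<int p} \<and> y \<in> {0..<int p} \<and> [weierstrass_poly (reduce_curve p E') x y = 0] (mod int p)}"
    have "finite ?A" by (rule finite_subset[of _ "{0..<int p} \<times> {0..<int p}"]) auto
    then have fin: "finite (points_mod p (reduce_curve p E'))"
      unfolding points_mod_def by (rule finite.insertI[OF finite_imageI])
    have "points_mod p (reduce_curve p E') \<noteq> {}" unfolding points_mod_def by (rule insert_not_empty)
    then have "0 < N" unfolding N_def card_gt_0_iff using fin by (rule conjI)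
    then show ?thesis by simp
  qed
  have "[a p = rat_mod p (r p)] (mod int p)"
  proof (rule ccontr)
    assume "\<not> ?thesis"
    then have "p \<le> B" using B pr by blast
    then show False using p3(4) by simp
  qed
  also have "[rat_mod p (r p) = rat_mod p c] (mod int p)" using cr[OF p3(3) h SrR] by blast
  finally have ac: "[a p = rat_mod p c] (mod int p)" .
  have "coprime v (int p)"
    using cr[OF p3(3) h SrR] prime_imp_coprime[of "int p" v] pr by (simp add: p_integral_def uv coprime_commute)
  then have inv: "[v * modular_inverse (int p) v = 1] (mod int p)" by (rule cong_modular_inverse1)
  have "[v * a p = v * (u * modular_inverse (int p) v)] (mod int p)"
    using cong_scalar_left[OF ac, of v] by (simp add: rat_mod_def uv cong_def mod_mult_right_eq)
  also have "v * (u * modular_inverse (int p) v) = (v * modular_inverse (int p) v) * u" by simp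
  also have "[(v * modular_inverse (int p) v) * u = 1 * u] (mod int p)" by (rule cong_scalar_right[OF inv])
  finally have vau: "[v * a p = u] (mod int p)" by simp
  note zr = zeta_residue[OF h p3(2) zM(1) _ zM(2)]
  have "M > 0" using Mm by simp
  note pM = zr(1)[OF this] and pM' = zr(2)[OF this]
  have "2 ^ (2 * j - s) dvd int p - 1"
  proof (rule two_power_dvd_pred[of p v "a p" u j m s])
    show "p > 0" using p3 by simp
    show "\<bar>a p\<bar> \<le> int p" using ap N1 N2 by linarith
    show "a p \<noteq> int p + 1" using ap N1 by linarith
    have "int (4 ^ j) dvd int N" using N4 by (simp only: of_nat_dvd_iff)
    then show "4 ^ j dvd int p + 1 - a p" unfolding ap by simp
    have "(2 :: int) ^ m dvd 2 ^ M" using Mm by (intro le_imp_power_dvd) simp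
    then show "2 ^ m dvd int p - 1" using pM by (rule dvd_trans)
  qed (use v vau m s in \<open>auto simp: j_def\<close>)
  moreover have "Suc M \<le> 2 * j - s" using Mj by (simp add: j_def)
  ultimately have "2 ^ Suc M dvd int p - 1" by (rule dvd_trans[OF le_imp_power_dvd, rotated])
  then show False using pM' by blast
qed

end
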